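(* Let $\Omega\subset\mathbb{R}^2$ be a bounded domain with sufficiently smooth boundary, $\alpha\in(1,2)$, $\nu=\alpha/2$, $T>0$, $r\ge 1$, and consider the graded mesh $t_n=T(n/N)^r$, $0\le n\le N$, $\tau_1=t_1$. Let $a_0=0$, $f=0$, and $a_1\in D((-\Delta)^{\gamma+\epsilon})$ with $\gamma\in(\frac12,1]$ and $0<\epsilon\ll 1$. Let $u$ be the solution of the fractional wave equation, $v=\partial_t^\nu u$, let $(U^n,V^n)$ be the solution of the L1 time semi-discrete scheme (all defined in the context), and set $\bar u^n=u(t_n)-U^n$, $\bar v^n=v(t_n)-V^n$. Then there is a constant $C>0$, independent of $n$, $N$ and $a_1$, such that $$\|\bar v^n\|_{L^2}+\|\nabla \bar u^n\|_{L^2}\le C\,(\tau_1+N^{-q_1}+N^{-q_2})\,\|(-\Delta)^{\gamma+\epsilon}a_1\|_{L^2},\qquad 1\le n\le N,$$ where $q_1=\min\{r(1-\nu),\,2-\nu\}$ and $q_2=\min\{r(1+\epsilon\alpha),\,2-\nu\}$.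
   Context: The Caputo derivative of order $\alpha\in(1,2)$ is $\partial_t^\alpha\psi(t)=\frac{1}{\Gamma(2-\alpha)}\int_0^t(t-s)^{1-\alpha}\psi''(s)\,ds$, and of order $\nu\in(0,1)$ is $\partial_t^\nu\psi(t)=\frac{1}{\Gamma(1-\nu)}\int_0^t(t-s)^{-\nu}\psi'(s)\,ds$. The fractional wave equation is $\partial_t^\alpha u-\Delta u=f$ in $\Omega\times(0,T)$, $u(\cdot,0)=a_0$, $\partial_tu(\cdot,0)=a_1$, $u=0$ on $\partial\Omega\times(0,T)$. Let $\omega_p(t)=t^{p-1}/\Gamma(p)$. Let $\{(\lambda_k,\varphi_k)\}$ be the Dirichlet eigensystem of $-\Delta$ on $\Omega$, with $\{\varphi_k\}$ orthonormal in $L^2(\Omega)$; $(-\Delta)^\gamma\psi=\sum_k\lambda_k^\gamma(\psi,\varphi_k)\varphi_k$, and $D((-\Delta)^\gamma)$ is the space of $\psi$ with $\sum_k|\lambda_k^\gamma(\psi,\varphi_k)|^2<\infty$. With $\tau_k=t_k-t_{k-1}$, the L1 approximation is $\bar\partial_t^\nu w^n=\sum_{k=1}^nA_{n-k}^{(n)}(w^k-w^{k-1})$, where $A_{n-k}^{(n)}=\int_{t_{k-1}}^{t_k}\frac{\omega_{1-\nu}(t_n-s)}{\tau_k}ds$. The time semi-discrete scheme is: $U^0=V^0=0$ and, for $1\le n\le N$, $\bar\partial_t^\nu V^n-\Delta U^n=a_1\,\omega_{2-\alpha}(t_n)$, $V^n=\bar\partial_t^\nu U^n$ in $\Omega$,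 with $U^n=V^n=0$ on $\partial\Omega$. *)

theory Defs
  imports "HOL-Analysis.Analysis"
begin

section \<open>Planar domains with smooth boundary\<close>

definition C_k_real :: "nat \<Rightarrow> (real \<Rightarrow> real) \<Rightarrow> bool" where
  "C_k_real m \<psi> \<longleftrightarrow>
     (\<forall>j<m. (deriv ^^ j) \<psi> differentiable_on UNIV) \<and> continuous_on UNIV ((deriv ^^ m) \<psi>)"

text \<open>Near each boundary point, after a rotation or reflection of the axes, the set is the region
  strictly above the graph of a function of class \<open>C^m\<close>.\<close>

definition C_k_boundary :: "nat \<Rightarrow> (real^2) set \<Rightarrow> bool" where
  "C_k_boundary m \<Omega> \<longleftrightarrow>
     (\<forall>p\<in>frontier \<Omega>. \<exists>\<rho>>0. \<exists>(R :: real^2 \<Rightarrow> real^2) \<psi>. orthogonal_transformation R \<and> C_k_real m \<psi> \<and>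
        \<Omega> \<inter> ball p \<rho> = {x \<in> ball p \<rho>. R x $ 2 > \<psi> (R x $ 1)})"

definition bounded_domain :: "(real^2) set \<Rightarrow> bool" where
  "bounded_domain \<Omega> \<longleftrightarrow> open \<Omega> \<and> connected \<Omega> \<and> \<Omega> \<noteq> {} \<and> bounded \<Omega>"


section \<open>The spaces \<open>L^2(\<Omega>)\<close> and \<open>H^1_0(\<Omega>)\<close>\<close>

text \<open>Elements of \<open>L^2(\<Omega>)\<close> are represented by functions on the plane, whose values outside \<open>\<Omega>\<close>
  are irrelevant; equality in \<open>L^2(\<Omega>)\<close> is equality almost everywhere in \<open>\<Omega>\<close>.\<close>

definition L2 :: "(real^2) set \<Rightarrow> (real^2 \<Rightarrow> 'b::euclidean_space) set" where
  "L2 \<Omega> = {f. f \<in> borel_measurable (lebesgue_on \<Omega>) \<and>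
               integrable (lebesgue_on \<Omega>) (\<lambda>x. (norm (f x))\<^sup>2)}"

definition L2_inner ::
    "(real^2) set \<Rightarrow> (real^2 \<Rightarrow> 'b::euclidean_space) \<Rightarrow> (real^2 \<Rightarrow> 'b) \<Rightarrow> real" where
  "L2_inner \<Omega> f g = (LINT x|lebesgue_on \<Omega>. f x \<bullet> g x)"

definition L2_norm :: "(real^2) set \<Rightarrow> (real^2 \<Rightarrow> 'b::euclidean_space) \<Rightarrow> real" where
  "L2_norm \<Omega> f = sqrt (LINT x|lebesgue_on \<Omega>. (norm (f x))\<^sup>2)"

definition partial :: "2 \<Rightarrow> (real^2 \<Rightarrow> real) \<Rightarrow> real^2 \<Rightarrow> real" where
  "partial i f x = frechet_derivative f (at x) (axis i 1)"

definition grad :: "(real^2 \<Rightarrow> real) \<Rightarrow> real^2 \<Rightarrow> real^2" where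
  "grad f x = (\<chi> i. partial i f x)"

definition laplace :: "(real^2 \<Rightarrow> real) \<Rightarrow> real^2 \<Rightarrow> real" where
  "laplace f x = (\<Sum>i\<in>UNIV. partial i (partial i f) x)"

text \<open>Differentiability of all iterated partial derivatives, of every order, is \<open>C^\<infinity>\<close>.\<close>

definition smooth :: "(real^2 \<Rightarrow> real) \<Rightarrow> bool" where
  "smooth f \<longleftrightarrow> (\<forall>is. foldr partial is f differentiable_on UNIV)"

definition test_functions :: "(real^2) set \<Rightarrow> (real^2 \<Rightarrow> real) set" where
  "test_functions \<Omega> = {\<eta>. smooth \<eta> \<and> (\<exists>K\<subseteq>\<Omega>. compact K \<and> (\<forall>x. x \<notin> K \<longrightarrow> \<eta> x = 0))}"

definition has_weak_grad ::
    "(real^2) set \<Rightarrow> (real^2 \<Rightarrow> real) \<Rightarrow> (real^2 \<Rightarrow> real^2) \<Rightarrow> bool" where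
  "has_weak_grad \<Omega> w g \<longleftrightarrow> w \<in> L2 \<Omega> \<and> g \<in> L2 \<Omega> \<and>
     (\<forall>\<eta>\<in>test_functions \<Omega>. \<forall>i.
        L2_inner \<Omega> w (partial i \<eta>) = - L2_inner \<Omega> (\<lambda>x. g x $ i) \<eta>)"

definition weak_grad :: "(real^2) set \<Rightarrow> (real^2 \<Rightarrow> real) \<Rightarrow> real^2 \<Rightarrow> real^2" where
  "weak_grad \<Omega> w = (SOME g. has_weak_grad \<Omega> w g)"

text \<open>The closure of the test functions in the norm of \<open>H^1(\<Omega>)\<close>.\<close>

definition H10 :: "(real^2) set \<Rightarrow> (real^2 \<Rightarrow> real) set" where
  "H10 \<Omega> = {w. \<exists>g. has_weak_grad \<Omega> w g \<and>
     (\<exists>\<eta>::nat \<Rightarrow> real^2 \<Rightarrow> real. (\<forall>j. \<eta> j \<in> test_functions \<Omega>) \<and>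
        (\<lambda>j. L2_norm \<Omega> (\<lambda>x. \<eta> j x - w x)) \<longlonglongrightarrow> 0 \<and>
        (\<lambda>j. L2_norm \<Omega> (\<lambda>x. grad (\<eta> j) x - g x)) \<longlonglongrightarrow> 0)}"

text \<open>\<open>\<Delta>w = g\<close> in the sense of distributions on \<open>\<Omega>\<close>, with \<open>g\<close> in \<open>L^2(\<Omega>)\<close>.\<close>

definition has_weak_laplace ::
    "(real^2) set \<Rightarrow> (real^2 \<Rightarrow> real) \<Rightarrow> (real^2 \<Rightarrow> real) \<Rightarrow> bool" where
  "has_weak_laplace \<Omega> w g \<longleftrightarrow> w \<in> L2 \<Omega> \<and> g \<in> L2 \<Omega> \<and>
     (\<forall>\<eta>\<in>test_functions \<Omega>. L2_inner \<Omega> w (laplace \<eta>) = L2_inner \<Omega> g \<eta>)"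


section \<open>The Dirichlet eigensystem and fractional powers of \<open>-\<Delta>\<close>\<close>

text \<open>Eigenvalues are listed in nondecreasing order, repeated according to multiplicity; the
  eigenfunctions form an orthonormal basis of \<open>L^2(\<Omega>)\<close>.  Indices start at 0.\<close>

definition dirichlet_eigensystem ::
    "(real^2) set \<Rightarrow> (nat \<Rightarrow> real) \<Rightarrow> (nat \<Rightarrow> real^2 \<Rightarrow> real) \<Rightarrow> bool" where
  "dirichlet_eigensystem \<Omega> lam \<phi> \<longleftrightarrow>
     mono lam \<and> (\<forall>k. 0 < lam k) \<and>
     (\<forall>k. \<phi> k \<in> H10 \<Omega> \<and> has_weak_laplace \<Omega> (\<phi> k) (\<lambda>x. - (lam k * \<phi> k x))) \<and>
     (\<forall>j k. L2_inner \<Omega> (\<phi> j) (\<phi> k) = (if j = k then 1 else 0)) \<and>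
     (\<forall>\<psi>\<in>L2 \<Omega>. (\<forall>k. L2_inner \<Omega> \<psi> (\<phi> k) = 0) \<longrightarrow> (AE x in lebesgue_on \<Omega>. \<psi> x = 0))"

definition frac_domain :: "(real^2) set \<Rightarrow> (nat \<Rightarrow> real) \<Rightarrow> (nat \<Rightarrow> real^2 \<Rightarrow> real) \<Rightarrow> real
    \<Rightarrow> (real^2 \<Rightarrow> real) set" where
  "frac_domain \<Omega> lam \<phi> p =
     {\<psi>\<in>L2 \<Omega>. summable (\<lambda>k. \<bar>lam k powr p * L2_inner \<Omega> \<psi> (\<phi> k)\<bar>\<^sup>2)}"

text \<open>The sum of the series in \<open>L^2(\<Omega>)\<close>, unique up to null sets.\<close>

definition frac_laplace :: "(real^2) set \<Rightarrow> (nat \<Rightarrow> real) \<Rightarrow> (nat \<Rightarrow> real^2 \<Rightarrow> real) \<Rightarrow> real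
    \<Rightarrow> (real^2 \<Rightarrow> real) \<Rightarrow> real^2 \<Rightarrow> real" where
  "frac_laplace \<Omega> lam \<phi> p \<psi> = (SOME g. g \<in> L2 \<Omega> \<and>
     (\<lambda>m. L2_norm \<Omega> (\<lambda>x. (\<Sum>k<m. lam k powr p * L2_inner \<Omega> \<psi> (\<phi> k) * \<phi> k x) - g x))
       \<longlonglongrightarrow> 0)"


section \<open>Calculus of \<open>L^2(\<Omega>)\<close>-valued functions of time\<close>

definition L2_continuous_on ::
    "(real^2) set \<Rightarrow> real set \<Rightarrow> (real \<Rightarrow> real^2 \<Rightarrow> real) \<Rightarrow> bool" where
  "L2_continuous_on \<Omega> S u \<longleftrightarrow> (\<forall>t\<in>S. u t \<in> L2 \<Omega>) \<and>
     (\<forall>t\<in>S. ((\<lambda>s. L2_norm \<Omega> (\<lambda>x. u s x - u t x)) \<longlongrightarrow> 0) (at t within S))"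

definition has_L2_derivative_on :: "(real^2) set \<Rightarrow> real set \<Rightarrow> (real \<Rightarrow> real^2 \<Rightarrow> real)
    \<Rightarrow> (real \<Rightarrow> real^2 \<Rightarrow> real) \<Rightarrow> bool" where
  "has_L2_derivative_on \<Omega> S u u' \<longleftrightarrow> (\<forall>t\<in>S. u t \<in> L2 \<Omega> \<and> u' t \<in> L2 \<Omega>) \<and>
     (\<forall>t\<in>S. ((\<lambda>s. L2_norm \<Omega> (\<lambda>x. (u s x - u t x) / (s - t) - u' t x)) \<longlongrightarrow> 0)
        (at t within S))"

text \<open>\<open>w\<close> is the Bochner integral of the \<open>L^2(\<Omega>)\<close>-valued function \<open>F\<close> over \<open>S\<close>.  As \<open>L^2(\<Omega>)\<close> is
  separable, weak measurability of \<open>F\<close> is strong measurability (Pettis), so that integrability of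
  the norm is Bochner integrability, and the integral is determined by its inner products.  This
  form does not depend on the representatives chosen for the \<open>F s\<close>.\<close>

definition has_L2_integral :: "(real^2) set \<Rightarrow> real set \<Rightarrow> (real \<Rightarrow> real^2 \<Rightarrow> real)
    \<Rightarrow> (real^2 \<Rightarrow> real) \<Rightarrow> bool" where
  "has_L2_integral \<Omega> S F w \<longleftrightarrow> w \<in> L2 \<Omega> \<and> (\<forall>s\<in>S. F s \<in> L2 \<Omega>) \<and>
     set_integrable lborel S (\<lambda>s. L2_norm \<Omega> (F s)) \<and>
     (\<forall>\<eta>\<in>L2 \<Omega>. set_integrable lborel S (\<lambda>s. L2_inner \<Omega> (F s) \<eta>) \<and>
        L2_inner \<Omega> w \<eta> = (LINT s:S|lborel. L2_inner \<Omega> (F s) \<eta>))"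

text \<open>\<open>w\<close> is the Caputo derivative at time \<open>t\<close>, of order \<open>\<nu>\<close> in (0,1) or \<open>\<alpha>\<close> in (1,2)
  respectively, of the \<open>L^2(\<Omega>)\<close>-valued function \<open>u\<close>.\<close>

definition has_caputo_01 :: "(real^2) set \<Rightarrow> real \<Rightarrow> (real \<Rightarrow> real^2 \<Rightarrow> real) \<Rightarrow> real
    \<Rightarrow> (real^2 \<Rightarrow> real) \<Rightarrow> bool" where
  "has_caputo_01 \<Omega> \<nu> u t w \<longleftrightarrow>
     (\<exists>u'. has_L2_derivative_on \<Omega> {0<..<t} u u' \<and>
        has_L2_integral \<Omega> {0<..<t}
          (\<lambda>s x. 1 / Gamma (1 - \<nu>) * (t - s) powr (- \<nu>) * u' s x) w)"

definition has_caputo_12 :: "(real^2) set \<Rightarrow> real \<Rightarrow> (real \<Rightarrow> real^2 \<Rightarrow> real) \<Rightarrow> real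
    \<Rightarrow> (real^2 \<Rightarrow> real) \<Rightarrow> bool" where
  "has_caputo_12 \<Omega> \<alpha> u t w \<longleftrightarrow>
     (\<exists>u' u''. has_L2_derivative_on \<Omega> {0<..<t} u u' \<and> has_L2_derivative_on \<Omega> {0<..<t} u' u'' \<and>
        has_L2_integral \<Omega> {0<..<t}
          (\<lambda>s x. 1 / Gamma (2 - \<alpha>) * (t - s) powr (1 - \<alpha>) * u'' s x) w)"


section \<open>The fractional wave equation\<close>

text \<open>Strong solutions: \<open>u\<close> is \<open>C^1\<close> on \<open>[0,T]\<close> with values in \<open>L^2(\<Omega>)\<close>, and at each time in
  \<open>(0,T)\<close> it vanishes on the boundary and the equation holds in \<open>L^2(\<Omega>)\<close>.\<close>

definition fractional_wave_solution :: "(real^2) set \<Rightarrow> real \<Rightarrow> real \<Rightarrow> (real^2 \<Rightarrow> real)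
    \<Rightarrow> (real^2 \<Rightarrow> real) \<Rightarrow> (real \<Rightarrow> real^2 \<Rightarrow> real) \<Rightarrow> (real \<Rightarrow> real^2 \<Rightarrow> real) \<Rightarrow> bool" where
  "fractional_wave_solution \<Omega> \<alpha> T a0 a1 f u \<longleftrightarrow>
     (\<exists>u'. has_L2_derivative_on \<Omega> {0..T} u u' \<and> L2_continuous_on \<Omega> {0..T} u' \<and>
        (AE x in lebesgue_on \<Omega>. u 0 x = a0 x) \<and> (AE x in lebesgue_on \<Omega>. u' 0 x = a1 x)) \<and>
     (\<forall>t\<in>{0<..<T}. u t \<in> H10 \<Omega> \<and>
        (\<exists>w g. has_caputo_12 \<Omega> \<alpha> u t w \<and> has_weak_laplace \<Omega> (u t) g \<and>
           (AE x in lebesgue_on \<Omega>. w x - g x = f t x)))"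


section \<open>The L1 time semi-discrete scheme\<close>

definition omega :: "real \<Rightarrow> real \<Rightarrow> real" where
  "omega p t = t powr (p - 1) / Gamma p"

definition graded_mesh :: "real \<Rightarrow> real \<Rightarrow> nat \<Rightarrow> nat \<Rightarrow> real" where
  "graded_mesh T r N n = T * (real n / real N) powr r"

text \<open>\<open>L1_coeff \<nu> t n k\<close> is the coefficient of \<open>w k - w (k - 1)\<close>, written \<open>A\<close> with superscript
  \<open>(n)\<close> and subscript \<open>n-k\<close> in the literature.\<close>

definition L1_coeff :: "real \<Rightarrow> (nat \<Rightarrow> real) \<Rightarrow> nat \<Rightarrow> nat \<Rightarrow> real" where
  "L1_coeff \<nu> t n k =
     (LINT s:{t (k - 1)..t k}|lborel. omega (1 - \<nu>) (t n - s) / (t k - t (k - 1)))"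

definition L1_derivative :: "real \<Rightarrow> (nat \<Rightarrow> real) \<Rightarrow> (nat \<Rightarrow> real^2 \<Rightarrow> real) \<Rightarrow> nat
    \<Rightarrow> real^2 \<Rightarrow> real" where
  "L1_derivative \<nu> t w n x = (\<Sum>k=1..n. L1_coeff \<nu> t n k * (w k x - w (k - 1) x))"

definition L1_scheme :: "(real^2) set \<Rightarrow> real \<Rightarrow> real \<Rightarrow> (nat \<Rightarrow> real) \<Rightarrow> nat
    \<Rightarrow> (real^2 \<Rightarrow> real) \<Rightarrow> (nat \<Rightarrow> real^2 \<Rightarrow> real) \<Rightarrow> (nat \<Rightarrow> real^2 \<Rightarrow> real) \<Rightarrow> bool" where
  "L1_scheme \<Omega> \<alpha> \<nu> t N a1 U V \<longleftrightarrow>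
     (AE x in lebesgue_on \<Omega>. U 0 x = 0) \<and> (AE x in lebesgue_on \<Omega>. V 0 x = 0) \<and>
     (\<forall>n\<in>{1..N}. U n \<in> H10 \<Omega> \<and> V n \<in> H10 \<Omega> \<and>
        (\<exists>g. has_weak_laplace \<Omega> (U n) g \<and>
           (AE x in lebesgue_on \<Omega>.
              L1_derivative \<nu> t V n x - g x = a1 x * omega (2 - \<alpha>) (t n))) \<and>
        (AE x in lebesgue_on \<Omega>. V n x = L1_derivative \<nu> t U n x))"

end

theory Submission
  imports Defs "HOL-Complex_Analysis.Cauchy_Integral_Theorem"
begin

text \<open>
  Expansion in the eigenfunctions reduces the wave equation and the scheme to scalar problems.  With \<open>\<mu>\<close>
  the square root of an eigenvalue, the coefficients of \<open>u\<close> and \<open>v\<close> are multiples of functions \<open>Y\<close> and \<open>V\<close>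
  for which \<open>V\<close> is the Caputo derivative of \<open>Y\<close> of order \<open>\<nu>\<close>, and that of \<open>V\<close> is
  \<open>omega (2 - \<alpha>) - \<mu>\<^sup>2 * Y\<close>.  The scheme has the same form with the L1 operator in place of the Caputo
  derivative.  Let \<open>W\<close> be the error in \<open>V\<close> plus \<open>\<i> * \<mu>\<close> times the error in \<open>Y\<close>.  Then the L1 operator maps
  \<open>W\<close> to \<open>\<i> * \<mu> * W + R\<close>, where \<open>R\<close> collects the truncation errors.  As \<open>\<i> * \<mu>\<close> is skew and the coefficients
  of the L1 formula are positive and increase towards the current time, the error is at most
  \<open>Gamma (1 - \<nu>)\<close> times the maximum of \<open>t\<^sub>m powr \<nu> * norm (R m)\<close> (\<open>L1_skew_stability\<close>).  This bound does
  not depend on \<open>\<mu>\<close>, and the squared modulus of \<open>W\<close> is the contribution of the mode to the squared norms of the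
  error of \<open>v\<close> and of the gradient of the error of \<open>u\<close>.

  The truncation error is estimated in \<open>L1_truncation\<close>.  On each mesh interval the interpolation error has a
  derivative of mean zero, so a constant may be subtracted from the kernel, and the increments of the
  kernel that remain add up by telescoping.  What is needed are bounds of the derivative and of its local
  Lipschitz constant by powers of \<open>t\<close>, with an explicit dependence on \<open>\<mu>\<close> (\<open>mode_regularity\<close>).  They are read
  off from inverse Laplace transforms of symbols \<open>p powr (- \<beta>) / (p powr (2 * \<nu>) + \<mu>\<^sup>2)\<close> along vertical
  lines.  In the right half plane the denominator is bounded below by a multiple of the sum of the moduli
  of its terms; interpolation between the two trades powers of \<open>\<mu>\<close> for powers of \<open>t\<close>, and the line of real
  part \<open>1 / t\<close> gives the right power.  The resulting weight \<open>\<mu> powr (1 + 2 * \<epsilon>)\<close> is the power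
  \<open>1/2 + \<epsilon>\<close> of the eigenvalue, which the regularity of \<open>a1\<close> controls because \<open>\<gamma> > 1/2\<close>.

  Two links connect the modes with the functions on \<open>\<Omega>\<close>.  The coefficients of a strong solution satisfy
  the scalar equation by Green's identity in weak form, and a scalar equation of Volterra type has only one
  solution (\<open>mode_unique\<close>).  Conversely, a function whose coefficients are square summable with the weight of the
  eigenvalues lies in \<open>H^1_0(\<Omega>)\<close>, and the sum is the squared norm of its gradient (\<open>H10_by_coefficients\<close>).
\<close>

section \<open>The Hilbert space \<open>L^2(\<Omega>)\<close>\<close>

lemma L2_measurable: "f \<in> L2 \<Omega> \<Longrightarrow> f \<in> borel_measurable (lebesgue_on \<Omega>)"
  by (simp add: L2_def)

lemma L2_inner_integrable:
  assumes "f \<in> L2 \<Omega>" "g \<in> L2 \<Omega>"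
  shows "integrable (lebesgue_on \<Omega>) (\<lambda>x. f x \<bullet> g x)"
proof (rule Bochner_Integration.integrable_bound)
  show "integrable (lebesgue_on \<Omega>) (\<lambda>x. (norm (f x))\<^sup>2 + (norm (g x))\<^sup>2)"
    using assms by (auto simp: L2_def)
  show "(\<lambda>x. f x \<bullet> g x) \<in> borel_measurable (lebesgue_on \<Omega>)"
    using assms by (auto simp: L2_def intro!: borel_measurable_inner)
  show "AE x in lebesgue_on \<Omega>. norm (f x \<bullet> g x) \<le> norm ((norm (f x))\<^sup>2 + (norm (g x))\<^sup>2)"
  proof (rule AE_I2)
    fix x
    have "\<bar>f x \<bullet> g x\<bar> \<le> norm (f x) * norm (g x)"
      by (rule Cauchy_Schwarz_ineq2)
    also have "\<dots> \<le> (norm (f x))\<^sup>2 + (norm (g x))\<^sup>2"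
      using sum_squares_bound[of "norm (f x)" "norm (g x)"]
        mult_nonneg_nonneg[OF norm_ge_zero[of "f x"] norm_ge_zero[of "g x"]] by linarith
    finally show "norm (f x \<bullet> g x) \<le> norm ((norm (f x))\<^sup>2 + (norm (g x))\<^sup>2)"
      by simp
  qed
qed

lemma L2_add [simp, intro]:
  assumes "f \<in> L2 \<Omega>" "g \<in> L2 \<Omega>"
  shows "(\<lambda>x. f x + g x) \<in> L2 \<Omega>"
proof -
  have eq: "(norm (f x + g x))\<^sup>2 = (norm (f x))\<^sup>2 + 2 * (f x \<bullet> g x) + (norm (g x))\<^sup>2" for x
    by (simp add: power2_norm_eq_inner inner_add_left inner_add_right inner_commute)
  have "integrable (lebesgue_on \<Omega>) (\<lambda>x. (norm (f x))\<^sup>2 + 2 * (f x \<bullet> g x) + (norm (g x))\<^sup>2)"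
    using assms L2_inner_integrable[OF assms] by (auto simp: L2_def)
  then show ?thesis
    using assms by (auto simp: L2_def eq)
qed

lemma L2_scaleR [simp, intro]:
  assumes "f \<in> L2 \<Omega>"
  shows "(\<lambda>x. c *\<^sub>R f x) \<in> L2 \<Omega>"
  using assms by (auto simp: L2_def power_mult_distrib)

lemma L2_mult [simp, intro]: "f \<in> L2 \<Omega> \<Longrightarrow> (\<lambda>x. c * f x :: real) \<in> L2 \<Omega>"
  using L2_scaleR[of f \<Omega> c] by simp

lemma L2_minus [simp, intro]: "f \<in> L2 \<Omega> \<Longrightarrow> (\<lambda>x. - f x) \<in> L2 \<Omega>"
  using L2_scaleR[of f \<Omega> "-1"] by simp

lemma L2_diff [simp, intro]:
  "f \<in> L2 \<Omega> \<Longrightarrow> g \<in> L2 \<Omega> \<Longrightarrow> (\<lambda>x. f x - g x) \<in> L2 \<Omega>"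
  using L2_add[of f \<Omega> "\<lambda>x. - g x"] by auto

lemma L2_zero [simp, intro]: "(\<lambda>x. 0) \<in> L2 \<Omega>"
  by (simp add: L2_def)

lemma L2_sum [simp, intro]:
  "(\<And>i. i \<in> I \<Longrightarrow> f i \<in> L2 \<Omega>) \<Longrightarrow> (\<lambda>x. \<Sum>i\<in>I. f i x) \<in> L2 \<Omega>"
  by (induction I rule: infinite_finite_induct) auto

lemma L2_component [intro]:
  assumes "(f :: real^2 \<Rightarrow> real^2) \<in> L2 \<Omega>"
  shows "(\<lambda>x. f x $ i) \<in> L2 \<Omega>"
proof -
  have m: "(\<lambda>x. f x $ i) \<in> borel_measurable (lebesgue_on \<Omega>)"
    using borel_measurable_inner[OF L2_measurable[OF assms] borel_measurable_const[of "axis i 1"]]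
    by (simp add: inner_axis)
  have "integrable (lebesgue_on \<Omega>) (\<lambda>x. (norm (f x $ i))\<^sup>2)"
  proof (rule Bochner_Integration.integrable_bound)
    show "integrable (lebesgue_on \<Omega>) (\<lambda>x. (norm (f x))\<^sup>2)" using assms by (auto simp: L2_def)
    show "(\<lambda>x. (norm (f x $ i))\<^sup>2) \<in> borel_measurable (lebesgue_on \<Omega>)"
      using m by measurable
    show "AE x in lebesgue_on \<Omega>. norm ((norm (f x $ i))\<^sup>2) \<le> norm ((norm (f x))\<^sup>2)"
    proof (rule AE_I2)
      fix x
      have "(norm (f x $ i))\<^sup>2 \<le> (norm (f x))\<^sup>2" by (rule power_mono[OF Finite_Cartesian_Product.norm_nth_le norm_ge_zero])
      then show "norm ((norm (f x $ i))\<^sup>2) \<le> norm ((norm (f x))\<^sup>2)" by simp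
    qed
  qed
  with m show ?thesis by (simp add: L2_def)
qed

lemma L2_inner_commute: "L2_inner \<Omega> f g = L2_inner \<Omega> g f"
  by (simp add: L2_inner_def inner_commute)

lemma L2_inner_add_left:
  "f \<in> L2 \<Omega> \<Longrightarrow> g \<in> L2 \<Omega> \<Longrightarrow> h \<in> L2 \<Omega> \<Longrightarrow>
    L2_inner \<Omega> (\<lambda>x. f x + g x) h = L2_inner \<Omega> f h + L2_inner \<Omega> g h"
  unfolding L2_inner_def inner_add_left
  by (intro Bochner_Integration.integral_add L2_inner_integrable)

lemma L2_inner_scaleR_left: "L2_inner \<Omega> (\<lambda>x. c *\<^sub>R f x) h = c * L2_inner \<Omega> f h"
  by (simp add: L2_inner_def)

lemma L2_inner_mult_left: "L2_inner \<Omega> (\<lambda>x. c * f x) h = c * L2_inner \<Omega> f (h :: _ \<Rightarrow> real)"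
  using L2_inner_scaleR_left[of \<Omega> c f h] by simp

lemma L2_inner_minus_left: "L2_inner \<Omega> (\<lambda>x. - f x) h = - L2_inner \<Omega> f h"
  by (simp add: L2_inner_def)

lemma L2_inner_diff_left:
  "f \<in> L2 \<Omega> \<Longrightarrow> g \<in> L2 \<Omega> \<Longrightarrow> h \<in> L2 \<Omega> \<Longrightarrow>
    L2_inner \<Omega> (\<lambda>x. f x - g x) h = L2_inner \<Omega> f h - L2_inner \<Omega> g h"
  unfolding L2_inner_def inner_diff_left
  by (intro Bochner_Integration.integral_diff L2_inner_integrable)

lemma L2_inner_zero_left [simp]: "L2_inner \<Omega> (\<lambda>x. 0) h = 0"
  by (simp add: L2_inner_def)

lemma L2_inner_sum_left:
  "(\<And>i. i \<in> I \<Longrightarrow> f i \<in> L2 \<Omega>) \<Longrightarrow> h \<in> L2 \<Omega> \<Longrightarrow>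
    L2_inner \<Omega> (\<lambda>x. \<Sum>i\<in>I. f i x) h = (\<Sum>i\<in>I. L2_inner \<Omega> (f i) h)"
  by (induction I rule: infinite_finite_induct) (auto simp: L2_inner_add_left)

lemma L2_inner_sum_right:
  "(\<And>i. i \<in> I \<Longrightarrow> f i \<in> L2 \<Omega>) \<Longrightarrow> h \<in> L2 \<Omega> \<Longrightarrow>
    L2_inner \<Omega> h (\<lambda>x. \<Sum>i\<in>I. f i x) = (\<Sum>i\<in>I. L2_inner \<Omega> h (f i))"
  using L2_inner_sum_left[of I f \<Omega> h] by (simp add: L2_inner_commute)

lemma L2_inner_mult_right: "L2_inner \<Omega> h (\<lambda>x. c * f x) = c * L2_inner \<Omega> h (f :: _ \<Rightarrow> real)"
  using L2_inner_mult_left[of \<Omega> c f h] by (simp add: L2_inner_commute)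

lemma L2_inner_diff_right:
  "f \<in> L2 \<Omega> \<Longrightarrow> g \<in> L2 \<Omega> \<Longrightarrow> h \<in> L2 \<Omega> \<Longrightarrow>
    L2_inner \<Omega> h (\<lambda>x. f x - g x) = L2_inner \<Omega> h f - L2_inner \<Omega> h g"
  using L2_inner_diff_left[of f \<Omega> g h] by (simp add: L2_inner_commute)

lemma L2_inner_AE_cong:
  assumes "AE x in lebesgue_on \<Omega>. f x = g x" "f \<in> L2 \<Omega>" "g \<in> L2 \<Omega>" "h \<in> L2 \<Omega>"
  shows "L2_inner \<Omega> f h = L2_inner \<Omega> g h"
  unfolding L2_inner_def
proof (rule integral_cong_AE)
  show "AE x in lebesgue_on \<Omega>. f x \<bullet> h x = g x \<bullet> h x"
    using assms(1) by eventually_elim simp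
qed (use assms in \<open>auto intro: borel_measurable_integrable L2_inner_integrable\<close>)

lemma L2_norm_nonneg [simp]: "0 \<le> L2_norm \<Omega> f"
  by (simp add: L2_norm_def)

lemma L2_norm_power2: "(L2_norm \<Omega> f)\<^sup>2 = L2_inner \<Omega> f f"
  by (simp add: L2_norm_def L2_inner_def power2_norm_eq_inner[symmetric])

lemma L2_norm_minus_commute: "L2_norm \<Omega> (\<lambda>x. f x - g x) = L2_norm \<Omega> (\<lambda>x. g x - f x)"
  by (simp add: L2_norm_def norm_minus_commute)

lemma L2_norm_zero [simp]: "L2_norm \<Omega> (\<lambda>x. 0) = 0"
  by (simp add: L2_norm_def)

lemma L2_norm_mult: "L2_norm \<Omega> (\<lambda>x. c * f x :: real) = \<bar>c\<bar> * L2_norm \<Omega> f"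
  by (simp add: L2_norm_def power_mult_distrib real_sqrt_mult)

lemma L2_norm_AE_cong:
  assumes "AE x in lebesgue_on \<Omega>. f x = g x" "f \<in> L2 \<Omega>" "g \<in> L2 \<Omega>"
  shows "L2_norm \<Omega> f = L2_norm \<Omega> g"
proof -
  have "(LINT x|lebesgue_on \<Omega>. (norm (f x))\<^sup>2) = (LINT x|lebesgue_on \<Omega>. (norm (g x))\<^sup>2)"
  proof (rule integral_cong_AE)
    show "AE x in lebesgue_on \<Omega>. (norm (f x))\<^sup>2 = (norm (g x))\<^sup>2"
      using assms(1) by eventually_elim simp
  qed (use assms in \<open>auto simp: L2_def\<close>)
  then show ?thesis by (simp add: L2_norm_def)
qed

lemma L2_Cauchy_Schwarz:
  assumes f: "f \<in> L2 \<Omega>" and g: "g \<in> L2 \<Omega>"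
  shows "\<bar>L2_inner \<Omega> f g\<bar> \<le> L2_norm \<Omega> f * L2_norm \<Omega> g"
proof -
  define A B C where "A = L2_inner \<Omega> f f" and "B = L2_inner \<Omega> f g" and "C = L2_inner \<Omega> g g"
  have pos: "0 \<le> A - 2 * s * B + s\<^sup>2 * C" for s
  proof -
    have "0 \<le> (L2_norm \<Omega> (\<lambda>x. f x - s *\<^sub>R g x))\<^sup>2" by simp
    also have "\<dots> = L2_inner \<Omega> f (\<lambda>x. f x - s *\<^sub>R g x) - s * L2_inner \<Omega> g (\<lambda>x. f x - s *\<^sub>R g x)"
      unfolding L2_norm_power2
      by (subst L2_inner_diff_left) (use f g in \<open>auto simp: L2_inner_scaleR_left\<close>)
    also have "\<dots> = A - 2 * s * B + s\<^sup>2 * C"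
      by (subst (1 2) L2_inner_commute, (subst L2_inner_diff_left; (intro f g L2_scaleR)?)+)
         (simp add: L2_inner_scaleR_left A_def B_def C_def L2_inner_commute[of \<Omega> g f]
           power2_eq_square algebra_simps)
    finally show ?thesis .
  qed
  have AC: "0 \<le> A" "0 \<le> C"
    by (simp_all add: A_def C_def L2_norm_power2[symmetric])
  have "B\<^sup>2 \<le> A * C"
  proof (cases "C = 0")
    case True
    then have B0: "0 \<le> A - 2 * s * B" for s using pos[of s] by simp
    have "B = 0"
    proof (rule ccontr)
      assume "B \<noteq> 0"
      then show False using B0[of "(A + 1) / (2 * B)"] by simp
    qed
    then show ?thesis using True by simp
  next
    case False
    then have "0 < C" using AC by simp
    then show ?thesis using pos[of "B / C"]
      by (simp add: field_simps power2_eq_square)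
  qed
  then have "\<bar>B\<bar> \<le> sqrt (A * C)"
    by (metis real_le_rsqrt power2_abs)
  also have "\<dots> = L2_norm \<Omega> f * L2_norm \<Omega> g"
    unfolding A_def C_def L2_norm_power2[symmetric] by (simp add: real_sqrt_mult)
  finally show ?thesis by (simp add: B_def)
qed

lemma L2_norm_triangle:
  assumes f: "f \<in> L2 \<Omega>" and g: "g \<in> L2 \<Omega>"
  shows "L2_norm \<Omega> (\<lambda>x. f x + g x) \<le> L2_norm \<Omega> f + L2_norm \<Omega> g"
proof (rule power2_le_imp_le)
  have "(L2_norm \<Omega> (\<lambda>x. f x + g x))\<^sup>2 =
      L2_inner \<Omega> f (\<lambda>x. f x + g x) + L2_inner \<Omega> g (\<lambda>x. f x + g x)"
    unfolding L2_norm_power2 by (subst L2_inner_add_left) (use f g in auto)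
  also have "\<dots> = (L2_norm \<Omega> f)\<^sup>2 + 2 * L2_inner \<Omega> f g + (L2_norm \<Omega> g)\<^sup>2"
    by (subst (1 2) L2_inner_commute, (subst L2_inner_add_left; (intro f g)?)+)
       (simp add: L2_norm_power2 L2_inner_commute[of \<Omega> g f])
  also have "\<dots> \<le> (L2_norm \<Omega> f + L2_norm \<Omega> g)\<^sup>2"
    using L2_Cauchy_Schwarz[OF f g] by (simp add: power2_sum)
  finally show "(L2_norm \<Omega> (\<lambda>x. f x + g x))\<^sup>2 \<le> (L2_norm \<Omega> f + L2_norm \<Omega> g)\<^sup>2" .
qed simp

lemma L2_norm_triangle_diff:
  assumes "f \<in> L2 \<Omega>" "g \<in> L2 \<Omega>" "h \<in> L2 \<Omega>"
  shows "L2_norm \<Omega> (\<lambda>x. f x - h x) \<le> L2_norm \<Omega> (\<lambda>x. f x - g x) + L2_norm \<Omega> (\<lambda>x. g x - h x)"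
  using L2_norm_triangle[of "\<lambda>x. f x - g x" \<Omega> "\<lambda>x. g x - h x"] assms by auto

lemma L2_inner_tendsto_left:
  assumes "((\<lambda>j. L2_norm \<Omega> (\<lambda>x. f j x - g x)) \<longlongrightarrow> 0) F"
    and "\<And>j. f j \<in> L2 \<Omega>" and "g \<in> L2 \<Omega>" and "h \<in> L2 \<Omega>"
  shows "((\<lambda>j. L2_inner \<Omega> (f j) h) \<longlongrightarrow> L2_inner \<Omega> g h) F"
proof -
  have "((\<lambda>j. L2_norm \<Omega> (\<lambda>x. f j x - g x) * L2_norm \<Omega> h) \<longlongrightarrow> 0) F"
    using tendsto_mult_left_zero[OF assms(1)] .
  then have "((\<lambda>j. L2_inner \<Omega> (f j) h - L2_inner \<Omega> g h) \<longlongrightarrow> 0) F"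
  proof (rule Lim_null_comparison[rotated])
    show "\<forall>\<^sub>F j in F. norm (L2_inner \<Omega> (f j) h - L2_inner \<Omega> g h)
        \<le> L2_norm \<Omega> (\<lambda>x. f j x - g x) * L2_norm \<Omega> h"
      using L2_Cauchy_Schwarz[of "\<lambda>x. f _ x - g x" \<Omega> h] assms
      by (auto simp: L2_inner_diff_left[symmetric])
  qed
  then show ?thesis by (simp add: LIM_zero_iff)
qed

lemma L2_inner_tendsto_right:
  assumes "((\<lambda>j. L2_norm \<Omega> (\<lambda>x. f j x - g x)) \<longlongrightarrow> 0) F"
    and "\<And>j. f j \<in> L2 \<Omega>" and "g \<in> L2 \<Omega>" and "h \<in> L2 \<Omega>"
  shows "((\<lambda>j. L2_inner \<Omega> h (f j)) \<longlongrightarrow> L2_inner \<Omega> h g) F"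
  using L2_inner_tendsto_left[OF assms] by (simp add: L2_inner_commute)

lemma L2_norm_tendsto:
  assumes "((\<lambda>j. L2_norm \<Omega> (\<lambda>x. f j x - g x)) \<longlongrightarrow> 0) F"
    and "\<And>j. f j \<in> L2 \<Omega>" and "g \<in> L2 \<Omega>"
  shows "((\<lambda>j. L2_norm \<Omega> (f j)) \<longlongrightarrow> L2_norm \<Omega> g) F"
proof -
  have "((\<lambda>j. L2_norm \<Omega> (f j) - L2_norm \<Omega> g) \<longlongrightarrow> 0) F"
  proof (rule Lim_null_comparison[OF _ assms(1)], rule always_eventually, rule allI)
    fix j
    have "L2_norm \<Omega> (f j) \<le> L2_norm \<Omega> (\<lambda>x. f j x - g x) + L2_norm \<Omega> g"
      using L2_norm_triangle[of "\<lambda>x. f j x - g x" \<Omega> g] assms by auto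
    moreover have "L2_norm \<Omega> g \<le> L2_norm \<Omega> (\<lambda>x. f j x - g x) + L2_norm \<Omega> (f j)"
      using L2_norm_triangle[of "\<lambda>x. g x - f j x" \<Omega> "f j"] assms
      by (auto simp: L2_norm_minus_commute[of \<Omega> g])
    ultimately show "norm (L2_norm \<Omega> (f j) - L2_norm \<Omega> g) \<le> L2_norm \<Omega> (\<lambda>x. f j x - g x)"
      by (simp add: abs_le_iff)
  qed
  then show ?thesis by (simp add: LIM_zero_iff)
qed

lemma L2_nn_integral:
  assumes "f \<in> L2 \<Omega>"
  shows "(\<integral>\<^sup>+x. ennreal ((norm (f x))\<^sup>2) \<partial>lebesgue_on \<Omega>) = ennreal ((L2_norm \<Omega> f)\<^sup>2)"
  using assms by (subst nn_integral_eq_integral) (auto simp: L2_def L2_norm_def)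

lemma L2I_nn_integral:
  assumes "f \<in> borel_measurable (lebesgue_on \<Omega>)" "0 \<le> B"
    "(\<integral>\<^sup>+x. ennreal ((norm (f x))\<^sup>2) \<partial>lebesgue_on \<Omega>) \<le> ennreal (B\<^sup>2)"
  shows "f \<in> L2 \<Omega>" "L2_norm \<Omega> f \<le> B"
proof -
  have "integrable (lebesgue_on \<Omega>) (\<lambda>x. (norm (f x))\<^sup>2)"
    using assms(1,3) by (intro integrableI_bounded) (auto intro: le_less_trans)
  then show *: "f \<in> L2 \<Omega>" using assms by (simp add: L2_def)
  have "(L2_norm \<Omega> f)\<^sup>2 \<le> B\<^sup>2" using assms(3) by (simp add: L2_nn_integral[OF *])
  then show "L2_norm \<Omega> f \<le> B" using assms(2) by (rule power2_le_imp_le)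
qed

text \<open>The argument of Riesz and Fischer: along a subsequence with increments of norm at most
  \<open>(1/2)^k\<close> the sequence converges almost everywhere, and Fatou's lemma identifies the pointwise limit
  with the limit in \<open>L^2\<close>.\<close>

theorem L2_complete:
  fixes f :: "nat \<Rightarrow> real^2 \<Rightarrow> 'b::euclidean_space"
  assumes f: "\<And>n. f n \<in> L2 \<Omega>"
    and Cauchy: "\<And>e. e > 0 \<Longrightarrow> \<exists>N. \<forall>m\<ge>N. \<forall>n\<ge>N. L2_norm \<Omega> (\<lambda>x. f m x - f n x) < e"
  shows "\<exists>g\<in>L2 \<Omega>. (\<lambda>n. L2_norm \<Omega> (\<lambda>x. f n x - g x)) \<longlonglongrightarrow> 0"
proof -
  let ?M = "lebesgue_on \<Omega>"
  have "\<forall>k. \<exists>N. \<forall>m\<ge>N. \<forall>n\<ge>N. L2_norm \<Omega> (\<lambda>x. f m x - f n x) < (1/2)^k"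
    using Cauchy by simp
  then obtain N where N: "\<And>k m n. m \<ge> N k \<Longrightarrow> n \<ge> N k \<Longrightarrow>
      L2_norm \<Omega> (\<lambda>x. f m x - f n x) < (1/2)^k"
    by metis
  \<comment> \<open>The sum makes the indices dominate every earlier \<open>N j\<close>, whether or not \<open>N\<close> is monotone.\<close>
  define s where "s k = (\<Sum>i\<le>k. N i) + k" for k
  have sN: "N j \<le> s k" if "j \<le> k" for j k
  proof -
    have "N j \<le> (\<Sum>i\<le>k. N i)" using that by (intro member_le_sum) auto
    then show ?thesis by (simp add: s_def)
  qed
  have sk: "k \<le> s k" for k by (simp add: s_def)
  define h where "h k x = f (s (Suc k)) x - f (s k) x" for k x
  have hL2: "h k \<in> L2 \<Omega>" for k unfolding h_def by (intro L2_diff f)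
  have hn: "(L2_norm \<Omega> (h k))\<^sup>2 \<le> ((1/2)^k)\<^sup>2" for k
    unfolding h_def using N[of k "s (Suc k)" "s k"] sN[of k "Suc k"] sN[of k k]
    by (intro power_mono) (auto simp: less_imp_le)
  have fm [measurable]: "f n \<in> borel_measurable ?M" for n using f by (rule L2_measurable)
  have hm [measurable]: "h n \<in> borel_measurable ?M" for n using hL2 by (rule L2_measurable)
  \<comment> \<open>The weights \<open>2^k\<close> still leave a convergent series of integrals, and turn pointwise
      finiteness of the sum into geometric decay of the increments.\<close>
  have "(\<integral>\<^sup>+x. (\<Sum>k. ennreal (2^k * (norm (h k x))\<^sup>2)) \<partial>?M)
      = (\<Sum>k. \<integral>\<^sup>+x. ennreal (2^k * (norm (h k x))\<^sup>2) \<partial>?M)"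
    by (rule nn_integral_suminf) measurable
  also have "\<dots> = (\<Sum>k. ennreal (2^k * (L2_norm \<Omega> (h k))\<^sup>2))"
    by (simp add: ennreal_mult nn_integral_cmult L2_nn_integral[OF hL2])
  also have "\<dots> \<le> (\<Sum>k. ennreal ((1/2)^k))"
  proof (intro suminf_le summableI ennreal_leI)
    fix k
    have "2^k * (L2_norm \<Omega> (h k))\<^sup>2 \<le> 2^k * ((1/2)^k)\<^sup>2"
      using hn[of k] by (intro mult_left_mono) auto
    also have "\<dots> = (1/2)^k"
      by (simp add: power2_eq_square power_one_over field_simps)
    finally show "2^k * (L2_norm \<Omega> (h k))\<^sup>2 \<le> (1/2)^k" .
  qed
  also have "\<dots> = ennreal (\<Sum>k. (1/2)^k)"
    by (intro suminf_ennreal2 summable_geometric) auto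
  also have "\<dots> < \<infinity>" by simp
  finally have "(\<integral>\<^sup>+x. (\<Sum>k. ennreal (2^k * (norm (h k x))\<^sup>2)) \<partial>?M) < \<infinity>" .
  then have "AE x in ?M. (\<Sum>k. ennreal (2^k * (norm (h k x))\<^sup>2)) \<noteq> \<infinity>"
    by (intro nn_integral_PInf_AE) auto
  then have conv: "AE x in ?M. convergent (\<lambda>k. f (s k) x)"
  proof eventually_elim
    case (elim x)
    define S where "S = (\<Sum>k. ennreal (2^k * (norm (h k x))\<^sup>2))"
    have bound: "norm (h k x) \<le> sqrt (enn2real S) * (sqrt (1/2))^k" for k
    proof -
      have "(\<Sum>j\<in>{k}. ennreal (2^j * (norm (h j x))\<^sup>2)) \<le> S"
        unfolding S_def by (rule sum_le_suminf) auto
      then have "ennreal (2^k * (norm (h k x))\<^sup>2) \<le> S" by simp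
      also have "S = ennreal (enn2real S)" using elim by (simp add: S_def top.not_eq_extremum)
      finally have "2^k * (norm (h k x))\<^sup>2 \<le> enn2real S"
        by (subst (asm) ennreal_le_iff) (rule enn2real_nonneg)
      then have "2^k * (norm (h k x))\<^sup>2 * (1/2)^k \<le> enn2real S * (1/2)^k"
        by (rule mult_right_mono) simp
      moreover have "2^k * (norm (h k x))\<^sup>2 * (1/2)^k = (norm (h k x))\<^sup>2"
        by (simp add: power_one_over)
      ultimately have "(norm (h k x))\<^sup>2 \<le> enn2real S * (1/2)^k" by simp
      then have "norm (h k x) \<le> sqrt (enn2real S * (1/2)^k)" by (rule real_le_rsqrt)
      then show ?thesis by (simp add: real_sqrt_mult real_sqrt_power)
    qed
    have "summable (\<lambda>k. sqrt (enn2real S) * (sqrt (1/2))^k)"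
      by (intro summable_mult summable_geometric) (simp add: real_sqrt_lt_1_iff)
    then have "summable (\<lambda>k. h k x)"
      by (rule summable_comparison_test[rotated]) (use bound in auto)
    then have "convergent (\<lambda>n. \<Sum>k<n. h k x)" by (simp add: summable_iff_convergent)
    then have "convergent (\<lambda>n. (\<Sum>k<n. h k x) + f (s 0) x)" by (intro convergent_add convergent_const)
    moreover have "(\<Sum>k<n. h k x) + f (s 0) x = f (s n) x" for n
      using sum_lessThan_telescope[of "\<lambda>k. f (s k) x" n] by (simp add: h_def)
    ultimately show ?case by simp
  qed
  define g where "g x = lim (\<lambda>k. f (s k) x)" for x
  have gm [measurable]: "g \<in> borel_measurable ?M"
    unfolding g_def by (intro borel_measurable_lim_metric fm)
  have glim: "AE x in ?M. (\<lambda>k. f (s k) x) \<longlonglongrightarrow> g x"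
    using conv by eventually_elim (auto simp: g_def convergent_LIMSEQ_iff)
  have close: "(\<lambda>x. f m x - g x) \<in> L2 \<Omega> \<and> L2_norm \<Omega> (\<lambda>x. f m x - g x) \<le> (1/2)^j"
    if m: "m \<ge> N j" for m j
  proof -
    have "(\<integral>\<^sup>+x. ennreal ((norm (f m x - g x))\<^sup>2) \<partial>?M) =
        (\<integral>\<^sup>+x. liminf (\<lambda>k. ennreal ((norm (f m x - f (s k) x))\<^sup>2)) \<partial>?M)"
    proof (rule nn_integral_cong_AE)
      show "AE x in ?M. ennreal ((norm (f m x - g x))\<^sup>2)
          = liminf (\<lambda>k. ennreal ((norm (f m x - f (s k) x))\<^sup>2))"
        using glim
      proof eventually_elim
        case (elim x)
        then have "(\<lambda>k. ennreal ((norm (f m x - f (s k) x))\<^sup>2)) \<longlonglongrightarrow> ennreal ((norm (f m x - g x))\<^sup>2)"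
          by (intro tendsto_intros tendsto_ennrealI)
        then show ?case by (rule lim_imp_Liminf[OF sequentially_bot, symmetric])
      qed
    qed
    also have "\<dots> \<le> liminf (\<lambda>k. \<integral>\<^sup>+x. ennreal ((norm (f m x - f (s k) x))\<^sup>2) \<partial>?M)"
      by (rule nn_integral_liminf) measurable
    also have "\<dots> \<le> limsup (\<lambda>k. \<integral>\<^sup>+x. ennreal ((norm (f m x - f (s k) x))\<^sup>2) \<partial>?M)"
      by (rule Liminf_le_Limsup) simp
    also have "\<dots> \<le> ennreal (((1/2)^j)\<^sup>2)"
    proof (rule Limsup_bounded)
      have "(\<integral>\<^sup>+x. ennreal ((norm (f m x - f (s k) x))\<^sup>2) \<partial>?M) \<le> ennreal (((1/2)^j)\<^sup>2)"
        if "k \<ge> j" for k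
        using N[of j m "s k"] m sN[OF that]
        by (subst L2_nn_integral) (auto intro!: f power_mono ennreal_leI simp: less_imp_le)
      then show "\<forall>\<^sub>F k in sequentially.
          (\<integral>\<^sup>+x. ennreal ((norm (f m x - f (s k) x))\<^sup>2) \<partial>?M) \<le> ennreal (((1/2)^j)\<^sup>2)"
        by (auto simp: eventually_sequentially)
    qed
    finally have *: "(\<integral>\<^sup>+x. ennreal ((norm (f m x - g x))\<^sup>2) \<partial>?M) \<le> ennreal (((1/2)^j)\<^sup>2)" .
    show ?thesis
      using L2I_nn_integral[OF _ _ *] by auto
  qed
  have "(\<lambda>x. f (N 0) x - (f (N 0) x - g x)) \<in> L2 \<Omega>"
    by (rule L2_diff[OF f]) (use close[where m = "N 0" and j = 0] in simp)
  moreover have "(\<lambda>x. f (N 0) x - (f (N 0) x - g x)) = g" by auto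
  ultimately have "g \<in> L2 \<Omega>" by metis
  moreover have "(\<lambda>n. L2_norm \<Omega> (\<lambda>x. f n x - g x)) \<longlonglongrightarrow> 0"
  proof (rule LIMSEQ_I)
    fix e :: real assume "e > 0"
    then obtain j where j: "(1/2)^j < e" using real_arch_pow_inv[of e "1/2"] by auto
    show "\<exists>no. \<forall>n\<ge>no. norm (L2_norm \<Omega> (\<lambda>x. f n x - g x) - 0) < e"
      using close[of j] j by (intro exI[of _ "N j"]) force
  qed
  ultimately show ?thesis by blast
qed

section \<open>Orthogonal series in \<open>L^2(\<Omega>)\<close>\<close>

lemma L2_inner_scaleR_right: "L2_inner \<Omega> h (\<lambda>x. c *\<^sub>R f x) = c * L2_inner \<Omega> h f"
  using L2_inner_scaleR_left[of \<Omega> c f h] by (simp add: L2_inner_commute)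

lemma L2_norm_orthogonal_sum:
  fixes e :: "nat \<Rightarrow> real^2 \<Rightarrow> 'b::euclidean_space"
  assumes e: "\<And>k. e k \<in> L2 \<Omega>"
    and orth: "\<And>j k. L2_inner \<Omega> (e j) (e k) = (if j = k then w k else 0)" and I: "finite I"
  shows "(L2_norm \<Omega> (\<lambda>x. \<Sum>k\<in>I. c k *\<^sub>R e k x))\<^sup>2 = (\<Sum>k\<in>I. w k * (c k)\<^sup>2)"
proof -
  have "(L2_norm \<Omega> (\<lambda>x. \<Sum>k\<in>I. c k *\<^sub>R e k x))\<^sup>2 = (\<Sum>j\<in>I. \<Sum>k\<in>I. c j * (c k * L2_inner \<Omega> (e j) (e k)))"
    unfolding L2_norm_power2
    by (subst L2_inner_sum_left) (auto simp: e L2_inner_sum_right L2_inner_scaleR_left L2_inner_scaleR_right sum_distrib_left intro!: sum.cong)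
  also have "\<dots> = (\<Sum>j\<in>I. w j * (c j)\<^sup>2)"
  proof (intro sum.cong refl)
    fix j assume j: "j \<in> I"
    have "(\<Sum>k\<in>I. c j * (c k * L2_inner \<Omega> (e j) (e k))) = (\<Sum>k\<in>I. if k = j then w j * (c j)\<^sup>2 else 0)"
      by (intro sum.cong refl) (auto simp: orth power2_eq_square)
    then show "(\<Sum>k\<in>I. c j * (c k * L2_inner \<Omega> (e j) (e k))) = w j * (c j)\<^sup>2"
      using I j by simp
  qed
  finally show ?thesis .
qed

text \<open>The weights \<open>w\<close> allow orthogonal systems that are not normalised; the case in point is the system
  of the gradients of the eigenfunctions, whose squared norms are the eigenvalues.\<close>

lemma orthogonal_series_converges:
  fixes e :: "nat \<Rightarrow> real^2 \<Rightarrow> 'b::euclidean_space"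
  assumes e: "\<And>k. e k \<in> L2 \<Omega>"
    and orth: "\<And>j k. L2_inner \<Omega> (e j) (e k) = (if j = k then w k else 0)"
    and summ: "summable (\<lambda>k. w k * (c k)\<^sup>2)"
  shows "\<exists>g\<in>L2 \<Omega>. (\<lambda>m. L2_norm \<Omega> (\<lambda>x. (\<Sum>k<m. c k *\<^sub>R e k x) - g x)) \<longlonglongrightarrow> 0"
proof (rule L2_complete)
  show "(\<lambda>x. \<Sum>k<n. c k *\<^sub>R e k x) \<in> L2 \<Omega>" for n by (intro L2_sum L2_scaleR e)
  fix d :: real assume d: "0 < d"
  then have "0 < d\<^sup>2" by simp
  then obtain N where N: "\<And>m n. m \<ge> N \<Longrightarrow> norm (\<Sum>k=m..<n. w k * (c k)\<^sup>2) < d\<^sup>2"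
    using summ unfolding summable_Cauchy by blast
  have *: "L2_norm \<Omega> (\<lambda>x. (\<Sum>k<n. c k *\<^sub>R e k x) - (\<Sum>k<m. c k *\<^sub>R e k x)) < d" if "m \<ge> N" "m \<le> n" for m n
  proof -
    have "(\<Sum>k<n. c k *\<^sub>R e k x) - (\<Sum>k<m. c k *\<^sub>R e k x) = (\<Sum>k\<in>{m..<n}. c k *\<^sub>R e k x)" for x
      using sum_diff_nat_ivl[of 0 m n "\<lambda>k. c k *\<^sub>R e k x"] that(2) by (simp add: lessThan_atLeast0)
    then have "(L2_norm \<Omega> (\<lambda>x. (\<Sum>k<n. c k *\<^sub>R e k x) - (\<Sum>k<m. c k *\<^sub>R e k x)))\<^sup>2 = (\<Sum>k\<in>{m..<n}. w k * (c k)\<^sup>2)"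
      using L2_norm_orthogonal_sum[OF e orth, of "{m..<n}" c] by simp
    also have "\<dots> < d\<^sup>2" using N[OF that(1), of n] by simp
    finally show ?thesis by (rule power2_less_imp_less) (use d in simp)
  qed
  show "\<exists>N. \<forall>m\<ge>N. \<forall>n\<ge>N. L2_norm \<Omega> (\<lambda>x. (\<Sum>k<m. c k *\<^sub>R e k x) - (\<Sum>k<n. c k *\<^sub>R e k x)) < d"
  proof (intro exI[of _ N] allI impI)
    fix m n assume mn: "N \<le> m" "N \<le> n"
    show "L2_norm \<Omega> (\<lambda>x. (\<Sum>k<m. c k *\<^sub>R e k x) - (\<Sum>k<n. c k *\<^sub>R e k x)) < d"
    proof (cases "m \<le> n")
      case True
      show ?thesis by (subst L2_norm_minus_commute) (rule *[OF mn(1) True])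
    next
      case False
      then show ?thesis using *[OF mn(2), of m] by simp
    qed
  qed
qed

lemma orthogonal_series_norm:
  fixes e :: "nat \<Rightarrow> real^2 \<Rightarrow> 'b::euclidean_space"
  assumes e: "\<And>k. e k \<in> L2 \<Omega>"
    and orth: "\<And>j k. L2_inner \<Omega> (e j) (e k) = (if j = k then w k else 0)"
    and g: "g \<in> L2 \<Omega>" and lim: "(\<lambda>m. L2_norm \<Omega> (\<lambda>x. (\<Sum>k<m. c k *\<^sub>R e k x) - g x)) \<longlonglongrightarrow> 0"
  shows "(\<lambda>k. w k * (c k)\<^sup>2) sums (L2_norm \<Omega> g)\<^sup>2"
proof -
  have "(\<lambda>m. L2_norm \<Omega> (\<lambda>x. \<Sum>k<m. c k *\<^sub>R e k x)) \<longlonglongrightarrow> L2_norm \<Omega> g"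
    by (rule L2_norm_tendsto[OF lim _ g]) (intro L2_sum L2_scaleR e)
  then have "(\<lambda>m. (L2_norm \<Omega> (\<lambda>x. \<Sum>k<m. c k *\<^sub>R e k x))\<^sup>2) \<longlonglongrightarrow> (L2_norm \<Omega> g)\<^sup>2"
    by (rule tendsto_power)
  then show ?thesis
    unfolding sums_def by (simp add: L2_norm_orthogonal_sum[OF e orth])
qed

section \<open>Test functions\<close>

lemma smooth_differentiable: "smooth f \<Longrightarrow> f differentiable (at x)"
  unfolding smooth_def differentiable_on_def by (drule spec[of _ "[]"]) simp

lemma smooth_partial: "smooth f \<Longrightarrow> smooth (partial i f)"
  unfolding smooth_def
proof
  fix "is" assume "\<forall>is. foldr partial is f differentiable_on UNIV"
  then have "foldr partial (is @ [i]) f differentiable_on UNIV" by blast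
  then show "foldr partial is (partial i f) differentiable_on UNIV" by simp
qed

lemma partial_lincomb:
  assumes "f differentiable (at x)" "g differentiable (at x)"
  shows "partial i (\<lambda>x. c * f x + g x) x = c * partial i f x + partial i g x"
proof -
  have "((\<lambda>x. c * f x + g x) has_derivative
      (\<lambda>h. c * frechet_derivative f (at x) h + frechet_derivative g (at x) h)) (at x)"
    using assms by (intro has_derivative_add has_derivative_mult_right) (simp_all add: frechet_derivative_works)
  then have "frechet_derivative (\<lambda>x. c * f x + g x) (at x) =
      (\<lambda>h. c * frechet_derivative f (at x) h + frechet_derivative g (at x) h)"
    by (rule frechet_derivative_at[symmetric])
  then show ?thesis by (simp add: partial_def)
qed

lemma smooth_lincomb:
  assumes f: "smooth f" and g: "smooth g"
  shows "smooth (\<lambda>x. c * f x + g x)"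
proof -
  have eq: "foldr partial is (\<lambda>x. c * f x + g x) = (\<lambda>x. c * foldr partial is f x + foldr partial is g x)" for "is"
  proof (induction "is")
    case (Cons i "is")
    have d: "foldr partial is f differentiable (at x)" "foldr partial is g differentiable (at x)" for x
      using f g by (auto simp: smooth_def differentiable_on_def)
    show ?case by (rule ext) (simp add: Cons partial_lincomb[OF d])
  qed simp
  show ?thesis
    unfolding smooth_def eq
    using f g by (intro allI differentiable_on_add differentiable_on_mult differentiable_on_const) (auto simp: smooth_def)
qed

lemma smooth_zero: "smooth (\<lambda>x. 0)"
proof -
  have p: "partial i (\<lambda>x. 0) = (\<lambda>x. 0)" for i
    by (rule ext) (simp add: partial_def)
  have "foldr partial is (\<lambda>x. 0) = (\<lambda>x. 0)" for "is"
    by (induction "is") (auto simp: p)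
  then show ?thesis by (simp add: smooth_def)
qed

lemma test_functions_zero: "(\<lambda>x. 0) \<in> test_functions \<Omega>"
  by (auto simp: test_functions_def smooth_zero intro!: exI[of _ "{}"])

lemma test_functions_lincomb:
  assumes "\<eta> \<in> test_functions \<Omega>" "\<zeta> \<in> test_functions \<Omega>"
  shows "(\<lambda>x. c * \<eta> x + \<zeta> x) \<in> test_functions \<Omega>"
proof -
  obtain K L where "K \<subseteq> \<Omega>" "compact K" "\<And>x. x \<notin> K \<Longrightarrow> \<eta> x = 0" "L \<subseteq> \<Omega>" "compact L" "\<And>x. x \<notin> L \<Longrightarrow> \<zeta> x = 0"
    using assms by (auto simp: test_functions_def)
  then show ?thesis
    using assms by (auto simp: test_functions_def intro!: smooth_lincomb exI[of _ "K \<union> L"])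
qed

lemma test_functions_partial:
  assumes "\<eta> \<in> test_functions \<Omega>" shows "partial i \<eta> \<in> test_functions \<Omega>"
proof -
  obtain K where K: "K \<subseteq> \<Omega>" "compact K" "\<And>x. x \<notin> K \<Longrightarrow> \<eta> x = 0" and s: "smooth \<eta>"
    using assms by (auto simp: test_functions_def)
  have "partial i \<eta> x = 0" if x: "x \<notin> K" for x
  proof -
    have "open (- K)" using K(2) by (simp add: compact_imp_closed open_Compl)
    then have "(\<eta> has_derivative (\<lambda>h. 0)) (at x)"
      by (rule has_derivative_transform_within_open[OF has_derivative_const[of 0]]) (use x K(3) in auto)
    then show ?thesis by (simp add: partial_def frechet_derivative_at[symmetric])
  qed
  then show ?thesis using K s by (auto simp: test_functions_def smooth_partial)
qed

lemma grad_lincomb: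
  assumes "\<eta> \<in> test_functions \<Omega>" "\<zeta> \<in> test_functions \<Omega>"
  shows "grad (\<lambda>x. c * \<eta> x + \<zeta> x) x = c *\<^sub>R grad \<eta> x + grad \<zeta> x"
  using assms by (simp add: grad_def vec_eq_iff partial_lincomb test_functions_def smooth_differentiable)

lemma test_functions_L2:
  assumes dom: "bounded_domain \<Omega>" and \<eta>: "\<eta> \<in> test_functions \<Omega>"
  shows "\<eta> \<in> L2 \<Omega>"
proof -
  obtain K where K: "K \<subseteq> \<Omega>" "compact K" "\<And>x. x \<notin> K \<Longrightarrow> \<eta> x = 0" and s: "smooth \<eta>"
    using \<eta> by (auto simp: test_functions_def)
  have cont: "continuous_on UNIV \<eta>"
    using s smooth_differentiable by (simp add: continuous_at_imp_continuous_on differentiable_imp_continuous_within)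
  have meas: "\<eta> \<in> borel_measurable (lebesgue_on \<Omega>)"
    using borel_measurable_continuous_onI[OF cont] by (intro measurable_restrict_space1 measurable_completion) simp
  have "bounded (\<eta> ` K)"
    using K cont by (intro compact_imp_bounded compact_continuous_image continuous_on_subset[OF cont]) auto
  then obtain B where "\<forall>y\<in>\<eta> ` K. norm y \<le> B" unfolding bounded_iff by blast
  then have B: "\<bar>\<eta> x\<bar> \<le> max B 0" for x using K(3)[of x] by (cases "x \<in> K") auto
  have lm: "\<Omega> \<in> lmeasurable" using dom by (intro lmeasurable_open) (auto simp: bounded_domain_def)
  have "integrable (lebesgue_on \<Omega>) (\<lambda>x. (norm (\<eta> x))\<^sup>2)"
  proof (rule Bochner_Integration.integrable_bound)
    show "integrable (lebesgue_on \<Omega>) (\<lambda>x. (max B 0)\<^sup>2)"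
      by (rule finite_measure.integrable_const[OF finite_measure_lebesgue_on[OF lm]])
    show "(\<lambda>x. (norm (\<eta> x))\<^sup>2) \<in> borel_measurable (lebesgue_on \<Omega>)" using meas by measurable
    show "AE x in lebesgue_on \<Omega>. norm ((norm (\<eta> x))\<^sup>2) \<le> norm ((max B 0)\<^sup>2)"
    proof (rule AE_I2)
      fix x
      have "\<bar>\<eta> x\<bar>\<^sup>2 \<le> (max B 0)\<^sup>2" using B by (intro power_mono) auto
      then show "norm ((norm (\<eta> x))\<^sup>2) \<le> norm ((max B 0)\<^sup>2)" by simp
    qed
  qed
  with meas show ?thesis by (simp add: L2_def)
qed

lemma L2_vec:
  fixes f :: "real^2 \<Rightarrow> real^2"
  assumes "\<And>i. (\<lambda>x. f x $ i) \<in> L2 \<Omega>"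
  shows "f \<in> L2 \<Omega>"
proof -
  have "(\<lambda>x. (f x $ i) *\<^sub>R (axis i 1 :: real^2)) \<in> L2 \<Omega>" for i
  proof -
    have "(\<lambda>x. (f x $ i) *\<^sub>R (axis i 1 :: real^2)) \<in> borel_measurable (lebesgue_on \<Omega>)"
      using L2_measurable[OF assms] by (intro borel_measurable_scaleR) auto
    then show ?thesis using assms[of i] by (simp add: L2_def norm_axis_1)
  qed
  then have "(\<lambda>x. \<Sum>i\<in>UNIV. (f x $ i) *\<^sub>R (axis i 1 :: real^2)) \<in> L2 \<Omega>" by (intro L2_sum)
  moreover have "(\<lambda>x. \<Sum>i\<in>UNIV. (f x $ i) *\<^sub>R (axis i 1 :: real^2)) = f"
    by (rule ext) (simp add: vec_eq_iff axis_def if_distrib[of "\<lambda>y. _ * y"] cong: if_cong)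
  ultimately show ?thesis by simp
qed

lemma grad_L2: "bounded_domain \<Omega> \<Longrightarrow> \<eta> \<in> test_functions \<Omega> \<Longrightarrow> grad \<eta> \<in> L2 \<Omega>"
  by (intro L2_vec) (simp add: grad_def test_functions_L2 test_functions_partial)

lemma L2_inner_components:
  fixes f g :: "real^2 \<Rightarrow> real^2"
  assumes "f \<in> L2 \<Omega>" "g \<in> L2 \<Omega>"
  shows "L2_inner \<Omega> f g = (\<Sum>i\<in>UNIV. L2_inner \<Omega> (\<lambda>x. f x $ i) (\<lambda>x. g x $ i))"
  unfolding L2_inner_def inner_vec_def
  by (rule Bochner_Integration.integral_sum)
     (use L2_inner_integrable[OF L2_component[OF assms(1)] L2_component[OF assms(2)]] in simp)

lemma L2_norm_component_le:
  fixes f :: "real^2 \<Rightarrow> real^2"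
  assumes "f \<in> L2 \<Omega>"
  shows "L2_norm \<Omega> (\<lambda>x. f x $ i) \<le> L2_norm \<Omega> f"
  unfolding L2_norm_def
proof (intro real_sqrt_le_mono integral_mono)
  show "integrable (lebesgue_on \<Omega>) (\<lambda>x. (norm (f x $ i))\<^sup>2)" using L2_component[OF assms] by (simp add: L2_def)
  show "integrable (lebesgue_on \<Omega>) (\<lambda>x. (norm (f x))\<^sup>2)" using assms by (simp add: L2_def)
  show "(norm (f x $ i))\<^sup>2 \<le> (norm (f x))\<^sup>2" for x
    by (rule power_mono[OF Finite_Cartesian_Product.norm_nth_le norm_ge_zero])
qed

section \<open>The space \<open>H^1_0(\<Omega>)\<close>\<close>

text \<open>Membership in \<open>H^1_0(\<Omega>)\<close> with the gradient made explicit, so that the pair of function and gradient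
  can be treated as an element of a closed linear space.\<close>

definition has_H10_grad :: "(real^2) set \<Rightarrow> (real^2 \<Rightarrow> real) \<Rightarrow> (real^2 \<Rightarrow> real^2) \<Rightarrow> bool" where
  "has_H10_grad \<Omega> w g \<longleftrightarrow> has_weak_grad \<Omega> w g \<and>
     (\<exists>\<eta>::nat \<Rightarrow> real^2 \<Rightarrow> real. (\<forall>j. \<eta> j \<in> test_functions \<Omega>) \<and>
        (\<lambda>j. L2_norm \<Omega> (\<lambda>x. \<eta> j x - w x)) \<longlonglongrightarrow> 0 \<and>
        (\<lambda>j. L2_norm \<Omega> (\<lambda>x. grad (\<eta> j) x - g x)) \<longlonglongrightarrow> 0)"

lemma H10_iff: "w \<in> H10 \<Omega> \<longleftrightarrow> (\<exists>g. has_H10_grad \<Omega> w g)"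
  by (simp add: H10_def has_H10_grad_def)

lemma has_H10_gradD:
  assumes "has_H10_grad \<Omega> w g"
  shows "w \<in> L2 \<Omega>" "g \<in> L2 \<Omega>" "has_weak_grad \<Omega> w g"
  using assms by (auto simp: has_H10_grad_def has_weak_grad_def)

lemma H10_L2: "w \<in> H10 \<Omega> \<Longrightarrow> w \<in> L2 \<Omega>"
  by (auto simp: H10_iff dest: has_H10_gradD)

lemma has_H10_grad_lincomb:
  assumes dom: "bounded_domain \<Omega>" and w: "has_H10_grad \<Omega> w g" and v: "has_H10_grad \<Omega> v h"
  shows "has_H10_grad \<Omega> (\<lambda>x. c * w x + v x) (\<lambda>x. c *\<^sub>R g x + h x)"
proof -
  note L = has_H10_gradD[OF w] has_H10_gradD[OF v]
  have LL: "(\<lambda>x. c * w x + v x) \<in> L2 \<Omega>" "(\<lambda>x. c *\<^sub>R g x + h x) \<in> L2 \<Omega>"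
    using L by auto
  have "has_weak_grad \<Omega> (\<lambda>x. c * w x + v x) (\<lambda>x. c *\<^sub>R g x + h x)"
    unfolding has_weak_grad_def
  proof (intro conjI ballI allI LL)
    fix \<eta> i assume \<eta>: "\<eta> \<in> test_functions \<Omega>"
    have e: "\<eta> \<in> L2 \<Omega>" "partial i \<eta> \<in> L2 \<Omega>"
      using \<eta> dom by (auto intro: test_functions_L2 test_functions_partial)
    have "L2_inner \<Omega> (\<lambda>x. c * w x + v x) (partial i \<eta>) = c * L2_inner \<Omega> w (partial i \<eta>) + L2_inner \<Omega> v (partial i \<eta>)"
      using L e by (subst L2_inner_add_left) (auto simp: L2_inner_mult_left)
    also have "\<dots> = - (c * L2_inner \<Omega> (\<lambda>x. g x $ i) \<eta> + L2_inner \<Omega> (\<lambda>x. h x $ i) \<eta>)"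
      using L \<eta> by (simp add: has_weak_grad_def)
    also have "c * L2_inner \<Omega> (\<lambda>x. g x $ i) \<eta> + L2_inner \<Omega> (\<lambda>x. h x $ i) \<eta> = L2_inner \<Omega> (\<lambda>x. c * g x $ i + h x $ i) \<eta>"
      using L2_component[OF L(2), of i] L2_component[OF L(5), of i] e
      by (subst L2_inner_add_left) (auto simp: L2_inner_mult_left)
    finally show "L2_inner \<Omega> (\<lambda>x. c * w x + v x) (partial i \<eta>) = - L2_inner \<Omega> (\<lambda>x. (c *\<^sub>R g x + h x) $ i) \<eta>"
      by simp
  qed
  moreover obtain \<eta> where \<eta>: "\<And>j. \<eta> j \<in> test_functions \<Omega>" "(\<lambda>j. L2_norm \<Omega> (\<lambda>x. \<eta> j x - w x)) \<longlonglongrightarrow> 0"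
      "(\<lambda>j. L2_norm \<Omega> (\<lambda>x. grad (\<eta> j) x - g x)) \<longlonglongrightarrow> 0"
    using w by (auto simp: has_H10_grad_def)
  moreover obtain \<zeta> where \<zeta>: "\<And>j. \<zeta> j \<in> test_functions \<Omega>" "(\<lambda>j. L2_norm \<Omega> (\<lambda>x. \<zeta> j x - v x)) \<longlonglongrightarrow> 0"
      "(\<lambda>j. L2_norm \<Omega> (\<lambda>x. grad (\<zeta> j) x - h x)) \<longlonglongrightarrow> 0"
    using v by (auto simp: has_H10_grad_def)
  have lim1: "(\<lambda>j. L2_norm \<Omega> (\<lambda>x. (c * \<eta> j x + \<zeta> j x) - (c * w x + v x))) \<longlonglongrightarrow> 0"
  proof (rule tendsto_sandwich[OF always_eventually always_eventually tendsto_const])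
    show "(\<lambda>j. \<bar>c\<bar> * L2_norm \<Omega> (\<lambda>x. \<eta> j x - w x) + L2_norm \<Omega> (\<lambda>x. \<zeta> j x - v x)) \<longlonglongrightarrow> 0"
      using tendsto_add[OF tendsto_mult_left[OF \<eta>(2), of "\<bar>c\<bar>"] \<zeta>(2)] by simp
    show "\<forall>j. L2_norm \<Omega> (\<lambda>x. (c * \<eta> j x + \<zeta> j x) - (c * w x + v x)) \<le> \<bar>c\<bar> * L2_norm \<Omega> (\<lambda>x. \<eta> j x - w x) + L2_norm \<Omega> (\<lambda>x. \<zeta> j x - v x)"
    proof
      fix j
      have "(\<lambda>x. (c * \<eta> j x + \<zeta> j x) - (c * w x + v x)) = (\<lambda>x. c * (\<eta> j x - w x) + (\<zeta> j x - v x))"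
        by (simp add: fun_eq_iff algebra_simps)
      then show "L2_norm \<Omega> (\<lambda>x. (c * \<eta> j x + \<zeta> j x) - (c * w x + v x)) \<le> \<bar>c\<bar> * L2_norm \<Omega> (\<lambda>x. \<eta> j x - w x) + L2_norm \<Omega> (\<lambda>x. \<zeta> j x - v x)"
        using L2_norm_triangle[of "\<lambda>x. c * (\<eta> j x - w x)" \<Omega> "\<lambda>x. \<zeta> j x - v x"] L
          test_functions_L2[OF dom \<eta>(1)] test_functions_L2[OF dom \<zeta>(1)]
        by (simp add: L2_norm_mult)
    qed
  qed simp
  have lim2: "(\<lambda>j. L2_norm \<Omega> (\<lambda>x. grad (\<lambda>x. c * \<eta> j x + \<zeta> j x) x - (c *\<^sub>R g x + h x))) \<longlonglongrightarrow> 0"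
  proof (rule tendsto_sandwich[OF always_eventually always_eventually tendsto_const])
    show "(\<lambda>j. \<bar>c\<bar> * L2_norm \<Omega> (\<lambda>x. grad (\<eta> j) x - g x) + L2_norm \<Omega> (\<lambda>x. grad (\<zeta> j) x - h x)) \<longlonglongrightarrow> 0"
      using tendsto_add[OF tendsto_mult_left[OF \<eta>(3), of "\<bar>c\<bar>"] \<zeta>(3)] by simp
    show "\<forall>j. L2_norm \<Omega> (\<lambda>x. grad (\<lambda>x. c * \<eta> j x + \<zeta> j x) x - (c *\<^sub>R g x + h x)) \<le> \<bar>c\<bar> * L2_norm \<Omega> (\<lambda>x. grad (\<eta> j) x - g x) + L2_norm \<Omega> (\<lambda>x. grad (\<zeta> j) x - h x)"
    proof
      fix j
      have "(\<lambda>x. grad (\<lambda>x. c * \<eta> j x + \<zeta> j x) x - (c *\<^sub>R g x + h x)) = (\<lambda>x. c *\<^sub>R (grad (\<eta> j) x - g x) + (grad (\<zeta> j) x - h x))"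
        by (rule ext, subst grad_lincomb[OF \<eta>(1) \<zeta>(1)], simp add: algebra_simps)
      moreover have "L2_norm \<Omega> (\<lambda>x. c *\<^sub>R (grad (\<eta> j) x - g x)) = \<bar>c\<bar> * L2_norm \<Omega> (\<lambda>x. grad (\<eta> j) x - g x)"
        by (simp add: L2_norm_def power_mult_distrib real_sqrt_mult)
      ultimately show "L2_norm \<Omega> (\<lambda>x. grad (\<lambda>x. c * \<eta> j x + \<zeta> j x) x - (c *\<^sub>R g x + h x)) \<le> \<bar>c\<bar> * L2_norm \<Omega> (\<lambda>x. grad (\<eta> j) x - g x) + L2_norm \<Omega> (\<lambda>x. grad (\<zeta> j) x - h x)"
        using L2_norm_triangle[of "\<lambda>x. c *\<^sub>R (grad (\<eta> j) x - g x)" \<Omega> "\<lambda>x. grad (\<zeta> j) x - h x"] L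
          grad_L2[OF dom \<eta>(1)] grad_L2[OF dom \<zeta>(1)]
        by simp
    qed
  qed simp
  ultimately show ?thesis
    unfolding has_H10_grad_def using test_functions_lincomb[OF \<eta>(1) \<zeta>(1)] lim1 lim2
    by (intro conjI exI[of _ "\<lambda>j x. c * \<eta> j x + \<zeta> j x"]) auto
qed

lemma has_H10_grad_zero: "has_H10_grad \<Omega> (\<lambda>x. 0) (\<lambda>x. 0)"
proof -
  have "grad (\<lambda>x. 0) = (\<lambda>x. 0)" by (rule ext) (simp add: grad_def partial_def vec_eq_iff)
  then show ?thesis
    unfolding has_H10_grad_def has_weak_grad_def
    by (auto simp: test_functions_zero intro!: exI[of _ "\<lambda>j x. 0"])
qed

lemma has_H10_grad_sum:
  fixes m :: nat
  assumes "bounded_domain \<Omega>" "\<And>k. has_H10_grad \<Omega> (w k) (g k)"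
  shows "has_H10_grad \<Omega> (\<lambda>x. \<Sum>k<m. c k * w k x) (\<lambda>x. \<Sum>k<m. c k *\<^sub>R g k x)"
proof (induction m)
  case (Suc m)
  show ?case using has_H10_grad_lincomb[OF assms(1,2) Suc, of "c m"] by (simp add: add.commute)
qed (simp add: has_H10_grad_zero)

text \<open>Both parts of the definition survive limits in \<open>L^2\<close>: the weak gradient because it is defined by
  inner products with fixed test functions, the approximability by choosing for each \<open>m\<close> a test
  function within \<open>1/(m+1)\<close> of \<open>W m\<close>.\<close>

lemma has_H10_grad_closed:
  assumes dom: "bounded_domain \<Omega>" and W: "\<And>m. has_H10_grad \<Omega> (W m) (G m)"
    and w: "w \<in> L2 \<Omega>" "(\<lambda>m. L2_norm \<Omega> (\<lambda>x. W m x - w x)) \<longlonglongrightarrow> 0"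
    and g: "g \<in> L2 \<Omega>" "(\<lambda>m. L2_norm \<Omega> (\<lambda>x. G m x - g x)) \<longlonglongrightarrow> 0"
  shows "has_H10_grad \<Omega> w g"
proof -
  note L = has_H10_gradD[OF W]
  have "has_weak_grad \<Omega> w g"
    unfolding has_weak_grad_def
  proof (intro conjI ballI allI w(1) g(1))
    fix \<eta> i assume \<eta>: "\<eta> \<in> test_functions \<Omega>"
    have e: "\<eta> \<in> L2 \<Omega>" "partial i \<eta> \<in> L2 \<Omega>"
      using \<eta> dom by (auto intro: test_functions_L2 test_functions_partial)
    have l1: "(\<lambda>m. L2_inner \<Omega> (W m) (partial i \<eta>)) \<longlonglongrightarrow> L2_inner \<Omega> w (partial i \<eta>)"
      by (rule L2_inner_tendsto_left[OF w(2) L(1) w(1) e(2)])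
    have "(\<lambda>m. L2_norm \<Omega> (\<lambda>x. G m x $ i - g x $ i)) \<longlonglongrightarrow> 0"
    proof (rule tendsto_sandwich[OF always_eventually always_eventually tendsto_const g(2)])
      show "\<forall>m. L2_norm \<Omega> (\<lambda>x. G m x $ i - g x $ i) \<le> L2_norm \<Omega> (\<lambda>x. G m x - g x)"
        using L2_norm_component_le[OF L2_diff[OF L(2) g(1)], of _ i] by simp
    qed simp
    then have "(\<lambda>m. L2_inner \<Omega> (\<lambda>x. G m x $ i) \<eta>) \<longlonglongrightarrow> L2_inner \<Omega> (\<lambda>x. g x $ i) \<eta>"
      by (rule L2_inner_tendsto_left[OF _ L2_component[OF L(2)] L2_component[OF g(1)] e(1)])
    then have "(\<lambda>m. - L2_inner \<Omega> (\<lambda>x. G m x $ i) \<eta>) \<longlonglongrightarrow> - L2_inner \<Omega> (\<lambda>x. g x $ i) \<eta>"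
      by (rule tendsto_minus)
    moreover have "- L2_inner \<Omega> (\<lambda>x. G m x $ i) \<eta> = L2_inner \<Omega> (W m) (partial i \<eta>)" for m
      using L(3)[of m] \<eta> by (simp add: has_weak_grad_def)
    ultimately have l2: "(\<lambda>m. L2_inner \<Omega> (W m) (partial i \<eta>)) \<longlonglongrightarrow> - L2_inner \<Omega> (\<lambda>x. g x $ i) \<eta>" by simp
    show "L2_inner \<Omega> w (partial i \<eta>) = - L2_inner \<Omega> (\<lambda>x. g x $ i) \<eta>"
      by (rule LIMSEQ_unique[OF l1 l2])
  qed
  moreover
  have "\<exists>\<eta>. \<eta> \<in> test_functions \<Omega> \<and> L2_norm \<Omega> (\<lambda>x. \<eta> x - W m x) < 1 / Suc m \<and> L2_norm \<Omega> (\<lambda>x. grad \<eta> x - G m x) < 1 / Suc m" for m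
  proof -
    obtain \<eta> where \<eta>: "\<And>j. \<eta> j \<in> test_functions \<Omega>" "(\<lambda>j. L2_norm \<Omega> (\<lambda>x. \<eta> j x - W m x)) \<longlonglongrightarrow> 0"
        "(\<lambda>j. L2_norm \<Omega> (\<lambda>x. grad (\<eta> j) x - G m x)) \<longlonglongrightarrow> 0"
      using W[of m] by (auto simp: has_H10_grad_def)
    have "0 < 1 / real (Suc m)" by simp
    then have "\<forall>\<^sub>F j in sequentially. L2_norm \<Omega> (\<lambda>x. \<eta> j x - W m x) < 1 / Suc m"
      "\<forall>\<^sub>F j in sequentially. L2_norm \<Omega> (\<lambda>x. grad (\<eta> j) x - G m x) < 1 / Suc m"
      using order_tendstoD(2)[OF \<eta>(2)] order_tendstoD(2)[OF \<eta>(3)] by auto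
    then have "\<forall>\<^sub>F j in sequentially. L2_norm \<Omega> (\<lambda>x. \<eta> j x - W m x) < 1 / Suc m \<and> L2_norm \<Omega> (\<lambda>x. grad (\<eta> j) x - G m x) < 1 / Suc m"
      by (rule eventually_conj)
    then obtain j where "L2_norm \<Omega> (\<lambda>x. \<eta> j x - W m x) < 1 / Suc m \<and> L2_norm \<Omega> (\<lambda>x. grad (\<eta> j) x - G m x) < 1 / Suc m"
      using eventually_happens' sequentially_bot by blast
    then show ?thesis using \<eta>(1) by blast
  qed
  then have "\<forall>m. \<exists>\<eta>. \<eta> \<in> test_functions \<Omega> \<and> L2_norm \<Omega> (\<lambda>x. \<eta> x - W m x) < 1 / Suc m \<and> L2_norm \<Omega> (\<lambda>x. grad \<eta> x - G m x) < 1 / Suc m"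
    by (rule allI)
  from choice[OF this] obtain \<eta> where "\<forall>m. \<eta> m \<in> test_functions \<Omega> \<and> L2_norm \<Omega> (\<lambda>x. \<eta> m x - W m x) < 1 / Suc m \<and> L2_norm \<Omega> (\<lambda>x. grad (\<eta> m) x - G m x) < 1 / Suc m"
    by (rule exE)
  then have \<eta>: "\<And>m. \<eta> m \<in> test_functions \<Omega>" "\<And>m. L2_norm \<Omega> (\<lambda>x. \<eta> m x - W m x) < 1 / Suc m"
      "\<And>m. L2_norm \<Omega> (\<lambda>x. grad (\<eta> m) x - G m x) < 1 / Suc m"
    by simp_all
  have inv: "(\<lambda>m. 1 / real (Suc m)) \<longlonglongrightarrow> 0" using LIMSEQ_inverse_real_of_nat by (simp add: inverse_eq_divide)
  have "(\<lambda>m. L2_norm \<Omega> (\<lambda>x. \<eta> m x - w x)) \<longlonglongrightarrow> 0"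
  proof (rule tendsto_sandwich[OF always_eventually always_eventually tendsto_const])
    show "(\<lambda>m. 1 / real (Suc m) + L2_norm \<Omega> (\<lambda>x. W m x - w x)) \<longlonglongrightarrow> 0"
      using tendsto_add[OF inv w(2)] by simp
    show "\<forall>m. L2_norm \<Omega> (\<lambda>x. \<eta> m x - w x) \<le> 1 / real (Suc m) + L2_norm \<Omega> (\<lambda>x. W m x - w x)"
      using L2_norm_triangle_diff[OF test_functions_L2[OF dom \<eta>(1)] L(1) w(1)] \<eta>(2)
      by (meson add_right_mono less_imp_le order.trans)
  qed simp
  moreover have "(\<lambda>m. L2_norm \<Omega> (\<lambda>x. grad (\<eta> m) x - g x)) \<longlonglongrightarrow> 0"
  proof (rule tendsto_sandwich[OF always_eventually always_eventually tendsto_const])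
    show "(\<lambda>m. 1 / real (Suc m) + L2_norm \<Omega> (\<lambda>x. G m x - g x)) \<longlonglongrightarrow> 0"
      using tendsto_add[OF inv g(2)] by simp
    show "\<forall>m. L2_norm \<Omega> (\<lambda>x. grad (\<eta> m) x - g x) \<le> 1 / real (Suc m) + L2_norm \<Omega> (\<lambda>x. G m x - g x)"
      using L2_norm_triangle_diff[OF grad_L2[OF dom \<eta>(1)] L(2) g(1)] \<eta>(3)
      by (meson add_right_mono less_imp_le order.trans)
  qed simp
  ultimately show ?thesis unfolding has_H10_grad_def using \<eta>(1) by blast
qed

text \<open>For a test function \<open>\<psi>\<close> this is the definition of the weak Laplacian followed by that of the weak
  gradient, tested with the first partial derivatives of \<open>\<psi>\<close>, which are again test functions.
  Density gives the rest, so that no boundary integral and no trace is ever formed.\<close>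

lemma weak_Green:
  assumes dom: "bounded_domain \<Omega>" and lap: "has_weak_laplace \<Omega> w f" and w: "has_weak_grad \<Omega> w g"
    and \<psi>: "has_H10_grad \<Omega> \<psi> h"
  shows "L2_inner \<Omega> f \<psi> = - L2_inner \<Omega> g h"
proof -
  have L: "w \<in> L2 \<Omega>" "f \<in> L2 \<Omega>" "g \<in> L2 \<Omega>" using lap w by (auto simp: has_weak_laplace_def has_weak_grad_def)
  note L' = has_H10_gradD[OF \<psi>]
  have test: "L2_inner \<Omega> f \<eta> = - L2_inner \<Omega> g (grad \<eta>)" if \<eta>: "\<eta> \<in> test_functions \<Omega>" for \<eta>
  proof -
    have p: "partial i \<eta> \<in> test_functions \<Omega>" for i using test_functions_partial[OF \<eta>] .
    have "L2_inner \<Omega> f \<eta> = L2_inner \<Omega> w (laplace \<eta>)" using lap \<eta> by (simp add: has_weak_laplace_def)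
    also have "\<dots> = (\<Sum>i\<in>UNIV. L2_inner \<Omega> w (partial i (partial i \<eta>)))"
      unfolding laplace_def[abs_def]
      by (rule L2_inner_sum_right) (use test_functions_L2[OF dom test_functions_partial[OF p]] L in auto)
    also have "\<dots> = (\<Sum>i\<in>UNIV. - L2_inner \<Omega> (\<lambda>x. g x $ i) (partial i \<eta>))"
      using w p by (intro sum.cong refl) (simp add: has_weak_grad_def)
    also have "\<dots> = - (\<Sum>i\<in>UNIV. L2_inner \<Omega> (\<lambda>x. g x $ i) (\<lambda>x. grad \<eta> x $ i))"
      by (simp add: sum_negf grad_def)
    also have "\<dots> = - L2_inner \<Omega> g (grad \<eta>)"
      using L2_inner_components[OF L(3) grad_L2[OF dom \<eta>]] by simp
    finally show ?thesis .
  qed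
  obtain \<eta> where \<eta>: "\<And>j. \<eta> j \<in> test_functions \<Omega>" "(\<lambda>j. L2_norm \<Omega> (\<lambda>x. \<eta> j x - \<psi> x)) \<longlonglongrightarrow> 0"
      "(\<lambda>j. L2_norm \<Omega> (\<lambda>x. grad (\<eta> j) x - h x)) \<longlonglongrightarrow> 0"
    using \<psi> by (auto simp: has_H10_grad_def)
  have l1: "(\<lambda>j. L2_inner \<Omega> f (\<eta> j)) \<longlonglongrightarrow> L2_inner \<Omega> f \<psi>"
    by (rule L2_inner_tendsto_right[OF \<eta>(2) test_functions_L2[OF dom \<eta>(1)] L'(1) L(2)])
  have "(\<lambda>j. L2_inner \<Omega> g (grad (\<eta> j))) \<longlonglongrightarrow> L2_inner \<Omega> g h"
    by (rule L2_inner_tendsto_right[OF \<eta>(3) grad_L2[OF dom \<eta>(1)] L'(2) L(3)])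
  then have l2: "(\<lambda>j. L2_inner \<Omega> f (\<eta> j)) \<longlonglongrightarrow> - L2_inner \<Omega> g h"
    unfolding test[OF \<eta>(1)] by (rule tendsto_minus)
  show ?thesis by (rule LIMSEQ_unique[OF l1 l2])
qed

section \<open>Expansions in Dirichlet eigenfunctions\<close>

context
  fixes \<Omega> :: "(real^2) set" and lam :: "nat \<Rightarrow> real" and \<phi> :: "nat \<Rightarrow> real^2 \<Rightarrow> real"
  assumes dom: "bounded_domain \<Omega>" and eig: "dirichlet_eigensystem \<Omega> lam \<phi>"
begin

lemma eig_H10: "\<phi> k \<in> H10 \<Omega>" and eig_lap: "has_weak_laplace \<Omega> (\<phi> k) (\<lambda>x. - (lam k * \<phi> k x))"
  and lam_pos: "0 < lam k" and lam_mono: "mono lam"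
  and eig_orth: "L2_inner \<Omega> (\<phi> j) (\<phi> k) = (if j = k then 1 else 0)"
  and eig_complete: "\<psi> \<in> L2 \<Omega> \<Longrightarrow> (\<And>k. L2_inner \<Omega> \<psi> (\<phi> k) = 0) \<Longrightarrow> AE x in lebesgue_on \<Omega>. \<psi> x = 0"
  using eig unfolding dirichlet_eigensystem_def by auto

lemma eig_L2: "\<phi> k \<in> L2 \<Omega>"
  using eig_H10 by (rule H10_L2)

text \<open>The partial sums converge by completeness of \<open>L^2\<close> and Bessel's inequality; the limit has the same
  coefficients as \<open>\<psi>\<close>, and therefore equals \<open>\<psi>\<close> almost everywhere.\<close>

lemma Parseval:
  assumes \<psi>: "\<psi> \<in> L2 \<Omega>"
  shows "(\<lambda>k. (L2_inner \<Omega> \<psi> (\<phi> k))\<^sup>2) sums (L2_norm \<Omega> \<psi>)\<^sup>2"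
    and "(\<lambda>m. L2_norm \<Omega> (\<lambda>x. (\<Sum>k<m. L2_inner \<Omega> \<psi> (\<phi> k) * \<phi> k x) - \<psi> x)) \<longlonglongrightarrow> 0"
proof -
  define c where "c k = L2_inner \<Omega> \<psi> (\<phi> k)" for k
  define S where "S m x = (\<Sum>k<m. c k *\<^sub>R \<phi> k x)" for m x
  have SL: "S m \<in> L2 \<Omega>" for m unfolding S_def by (intro L2_sum L2_scaleR eig_L2)
  have nS: "L2_inner \<Omega> (S m) (S m) = (\<Sum>k<m. (c k)\<^sup>2)" for m
    using L2_norm_orthogonal_sum[where e = \<phi> and w = "\<lambda>k. 1" and I = "{..<m}" and c = c] eig_L2 eig_orth
    by (simp add: L2_norm_power2 S_def[abs_def])
  have pS: "L2_inner \<Omega> \<psi> (S m) = (\<Sum>k<m. (c k)\<^sup>2)" for m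
    unfolding S_def by (subst L2_inner_sum_right)
      (auto simp: \<psi> eig_L2 L2_inner_mult_right c_def[symmetric] power2_eq_square)
  have bessel: "(\<Sum>k<m. (c k)\<^sup>2) \<le> (L2_norm \<Omega> \<psi>)\<^sup>2" for m
  proof -
    have "0 \<le> L2_inner \<Omega> (\<lambda>x. \<psi> x - S m x) (\<lambda>x. \<psi> x - S m x)"
      unfolding L2_norm_power2[symmetric] by simp
    also have "\<dots> = (L2_norm \<Omega> \<psi>)\<^sup>2 - (\<Sum>k<m. (c k)\<^sup>2)"
      using L2_diff[OF \<psi> SL[of m]]
      by (simp add: L2_inner_diff_left L2_inner_diff_right \<psi> SL nS pS L2_inner_commute[of \<Omega> "S m" \<psi>] L2_norm_power2)
    finally show ?thesis by simp
  qed
  have "summable (\<lambda>k. (c k)\<^sup>2)"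
    by (rule summableI_nonneg_bounded[OF _ bessel]) simp
  then obtain g where g: "g \<in> L2 \<Omega>" "(\<lambda>m. L2_norm \<Omega> (\<lambda>x. S m x - g x)) \<longlonglongrightarrow> 0"
    using orthogonal_series_converges[where e = \<phi> and w = "\<lambda>k. 1" and c = c and \<Omega> = \<Omega>] eig_L2 eig_orth
    unfolding S_def by auto
  have gc: "L2_inner \<Omega> g (\<phi> k) = c k" for k
  proof -
    have "(\<lambda>m. L2_inner \<Omega> (S m) (\<phi> k)) \<longlonglongrightarrow> L2_inner \<Omega> g (\<phi> k)"
      by (rule L2_inner_tendsto_left[OF g(2) SL g(1) eig_L2])
    moreover have "(\<lambda>m. L2_inner \<Omega> (S m) (\<phi> k)) \<longlonglongrightarrow> c k"
    proof (rule tendsto_eventually)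
      have "L2_inner \<Omega> (S m) (\<phi> k) = c k" if "m > k" for m
      proof -
        have "L2_inner \<Omega> (S m) (\<phi> k) = (\<Sum>j<m. c j * L2_inner \<Omega> (\<phi> j) (\<phi> k))"
          unfolding S_def by (subst L2_inner_sum_left) (auto simp: eig_L2 L2_inner_mult_left)
        also have "\<dots> = (\<Sum>j<m. if j = k then c k else 0)"
          by (intro sum.cong refl) (auto simp: eig_orth)
        finally show ?thesis using that by simp
      qed
      then show "\<forall>\<^sub>F m in sequentially. L2_inner \<Omega> (S m) (\<phi> k) = c k"
        by (auto simp: eventually_sequentially intro!: exI[of _ "Suc k"])
    qed
    ultimately show ?thesis by (rule LIMSEQ_unique)
  qed
  have ae: "AE x in lebesgue_on \<Omega>. \<psi> x - g x = 0"
    by (rule eig_complete) (auto simp: \<psi> g L2_inner_diff_left eig_L2 gc c_def)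
  have "L2_norm \<Omega> (\<lambda>x. S m x - \<psi> x) = L2_norm \<Omega> (\<lambda>x. S m x - g x)" for m
    by (rule L2_norm_AE_cong) (use ae in \<open>auto simp: SL \<psi> g\<close>)
  then have lim: "(\<lambda>m. L2_norm \<Omega> (\<lambda>x. S m x - \<psi> x)) \<longlonglongrightarrow> 0" using g(2) by simp
  then show "(\<lambda>m. L2_norm \<Omega> (\<lambda>x. (\<Sum>k<m. L2_inner \<Omega> \<psi> (\<phi> k) * \<phi> k x) - \<psi> x)) \<longlonglongrightarrow> 0"
    by (simp add: S_def c_def)
  show "(\<lambda>k. (L2_inner \<Omega> \<psi> (\<phi> k))\<^sup>2) sums (L2_norm \<Omega> \<psi>)\<^sup>2"
    using orthogonal_series_norm[where e = \<phi> and w = "\<lambda>k. 1" and c = c and g = \<psi> and \<Omega> = \<Omega>] eig_L2 eig_orth \<psi> lim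
    by (simp add: S_def c_def)
qed

lemma frac_laplace_norm:
  assumes "\<psi> \<in> frac_domain \<Omega> lam \<phi> p"
  shows "(\<lambda>k. (lam k powr p * L2_inner \<Omega> \<psi> (\<phi> k))\<^sup>2) sums (L2_norm \<Omega> (frac_laplace \<Omega> lam \<phi> p \<psi>))\<^sup>2"
proof -
  define c where "c k = lam k powr p * L2_inner \<Omega> \<psi> (\<phi> k)" for k
  have "summable (\<lambda>k. 1 * (c k)\<^sup>2)" using assms by (simp add: frac_domain_def c_def)
  then have "\<exists>g. g \<in> L2 \<Omega> \<and> (\<lambda>m. L2_norm \<Omega> (\<lambda>x. (\<Sum>k<m. c k * \<phi> k x) - g x)) \<longlonglongrightarrow> 0"
    using orthogonal_series_converges[where e = \<phi> and w = "\<lambda>k. 1" and c = c and \<Omega> = \<Omega>] eig_L2 eig_orth by auto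
  from someI_ex[OF this] have "frac_laplace \<Omega> lam \<phi> p \<psi> \<in> L2 \<Omega> \<and>
      (\<lambda>m. L2_norm \<Omega> (\<lambda>x. (\<Sum>k<m. c k * \<phi> k x) - frac_laplace \<Omega> lam \<phi> p \<psi> x)) \<longlonglongrightarrow> 0"
    unfolding frac_laplace_def c_def .
  then show ?thesis
    using orthogonal_series_norm[where e = \<phi> and w = "\<lambda>k. 1" and c = c and g = "frac_laplace \<Omega> lam \<phi> p \<psi>" and \<Omega> = \<Omega>] eig_L2 eig_orth
    by (simp add: c_def)
qed

text \<open>Green's identity is used twice, to move the Laplacian from \<open>w\<close> to the eigenfunction.  This turns the
  partial differential equations into scalar equations for the coefficients.\<close>

lemma weak_laplace_coefficient:
  assumes w: "w \<in> H10 \<Omega>" and lap: "has_weak_laplace \<Omega> w f"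
  shows "L2_inner \<Omega> f (\<phi> k) = - (lam k * L2_inner \<Omega> w (\<phi> k))"
proof -
  obtain g where g: "has_H10_grad \<Omega> w g" using w by (auto simp: H10_iff)
  obtain h where h: "has_H10_grad \<Omega> (\<phi> k) h" using eig_H10 by (auto simp: H10_iff)
  have "L2_inner \<Omega> f (\<phi> k) = - L2_inner \<Omega> g h"
    by (rule weak_Green[OF dom lap has_H10_gradD(3)[OF g] h])
  also have "\<dots> = L2_inner \<Omega> (\<lambda>x. - (lam k * \<phi> k x)) w"
    using weak_Green[OF dom eig_lap has_H10_gradD(3)[OF h] g] by (simp add: L2_inner_commute[of \<Omega> g h])
  also have "\<dots> = - (lam k * L2_inner \<Omega> w (\<phi> k))"
    by (simp add: L2_inner_minus_left L2_inner_mult_left L2_inner_commute[of \<Omega> "\<phi> k" w])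
  finally show ?thesis .
qed

text \<open>Every eigenfunction is a limit of test functions, so a function orthogonal to these has only zero
  coefficients.  This replaces an approximation argument by mollifiers.\<close>

lemma test_functions_total:
  assumes f: "f \<in> L2 \<Omega>" and orth: "\<And>\<eta>. \<eta> \<in> test_functions \<Omega> \<Longrightarrow> L2_inner \<Omega> f \<eta> = 0"
  shows "AE x in lebesgue_on \<Omega>. f x = 0"
proof (rule eig_complete[OF f])
  fix k
  obtain h where "has_H10_grad \<Omega> (\<phi> k) h" using eig_H10 by (auto simp: H10_iff)
  then obtain \<eta> where \<eta>: "\<And>j. \<eta> j \<in> test_functions \<Omega>" "(\<lambda>j. L2_norm \<Omega> (\<lambda>x. \<eta> j x - \<phi> k x)) \<longlonglongrightarrow> 0"
    by (auto simp: has_H10_grad_def)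
  have "(\<lambda>j. L2_inner \<Omega> f (\<eta> j)) \<longlonglongrightarrow> L2_inner \<Omega> f (\<phi> k)"
    by (rule L2_inner_tendsto_right[OF \<eta>(2) test_functions_L2[OF dom \<eta>(1)] eig_L2 f])
  then show "L2_inner \<Omega> f (\<phi> k) = 0"
    unfolding orth[OF \<eta>(1)] using LIMSEQ_unique tendsto_const by blast
qed

text \<open>A weak gradient is unique almost everywhere because the test functions are total.\<close>

lemma weak_grad_norm:
  assumes g: "has_weak_grad \<Omega> w g"
  shows "L2_norm \<Omega> (weak_grad \<Omega> w) = L2_norm \<Omega> g"
proof -
  have g': "has_weak_grad \<Omega> w (weak_grad \<Omega> w)"
    unfolding weak_grad_def using g by (rule someI[where P = "has_weak_grad \<Omega> w"])
  have L: "g \<in> L2 \<Omega>" "weak_grad \<Omega> w \<in> L2 \<Omega>" using g g' by (auto simp: has_weak_grad_def)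
  have "AE x in lebesgue_on \<Omega>. weak_grad \<Omega> w x $ i - g x $ i = 0" for i
  proof (rule test_functions_total)
    show "(\<lambda>x. weak_grad \<Omega> w x $ i - g x $ i) \<in> L2 \<Omega>"
      by (intro L2_diff L2_component L)
    fix \<eta> assume \<eta>: "\<eta> \<in> test_functions \<Omega>"
    have "L2_inner \<Omega> (\<lambda>x. weak_grad \<Omega> w x $ i) \<eta> = L2_inner \<Omega> (\<lambda>x. g x $ i) \<eta>"
      using g g' \<eta> unfolding has_weak_grad_def by (metis neg_equal_iff_equal)
    then show "L2_inner \<Omega> (\<lambda>x. weak_grad \<Omega> w x $ i - g x $ i) \<eta> = 0"
      by (subst L2_inner_diff_left) (auto intro: L2_component L test_functions_L2[OF dom \<eta>])
  qed
  then have "AE x in lebesgue_on \<Omega>. \<forall>i. weak_grad \<Omega> w x $ i - g x $ i = 0"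
    by (intro AE_all_countable[THEN iffD2]) auto
  then have "AE x in lebesgue_on \<Omega>. weak_grad \<Omega> w x = g x"
    by eventually_elim (simp add: vec_eq_iff)
  then show ?thesis by (rule L2_norm_AE_cong[OF _ L(2,1)])
qed

text \<open>The gradients of the eigenfunctions are orthogonal with squared norms \<open>lam k\<close>, by Green's identity.
  Hence the gradients of the partial sums converge under the summability condition, and the closedness
  of \<open>H^1_0\<close> puts the limit \<open>w\<close> there.\<close>

theorem H10_by_coefficients:
  assumes w: "w \<in> L2 \<Omega>" and summ: "summable (\<lambda>k. lam k * (L2_inner \<Omega> w (\<phi> k))\<^sup>2)"
  shows "w \<in> H10 \<Omega>" and "(\<lambda>k. lam k * (L2_inner \<Omega> w (\<phi> k))\<^sup>2) sums (L2_norm \<Omega> (weak_grad \<Omega> w))\<^sup>2"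
proof -
  define c where "c k = L2_inner \<Omega> w (\<phi> k)" for k
  have "\<forall>k. \<exists>g. has_H10_grad \<Omega> (\<phi> k) g" using eig_H10 by (simp add: H10_iff)
  then obtain G where G: "\<And>k. has_H10_grad \<Omega> (\<phi> k) (G k)" by metis
  have GL: "G k \<in> L2 \<Omega>" for k using has_H10_gradD[OF G] by blast
  have orth: "L2_inner \<Omega> (G j) (G k) = (if j = k then lam k else 0)" for j k
  proof -
    have "L2_inner \<Omega> (\<lambda>x. - (lam j * \<phi> j x)) (\<phi> k) = - L2_inner \<Omega> (G j) (G k)"
      by (rule weak_Green[OF dom eig_lap has_H10_gradD(3)[OF G] G])
    then show ?thesis by (cases "j = k") (simp_all add: L2_inner_minus_left L2_inner_mult_left eig_orth)
  qed
  obtain g where g: "g \<in> L2 \<Omega>" "(\<lambda>m. L2_norm \<Omega> (\<lambda>x. (\<Sum>k<m. c k *\<^sub>R G k x) - g x)) \<longlonglongrightarrow> 0"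
    using orthogonal_series_converges[OF GL orth, of c] summ by (auto simp: c_def)
  have H: "has_H10_grad \<Omega> w g"
  proof (rule has_H10_grad_closed[OF dom _ w _ g])
    show "has_H10_grad \<Omega> (\<lambda>x. \<Sum>k<m. c k * \<phi> k x) (\<lambda>x. \<Sum>k<m. c k *\<^sub>R G k x)" for m
      by (rule has_H10_grad_sum[OF dom G])
    show "(\<lambda>m. L2_norm \<Omega> (\<lambda>x. (\<Sum>k<m. c k * \<phi> k x) - w x)) \<longlonglongrightarrow> 0"
      using Parseval(2)[OF w] by (simp add: c_def)
  qed
  then show "w \<in> H10 \<Omega>" by (auto simp: H10_iff)
  show "(\<lambda>k. lam k * (L2_inner \<Omega> w (\<phi> k))\<^sup>2) sums (L2_norm \<Omega> (weak_grad \<Omega> w))\<^sup>2"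
    using orthogonal_series_norm[OF GL orth g] weak_grad_norm[OF has_H10_gradD(3)[OF H]] by (simp add: c_def)
qed

end

section \<open>Integrals with weak singularities\<close>

text \<open>For nonnegative integrands the gauge integral, for which the antiderivatives are at hand, and the
  Lebesgue integral agree, integrability included.\<close>

lemma has_integral_nonneg_lborel:
  fixes f :: "real \<Rightarrow> real"
  assumes m: "f \<in> borel_measurable borel" and S: "S \<in> sets borel"
    and nonneg: "\<And>x. x \<in> S \<Longrightarrow> 0 \<le> f x" and I: "(f has_integral I) S"
  shows "set_integrable lborel S f" "(LINT x:S|lborel. f x) = I"
proof -
  have "f absolutely_integrable_on S"
    using I nonneg by (intro nonnegative_absolutely_integrable_1) (auto simp: integrable_on_def)
  then show *: "set_integrable lborel S f"
    unfolding set_integrable_def using m S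
    by (subst (asm) integrable_completion) auto
  show "(LINT x:S|lborel. f x) = I"
    using set_borel_integral_eq_integral(2)[OF *] I by (simp add: integral_unique)
qed

lemma has_integral_Beta_scaled:
  fixes a b t :: real
  assumes "a > 0" "b > 0" "t > 0"
  shows "((\<lambda>s. (t - s) powr (a - 1) * s powr (b - 1)) has_integral
           Beta a b * t powr (a + b - 1)) {0<..<t}"
proof -
  have "((\<lambda>x. (1/t * x) powr (b - 1) * (1 - 1/t * x) powr (a - 1)) has_integral
      (1 / \<bar>1/t\<bar>) *\<^sub>R Beta b a) ((\<lambda>x. x / (1/t)) ` {0..1})"
    by (rule has_integral_stretch_real[OF has_integral_Beta_real]) (use assms in auto)
  also have "(\<lambda>x. x / (1/t)) ` {0..1} = {0..t}"
    using assms by (auto simp: image_iff intro!: bexI[of _ "_ / t"])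
  finally have "((\<lambda>x. t powr (a + b - 2) * ((x / t) powr (b - 1) * (1 - x / t) powr (a - 1)))
      has_integral t powr (a + b - 2) * (t * Beta b a)) {0..t}"
    using assms by (intro has_integral_mult_right) auto
  then have "((\<lambda>x. t powr (a + b - 2) * ((x / t) powr (b - 1) * (1 - x / t) powr (a - 1)))
      has_integral t powr (a + b - 2) * (t * Beta b a)) {0<..<t}"
    by (simp add: has_integral_Icc_iff_Ioo)
  moreover have "t powr (a + b - 2) * (t * Beta b a) = Beta a b * t powr (a + b - 1)"
  proof -
    have "t powr (a + b - 1) = t powr (a + b - 2) * t powr 1"
      by (simp only: powr_add[symmetric]) simp
    then show ?thesis using assms by (simp add: Beta_commute)
  qed
  moreover have "t powr (a + b - 2) * ((x / t) powr (b - 1) * (1 - x / t) powr (a - 1))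
      = (t - x) powr (a - 1) * x powr (b - 1)" if "x \<in> {0<..<t}" for x
  proof -
    have "1 - x / t = (t - x) / t" using assms by (simp add: field_simps)
    then have "(x / t) powr (b - 1) * (1 - x / t) powr (a - 1)
        = x powr (b - 1) * (t - x) powr (a - 1) / (t powr (b - 1) * t powr (a - 1))"
      using that by (simp add: powr_divide)
    also have "t powr (b - 1) * t powr (a - 1) = t powr (a + b - 2)"
      by (simp add: powr_add[symmetric] algebra_simps)
    finally show ?thesis using assms by simp
  qed
  ultimately show ?thesis by (metis (no_types, lifting) has_integral_eq)
qed

lemma Beta_integral_lborel:
  fixes a b t :: real
  assumes "a > 0" "b > 0" "t > 0"
  shows "set_integrable lborel {0<..<t} (\<lambda>s. (t - s) powr (a - 1) * s powr (b - 1))"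
    and "(LINT s:{0<..<t}|lborel. (t - s) powr (a - 1) * s powr (b - 1)) = Beta a b * t powr (a + b - 1)"
  by (rule has_integral_nonneg_lborel[OF _ _ _ has_integral_Beta_scaled[OF assms]]; simp)+

section \<open>The L1 formula on a mesh\<close>

text \<open>The L1 operator on sequences of vectors.  Scalar sequences are the coefficients of a grid function
  in one eigenfunction; complex ones carry the two error components of a mode at once.\<close>

definition L1_diff :: "real \<Rightarrow> (nat \<Rightarrow> real) \<Rightarrow> (nat \<Rightarrow> 'a::real_vector) \<Rightarrow> nat \<Rightarrow> 'a" where
  "L1_diff \<nu> t w n = (\<Sum>k=1..n. L1_coeff \<nu> t n k *\<^sub>R (w k - w (k - 1)))"

lemma omega_nonneg: "0 < p \<Longrightarrow> 0 \<le> omega p s"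
  by (simp add: omega_def)

lemma omega_antimono: "0 < p \<Longrightarrow> p < 1 \<Longrightarrow> 0 < x \<Longrightarrow> x \<le> y \<Longrightarrow> omega p y \<le> omega p x"
  by (auto simp: omega_def intro!: divide_right_mono powr_mono2')

lemma omega_measurable [measurable]: "omega p \<in> borel_measurable borel"
  unfolding omega_def[abs_def] by measurable

lemma omega_has_integral:
  assumes "0 < p" "a \<le> b" "b \<le> c"
  shows "((\<lambda>s. omega p (c - s)) has_integral (omega (p + 1) (c - a) - omega (p + 1) (c - b))) {a..b}"
proof -
  have "((\<lambda>s. omega p (c - s)) has_integral
      (- omega (p + 1) (c - b) - - omega (p + 1) (c - a))) {a..b}"
  proof (rule fundamental_theorem_of_calculus_interior[OF assms(2)])
    show "continuous_on {a..b} (\<lambda>s. - omega (p + 1) (c - s))"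
      using assms unfolding omega_def
      by (auto intro!: continuous_intros continuous_on_powr' simp: Gamma_eq_zero_iff nonpos_Ints_def)
    fix x assume x: "x \<in> {a<..<b}"
    have "((\<lambda>s. - omega (p + 1) (c - s)) has_real_derivative
        p * (c - x) powr (p - 1) / Gamma (p + 1)) (at x)"
    proof -
      have "((\<lambda>s. c - s) has_real_derivative 0 - 1) (at x)" by (intro derivative_intros)
      from DERIV_chain2[OF has_real_derivative_powr[of "c - x" p] this] x assms
      have "((\<lambda>s. (c - s) powr p) has_real_derivative p * (c - x) powr (p - 1) * (0 - 1)) (at x)" by simp
      from DERIV_cdivide[OF DERIV_minus[OF this], of "Gamma (p + 1)"]
      show ?thesis by (simp add: omega_def)
    qed
    also have "p * (c - x) powr (p - 1) / Gamma (p + 1) = omega p (c - x)"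
      using assms Gamma_plus1[of p] by (simp add: omega_def field_simps nonpos_Ints_def)
    finally show "((\<lambda>s. - omega (p + 1) (c - s)) has_vector_derivative omega p (c - x)) (at x)"
      by (simp add: has_real_derivative_iff_has_vector_derivative)
  qed
  then show ?thesis by simp
qed

lemma omega_lborel:
  assumes "0 < p" "a \<le> b" "b \<le> c"
  shows "set_integrable lborel {a..b} (\<lambda>s. omega p (c - s))"
    and "(LINT s:{a..b}|lborel. omega p (c - s)) = omega (p + 1) (c - a) - omega (p + 1) (c - b)"
  by (rule has_integral_nonneg_lborel[OF _ _ _ omega_has_integral[OF assms]];
      use assms in \<open>auto intro: omega_nonneg\<close>)+

lemma L1_coeff_eq:
  assumes "0 < \<nu>" "\<nu> < 1" "t (k - 1) \<le> t k" "t k \<le> t n"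
  shows "L1_coeff \<nu> t n k = integral {t (k - 1)..t k} (\<lambda>s. omega (1 - \<nu>) (t n - s)) / (t k - t (k - 1))"
  unfolding L1_coeff_def using assms omega_has_integral[of "1 - \<nu>" "t (k - 1)" "t k" "t n"]
    omega_lborel(2)[of "1 - \<nu>" "t (k - 1)" "t k" "t n"]
  by (simp add: integral_unique)

text \<open>The coefficient is the mean of the decreasing kernel over the interval, hence lies between the
  values of the kernel at the two end points.  For \<open>k = n\<close> the right end point is the singularity.\<close>

lemma L1_coeff_bounds:
  assumes \<nu>: "0 < \<nu>" "\<nu> < 1" and t: "strict_mono t" and k: "1 \<le> k" "k \<le> n"
  shows "omega (1 - \<nu>) (t n - t (k - 1)) \<le> L1_coeff \<nu> t n k"
    and "k < n \<Longrightarrow> L1_coeff \<nu> t n k \<le> omega (1 - \<nu>) (t n - t k)"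
proof -
  let ?x = "t (k - 1)" and ?y = "t k"
  have xy: "?x < ?y" using t k by (auto simp: strict_mono_def)
  have yn: "?y \<le> t n" using t k by (simp add: strict_mono_less_eq)
  note int = omega_has_integral[of "1 - \<nu>" ?x ?y "t n"]
  have i: "(\<lambda>s. omega (1 - \<nu>) (t n - s)) integrable_on {?x..?y}"
    using int \<nu> xy yn by (auto simp: integrable_on_def)
  have eq: "L1_coeff \<nu> t n k * (?y - ?x) = integral {?x..?y} (\<lambda>s. omega (1 - \<nu>) (t n - s))"
    using L1_coeff_eq[OF \<nu>, of t k n] xy yn by simp
  have "omega (1 - \<nu>) (t n - ?x) * (?y - ?x) \<le> integral {?x..?y} (\<lambda>s. omega (1 - \<nu>) (t n - s))"
  proof (rule has_integral_le)
    show "((\<lambda>s. omega (1 - \<nu>) (t n - ?x)) has_integral omega (1 - \<nu>) (t n - ?x) * (?y - ?x)) {?x<..<?y}"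
      using has_integral_const_real[of "omega (1 - \<nu>) (t n - ?x)" ?x ?y] xy
      by (simp add: has_integral_Icc_iff_Ioo mult.commute)
    show "((\<lambda>s. omega (1 - \<nu>) (t n - s)) has_integral
        integral {?x..?y} (\<lambda>s. omega (1 - \<nu>) (t n - s))) {?x<..<?y}"
      using integrable_integral[OF i] by (simp add: has_integral_Icc_iff_Ioo)
  qed (use \<nu> yn in \<open>auto intro!: omega_antimono\<close>)
  also have "\<dots> = L1_coeff \<nu> t n k * (?y - ?x)" using eq by simp
  finally show "omega (1 - \<nu>) (t n - ?x) \<le> L1_coeff \<nu> t n k" using xy by simp
  assume "k < n"
  then have yn': "?y < t n" using t by (simp add: strict_mono_less)
  have "L1_coeff \<nu> t n k * (?y - ?x) \<le> integral {?x..?y} (\<lambda>s. omega (1 - \<nu>) (t n - ?y))"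
    unfolding eq using i xy yn' \<nu> by (intro integral_le) (auto intro!: omega_antimono)
  also have "\<dots> = omega (1 - \<nu>) (t n - ?y) * (?y - ?x)" using xy by simp
  finally show "L1_coeff \<nu> t n k \<le> omega (1 - \<nu>) (t n - ?y)" using xy by simp
qed

lemma L1_coeff_mono:
  assumes "0 < \<nu>" "\<nu> < 1" "strict_mono t" "1 \<le> k" "k < n"
  shows "L1_coeff \<nu> t n k \<le> L1_coeff \<nu> t n (k + 1)"
  using L1_coeff_bounds(2)[of \<nu> t k n] L1_coeff_bounds(1)[of \<nu> t "k + 1" n] assms by simp

lemma summation_by_parts_from_0:
  fixes W :: "nat \<Rightarrow> 'a::real_vector"
  assumes "W 0 = 0"
  shows "(\<Sum>k=1..n. a k *\<^sub>R (W k - W (k - 1))) = a n *\<^sub>R W n - (\<Sum>k=1..<n. (a (k + 1) - a k) *\<^sub>R W k)"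
proof (induction n)
  case (Suc n)
  then show ?case
    using assms by (cases "n = 0") (simp_all add: algebra_simps)
qed (use assms in auto)

text \<open>The coefficients increase with \<open>k\<close>, so after summation by parts \<open>L1_diff\<close> at level \<open>n\<close> is
  \<open>a n * W n\<close> minus a combination of earlier values with nonnegative weights of total \<open>a n - a 1\<close>.
  The real part of the product with \<open>cnj (W n)\<close> does not see the imaginary factor \<open>\<i> * \<mu>\<close>, whatever
  its size.  The missing weight \<open>a 1\<close> pays for the residual, because \<open>a 1\<close> is at least
  \<open>omega (1 - \<nu>) (t n)\<close>; this is where the factor \<open>t n powr \<nu>\<close> comes from.  The bound holds without any
  growth in \<open>n\<close> or \<open>\<mu>\<close>, which is what permits summation over all modes.\<close>

lemma L1_skew_stability:
  fixes W R :: "nat \<Rightarrow> complex"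
  assumes \<nu>: "0 < \<nu>" "\<nu> < 1" and t: "strict_mono t" "t 0 = 0"
    and W0: "W 0 = 0"
    and eq: "\<And>n. 1 \<le> n \<Longrightarrow> n \<le> N \<Longrightarrow> L1_diff \<nu> t W n = \<i> * complex_of_real \<mu> * W n + R n"
    and R: "\<And>n. 1 \<le> n \<Longrightarrow> n \<le> N \<Longrightarrow> t n powr \<nu> * norm (R n) \<le> B" and B: "0 \<le> B"
    and n: "n \<le> N"
  shows "norm (W n) \<le> Gamma (1 - \<nu>) * B"
  using n
proof (induction n rule: less_induct)
  case (less n)
  let ?B = "Gamma (1 - \<nu>) * B"
  have G: "0 < Gamma (1 - \<nu>)" using \<nu> by simp
  have B': "0 \<le> ?B" using G B by simp
  show ?case
  proof (cases "n = 0")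
    case True
    then show ?thesis using W0 B' by simp
  next
    case False
    then have n1: "1 \<le> n" by simp
    define a where "a k = L1_coeff \<nu> t n k" for k
    have tn: "0 < t n" using strict_monoD[OF t(1), of 0 n] t(2) n1 by simp
    have a1: "omega (1 - \<nu>) (t n) \<le> a 1"
      unfolding a_def using L1_coeff_bounds(1)[OF \<nu> t(1), of 1 n] n1 t(2) by simp
    have Ra: "norm (R n) \<le> ?B * a 1"
    proof -
      have "norm (R n) \<le> B / t n powr \<nu>"
        using R[OF n1 less.prems] tn by (simp add: field_simps)
      also have "\<dots> = ?B * omega (1 - \<nu>) (t n)"
        using G by (simp add: omega_def powr_minus field_simps)
      also have "\<dots> \<le> ?B * a 1" using a1 B' by (intro mult_left_mono) auto
      finally show ?thesis .
    qed
    have mono: "a k \<le> a (k + 1)" if "1 \<le> k" "k < n" for k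
      unfolding a_def using L1_coeff_mono[OF \<nu> t(1)] that by simp
    have an: "0 < a n"
    proof -
      have "0 < omega (1 - \<nu>) (t n - t (n - 1))"
        using \<nu> strict_monoD[OF t(1), of "n-1" n] n1 by (simp add: omega_def)
      also have "\<dots> \<le> a n" unfolding a_def by (rule L1_coeff_bounds(1)[OF \<nu> t(1) n1 order.refl])
      finally show ?thesis .
    qed
    have main: "a n *\<^sub>R W n = \<i> * complex_of_real \<mu> * W n + R n + (\<Sum>k=1..<n. (a (k + 1) - a k) *\<^sub>R W k)"
      using eq[OF n1 less.prems] summation_by_parts_from_0[of W a n, OF W0]
      by (simp add: L1_diff_def a_def algebra_simps)
    \<comment> \<open>Testing with \<open>cnj (W n)\<close> removes the skew term.\<close>
    define S where "S = (\<Sum>k=1..<n. (a (k + 1) - a k) *\<^sub>R W k)"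
    have sq: "cnj (W n) * W n = complex_of_real ((norm (W n))\<^sup>2)"
      by (simp only: complex_norm_square mult.commute)
    have "complex_of_real (a n * (norm (W n))\<^sup>2) = cnj (W n) * (a n *\<^sub>R W n)"
      by (simp only: of_real_mult sq[symmetric] scaleR_conv_of_real mult_ac)
    also have "\<dots> = \<i> * complex_of_real \<mu> * (cnj (W n) * W n) + cnj (W n) * (R n + S)"
      unfolding main S_def[symmetric] by (simp only: distrib_left mult_ac add_ac)
    also have "\<dots> = \<i> * complex_of_real (\<mu> * (norm (W n))\<^sup>2) + cnj (W n) * (R n + S)"
      by (simp only: sq of_real_mult mult.assoc)
    finally have "Re (complex_of_real (a n * (norm (W n))\<^sup>2)) =
        Re (\<i> * complex_of_real (\<mu> * (norm (W n))\<^sup>2) + cnj (W n) * (R n + S))" by simp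
    then have "a n * (norm (W n))\<^sup>2 = Re (cnj (W n) * (R n + S))"
      by (simp only: Re_complex_of_real plus_complex.sel Re_i_times Im_complex_of_real minus_zero add_0_left)
    also have "\<dots> \<le> norm (W n) * norm (R n + S)"
      by (metis complex_Re_le_cmod norm_mult complex_mod_cnj)
    also have "norm (R n + S) \<le> ?B * a n"
    proof -
      have "norm S \<le> (\<Sum>k=1..<n. (a (k + 1) - a k) * ?B)"
        unfolding S_def
      proof (rule sum_norm_le)
        fix k assume k: "k \<in> {1..<n}"
        then have "norm (W k) \<le> ?B" using less.IH[of k] less.prems by simp
        then show "norm ((a (k + 1) - a k) *\<^sub>R W k) \<le> (a (k + 1) - a k) * ?B"
          using mono[of k] k by (auto intro!: mult_left_mono)
      qed
      also have "\<dots> = (a n - a 1) * ?B"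
        using n1 sum_Suc_diff'[of 1 n a] by (simp add: sum_distrib_right[symmetric])
      finally have "norm S \<le> (a n - a 1) * ?B" .
      then have "norm (R n + S) \<le> ?B * a 1 + (a n - a 1) * ?B"
        using Ra norm_triangle_ineq[of "R n" "S"] by linarith
      then show ?thesis by (simp add: algebra_simps)
    qed
    finally have "a n * (norm (W n))\<^sup>2 \<le> norm (W n) * (?B * a n)"
      by (simp add: mult_left_mono)
    then have "a n * norm (W n) * norm (W n) \<le> a n * ?B * norm (W n)"
      by (simp add: power2_eq_square algebra_simps)
    then show ?thesis using an B' by (cases "norm (W n) = 0") (auto simp: mult_le_cancel_right)
  qed
qed

section \<open>Graded meshes\<close>

lemma graded_mesh_0 [simp]: "0 < r \<Longrightarrow> graded_mesh T r N 0 = 0"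
  by (simp add: graded_mesh_def)

lemma graded_mesh_strict_mono:
  assumes "0 < T" "0 < r" "1 \<le> N"
  shows "strict_mono (graded_mesh T r N)"
  unfolding graded_mesh_def
  using assms by (intro strict_monoI mult_strict_left_mono powr_less_mono2) (auto simp: divide_strict_right_mono)

lemma graded_mesh_pos: "0 < T \<Longrightarrow> 1 \<le> N \<Longrightarrow> 1 \<le> n \<Longrightarrow> 0 < graded_mesh T r N n"
  by (simp add: graded_mesh_def)

lemma graded_mesh_le:
  assumes "0 < T" "0 < r" "n \<le> N" shows "graded_mesh T r N n \<le> T"
proof -
  have "(real n / real N) powr r \<le> 1 powr r"
    using assms by (intro powr_mono2) (auto simp: divide_le_eq)
  then show ?thesis using assms by (simp add: graded_mesh_def)
qed

lemma graded_mesh_scale: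
  assumes "1 \<le> k"
  shows "graded_mesh T r N j = graded_mesh T r N k * (real j / real k) powr r"
proof -
  have "real j / real N = real k / real N * (real j / real k)" using assms by simp
  then have "(real j / real N) powr r = (real k / real N) powr r * (real j / real k) powr r"
    by (simp only: powr_mult)
  then show ?thesis by (simp add: graded_mesh_def)
qed

lemma graded_mesh_step_upper:
  assumes "0 < T" "1 \<le> r" "1 \<le> N" "1 \<le> k"
  shows "graded_mesh T r N k - graded_mesh T r N (k - 1) \<le> r * graded_mesh T r N k / real k"
proof -
  have "1 - r * (1 / real k) \<le> (1 - 1 / real k) powr r"
  proof (cases "k = 1")
    case True
    then show ?thesis using assms by simp
  next
    case False
    define x where "x = 1 - 1 / real k"
    have x: "0 < x" "x < 1" using False assms by (auto simp: x_def)
    obtain z where z: "x < z" "z < 1" "1 powr r - x powr r = (1 - x) * (r * z powr (r - 1))"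
    proof -
      have "((\<lambda>z. z powr r) has_real_derivative r * y powr (r - 1)) (at y)" if "x \<le> y" for y
        using has_real_derivative_powr[of y r] x that by simp
      from MVT2[OF x(2), of "\<lambda>z. z powr r" "\<lambda>z. r * z powr (r - 1)", OF this] that
      show ?thesis by blast
    qed
    have "z powr (r - 1) \<le> 1 powr (r - 1)" using z x assms by (intro powr_mono2) auto
    then have "(1 - x) * (r * z powr (r - 1)) \<le> (1 - x) * (r * 1)"
      using x assms by (intro mult_left_mono) auto
    then have "1 - x powr r \<le> (1 - x) * (r * 1)" using z(3) by (simp only: powr_one_eq_one)
    then show ?thesis by (simp add: x_def algebra_simps)
  qed
  moreover have "real (k - 1) / real k = 1 - 1 / real k" using assms by (simp add: field_simps)
  ultimately have "graded_mesh T r N k * (1 - r * (1 / real k)) \<le> graded_mesh T r N (k - 1)"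
    using graded_mesh_pos[of T N k r] assms
    by (subst graded_mesh_scale[of k T r N "k-1"]) (auto intro!: mult_left_mono)
  then show ?thesis by (simp add: algebra_simps)
qed

lemma graded_mesh_step_lower:
  assumes "0 < T" "1 \<le> r" "1 \<le> N" "1 \<le> k"
  shows "graded_mesh T r N k / real k \<le> graded_mesh T r N k - graded_mesh T r N (k - 1)"
proof -
  have eq: "real (k - 1) / real k = 1 - 1 / real k" using assms by (simp add: field_simps)
  have "(1 - 1 / real k) powr r \<le> (1 - 1 / real k) powr 1"
    using assms by (intro powr_mono') auto
  also have "\<dots> = 1 - 1 / real k" using assms by simp
  finally have "graded_mesh T r N (k - 1) \<le> graded_mesh T r N k * (1 - 1 / real k)"
    using graded_mesh_pos[of T N k r] assms eq
    by (subst graded_mesh_scale[of k T r N "k-1"]) (auto intro!: mult_left_mono)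
  then show ?thesis by (simp add: algebra_simps)
qed

lemma graded_mesh_half:
  assumes "0 < T" "1 \<le> r" "1 \<le> N" "1 \<le> m" "2 * k \<le> m"
  shows "graded_mesh T r N k \<le> graded_mesh T r N m / 2"
proof -
  have "(real k / real m) powr r \<le> (1/2) powr r"
    using assms by (intro powr_mono2) (auto simp: divide_simps)
  also have "\<dots> \<le> (1/2) powr 1" using assms by (intro powr_mono') auto
  finally have "graded_mesh T r N m * (real k / real m) powr r \<le> graded_mesh T r N m * (1/2)"
    using graded_mesh_pos[of T N m r] assms by (intro mult_left_mono) auto
  then show ?thesis using assms by (subst graded_mesh_scale[of m T r N k]) auto
qed

lemma graded_mesh_pred_lower:
  assumes "0 < T" "0 < r" "1 \<le> N" "2 \<le> k"
  shows "2 powr (- r) * graded_mesh T r N k \<le> graded_mesh T r N (k - 1)"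
proof -
  have "2 powr (- r) = (1/2) powr r" by (simp add: powr_minus powr_divide divide_simps)
  also have "\<dots> \<le> (real (k - 1) / real k) powr r"
    using assms by (intro powr_mono2) (auto simp: divide_simps of_nat_diff)
  finally have "graded_mesh T r N k * 2 powr (- r) \<le> graded_mesh T r N k * (real (k - 1) / real k) powr r"
    using graded_mesh_pos[of T N k r] assms by (intro mult_left_mono) auto
  then show ?thesis using assms by (subst graded_mesh_scale[of k T r N "k-1"]) (auto simp: mult.commute)
qed

text \<open>Regularity \<open>t powr \<sigma>\<close> at the node \<open>t\<^sub>k\<close> is worth \<open>(k/N) powr (r * \<sigma>)\<close>, which is at most
  \<open>(k/N) powr q\<close>: the grading trades weak regularity at the origin for powers of \<open>N\<close>.\<close>

lemma graded_mesh_powr_decay: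
  assumes "0 < T" "1 \<le> N" "1 \<le> k" "k \<le> N" "q \<le> r * \<sigma>"
  shows "graded_mesh T r N k powr \<sigma> * real k powr (- q) \<le> T powr \<sigma> * real N powr (- q)"
proof -
  have "(real k / real N) powr (r * \<sigma>) \<le> (real k / real N) powr q"
    using assms by (intro powr_mono') auto
  also have "\<dots> = real k powr q * real N powr (- q)"
    by (simp add: powr_divide powr_minus_divide)
  finally have "T powr \<sigma> * (real k / real N) powr (r * \<sigma>) * real k powr (- q)
      \<le> T powr \<sigma> * (real k powr q * real N powr (- q)) * real k powr (- q)"
    by (intro mult_right_mono mult_left_mono) auto
  also have "\<dots> = T powr \<sigma> * real N powr (- q)"
    using assms by (simp add: powr_minus)
  finally show ?thesis
    using assms by (simp add: graded_mesh_def powr_mult powr_powr)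
qed

section \<open>Truncation error of the L1 formula\<close>

lemma weak_singular_integrable:
  fixes g :: "real \<Rightarrow> real"
  assumes "a > 0" "b > 0" "t > 0"
    and g: "set_borel_measurable borel {0<..<t} g"
    and bound: "\<And>s. 0 < s \<Longrightarrow> s < t \<Longrightarrow> \<bar>g s\<bar> \<le> M * ((t - s) powr (a - 1) * s powr (b - 1))"
  shows "set_integrable lborel {0<..<t} g"
proof (rule set_integrable_bound)
  show "set_integrable lborel {0<..<t} (\<lambda>s. M * ((t - s) powr (a - 1) * s powr (b - 1)))"
    using Beta_integral_lborel(1)[OF assms(1-3)] by (rule set_integrable_mult_right)
  show "set_borel_measurable lborel {0<..<t} g" using g by (simp add: set_borel_measurable_def)
  show "AE s in lborel. s \<in> {0<..<t} \<longrightarrow> norm (g s) \<le> norm (M * ((t - s) powr (a - 1) * s powr (b - 1)))"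
  proof (intro AE_I2 impI)
    fix s assume "s \<in> {0<..<t}"
    then have "\<bar>g s\<bar> \<le> M * ((t - s) powr (a - 1) * s powr (b - 1))" using bound by simp
    also have "\<dots> \<le> \<bar>M * ((t - s) powr (a - 1) * s powr (b - 1))\<bar>" by (rule abs_ge_self)
    finally show "norm (g s) \<le> norm (M * ((t - s) powr (a - 1) * s powr (b - 1)))"
      unfolding real_norm_def .
  qed
qed

lemma sum_integral_consecutive:
 fixes g :: "real \<Rightarrow> real" and t :: "nat \<Rightarrow> real"
  assumes "g integrable_on {t 0..t m}" "mono t"
  shows "integral {t 0..t m} g = (\<Sum>k=1..m. integral {t (k - 1)..t k} g)"
  using assms(1)
proof (induction m)
  case (Suc m)
  have le: "t 0 \<le> t m" "t m \<le> t (Suc m)" using assms(2) by (auto simp: mono_def)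
  then have "g integrable_on {t 0..t m}"
    using Suc.prems by (rule_tac integrable_subinterval_real) auto
  then show ?case
    using Suc.IH Henstock_Kurzweil_Integration.integral_combine[OF le Suc.prems] by simp
qed simp

text \<open>The contribution of one mesh interval to the truncation error.  On it the error of the
  interpolant has zero mean derivative, so a constant may be subtracted from the kernel.\<close>

lemma kernel_oscillation_bound:
  fixes w w' \<kappa> :: "real \<Rightarrow> real"
  assumes xy: "x < y"
    and contw: "continuous_on {x..y} w"
    and deriv: "\<And>s. s \<in> {x<..<y} \<Longrightarrow> (w has_real_derivative w' s) (at s)"
    and prod: "(\<lambda>s. \<kappa> s * w' s) integrable_on {x..y}"
    and \<kappa>: "\<kappa> integrable_on {x..y}"
    and H: "(H has_integral I) {x..y}"
    and bound: "\<And>s. s \<in> {x<..<y} \<Longrightarrow> \<bar>(\<kappa> s - c) * (w' s - (w y - w x) / (y - x))\<bar> \<le> H s"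
  shows "\<bar>integral {x..y} (\<lambda>s. \<kappa> s * w' s) - (w y - w x) / (y - x) * integral {x..y} \<kappa>\<bar> \<le> I"
proof -
  define d where "d = (w y - w x) / (y - x)"
  have w': "(w' has_integral w y - w x) {x..y}"
    using xy contw deriv
    by (intro fundamental_theorem_of_calculus_interior)
       (auto simp: has_real_derivative_iff_has_vector_derivative)
  have dd: "((\<lambda>s. d) has_integral w y - w x) {x..y}"
    using has_integral_const_real[of d x y] xy by (simp add: d_def)
  have "((\<lambda>s. \<kappa> s * w' s - d * \<kappa> s - c * (w' s - d)) has_integral
      integral {x..y} (\<lambda>s. \<kappa> s * w' s) - d * integral {x..y} \<kappa> - c * ((w y - w x) - (w y - w x))) {x..y}"
    by (intro has_integral_diff has_integral_mult_right w' dd integrable_integral prod \<kappa>)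
  then have I: "((\<lambda>s. (\<kappa> s - c) * (w' s - d)) has_integral
      integral {x..y} (\<lambda>s. \<kappa> s * w' s) - d * integral {x..y} \<kappa>) {x<..<y}"
    by (simp add: algebra_simps has_integral_Icc_iff_Ioo)
  have H': "(H has_integral I) {x<..<y}" using H by (simp add: has_integral_Icc_iff_Ioo)
  have "norm (integral {x..y} (\<lambda>s. \<kappa> s * w' s) - d * integral {x..y} \<kappa>) \<le> I"
  proof (rule integral_norm_bound_integral[of "\<lambda>s. (\<kappa> s - c) * (w' s - d)" "{x<..<y}" H,
        unfolded integral_unique[OF I] integral_unique[OF H']])
    show "norm ((\<kappa> s - c) * (w' s - d)) \<le> H s" if "s \<in> {x<..<y}" for s
      using bound[OF that] by (simp add: d_def)
  qed (use I H' in \<open>auto simp: integrable_on_def\<close>)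
  then show ?thesis by (simp add: d_def)
qed

definition L1_error :: "real \<Rightarrow> (nat \<Rightarrow> real) \<Rightarrow> (real \<Rightarrow> real) \<Rightarrow> (real \<Rightarrow> real) \<Rightarrow> nat \<Rightarrow> real" where
  "L1_error \<nu> t w w' m =
     (LINT s:{0<..<t m}|lborel. omega (1 - \<nu>) (t m - s) * w' s) - L1_diff \<nu> t (\<lambda>n. w (t n)) m"

text \<open>The exponent \<open>\<sigma>\<close> measures the regularity at the origin: \<open>w'\<close> minus a constant is bounded by
  \<open>M * s powr (\<sigma> - 1)\<close> and its local Lipschitz constant by \<open>M * s powr (\<sigma> - 2)\<close>.  The constant \<open>C\<close> is the
  sum of four contributions: the only interval if \<open>m = 1\<close>, the first one if \<open>m > 1\<close>, the inner
  ones, and the last one, on which the kernel is singular.\<close>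

locale L1_truncation_parameters =
  fixes \<nu> r T \<sigma> q :: real
  assumes \<nu>: "0 < \<nu>" "\<nu> < 1" and r: "1 \<le> r" and T: "0 < T"
    and \<sigma>: "0 < \<sigma>" "\<sigma> \<le> 2" and q: "q \<le> r * \<sigma>" "q \<le> 2 - \<nu>"
begin

definition G where "G = Gamma (1 - \<nu>)"
definition G2 where "G2 = Gamma (2 - \<nu>)"
definition c1 where "c1 = (2 powr (- r)) powr (\<sigma> - 2) * r\<^sup>2"
definition P where "P = T powr \<sigma>"
definition C where "C = P * (Beta (1 - \<nu>) \<sigma> / G + 1 / (\<sigma> * G2)) + P * (2 powr \<nu> * 2 / (G * \<sigma>))
      + P * (c1 * (2 powr \<nu> + 4) / G) + P * (c1 / G2)"

lemma G: "0 < G" "0 < G2" using \<nu> by (simp_all add: G_def G2_def)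

lemma c1: "0 \<le> c1" by (simp add: c1_def)

lemma P: "0 \<le> P" by (simp add: P_def)

lemma Bt: "0 \<le> Beta (1 - \<nu>) \<sigma>" using \<nu> \<sigma> by (simp add: Beta_def)

lemma C_parts_nonneg: "0 \<le> P * (Beta (1 - \<nu>) \<sigma> / G + 1 / (\<sigma> * G2))" "0 \<le> P * (2 powr \<nu> * 2 / (G * \<sigma>))"
    "0 \<le> P * (c1 * (2 powr \<nu> + 4) / G)" "0 \<le> P * (c1 / G2)"
  using G c1 P Bt \<sigma> by simp_all

lemma C_nonneg: "0 \<le> C" unfolding C_def using C_parts_nonneg by linarith

end

locale L1_truncation_setting = L1_truncation_parameters +
  fixes N m :: nat and w w' :: "real \<Rightarrow> real" and b M :: real
  assumes m: "1 \<le> m" "m \<le> N" and M: "0 \<le> M" and w: "continuous_on {0..T} w"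
    and w'c: "continuous_on {0<..T} w'"
    and d: "\<And>s. s \<in> {0<..T} \<Longrightarrow> (w has_real_derivative w' s) (at s)"
    and b1: "\<And>s. s \<in> {0<..T} \<Longrightarrow> \<bar>w' s - b\<bar> \<le> M * s powr (\<sigma> - 1)"
    and b2: "\<And>x y. x \<in> {0<..T} \<Longrightarrow> y \<in> {x..T} \<Longrightarrow> \<bar>w' y - w' x\<bar> \<le> M * x powr (\<sigma> - 2) * (y - x)"
begin

definition t where "t = graded_mesh T r N"

definition \<kappa> where "\<kappa> s = omega (1 - \<nu>) (t m - s)"

definition D where "D k = (w (t k) - w (t (k - 1))) / (t k - t (k - 1))"

definition E where "E k = integral {t (k - 1)..t k} (\<lambda>s. \<kappa> s * w' s) - D k * integral {t (k - 1)..t k} \<kappa>"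

lemma N1: "1 \<le> N" using m by simp

lemma mesh_0: "t 0 = 0" using r by (simp add: t_def)

lemma mesh_strict_mono: "strict_mono t" unfolding t_def using graded_mesh_strict_mono[of T r N] T r N1 by simp

lemma mesh_pos: "0 < t k" if "1 \<le> k" for k unfolding t_def using graded_mesh_pos T N1 that by blast

lemma mesh_le: "t k \<le> T" if "k \<le> N" for k unfolding t_def using graded_mesh_le T r that by simp

lemma mesh_end: "0 < t m" "t m \<le> T" using mesh_pos mesh_le m by auto

lemma mesh_less: "t (k - 1) < t k" if "1 \<le> k" for k using strict_monoD[OF mesh_strict_mono, of "k-1" k] that by simp

lemma mesh_nonneg: "0 \<le> t k" for k using mesh_pos[of k] mesh_0 by (cases "k = 0") auto

lemma mesh_le_end: "t k \<le> t m" if "k \<le> m" for k using mesh_strict_mono that by (simp add: strict_mono_less_eq)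

lemma kernel_eq: "\<kappa> s = (t m - s) powr (- \<nu>) / G" for s by (simp add: \<kappa>_def omega_def G_def)

lemma kernel_nonneg: "0 \<le> \<kappa> s" for s using G by (simp add: kernel_eq)

lemma kernel_mono: "\<kappa> x \<le> \<kappa> y" if "x \<le> y" "y < t m" for x y
  unfolding \<kappa>_def using omega_antimono[of "1-\<nu>" "t m - y" "t m - x"] \<nu> that by simp

lemma kernel_has_integral: "(\<kappa> has_integral (omega (2 - \<nu>) (t m - x) - omega (2 - \<nu>) (t m - y))) {x..y}"
  if "x \<le> y" "y \<le> t m" for x y
  using omega_has_integral[of "1 - \<nu>" x y "t m"] that \<nu> by (simp add: \<kappa>_def[abs_def])

lemma derivative_measurable: "set_borel_measurable borel {0<..<t m} w'"
proof -
  have "continuous_on {0<..<t m} w'" by (rule continuous_on_subset[OF w'c]) (use mesh_end in auto)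
  then show ?thesis
    unfolding set_borel_measurable_def by (intro borel_measurable_continuous_on_indicator) auto
qed

lemma product_set_integrable: "set_integrable lborel {0<..<t m} (\<lambda>s. \<kappa> s * w' s)"
proof -
  have "set_integrable lborel {0<..<t m} (\<lambda>s. \<kappa> s * (w' s - b))"
  proof (rule weak_singular_integrable[where a = "1 - \<nu>" and b = \<sigma> and M = "M / G"])
    have "(\<lambda>s. \<kappa> s * (indicat_real {0<..<t m} s * w' s - indicat_real {0<..<t m} s * b)) \<in> borel_measurable borel"
      using derivative_measurable unfolding \<kappa>_def set_borel_measurable_def by simp
    then show "set_borel_measurable borel {0<..<t m} (\<lambda>s. \<kappa> s * (w' s - b))"
      unfolding set_borel_measurable_def by (simp add: algebra_simps)
    fix s assume s: "0 < s" "s < t m"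
    have "\<bar>\<kappa> s * (w' s - b)\<bar> \<le> \<kappa> s * (M * s powr (\<sigma> - 1))"
      using b1[of s] kernel_nonneg[of s] s mesh_end by (auto simp: abs_mult intro!: mult_left_mono)
    also have "\<dots> = M / G * ((t m - s) powr (1 - \<nu> - 1) * s powr (\<sigma> - 1))"
      by (simp add: kernel_eq)
    finally show "\<bar>\<kappa> s * (w' s - b)\<bar> \<le> M / G * ((t m - s) powr (1 - \<nu> - 1) * s powr (\<sigma> - 1))" .
  qed (use \<nu> \<sigma> mesh_end in auto)
  moreover have "set_integrable lborel {0<..<t m} \<kappa>"
    using omega_lborel(1)[of "1 - \<nu>" 0 "t m" "t m"] \<nu> mesh_end
    unfolding \<kappa>_def[abs_def] by (rule_tac set_integrable_subset) auto
  ultimately have "set_integrable lborel {0<..<t m} (\<lambda>s. \<kappa> s * (w' s - b) + b * \<kappa> s)"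
    by (intro set_integral_add(1) set_integrable_mult_right)
  then show ?thesis by (simp add: algebra_simps)
qed

lemma product_integrable: "(\<lambda>s. \<kappa> s * w' s) integrable_on {0..t m}"
  using set_borel_integral_eq_integral(1)[OF product_set_integrable]
  by (simp add: integrable_on_def has_integral_Icc_iff_Ioo)

lemma product_integral: "(LINT s:{0<..<t m}|lborel. \<kappa> s * w' s) = integral {0..t m} (\<lambda>s. \<kappa> s * w' s)"
  using set_borel_integral_eq_integral(2)[OF product_set_integrable] by (simp add: integral_open_interval_real)

text \<open>The L1 formula integrates the kernel against the derivative \<open>D k\<close> of the piecewise linear
  interpolant, so the error splits into one term \<open>E k\<close> per mesh interval.\<close>

lemma error_eq_sum: "(LINT s:{0<..<t m}|lborel. \<kappa> s * w' s) - L1_diff \<nu> t (\<lambda>n. w (t n)) m = (\<Sum>k=1..m. E k)"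
proof -
  have "integral {0..t m} (\<lambda>s. \<kappa> s * w' s) = (\<Sum>k=1..m. integral {t (k - 1)..t k} (\<lambda>s. \<kappa> s * w' s))"
    using sum_integral_consecutive[of _ t m] product_integrable mesh_0 mesh_strict_mono by (simp add: strict_mono_mono)
  moreover have "L1_diff \<nu> t (\<lambda>n. w (t n)) m = (\<Sum>k=1..m. D k * integral {t (k - 1)..t k} \<kappa>)"
    unfolding L1_diff_def
  proof (intro sum.cong refl)
    fix k assume "k \<in> {1..m}"
    then show "L1_coeff \<nu> t m k *\<^sub>R (w (t k) - w (t (k - 1))) = D k * integral {t (k - 1)..t k} \<kappa>"
      using L1_coeff_eq[OF \<nu>, of t k m] mesh_less[of k] mesh_le_end[of k]
      by (simp add: D_def \<kappa>_def[abs_def])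
  qed
  ultimately show ?thesis unfolding product_integral E_def by (simp add: sum_subtractf)
qed

lemmas interval_bound = kernel_oscillation_bound[where w = w and w' = w' and \<kappa> = \<kappa>]

lemma interval_premises: "continuous_on {t (k - 1)..t k} w" "(\<lambda>s. \<kappa> s * w' s) integrable_on {t (k - 1)..t k}"
   "\<kappa> integrable_on {t (k - 1)..t k}"
   "\<And>s. s \<in> {t (k - 1)<..<t k} \<Longrightarrow> (w has_real_derivative w' s) (at s)"
  if "1 \<le> k" "k \<le> m" for k
proof -
  have *: "0 \<le> t (k - 1)" "t k \<le> t m" "t k \<le> T" "t (k - 1) < t k"
    using mesh_nonneg mesh_le_end mesh_le mesh_less that m by auto
  then show "continuous_on {t (k - 1)..t k} w" using w by (rule_tac continuous_on_subset) auto
  show "(\<lambda>s. \<kappa> s * w' s) integrable_on {t (k - 1)..t k}"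
    using product_integrable * by (rule_tac integrable_subinterval_real) auto
  show "\<kappa> integrable_on {t (k - 1)..t k}"
    using kernel_has_integral[of "t (k-1)" "t k"] * by (auto simp: integrable_on_def)
  show "(w has_real_derivative w' s) (at s)" if "s \<in> {t (k - 1)<..<t k}" for s
    using d[of s] that * by auto
qed

text \<open>The difference quotient is a value of \<open>w'\<close> inside the interval, by the mean value theorem.\<close>

lemma slope_error: "\<bar>w' s - D k\<bar> \<le> M * t (k - 1) powr (\<sigma> - 2) * (t k - t (k - 1))"
  if k: "2 \<le> k" "k \<le> m" and s: "s \<in> {t (k - 1)<..<t k}" for k s
proof -
  have *: "0 < t (k - 1)" "t k \<le> T" "t (k - 1) < t k" using mesh_pos mesh_le mesh_less k m by auto
  obtain \<xi> where \<xi>: "t (k - 1) < \<xi>" "\<xi> < t k" "w (t k) - w (t (k - 1)) = (t k - t (k - 1)) * w' \<xi>"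
    using MVT2[of "t (k-1)" "t k" w w'] d * by auto
  then have D: "D k = w' \<xi>" using * by (simp add: D_def)
  have pw: "z powr (\<sigma> - 2) \<le> t (k - 1) powr (\<sigma> - 2)" if "t (k-1) \<le> z" for z
    using that * \<sigma> by (intro powr_mono2') auto
  have "\<bar>w' s - w' \<xi>\<bar> \<le> M * min s \<xi> powr (\<sigma> - 2) * \<bar>s - \<xi>\<bar>"
    using b2[of s \<xi>] b2[of \<xi> s] s \<xi> * by (cases "s \<le> \<xi>") (auto simp: min_def abs_minus_commute)
  also have "\<dots> \<le> M * t (k - 1) powr (\<sigma> - 2) * (t k - t (k - 1))"
    using s \<xi> M pw[of "min s \<xi>"] by (intro mult_mono mult_left_mono) auto
  finally show ?thesis by (simp add: D)
qed

text \<open>Up to the origin there is no Lipschitz bound, and both \<open>w'\<close> and the difference quotient are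
  compared with the constant \<open>b\<close>.\<close>

lemma slope_error_first: "\<bar>w' s - D 1\<bar> \<le> M * s powr (\<sigma> - 1) + M * t 1 powr (\<sigma> - 1) / \<sigma>"
  if s: "s \<in> {0<..<t 1}" for s
proof -
  have t1: "0 < t 1" "t 1 \<le> T" using mesh_pos mesh_le m by auto
  have "(w' has_integral w (t 1) - w 0) {0..t 1}"
    by (rule fundamental_theorem_of_calculus_interior)
       (use t1 d in \<open>auto simp: has_real_derivative_iff_has_vector_derivative[symmetric]
          intro: continuous_on_subset[OF w]\<close>)
  then have w'I: "(w' has_integral w (t 1) - w (t 0)) {0..t 1}" by (simp add: mesh_0)
  have I1: "((\<lambda>s. w' s - b) has_integral (w (t 1) - w (t 0) - b * t 1)) {0..t 1}"
    using has_integral_diff[OF w'I has_integral_const_real[of b 0 "t 1"]] t1 by (simp add: mult.commute)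
  have I2: "((\<lambda>s. M * s powr (\<sigma> - 1)) has_integral M * (t 1 powr \<sigma> / \<sigma>)) {0..t 1}"
    using has_integral_powr_from_0[of "\<sigma> - 1" "t 1"] t1 \<sigma> by (intro has_integral_mult_right) auto
  have "norm (w (t 1) - w (t 0) - b * t 1) \<le> M * (t 1 powr \<sigma> / \<sigma>)"
  proof (rule integral_norm_bound_integral[of "\<lambda>s. w' s - b" "{0<..<t 1}" "\<lambda>s. M * s powr (\<sigma> - 1)",
      unfolded integral_unique[OF I1[unfolded has_integral_Icc_iff_Ioo]] integral_unique[OF I2[unfolded has_integral_Icc_iff_Ioo]]])
    show "(\<lambda>s. w' s - b) integrable_on {0<..<t 1}"
      using I1[unfolded has_integral_Icc_iff_Ioo] by (rule has_integral_integrable)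
    show "(\<lambda>s. M * s powr (\<sigma> - 1)) integrable_on {0<..<t 1}"
      using I2[unfolded has_integral_Icc_iff_Ioo] by (rule has_integral_integrable)
    fix s assume "s \<in> {0<..<t 1}"
    then show "norm (w' s - b) \<le> M * s powr (\<sigma> - 1)" using b1[of s] t1 by simp
  qed
  moreover have "w (t 1) - w (t 0) - b * t 1 = t 1 * (D 1 - b)"
    using t1 by (simp add: D_def mesh_0 field_simps)
  ultimately have "t 1 * \<bar>D 1 - b\<bar> \<le> M * (t 1 powr \<sigma> / \<sigma>)" using t1 by (simp add: abs_mult)
  then have "\<bar>D 1 - b\<bar> \<le> M * t 1 powr (\<sigma> - 1) / \<sigma>"
    using t1 \<sigma> by (simp add: powr_diff field_simps)
  then show ?thesis using b1[of s] s t1 by auto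
qed

lemma weight_decay: "t k powr \<sigma> * real k powr (- q) \<le> P * real N powr (- q)" if "1 \<le> k" "k \<le> N" for k
  unfolding t_def P_def using graded_mesh_powr_decay[OF T N1 that q(1)] .

definition Q where "Q = M * real N powr (- q)"

lemma Q_nonneg: "0 \<le> Q" using M by (simp add: Q_def)

lemma first_weight: "M * t 1 powr \<sigma> \<le> P * Q"
  using mult_left_mono[OF weight_decay[of 1] M] m by (simp add: Q_def algebra_simps)

lemma bound_single_interval:
  assumes True: "m = 1"
  shows "t m powr \<nu> * \<bar>\<Sum>k=1..m. E k\<bar> \<le> C * Q"
proof -
  have t1: "0 < t 1" using mesh_pos by simp
  have kernel_first: "\<kappa> s = (t 1 - s) powr (- \<nu>) / G" for s using kernel_eq[of s] True by simp
  let ?H = "\<lambda>s. M / G * ((t 1 - s) powr (1 - \<nu> - 1) * s powr (\<sigma> - 1)) + M * t 1 powr (\<sigma> - 1) / \<sigma> * \<kappa> s"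
  have "(?H has_integral M / G * (Beta (1 - \<nu>) \<sigma> * t 1 powr (1 - \<nu> + \<sigma> - 1))
      + M * t 1 powr (\<sigma> - 1) / \<sigma> * omega (2 - \<nu>) (t 1)) {0..t 1}"
    using has_integral_Beta_scaled[of "1 - \<nu>" \<sigma> "t 1"] kernel_has_integral[of 0 "t 1"] \<nu> \<sigma> t1 True
    by (intro has_integral_add has_integral_mult_right) (auto simp: has_integral_Icc_iff_Ioo omega_def)
  then have "\<bar>E 1\<bar> \<le> M / G * (Beta (1 - \<nu>) \<sigma> * t 1 powr (1 - \<nu> + \<sigma> - 1))
      + M * t 1 powr (\<sigma> - 1) / \<sigma> * omega (2 - \<nu>) (t 1)"
    unfolding E_def D_def
  proof (intro interval_bound[where c = 0])
    fix s assume s: "s \<in> {t (1 - 1)<..<t 1}"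
    then have "\<bar>\<kappa> s * (w' s - D 1)\<bar> \<le> \<kappa> s * (M * s powr (\<sigma> - 1) + M * t 1 powr (\<sigma> - 1) / \<sigma>)"
      using slope_error_first[of s] mesh_0 kernel_nonneg[of s] by (auto simp: abs_mult intro!: mult_left_mono)
    then show "\<bar>(\<kappa> s - 0) * (w' s - (w (t 1) - w (t (1 - 1))) / (t 1 - t (1 - 1)))\<bar> \<le> ?H s"
      by (simp add: D_def kernel_first algebra_simps)
  qed (use interval_premises[of 1] m t1 mesh_0 in auto)
  also have "\<dots> = M * t 1 powr (\<sigma> - \<nu>) * (Beta (1 - \<nu>) \<sigma> / G + 1 / (\<sigma> * G2))"
    using t1 by (simp add: omega_def G2_def powr_diff powr_add field_simps)
  finally have "t 1 powr \<nu> * \<bar>E 1\<bar> \<le> t 1 powr \<nu> * (M * t 1 powr (\<sigma> - \<nu>) * (Beta (1 - \<nu>) \<sigma> / G + 1 / (\<sigma> * G2)))"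
    by (intro mult_left_mono) auto
  also have "\<dots> = M * t 1 powr \<sigma> * (Beta (1 - \<nu>) \<sigma> / G + 1 / (\<sigma> * G2))"
    using t1 by (simp add: powr_diff)
  also have "\<dots> \<le> P * Q * (Beta (1 - \<nu>) \<sigma> / G + 1 / (\<sigma> * G2))"
    using first_weight Bt G \<sigma> by (intro mult_right_mono) auto
  also have "\<dots> = P * (Beta (1 - \<nu>) \<sigma> / G + 1 / (\<sigma> * G2)) * Q" by simp
  also have "\<dots> \<le> C * Q"
    using C_parts_nonneg unfolding C_def by (intro mult_right_mono Q_nonneg) linarith
  finally show ?thesis using True by simp
qed

text \<open>Away from the singularity the kernel is of the size \<open>t m powr (- \<nu>)\<close>.\<close>

lemma kernel_first_half: "t m powr \<nu> * \<kappa> x \<le> 2 powr \<nu> / G" if "x \<le> t m / 2" for x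
proof -
  have "\<kappa> x \<le> \<kappa> (t m / 2)" using kernel_mono that mesh_end by simp
  also have "\<dots> = (1/2) powr (- \<nu>) * t m powr (- \<nu>) / G"
    by (simp add: kernel_eq powr_divide)
  finally have "t m powr \<nu> * \<kappa> x \<le> t m powr \<nu> * ((1/2) powr (- \<nu>) * t m powr (- \<nu>) / G)"
    by (intro mult_left_mono) auto
  also have "\<dots> = 2 powr \<nu> / G" using mesh_end by (simp add: powr_minus powr_divide field_simps)
  finally show ?thesis .
qed

lemma mesh_half: "t k \<le> t m / 2" if "2 * k \<le> m" for k
  unfolding t_def using graded_mesh_half T r N1 m that by blast

text \<open>The mesh is quasi-uniform away from the first interval: \<open>t (k - 1)\<close> is comparable with \<open>t k\<close>, and the
  step is at most \<open>r * t k / k\<close>.\<close>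

lemma step_bound: "t (k - 1) powr (\<sigma> - 2) * (t k - t (k - 1))\<^sup>2 \<le> c1 * (t k powr \<sigma> * real k powr (-2))"
  if k: "2 \<le> k" for k
proof -
  have tk: "0 < t k" "0 < t (k - 1)" using mesh_pos k by auto
  have "t (k - 1) powr (\<sigma> - 2) \<le> (2 powr (- r) * t k) powr (\<sigma> - 2)"
    using graded_mesh_pred_lower[of T r N k] T r N1 k tk \<sigma>
    by (intro powr_mono2') (auto simp: t_def)
  moreover have "(t k - t (k - 1))\<^sup>2 \<le> (r * t k / real k)\<^sup>2"
    using graded_mesh_step_upper[of T r N k] T r N1 k mesh_less[of k]
    by (intro power_mono) (auto simp: t_def)
  ultimately have "t (k - 1) powr (\<sigma> - 2) * (t k - t (k - 1))\<^sup>2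
      \<le> (2 powr (- r) * t k) powr (\<sigma> - 2) * (r * t k / real k)\<^sup>2"
    by (intro mult_mono) auto
  also have "\<dots> = c1 * (t k powr \<sigma> * real k powr (-2))"
  proof -
    have "(t k) powr \<sigma> = (t k) powr (\<sigma> - 2) * (t k)\<^sup>2"
      using tk by (simp add: powr_diff powr_numeral)
    moreover have "real k powr (-2) = 1 / (real k)\<^sup>2"
      using k by (simp add: powr_minus powr_numeral divide_inverse)
    ultimately show ?thesis
      by (simp add: c1_def powr_mult power_divide power_mult_distrib)
  qed
  finally show ?thesis .
qed

lemma last_step: "0 < t (m - 1)" "t (m - 1) < t m" if m2: "2 \<le> m" using mesh_pos mesh_less m2 by auto

lemma kernel_last_step: "t m powr \<nu> * (t m - t (m - 1)) powr (- \<nu>) \<le> real m powr \<nu>"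
proof -
  have "(t m - t (m - 1)) powr (- \<nu>) \<le> (t m / real m) powr (- \<nu>)"
    using graded_mesh_step_lower[of T r N m] T r N1 m mesh_end \<nu>
    by (intro powr_mono2') (auto simp: t_def)
  also have "\<dots> = t m powr (- \<nu>) * real m powr \<nu>"
    by (simp add: powr_divide powr_minus field_simps)
  finally have "t m powr \<nu> * (t m - t (m - 1)) powr (- \<nu>) \<le> t m powr \<nu> * (t m powr (- \<nu>) * real m powr \<nu>)"
    by (intro mult_left_mono) auto
  also have "\<dots> = real m powr \<nu>" using mesh_end by (simp add: powr_minus)
  finally show ?thesis .
qed

lemma PQ_nonneg: "0 \<le> P * Q" using P Q_nonneg by simp

text \<open>Here the limitation of the order by \<open>2 - \<nu>\<close> arises.\<close>

lemma weight_end: "M * (t m powr \<sigma> * real m powr (-2)) * real m powr \<nu> \<le> P * Q"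
proof -
  have "real m powr (-2) * real m powr \<nu> \<le> real m powr (- q)"
    unfolding powr_add[symmetric] using m q by (intro powr_mono) auto
  then have "t m powr \<sigma> * (real m powr (-2) * real m powr \<nu>) \<le> t m powr \<sigma> * real m powr (- q)"
    by (intro mult_left_mono) auto
  also have "\<dots> \<le> P * real N powr (- q)" using weight_decay m by simp
  finally show ?thesis using M unfolding Q_def
    by (metis (no_types, opaque_lifting) mult.assoc mult.left_commute mult_left_mono)
qed

lemma first_interval: "t m powr \<nu> * \<bar>E 1\<bar> \<le> P * (2 powr \<nu> * 2 / (G * \<sigma>)) * Q"
  if m2: "2 \<le> m"
proof -
  have t1: "0 < t 1" "t 1 \<le> t m / 2" using mesh_pos mesh_half[of 1] m2 by auto
  then have "t 1 < t m" using mesh_end by linarith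
  note t1 = t1 this
  let ?H = "\<lambda>s. \<kappa> (t 1) * (M * s powr (\<sigma> - 1) + M * t 1 powr (\<sigma> - 1) / \<sigma>)"
  have "(?H has_integral \<kappa> (t 1) * (M * (t 1 powr \<sigma> / \<sigma>) + t 1 * (M * t 1 powr (\<sigma> - 1) / \<sigma>))) {0..t 1}"
    using has_integral_powr_from_0[of "\<sigma> - 1" "t 1"] t1 \<sigma>
      has_integral_const_real[of "M * t 1 powr (\<sigma> - 1) / \<sigma>" 0 "t 1"]
    by (intro has_integral_mult_right has_integral_add) auto
  then have "\<bar>E 1\<bar> \<le> \<kappa> (t 1) * (M * (t 1 powr \<sigma> / \<sigma>) + t 1 * (M * t 1 powr (\<sigma> - 1) / \<sigma>))"
    unfolding E_def D_def
  proof (intro interval_bound[where c = "\<kappa> 0"])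
    fix s assume s: "s \<in> {t (1 - 1)<..<t 1}"
    then have "\<kappa> 0 \<le> \<kappa> s" "\<kappa> s \<le> \<kappa> (t 1)" using kernel_mono mesh_0 t1 by auto
    then have "\<bar>\<kappa> s - \<kappa> 0\<bar> \<le> \<kappa> (t 1)" using kernel_nonneg[of 0] by simp
    then have "\<bar>\<kappa> s - \<kappa> 0\<bar> * \<bar>w' s - D 1\<bar> \<le> ?H s"
      using slope_error_first[of s] s mesh_0 kernel_nonneg[of "t 1"] by (intro mult_mono) auto
    then show "\<bar>(\<kappa> s - \<kappa> 0) * (w' s - (w (t 1) - w (t (1 - 1))) / (t 1 - t (1 - 1)))\<bar> \<le> ?H s"
      by (simp add: D_def abs_mult)
  qed (use interval_premises[of 1] m t1 mesh_0 in auto)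
  also have "\<dots> = \<kappa> (t 1) * (M * t 1 powr \<sigma> * (2 / \<sigma>))"
    using t1 by (simp add: powr_diff field_simps)
  finally have "t m powr \<nu> * \<bar>E 1\<bar> \<le> t m powr \<nu> * (\<kappa> (t 1) * (M * t 1 powr \<sigma> * (2 / \<sigma>)))"
    by (intro mult_left_mono) auto
  also have "\<dots> = (t m powr \<nu> * \<kappa> (t 1)) * (M * t 1 powr \<sigma>) * (2 / \<sigma>)" by simp
  also have "\<dots> \<le> (2 powr \<nu> / G) * (P * Q) * (2 / \<sigma>)"
    using \<sigma> M G by (intro mult_right_mono[OF mult_mono[OF kernel_first_half[OF t1(2)] first_weight]]) auto
  also have "\<dots> = P * (2 powr \<nu> * 2 / (G * \<sigma>)) * Q" by simp
  finally show ?thesis .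
qed

lemma last_interval: "t m powr \<nu> * \<bar>E m\<bar> \<le> P * (c1 / G2) * Q"
  if m2: "2 \<le> m"
proof -
  define h where "h = t m - t (m - 1)"
  define B where "B = M * t (m - 1) powr (\<sigma> - 2) * h"
  have h: "0 < h" using last_step[OF m2] by (simp add: h_def)
  have B: "0 \<le> B" using M h by (simp add: B_def)
  have "((\<lambda>s. B * \<kappa> s) has_integral B * omega (2 - \<nu>) h) {t (m - 1)..t m}"
    using kernel_has_integral[of "t (m-1)" "t m"] last_step[OF m2] by (intro has_integral_mult_right) (auto simp: omega_def h_def)
  then have "\<bar>E m\<bar> \<le> B * omega (2 - \<nu>) h"
    unfolding E_def D_def
  proof (intro interval_bound[where c = 0])
    fix s assume s: "s \<in> {t (m - 1)<..<t m}"
    have "\<bar>w' s - D m\<bar> \<le> B" using slope_error[OF m2 order.refl s] by (simp add: B_def h_def)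
    then have "\<kappa> s * \<bar>w' s - D m\<bar> \<le> \<kappa> s * B" using kernel_nonneg by (rule mult_left_mono)
    then show "\<bar>(\<kappa> s - 0) * (w' s - (w (t m) - w (t (m - 1))) / (t m - t (m - 1)))\<bar> \<le> B * \<kappa> s"
      using kernel_nonneg[of s] by (simp add: D_def abs_mult mult.commute)
  qed (use interval_premises[of m] m last_step[OF m2] in auto)
  also have "\<dots> = M * (t (m - 1) powr (\<sigma> - 2) * h\<^sup>2) * h powr (- \<nu>) / G2"
    using h by (simp add: B_def omega_def G2_def powr_diff powr_minus power2_eq_square field_simps)
  also have "\<dots> \<le> M * (c1 * (t m powr \<sigma> * real m powr (-2))) * h powr (- \<nu>) / G2"
    using step_bound[OF m2] M G unfolding h_def by (intro divide_right_mono mult_right_mono mult_left_mono) auto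
  finally have "t m powr \<nu> * \<bar>E m\<bar> \<le> t m powr \<nu> * (M * (c1 * (t m powr \<sigma> * real m powr (-2))) * h powr (- \<nu>) / G2)"
    by (intro mult_left_mono) auto
  also have "\<dots> = (c1 / G2) * (M * (t m powr \<sigma> * real m powr (-2)) * (t m powr \<nu> * h powr (- \<nu>)))" by simp
  also have "\<dots> \<le> (c1 / G2) * (M * (t m powr \<sigma> * real m powr (-2)) * real m powr \<nu>)"
    using kernel_last_step c1 G M unfolding h_def by (intro mult_left_mono) auto
  also have "\<dots> \<le> (c1 / G2) * (P * Q)" using weight_end c1 G by (intro mult_left_mono) auto
  finally show ?thesis by (simp add: mult_ac)
qed

text \<open>The value of the kernel at the left end point is subtracted, which leaves its increment over the
  interval.  For the first half of the steps the remaining factor is bounded uniformly in \<open>k\<close>; for the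
  second half, where the increments add up to a singular value, it is comparable with its value at \<open>m\<close>.\<close>

lemma inner_interval: "\<bar>E k\<bar> \<le> c1 * (P * Q) * (if 2 * k \<le> m then \<kappa> (t k) - \<kappa> (t (k - 1)) else 0)
     + 4 * c1 * (M * (t m powr \<sigma> * real m powr (-2))) * (\<kappa> (t k) - \<kappa> (t (k - 1)))"
  if k: "2 \<le> k" "k < m" for k
proof -
  define h where "h = t k - t (k - 1)"
  define B where "B = M * t (k - 1) powr (\<sigma> - 2) * h"
  have tk: "0 < t (k - 1)" "t (k - 1) < t k" "t k < t m"
    using mesh_pos mesh_less k strict_monoD[OF mesh_strict_mono k(2)] by auto
  have h: "0 < h" using tk by (simp add: h_def)
  have B: "0 \<le> B" using M h by (simp add: B_def)
  define \<Delta> where "\<Delta> = \<kappa> (t k) - \<kappa> (t (k - 1))"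
  have \<Delta>: "0 \<le> \<Delta>" using kernel_mono tk by (simp add: \<Delta>_def)
  have "((\<lambda>s. \<Delta> * B) has_integral \<Delta> * B * h) {t (k - 1)..t k}"
    using has_integral_const_real[of "\<Delta> * B" "t (k-1)" "t k"] h by (simp add: h_def mult_ac)
  then have "\<bar>E k\<bar> \<le> \<Delta> * B * h"
    unfolding E_def D_def
  proof (intro interval_bound[where c = "\<kappa> (t (k - 1))"])
    fix s assume s: "s \<in> {t (k - 1)<..<t k}"
    have "\<bar>w' s - D k\<bar> \<le> B" using slope_error[OF k(1) _ s] k by (simp add: B_def h_def)
    moreover have "\<kappa> (t (k - 1)) \<le> \<kappa> s" "\<kappa> s \<le> \<kappa> (t k)" using kernel_mono s tk by auto
    ultimately have "\<bar>\<kappa> s - \<kappa> (t (k - 1))\<bar> * \<bar>w' s - D k\<bar> \<le> \<Delta> * B"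
      using \<Delta> by (intro mult_mono) (auto simp: \<Delta>_def)
    then show "\<bar>(\<kappa> s - \<kappa> (t (k - 1))) * (w' s - (w (t k) - w (t (k - 1))) / (t k - t (k - 1)))\<bar> \<le> \<Delta> * B"
      by (simp add: D_def abs_mult)
  qed (use interval_premises[of k] k tk in auto)
  also have "\<dots> = M * (t (k - 1) powr (\<sigma> - 2) * h\<^sup>2) * \<Delta>"
    by (simp add: B_def power2_eq_square)
  also have "\<dots> \<le> M * (c1 * (t k powr \<sigma> * real k powr (-2))) * \<Delta>"
    using step_bound[OF k(1)] M \<Delta> unfolding h_def by (intro mult_right_mono mult_left_mono) auto
  finally have Ek1: "\<bar>E k\<bar> \<le> c1 * (M * (t k powr \<sigma> * real k powr (-2))) * \<Delta>"
    by (simp add: mult_ac)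
  have nn: "0 \<le> 4 * c1 * (M * (t m powr \<sigma> * real m powr (-2))) * \<Delta>"
    using c1 M \<Delta> by simp
  show ?thesis
  proof (cases "2 * k \<le> m")
    case True
    have "real k powr (-2) \<le> real k powr (- q)" using k q \<nu> by (intro powr_mono) auto
    then have "t k powr \<sigma> * real k powr (-2) \<le> t k powr \<sigma> * real k powr (- q)"
      by (intro mult_left_mono) auto
    also have "\<dots> \<le> P * real N powr (- q)" using weight_decay k m by simp
    finally have "M * (t k powr \<sigma> * real k powr (-2)) \<le> M * (P * real N powr (- q))"
      using M by (rule mult_left_mono)
    then have "M * (t k powr \<sigma> * real k powr (-2)) \<le> P * Q" by (simp add: Q_def mult_ac)
    then have "c1 * (M * (t k powr \<sigma> * real k powr (-2))) * \<Delta> \<le> c1 * (P * Q) * \<Delta>"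
      using c1 \<Delta> by (intro mult_right_mono mult_left_mono)
    then have "\<bar>E k\<bar> \<le> c1 * (P * Q) * \<Delta> + 4 * c1 * (M * (t m powr \<sigma> * real m powr (-2))) * \<Delta>"
      using Ek1 nn by linarith
    then show ?thesis using True by (simp add: \<Delta>_def)
  next
    case False
    have "real k powr (-2) \<le> (real m / 2) powr (-2)" using False k by (intro powr_mono2') auto
    also have "\<dots> = 4 * real m powr (-2)"
      proof -
      have "inverse ((x / 2)\<^sup>2) = 4 * inverse (x\<^sup>2)" for x :: real
        by (simp add: power_divide inverse_eq_divide)
      then show ?thesis using m by (simp add: powr_minus powr_numeral)
    qed
    finally have "real k powr (-2) \<le> 4 * real m powr (-2)" .
    moreover have "t k powr \<sigma> \<le> t m powr \<sigma>" using tk \<sigma> by (intro powr_mono2) auto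
    ultimately have "t k powr \<sigma> * real k powr (-2) \<le> t m powr \<sigma> * (4 * real m powr (-2))"
      by (intro mult_mono) auto
    then have "c1 * (M * (t k powr \<sigma> * real k powr (-2))) * \<Delta> \<le> c1 * (M * (t m powr \<sigma> * (4 * real m powr (-2)))) * \<Delta>"
      using c1 \<Delta> M by (intro mult_right_mono mult_left_mono)
    then show ?thesis using Ek1 False by (simp add: \<Delta>_def mult_ac)
  qed
qed

lemma kernel_increment_nonneg: "0 \<le> \<kappa> (t k) - \<kappa> (t (k - 1))" if "1 \<le> k" "k < m" for k
  using kernel_mono[of "t (k-1)" "t k"] mesh_less[of k] strict_monoD[OF mesh_strict_mono that(2)] that by simp

lemma kernel_telescope: "(\<Sum>k=1..n. \<kappa> (t k) - \<kappa> (t (k - 1))) = \<kappa> (t n) - \<kappa> 0" for n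
  by (induction n) (auto simp: mesh_0)

text \<open>The increments of the kernel telescope: over the first half of the steps to a value of size
  \<open>t m powr (- \<nu>)\<close>, and over all of them to the large value at \<open>t (m - 1)\<close>.\<close>

lemma inner_intervals: "t m powr \<nu> * \<bar>\<Sum>k=2..<m. E k\<bar> \<le> P * (c1 * (2 powr \<nu> + 4) / G) * Q"
  if m2: "2 \<le> m"
proof -
  let ?\<Delta> = "\<lambda>k. \<kappa> (t k) - \<kappa> (t (k - 1))"
  have "\<bar>\<Sum>k=2..<m. E k\<bar> \<le> (\<Sum>k=2..<m. c1 * (P * Q) * (if 2 * k \<le> m then ?\<Delta> k else 0)
     + 4 * c1 * (M * (t m powr \<sigma> * real m powr (-2))) * ?\<Delta> k)"
    using inner_interval by (intro order.trans[OF sum_abs] sum_mono) auto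
  also have "\<dots> = c1 * (P * Q) * (\<Sum>k=2..<m. if 2 * k \<le> m then ?\<Delta> k else 0)
     + 4 * c1 * (M * (t m powr \<sigma> * real m powr (-2))) * (\<Sum>k=2..<m. ?\<Delta> k)"
    by (simp only: sum.distrib sum_distrib_left)
  also have "\<dots> \<le> c1 * (P * Q) * \<kappa> (t (m div 2))
     + 4 * c1 * (M * (t m powr \<sigma> * real m powr (-2))) * \<kappa> (t (m - 1))"
  proof (intro add_mono mult_left_mono)
    have "(\<Sum>k=2..<m. if 2 * k \<le> m then ?\<Delta> k else 0) = (\<Sum>k\<in>{k\<in>{2..<m}. 2 * k \<le> m}. ?\<Delta> k)"
      by (rule sum.inter_filter[symmetric]) simp
    also have "\<dots> \<le> (\<Sum>k=1..m div 2. ?\<Delta> k)"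
      using m2 by (intro sum_mono2 kernel_increment_nonneg) auto
    also have "\<dots> \<le> \<kappa> (t (m div 2))" unfolding kernel_telescope using kernel_nonneg[of 0] by simp
    finally show "(\<Sum>k=2..<m. if 2 * k \<le> m then ?\<Delta> k else 0) \<le> \<kappa> (t (m div 2))" .
    have "(\<Sum>k=2..<m. ?\<Delta> k) \<le> (\<Sum>k=1..m-1. ?\<Delta> k)"
      using m2 by (intro sum_mono2 kernel_increment_nonneg) auto
    also have "\<dots> \<le> \<kappa> (t (m - 1))" unfolding kernel_telescope using kernel_nonneg[of 0] by simp
    finally show "(\<Sum>k=2..<m. ?\<Delta> k) \<le> \<kappa> (t (m - 1))" .
  qed (use c1 P Q_nonneg M in auto)
  finally have "t m powr \<nu> * \<bar>\<Sum>k=2..<m. E k\<bar> \<le> t m powr \<nu> * (c1 * (P * Q) * \<kappa> (t (m div 2))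
     + 4 * c1 * (M * (t m powr \<sigma> * real m powr (-2))) * \<kappa> (t (m - 1)))"
    by (intro mult_left_mono) auto
  also have "\<dots> = c1 * (P * Q) * (t m powr \<nu> * \<kappa> (t (m div 2)))
     + 4 * c1 / G * (M * (t m powr \<sigma> * real m powr (-2)) * (t m powr \<nu> * (t m - t (m - 1)) powr (- \<nu>)))"
  proof -
    have "a * (b * h + 4 * c * z * (v / g)) = b * (a * h) + 4 * c / g * (z * (a * v))"
      for a b c h z v g :: real by (simp add: algebra_simps)
    then show ?thesis unfolding kernel_eq[of "t (m - 1)"] .
  qed
  also have "\<dots> \<le> c1 * (P * Q) * (2 powr \<nu> / G)
     + 4 * c1 / G * (M * (t m powr \<sigma> * real m powr (-2)) * real m powr \<nu>)"
    using kernel_first_half[OF mesh_half[of "m div 2"]] kernel_last_step c1 P Q_nonneg M G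
    by (intro add_mono mult_left_mono) auto
  also have "\<dots> \<le> c1 * (P * Q) * (2 powr \<nu> / G) + 4 * c1 / G * (P * Q)"
    using weight_end c1 G PQ_nonneg by (intro add_mono mult_left_mono) auto
  also have "\<dots> = P * (c1 * (2 powr \<nu> + 4) / G) * Q"
  proof -
    have "a * (P * Q) * (b / g) + 4 * a / g * (P * Q) = P * (a * (b + 4) / g) * Q" for a b g :: real
      by (cases "g = 0") (simp_all add: field_simps)
    then show ?thesis .
  qed
  finally show ?thesis .
qed

lemma bound_many_intervals:
  assumes m2: "2 \<le> m"
  shows "t m powr \<nu> * \<bar>\<Sum>k=1..m. E k\<bar> \<le> C * Q"
proof -
  have "(\<Sum>k=1..m. E k) = (\<Sum>k\<in>insert 1 (insert m {2..<m}). E k)"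
    using m2 by (intro sum.cong) auto
  also have "\<dots> = E 1 + (E m + (\<Sum>k=2..<m. E k))"
    using m2 by simp
  finally have sum3: "(\<Sum>k=1..m. E k) = E 1 + (E m + (\<Sum>k=2..<m. E k))" .
  have "t m powr \<nu> * \<bar>\<Sum>k=1..m. E k\<bar>
      \<le> t m powr \<nu> * (\<bar>E 1\<bar> + (\<bar>E m\<bar> + \<bar>\<Sum>k=2..<m. E k\<bar>))"
    unfolding sum3 by (intro mult_left_mono order.trans[OF abs_triangle_ineq] add_mono order.refl) auto
  also have "\<dots> = t m powr \<nu> * \<bar>E 1\<bar> + (t m powr \<nu> * \<bar>E m\<bar> + t m powr \<nu> * \<bar>\<Sum>k=2..<m. E k\<bar>)"
    by (simp add: algebra_simps)
  also have "\<dots> \<le> P * (2 powr \<nu> * 2 / (G * \<sigma>)) * Q + (P * (c1 / G2) * Q + P * (c1 * (2 powr \<nu> + 4) / G) * Q)"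
    using first_interval[OF m2] last_interval[OF m2] inner_intervals[OF m2] by linarith
  also have "\<dots> = (P * (2 powr \<nu> * 2 / (G * \<sigma>)) + P * (c1 / G2) + P * (c1 * (2 powr \<nu> + 4) / G)) * Q"
    by (simp only: distrib_right add.assoc)
  also have "\<dots> \<le> C * Q"
    using C_parts_nonneg unfolding C_def by (intro mult_right_mono Q_nonneg) linarith
  finally show ?thesis .
qed

lemma truncation_bound:
  "graded_mesh T r N m powr \<nu> * \<bar>L1_error \<nu> (graded_mesh T r N) w w' m\<bar> \<le> C * M * real N powr (- q)"
proof -
  have "t m powr \<nu> * \<bar>\<Sum>k=1..m. E k\<bar> \<le> C * Q"
  proof (cases "m = 1")
    case True
    then show ?thesis by (rule bound_single_interval)
  next
    case False
    then show ?thesis using m by (intro bound_many_intervals) simp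
  qed
  then show ?thesis
    unfolding error_eq_sum[symmetric] \<kappa>_def t_def Q_def L1_error_def by (simp only: mult.assoc)
qed

end

text \<open>The order on a graded mesh is the smaller one of \<open>r * \<sigma>\<close>, due to the regularity at the origin, and
  \<open>2 - \<nu>\<close>, due to the formula.  The constant depends on neither the function nor the mesh size; the
  size \<open>M\<close> of the derivatives enters linearly, which makes the dependence on the mode explicit.  The
  constant \<open>b\<close> is arbitrary because the formula is exact for linear functions.\<close>

theorem L1_truncation:
  fixes \<nu> r T \<sigma> q :: real
  assumes \<nu>: "0 < \<nu>" "\<nu> < 1" and r: "1 \<le> r" and T: "0 < T"
    and \<sigma>: "0 < \<sigma>" "\<sigma> \<le> 2" and q: "q \<le> r * \<sigma>" "q \<le> 2 - \<nu>"
  shows "\<exists>C\<ge>0. \<forall>N w w' b M m. 1 \<le> m \<longrightarrow> m \<le> N \<longrightarrow> 0 \<le> M \<longrightarrow>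
    continuous_on {0..T} w \<longrightarrow> continuous_on {0<..T} w' \<longrightarrow>
    (\<forall>s\<in>{0<..T}. (w has_real_derivative w' s) (at s)) \<longrightarrow>
    (\<forall>s\<in>{0<..T}. \<bar>w' s - b\<bar> \<le> M * s powr (\<sigma> - 1)) \<longrightarrow>
    (\<forall>x\<in>{0<..T}. \<forall>y\<in>{x..T}. \<bar>w' y - w' x\<bar> \<le> M * x powr (\<sigma> - 2) * (y - x)) \<longrightarrow>
    graded_mesh T r N m powr \<nu> * \<bar>L1_error \<nu> (graded_mesh T r N) w w' m\<bar>
    \<le> C * M * real N powr (- q)"
proof -
  interpret L1_truncation_parameters \<nu> r T \<sigma> q
    using assms by unfold_locales
  show ?thesis
  proof (intro exI[of _ C] conjI C_nonneg allI impI)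
    fix N m :: nat and w w' :: "real \<Rightarrow> real" and b M :: real
    assume "1 \<le> m" "m \<le> N" "0 \<le> M" "continuous_on {0..T} w" "continuous_on {0<..T} w'"
      "\<forall>s\<in>{0<..T}. (w has_real_derivative w' s) (at s)"
      "\<forall>s\<in>{0<..T}. \<bar>w' s - b\<bar> \<le> M * s powr (\<sigma> - 1)"
      "\<forall>x\<in>{0<..T}. \<forall>y\<in>{x..T}. \<bar>w' y - w' x\<bar> \<le> M * x powr (\<sigma> - 2) * (y - x)"
    then interpret L1_truncation_setting \<nu> r T \<sigma> q N m w w' b M
      by unfold_locales blast+
    show "graded_mesh T r N m powr \<nu> * \<bar>L1_error \<nu> (graded_mesh T r N) w w' m\<bar> \<le> C * M * real N powr (- q)"
      by (rule truncation_bound)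
  qed
qed

section \<open>The inverse Laplace transform along vertical lines\<close>

text \<open>Holomorphy and decay are asked for in the open right half plane only.  There the symbols of the wave
  equation have no singularity, so that no branch cut and no Hankel contour is needed.\<close>

definition decays :: "real \<Rightarrow> real \<Rightarrow> (complex \<Rightarrow> complex) \<Rightarrow> bool" where
  "decays \<delta> M H \<longleftrightarrow> H holomorphic_on {p. 0 < Re p} \<and>
     (\<forall>p. 0 < Re p \<longrightarrow> norm (H p) \<le> M * norm p powr (-1 - \<delta>))"

text \<open>The Bromwich integral along the line of real part \<open>c\<close>, for which it converges absolutely if \<open>H\<close>
  decays with a positive exponent.\<close>

definition inv_Laplace_line :: "real \<Rightarrow> (complex \<Rightarrow> complex) \<Rightarrow> real \<Rightarrow> complex" where
  "inv_Laplace_line c H t =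
     (LINT y|lborel. exp (of_real t * Complex c y) * H (Complex c y)) / of_real (2 * pi)"

abbreviation inv_Laplace :: "(complex \<Rightarrow> complex) \<Rightarrow> real \<Rightarrow> complex" where
  "inv_Laplace \<equiv> inv_Laplace_line 1"

text \<open>The integral over the line of real part 1 of the decay rate; a homogeneity argument reduces every
  other line to this one.\<close>

definition line_weight :: "real \<Rightarrow> real" where
  "line_weight \<delta> = (LINT y|lborel. norm (Complex 1 y) powr (-1 - \<delta>))"

lemma norm_Complex_ge: "\<bar>x\<bar> \<le> norm (Complex x y)" "\<bar>y\<bar> \<le> norm (Complex x y)"
  using abs_Re_le_cmod[of "Complex x y"] abs_Im_le_cmod[of "Complex x y"] by auto

lemma line_weight_integrable_1:
  assumes "0 < \<delta>"
  shows "integrable lborel (\<lambda>y. norm (Complex 1 y) powr (-1 - \<delta>))"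
proof -
  define F where "F y = indicator {1..} y * y powr (-1 - \<delta>)" for y :: real
  have "((\<lambda>y. y powr (-1 - \<delta>)) has_integral - (1 powr (-1 - \<delta> + 1)) / (-1 - \<delta> + 1)) {1..}"
    using has_integral_powr_to_inf[of "-1 - \<delta>" 1] assms by simp
  then have "set_integrable lborel {1..} (\<lambda>y::real. y powr (-1 - \<delta>))"
    by (rule has_integral_nonneg_lborel(1)[rotated 3]) auto
  then have F: "integrable lborel F" by (simp add: set_integrable_def F_def[abs_def])
  then have F': "integrable lborel (\<lambda>y. F (- y))"
    using lborel_integrable_real_affine[OF F, of "-1" 0] by simp
  have I: "integrable lborel (indicator {-1..1} :: real \<Rightarrow> real)"
    by (intro integrable_real_indicator) auto
  show ?thesis
  proof (rule Bochner_Integration.integrable_bound)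
    show "integrable lborel (\<lambda>y. indicator {-1..1} y + F y + F (- y))"
      using F F' I by (intro Bochner_Integration.integrable_add)
    show "(\<lambda>y. norm (Complex 1 y) powr (-1 - \<delta>)) \<in> borel_measurable lborel"
      unfolding Complex_eq by measurable
    show "AE y in lborel. norm (norm (Complex 1 y) powr (-1 - \<delta>)) \<le> norm (indicator {-1..1} y + F y + F (- y))"
    proof (rule AE_I2)
      fix y :: real
      have F0: "0 \<le> F y" "0 \<le> F (- y)" by (simp_all add: F_def)
      have "norm (Complex 1 y) powr (-1 - \<delta>) \<le> indicator {-1..1} y + F y + F (- y)"
      proof (cases "\<bar>y\<bar> \<le> 1")
        case True
        have "norm (Complex 1 y) powr (-1 - \<delta>) \<le> 1 powr (-1 - \<delta>)"
          using norm_Complex_ge[of 1 y] assms by (intro powr_mono2') auto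
        then show ?thesis using True F0 by (auto simp: abs_le_iff)
      next
        case False
        have "norm (Complex 1 y) powr (-1 - \<delta>) \<le> \<bar>y\<bar> powr (-1 - \<delta>)"
          using norm_Complex_ge(2)[of y 1] assms False by (intro powr_mono2') auto
        also have "\<dots> \<le> F y + F (- y)"
          using False F0 by (cases "0 \<le> y") (auto simp: F_def)
        also have "\<dots> \<le> indicator {-1..1} y + F y + F (- y)" by simp
        finally show ?thesis .
      qed
      then show "norm (norm (Complex 1 y) powr (-1 - \<delta>)) \<le> norm (indicator {-1..1} y + F y + F (- y))"
        using F0 by simp
    qed
  qed
qed

lemma norm_Complex_scale:
  assumes "0 < c" shows "norm (Complex c (c * y)) = c * norm (Complex 1 y)"
proof -
  have "Complex c (c * y) = of_real c * Complex 1 y" by (simp add: complex_eq_iff)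
  then show ?thesis using assms by (simp only: norm_mult norm_of_real abs_of_pos)
qed

lemma line_weight_integrable:
  assumes "0 < \<delta>" "0 < c"
  shows "integrable lborel (\<lambda>y. norm (Complex c y) powr (-1 - \<delta>))"
proof -
  have "integrable lborel (\<lambda>y. c powr (-1 - \<delta>) * norm (Complex 1 (0 + 1 / c * y)) powr (-1 - \<delta>))"
    using assms
    by (intro integrable_mult_right lborel_integrable_real_affine line_weight_integrable_1) auto
  then show ?thesis
    using norm_Complex_scale[of c "_ / c"] assms by (simp add: powr_mult)
qed

lemma line_weight_integral:
  assumes "0 < c"
  shows "(LINT y|lborel. norm (Complex c y) powr (-1 - \<delta>)) = c powr (- \<delta>) * line_weight \<delta>"
proof -
  have "(LINT y|lborel. norm (Complex c y) powr (-1 - \<delta>))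
      = c * (LINT y|lborel. norm (Complex c (c * y)) powr (-1 - \<delta>))"
    using assms by (subst lborel_integral_real_affine[of c _ 0]) auto
  also have "\<dots> = c * c powr (-1 - \<delta>) * line_weight \<delta>"
    using assms by (simp add: norm_Complex_scale powr_mult line_weight_def)
  also have "c * c powr (-1 - \<delta>) = c powr (- \<delta>)"
    using assms powr_add[of c 1 "-1 - \<delta>"] by simp
  finally show ?thesis .
qed

lemma line_weight_nonneg: "0 \<le> line_weight \<delta>"
  unfolding line_weight_def by (rule Bochner_Integration.integral_nonneg) simp

lemma decays_nonneg:
  assumes "decays \<delta> M H" shows "0 \<le> M"
proof -
  have "norm (H 1) \<le> M * norm (1::complex) powr (-1 - \<delta>)"
    using assms unfolding decays_def by (metis one_complex.sel(1) zero_less_one)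
  then show ?thesis using norm_ge_zero[of "H 1"] by (simp del: norm_ge_zero)
qed

lemma continuous_on_line:
  assumes "H holomorphic_on {p. 0 < Re p}" "0 < c"
  shows "continuous_on UNIV (\<lambda>y. H (Complex c y))"
proof (rule continuous_on_compose2[OF holomorphic_on_imp_continuous_on[OF assms(1)]])
  show "continuous_on UNIV (Complex c)" unfolding Complex_eq by (intro continuous_intros)
qed (use assms in auto)

lemma norm_line_integrand:
  assumes "decays \<delta> M H" "0 < c"
  shows "norm (exp (of_real t * Complex c y) * H (Complex c y))
    \<le> exp (c * t) * M * norm (Complex c y) powr (-1 - \<delta>)"
proof -
  have e: "norm (exp (of_real t * Complex c y)) = exp (c * t)" by (simp add: norm_exp_eq_Re mult.commute)
  have "norm (H (Complex c y)) \<le> M * norm (Complex c y) powr (-1 - \<delta>)"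
    using assms by (simp add: decays_def)
  then show ?thesis unfolding norm_mult e mult.assoc by (intro mult_left_mono) auto
qed

lemma line_integrable:
  assumes H: "decays \<delta> M H" and "0 < \<delta>" "0 < c"
  shows "integrable lborel (\<lambda>y. exp (of_real t * Complex c y) * H (Complex c y))"
proof (rule Bochner_Integration.integrable_bound)
  show "integrable lborel (\<lambda>y. exp (c * t) * M * norm (Complex c y) powr (-1 - \<delta>))"
    using line_weight_integrable assms by (intro integrable_mult_right)
  have "continuous_on UNIV (\<lambda>y. exp (of_real t * Complex c y) * H (Complex c y))"
    using continuous_on_line[of H c] H assms unfolding decays_def
    by (intro continuous_intros) (auto simp: Complex_eq intro!: continuous_intros)
  then show "(\<lambda>y. exp (of_real t * Complex c y) * H (Complex c y)) \<in> borel_measurable lborel"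
    by (simp add: borel_measurable_continuous_onI)
  show "AE y in lborel. norm (exp (of_real t * Complex c y) * H (Complex c y))
      \<le> norm (exp (c * t) * M * norm (Complex c y) powr (-1 - \<delta>))"
    using norm_line_integrand[OF H assms(3)]
    by (intro AE_I2) (simp add: decays_nonneg[OF H] order.trans[OF _ abs_ge_self])
qed

lemma inv_Laplace_line_bound:
  assumes H: "decays \<delta> M H" and \<delta>: "0 < \<delta>" and c: "0 < c"
  shows "norm (inv_Laplace_line c H t) \<le> exp (c * t) * M * c powr (- \<delta>) * line_weight \<delta>"
proof -
  have "norm (LINT y|lborel. exp (of_real t * Complex c y) * H (Complex c y))
      \<le> (LINT y|lborel. exp (c * t) * M * norm (Complex c y) powr (-1 - \<delta>))"
    by (rule Bochner_Integration.integral_norm_bound_integral[OF line_integrable[OF assms]])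
       (use line_weight_integrable[OF \<delta> c] norm_line_integrand[OF H c] in auto)
  also have "\<dots> = exp (c * t) * M * c powr (- \<delta>) * line_weight \<delta>"
    by (simp add: line_weight_integral[OF c])
  finally have *: "norm (LINT y|lborel. exp (of_real t * Complex c y) * H (Complex c y))
      \<le> exp (c * t) * M * c powr (- \<delta>) * line_weight \<delta>" .
  have "norm (inv_Laplace_line c H t)
      = norm (LINT y|lborel. exp (of_real t * Complex c y) * H (Complex c y)) / (2 * pi)"
    by (simp add: inv_Laplace_line_def norm_divide)
  also have "\<dots> \<le> norm (LINT y|lborel. exp (of_real t * Complex c y) * H (Complex c y)) / 1"
    using pi_ge_two by (intro divide_left_mono) auto
  finally show ?thesis using * by simp
qed

lemma symmetric_integral_limit:
  fixes f :: "real \<Rightarrow> 'b::{banach, second_countable_topology}"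
  assumes "integrable lborel f"
  shows "(\<lambda>n. LINT y:{- real n..real n}|lborel. f y) \<longlonglongrightarrow> (LINT y|lborel. f y)"
  unfolding set_lebesgue_integral_def
proof (rule integral_dominated_convergence[where w = "\<lambda>y. norm (f y)"])
  show "AE y in lborel. (\<lambda>n. indicat_real {- real n..real n} y *\<^sub>R f y) \<longlonglongrightarrow> f y"
  proof (rule AE_I2, rule tendsto_eventually)
    fix y :: real
    obtain N :: nat where "\<bar>y\<bar> \<le> real N" using real_arch_simple by blast
    then have "indicat_real {- real n..real n} y *\<^sub>R f y = f y" if "n \<ge> N" for n
      using that by (auto simp: indicator_def)
    then show "\<forall>\<^sub>F n in sequentially. indicat_real {- real n..real n} y *\<^sub>R f y = f y"
      by (auto simp: eventually_sequentially)
  qed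
qed (use assms in \<open>auto simp: indicator_def\<close>)

lemma symmetric_integral_FTC:
  fixes G g :: "real \<Rightarrow> 'b::euclidean_space"
  assumes "integrable lborel g" "\<And>y. (G has_vector_derivative g y) (at y)" "continuous_on UNIV g"
  shows "(\<lambda>n. G (real n) - G (- real n)) \<longlonglongrightarrow> (LINT y|lborel. g y)"
proof -
  have "(LINT y:{- real n..real n}|lborel. g y) = G (real n) - G (- real n)" for n
    unfolding set_lebesgue_integral_def
    by (rule integral_FTC_atLeastAtMost)
       (use assms in \<open>auto intro: has_vector_derivative_at_within continuous_on_subset\<close>)
  then show ?thesis using symmetric_integral_limit[OF assms(1)] by simp
qed

lemma Complex_line_vector_derivative:
  assumes "(P has_field_derivative D) (at (Complex c y))"
  shows "((\<lambda>y. P (Complex c y)) has_vector_derivative \<i> * D) (at y)"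
proof -
  have "((\<lambda>y. Complex c y) has_vector_derivative \<i>) (at y)"
    unfolding Complex_eq by (auto intro!: derivative_eq_intros simp: has_vector_derivative_def scaleR_conv_of_real mult.commute)
  from field_vector_diff_chain_at[OF this assms] show ?thesis by (simp add: o_def)
qed

text \<open>Cauchy's theorem for a tall rectangle.  Instead of contour integrals a primitive \<open>P\<close> on the half plane
  is used: the two vertical integrals over \<open>{-n..n}\<close> are differences of values of \<open>P\<close> at the
  corners, and the horizontal sides tend to 0 because the integrand does.\<close>

lemma inv_Laplace_line_independent_aux:
  assumes H: "decays \<delta> M H" and \<delta>: "0 < \<delta>" and c: "0 < c1" "c1 \<le> c2"
  shows "inv_Laplace_line c1 H t = inv_Laplace_line c2 H t"
proof -
  define F where "F p = exp (of_real t * p) * H p" for p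
  have cv: "convex {p. 0 < Re p}" by (rule convex_halfspace_Re_gt)
  have op: "open {p. 0 < Re p}" by (rule open_halfspace_Re_gt)
  have hol: "F holomorphic_on {p. 0 < Re p}"
    unfolding F_def using H by (auto simp: decays_def intro!: holomorphic_intros)
  obtain P where P': "\<And>p. p \<in> {p. 0 < Re p} \<Longrightarrow> (P has_field_derivative F p) (at p within {p. 0 < Re p})"
  proof (rule holomorphic_convex_primitive'[OF cv op hol])
    fix g assume "\<And>p. p \<in> {p. 0 < Re p} \<Longrightarrow> (g has_field_derivative F p) (at p within {p. 0 < Re p})"
    then show thesis by (rule that)
  qed
  have P: "(P has_field_derivative F p) (at p)" if "0 < Re p" for p
  proof -
    have "p \<in> {p. 0 < Re p}" using that by simp
    from P'[OF this] show ?thesis unfolding at_within_open[OF \<open>p \<in> {p. 0 < Re p}\<close> op] .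
  qed
  have Fint: "integrable lborel (\<lambda>y. F (Complex c y))" if "0 < c" for c
    unfolding F_def using line_integrable[OF H \<delta> that] .
  have lim: "(\<lambda>n. P (Complex c (real n)) - P (Complex c (- real n))) \<longlonglongrightarrow> \<i> * (LINT y|lborel. F (Complex c y))"
    if c: "0 < c" for c
  proof -
    have "(\<lambda>n. P (Complex c (real n)) - P (Complex c (- real n))) \<longlonglongrightarrow> (LINT y|lborel. \<i> * F (Complex c y))"
    proof (rule symmetric_integral_FTC)
      show "integrable lborel (\<lambda>y. \<i> * F (Complex c y))" using Fint[OF c] by simp
      show "((\<lambda>y. P (Complex c y)) has_vector_derivative \<i> * F (Complex c y)) (at y)" for y
        using c by (intro Complex_line_vector_derivative P) simp
      have "continuous_on UNIV (\<lambda>y. F (Complex c y))"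
        by (rule continuous_on_line[OF _ c])
           (use H in \<open>auto simp: F_def[abs_def] decays_def intro!: holomorphic_intros\<close>)
      then show "continuous_on UNIV (\<lambda>y. \<i> * F (Complex c y))" by (intro continuous_intros)
    qed
    then show ?thesis by simp
  qed
  define B where "B = (exp (c1 * t) + exp (c2 * t)) * M * (c2 - c1)"
  have M0: "0 \<le> M" using decays_nonneg[OF H] .
  have side: "norm (P (Complex c2 y) - P (Complex c1 y)) \<le> B * \<bar>y\<bar> powr (-1 - \<delta>)" if y: "y \<noteq> 0" for y
  proof -
    let ?S = "closed_segment (Complex c1 y) (Complex c2 y)"
    have S: "Im p = y \<and> c1 \<le> Re p \<and> Re p \<le> c2" if "p \<in> ?S" for p
      using that c by (auto simp: closed_segment_same_Im closed_segment_eq_real_ivl)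
    have "norm (P (Complex c2 y) - P (Complex c1 y))
        \<le> ((exp (c1 * t) + exp (c2 * t)) * M * \<bar>y\<bar> powr (-1 - \<delta>)) * norm (Complex c2 y - Complex c1 y)"
    proof (rule field_differentiable_bound[where S = ?S])
      show "(P has_field_derivative F p) (at p within ?S)" if "p \<in> ?S" for p
        using P[of p] S[OF that] c by (auto intro: has_field_derivative_at_within)
      show "norm (F p) \<le> (exp (c1 * t) + exp (c2 * t)) * M * \<bar>y\<bar> powr (-1 - \<delta>)" if "p \<in> ?S" for p
      proof -
        have p: "0 < Re p" "\<bar>y\<bar> \<le> norm p" using S[OF that] c abs_Im_le_cmod[of p] by auto
        have "exp (Re p * t) \<le> exp (c1 * t) + exp (c2 * t)"
        proof (cases "0 \<le> t")
          case True
          then have "Re p * t \<le> c2 * t" using S[OF that] by (intro mult_right_mono) auto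
          then have "exp (Re p * t) \<le> exp (c2 * t)" by simp
          then show ?thesis using exp_ge_zero[of "c1 * t"] by linarith
        next
          case False
          then have "Re p * t \<le> c1 * t" using S[OF that] by (intro mult_right_mono_neg) auto
          then have "exp (Re p * t) \<le> exp (c1 * t)" by simp
          then show ?thesis using exp_ge_zero[of "c2 * t"] by linarith
        qed
        moreover have "norm (H p) \<le> M * \<bar>y\<bar> powr (-1 - \<delta>)"
        proof -
          have "norm (H p) \<le> M * norm p powr (-1 - \<delta>)" using H p by (simp add: decays_def)
          also have "\<dots> \<le> M * \<bar>y\<bar> powr (-1 - \<delta>)"
            using p y \<delta> M0 by (intro mult_left_mono powr_mono2') auto
          finally show ?thesis .
        qed
        ultimately have "exp (Re p * t) * norm (H p) \<le> (exp (c1 * t) + exp (c2 * t)) * (M * \<bar>y\<bar> powr (-1 - \<delta>))"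
          by (intro mult_mono) auto
        then show ?thesis by (simp add: F_def norm_mult norm_exp_eq_Re mult.commute mult.left_commute)
      qed
    qed auto
    also have "norm (Complex c2 y - Complex c1 y) = c2 - c1"
      using c by (simp add: minus_complex_def cmod_def)
    finally show ?thesis by (simp add: B_def mult_ac)
  qed
  have y0: "(\<lambda>n. B * real n powr (-1 - \<delta>)) \<longlonglongrightarrow> 0"
  proof (rule tendsto_mult_right_zero)
    show "(\<lambda>n. real n powr (-1 - \<delta>)) \<longlonglongrightarrow> 0"
      using \<delta> by (intro tendsto_neg_powr filterlim_real_sequentially) auto
  qed
  have ev: "\<forall>\<^sub>F n in sequentially. n \<noteq> (0::nat)" by (auto simp: eventually_sequentially intro!: exI[of _ 1])
  have s1: "(\<lambda>n. P (Complex c2 (real n)) - P (Complex c1 (real n))) \<longlonglongrightarrow> 0"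
    by (rule Lim_null_comparison[OF _ y0], rule eventually_mono[OF ev])
       (use side[of "real _"] in auto)
  have s2: "(\<lambda>n. P (Complex c2 (- real n)) - P (Complex c1 (- real n))) \<longlonglongrightarrow> 0"
    by (rule Lim_null_comparison[OF _ y0], rule eventually_mono[OF ev])
       (use side[of "- real _"] in auto)
  have "0 < c2" using c by simp
  have eq: "(P (Complex c2 (real n)) - P (Complex c1 (real n))) - (P (Complex c2 (- real n)) - P (Complex c1 (- real n)))
     = (P (Complex c2 (real n)) - P (Complex c2 (- real n))) - (P (Complex c1 (real n)) - P (Complex c1 (- real n)))" for n
    by (simp only: diff_conv_add_uminus minus_add_distrib minus_minus add_ac)
  have D1: "(\<lambda>n. (P (Complex c2 (real n)) - P (Complex c2 (- real n))) - (P (Complex c1 (real n)) - P (Complex c1 (- real n)))) \<longlonglongrightarrow> 0"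
    using tendsto_diff[OF s1 s2] unfolding eq by simp
  have D2: "(\<lambda>n. (P (Complex c2 (real n)) - P (Complex c2 (- real n))) - (P (Complex c1 (real n)) - P (Complex c1 (- real n))))
      \<longlonglongrightarrow> \<i> * (LINT y|lborel. F (Complex c2 y)) - \<i> * (LINT y|lborel. F (Complex c1 y))"
    by (intro tendsto_diff lim c \<open>0 < c2\<close>)
  have "\<i> * (LINT y|lborel. F (Complex c2 y)) - \<i> * (LINT y|lborel. F (Complex c1 y)) = 0"
    by (rule LIMSEQ_unique[OF D2 D1])
  then show ?thesis by (simp add: inv_Laplace_line_def F_def)
qed

lemma inv_Laplace_line_independent:
  assumes "decays \<delta> M H" "0 < \<delta>" "0 < c1" "0 < c2"
  shows "inv_Laplace_line c1 H t = inv_Laplace_line c2 H t"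
proof (cases "c1 \<le> c2")
  case True
  show ?thesis by (rule inv_Laplace_line_independent_aux[OF assms(1,2,3) True])
next
  case False
  then have "c2 \<le> c1" by simp
  show ?thesis by (rule inv_Laplace_line_independent_aux[OF assms(1,2,4) \<open>c2 \<le> c1\<close>, symmetric])
qed

text \<open>The line may be moved to the right, where the integral tends to 0 if the exponential is bounded.\<close>

lemma inv_Laplace_nonpos:
  assumes H: "decays \<delta> M H" and \<delta>: "0 < \<delta>" and t: "t \<le> 0"
  shows "inv_Laplace H t = 0"
proof -
  have b: "norm (inv_Laplace H t) \<le> M * line_weight \<delta> * c powr (- \<delta>)" if c: "0 < c" for c
  proof -
    have "norm (inv_Laplace H t) \<le> exp (c * t) * (M * c powr (- \<delta>) * line_weight \<delta>)"
      using inv_Laplace_line_bound[OF H \<delta> c, of t] inv_Laplace_line_independent[OF H \<delta>, of 1 c t] c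
      by (simp add: mult.assoc)
    also have "\<dots> \<le> 1 * (M * c powr (- \<delta>) * line_weight \<delta>)"
      using t c decays_nonneg[OF H] line_weight_nonneg
      by (intro mult_right_mono) (auto simp: mult_nonneg_nonpos)
    finally show ?thesis by (simp add: mult_ac)
  qed
  have "((\<lambda>c. M * line_weight \<delta> * c powr (- \<delta>)) \<longlongrightarrow> 0) at_top"
    using \<delta> by (intro tendsto_mult_right_zero tendsto_neg_powr filterlim_ident) auto
  then have "norm (inv_Laplace H t) \<le> 0"
    by (rule tendsto_lowerbound) (auto intro!: b eventually_mono[OF eventually_gt_at_top[of 0]])
  then show ?thesis by simp
qed

text \<open>The line of real part \<open>1 / t\<close> is the right one for time \<open>t\<close>: the exponential is bounded on it, and
  decay in \<open>p\<close> becomes a power of \<open>t\<close>.\<close>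

lemma inv_Laplace_bound:
  assumes H: "decays \<delta> M H" and \<delta>: "0 < \<delta>" and t: "0 < t"
  shows "norm (inv_Laplace H t) \<le> exp 1 * line_weight \<delta> * M * t powr \<delta>"
proof -
  have "norm (inv_Laplace H t) \<le> exp (1 / t * t) * M * (1 / t) powr (- \<delta>) * line_weight \<delta>"
    using inv_Laplace_line_bound[OF H \<delta>, of "1 / t" t]
      inv_Laplace_line_independent[OF H \<delta>, of 1 "1 / t" t] t by simp
  also have "(1 / t) powr (- \<delta>) = t powr \<delta>" using t by (simp add: powr_minus powr_divide)
  finally show ?thesis using t by (simp add: mult_ac)
qed

lemma inv_Laplace_continuous:
  assumes H: "decays \<delta> M H" and \<delta>: "0 < \<delta>"
  shows "continuous_on UNIV (inv_Laplace H)"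
proof (rule continuous_at_imp_continuous_on, rule ballI, rule continuous_at_sequentiallyI)
  fix t :: real and u :: "nat \<Rightarrow> real" assume u: "u \<longlonglongrightarrow> t"
  then have "Bseq u" by (intro convergent_imp_Bseq convergentI)
  then obtain A where A: "\<And>n. norm (u n) \<le> A" unfolding Bseq_def by blast
  have "(\<lambda>n. LINT y|lborel. exp (of_real (u n) * Complex 1 y) * H (Complex 1 y))
      \<longlonglongrightarrow> (LINT y|lborel. exp (of_real t * Complex 1 y) * H (Complex 1 y))"
  proof (rule integral_dominated_convergence[where w = "\<lambda>y. exp A * M * norm (Complex 1 y) powr (-1 - \<delta>)"])
    show "integrable lborel (\<lambda>y. exp A * M * norm (Complex 1 y) powr (-1 - \<delta>))"
      using line_weight_integrable[OF \<delta>, of 1] by simp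
    show "AE y in lborel. (\<lambda>n. exp (of_real (u n) * Complex 1 y) * H (Complex 1 y))
        \<longlonglongrightarrow> exp (of_real t * Complex 1 y) * H (Complex 1 y)"
      by (intro AE_I2 tendsto_intros u)
    show "AE y in lborel. norm (exp (of_real (u n) * Complex 1 y) * H (Complex 1 y))
        \<le> exp A * M * norm (Complex 1 y) powr (-1 - \<delta>)" for n
    proof (rule AE_I2)
      fix y
      have "norm (exp (of_real (u n) * Complex 1 y) * H (Complex 1 y))
          \<le> exp (1 * u n) * (M * norm (Complex 1 y) powr (-1 - \<delta>))"
        using norm_line_integrand[OF H, of 1 "u n" y] by (simp add: mult.assoc)
      also have "\<dots> \<le> exp A * (M * norm (Complex 1 y) powr (-1 - \<delta>))"
        using A[of n] decays_nonneg[OF H] by (intro mult_right_mono) auto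
      finally show "norm (exp (of_real (u n) * Complex 1 y) * H (Complex 1 y))
          \<le> exp A * M * norm (Complex 1 y) powr (-1 - \<delta>)" by (simp add: mult.assoc)
    qed
  qed (use line_integrable[OF H \<delta>, of 1] in \<open>auto dest: borel_measurable_integrable\<close>)
  then show "(\<lambda>n. inv_Laplace H (u n)) \<longlonglongrightarrow> inv_Laplace H t"
    unfolding inv_Laplace_line_def by (intro tendsto_divide tendsto_const) auto
qed

text \<open>Integration by parts along the line.  It exchanges a derivative in \<open>p\<close> for a factor \<open>t\<close>, and so yields
  bounds in terms of constants with which the symbol itself decays too slowly.\<close>

lemma inv_Laplace_mult_time:
  assumes H: "decays \<delta> M H" and H': "decays \<delta>' M' H'" and \<delta>: "0 < \<delta>" "0 < \<delta>'"
    and deriv: "\<And>p. 0 < Re p \<Longrightarrow> (H has_field_derivative H' p) (at p)"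
  shows "of_real t * inv_Laplace H t = - inv_Laplace H' t"
proof -
  define F where "F p = exp (of_real t * p) * H p" for p
  define F' where "F' p = of_real t * (exp (of_real t * p) * H p) + exp (of_real t * p) * H' p" for p
  have FF: "(F has_field_derivative F' p) (at p)" if "0 < Re p" for p
    unfolding F_def F'_def by (auto intro!: derivative_eq_intros deriv that)
  have int: "integrable lborel (\<lambda>y. \<i> * F' (Complex 1 y))"
    unfolding F'_def using line_integrable[OF H \<delta>(1), of 1 t] line_integrable[OF H' \<delta>(2), of 1 t] by simp
  have lim: "(\<lambda>n. F (Complex 1 (real n)) - F (Complex 1 (- real n))) \<longlonglongrightarrow> (LINT y|lborel. \<i> * F' (Complex 1 y))"
  proof (rule symmetric_integral_FTC[OF int])
    show "((\<lambda>y. F (Complex 1 y)) has_vector_derivative \<i> * F' (Complex 1 y)) (at y)" for y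
      by (intro Complex_line_vector_derivative FF) simp
    have "continuous_on UNIV (\<lambda>y. F' (Complex 1 y))"
      by (rule continuous_on_line)
         (use H H' in \<open>auto simp: F'_def[abs_def] decays_def intro!: holomorphic_intros\<close>)
    then show "continuous_on UNIV (\<lambda>y. \<i> * F' (Complex 1 y))" by (intro continuous_intros)
  qed
  have y0: "(\<lambda>n. exp t * M * real n powr (-1 - \<delta>)) \<longlonglongrightarrow> 0"
  proof (rule tendsto_mult_right_zero)
    show "(\<lambda>n. real n powr (-1 - \<delta>)) \<longlonglongrightarrow> 0"
      using \<delta> by (intro tendsto_neg_powr filterlim_real_sequentially) auto
  qed
  have side: "norm (F (Complex 1 y)) \<le> exp t * M * \<bar>y\<bar> powr (-1 - \<delta>)" if "y \<noteq> 0" for y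
  proof -
    have "norm (F (Complex 1 y)) \<le> exp t * M * norm (Complex 1 y) powr (-1 - \<delta>)"
      using norm_line_integrand[OF H, of 1 t y] by (simp add: F_def)
    also have "\<dots> \<le> exp t * M * \<bar>y\<bar> powr (-1 - \<delta>)"
      using that \<delta> decays_nonneg[OF H] norm_Complex_ge(2)[of y 1]
      by (intro mult_left_mono powr_mono2') auto
    finally show ?thesis .
  qed
  have ev: "\<forall>\<^sub>F n in sequentially. n \<noteq> (0::nat)" by (auto simp: eventually_sequentially intro!: exI[of _ 1])
  have s1: "(\<lambda>n. F (Complex 1 (real n))) \<longlonglongrightarrow> 0"
    by (rule Lim_null_comparison[OF _ y0], rule eventually_mono[OF ev])
       (use side[of "real _"] in auto)
  have s2: "(\<lambda>n. F (Complex 1 (- real n))) \<longlonglongrightarrow> 0"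
    by (rule Lim_null_comparison[OF _ y0], rule eventually_mono[OF ev])
       (use side[of "- real _"] in auto)
  have "(LINT y|lborel. \<i> * F' (Complex 1 y)) = 0 - 0"
    by (rule LIMSEQ_unique[OF lim tendsto_diff[OF s1 s2]])
  then have "(LINT y|lborel. F' (Complex 1 y)) = 0" by simp
  also have "(LINT y|lborel. F' (Complex 1 y)) =
      of_real t * (LINT y|lborel. exp (of_real t * Complex 1 y) * H (Complex 1 y))
      + (LINT y|lborel. exp (of_real t * Complex 1 y) * H' (Complex 1 y))"
    unfolding F'_def using line_integrable[OF H \<delta>(1), of 1 t] line_integrable[OF H' \<delta>(2), of 1 t] by simp
  finally have "of_real t * (LINT y|lborel. exp (of_real t * Complex 1 y) * H (Complex 1 y))
      = - (LINT y|lborel. exp (of_real t * Complex 1 y) * H' (Complex 1 y))"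
    by (simp only: eq_neg_iff_add_eq_0)
  then show ?thesis unfolding inv_Laplace_line_def by simp
qed

section \<open>Fractional integration of inverse Laplace transforms\<close>

lemma real_Gamma_integral_scaled:
  fixes a b :: real
  assumes a: "0 < a" and b: "0 < b"
  shows "integrable lborel (\<lambda>r. indicator {0<..} r * (r powr (a - 1) * exp (- (b * r))))"
    and "(LINT r|lborel. indicator {0<..} r * (r powr (a - 1) * exp (- (b * r)))) = Gamma a / b powr a"
proof -
  define G where "G r = indicator {0<..} r * (r powr (a - 1) * exp (- r))" for r :: real
  have G_eq: "indicator {0..} r *\<^sub>R (r powr (a - 1) / exp r) = G r" for r :: real
    by (auto simp: G_def indicator_def exp_minus field_simps)
  note I = has_integral_nonneg_lborel[OF _ _ _ Gamma_integral_real[OF a]]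
  have s: "set_integrable lborel {0..} (\<lambda>t::real. t powr (a - 1) / exp t)" by (rule I) auto
  have v: "(LINT t:{0..}|lborel. t powr (a - 1) / exp t) = Gamma a" by (rule I) auto
  have Gi: "integrable lborel G" using s unfolding set_integrable_def G_eq .
  have Gv: "(LINT r|lborel. G r) = Gamma a" using v unfolding set_lebesgue_integral_def G_eq .
  have scale: "G (0 + b * r) = b powr (a - 1) * (indicator {0<..} r * (r powr (a - 1) * exp (- (b * r))))" for r
    using b by (auto simp: G_def indicator_def powr_mult zero_less_mult_iff)
  have "integrable lborel (\<lambda>r. G (0 + b * r))"
    by (rule lborel_integrable_real_affine[OF Gi]) (use b in simp)
  then show "integrable lborel (\<lambda>r. indicator {0<..} r * (r powr (a - 1) * exp (- (b * r))))"
    unfolding scale using b by (simp del: mult_minus_left)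
  have "Gamma a = b * (LINT r|lborel. G (0 + b * r))"
    using lborel_integral_real_affine[of b G 0] b by (simp add: Gv)
  also have "\<dots> = b powr a * (LINT r|lborel. indicator {0<..} r * (r powr (a - 1) * exp (- (b * r))))"
  proof -
    have "b * b powr (a - 1) = b powr a" using b by (simp add: powr_diff)
    then show ?thesis unfolding scale
      by (subst integral_mult_right_zero) (simp add: mult.assoc[symmetric])
  qed
  finally show "(LINT r|lborel. indicator {0<..} r * (r powr (a - 1) * exp (- (b * r)))) = Gamma a / b powr a"
    using b by simp
qed

text \<open>The Laplace transform of \<open>omega \<gamma>\<close>.  For real \<open>p\<close> it is Euler's integral.  For complex \<open>p\<close> one expands
  \<open>exp (r * (p0 - p))\<close> around a real \<open>p0\<close> and integrates term by term, which gives the binomial series of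
  \<open>p powr (- \<gamma>)\<close>; analytic continuation is avoided.\<close>

lemma complex_Gamma_integral_scaled:
  fixes \<gamma> :: real and p :: complex
  assumes \<gamma>: "0 < \<gamma>" and p: "0 < Re p"
  shows "integrable lborel (\<lambda>r. of_real (indicator {0<..} r * omega \<gamma> r) * exp (- (of_real r * p)))" (is ?I)
    and "(LINT r|lborel. of_real (indicator {0<..} r * omega \<gamma> r) * exp (- (of_real r * p))) = p powr (- of_real \<gamma>)" (is ?V)
proof -
  \<comment> \<open>Expand around a real point \<open>p0\<close> so large that \<open>p\<close> lies in the disc of convergence.\<close>
  define p0 where "p0 = (norm p)\<^sup>2 / Re p"
  have np: "0 < (norm p)\<^sup>2" using p by auto
  have p0: "0 < p0" using p np by (simp add: p0_def)
  define w where "w = (of_real p0 - p) / of_real p0"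
  have wless: "norm w < 1"
  proof -
    have "(norm (of_real p0 - p))\<^sup>2 = p0\<^sup>2 - 2 * p0 * Re p + (norm p)\<^sup>2"
      unfolding cmod_power2 by (simp add: power2_eq_square algebra_simps)
    also have "2 * p0 * Re p = 2 * (norm p)\<^sup>2" using p by (simp add: p0_def)
    finally have "(norm (of_real p0 - p))\<^sup>2 < p0\<^sup>2" using np by linarith
    then have "norm (of_real p0 - p) < p0" using p0 by (simp add: power2_less_imp_less)
    then show ?thesis using p0 by (simp add: w_def norm_divide)
  qed
  have \<Gamma>: "0 < Gamma \<gamma>" using \<gamma> by simp
  define h where "h n r = indicator {0<..} r * (r powr (\<gamma> + real n - 1) * exp (- (p0 * r)))" for n :: nat and r :: real
  define c where "c n = (of_real p0 - p) ^ n / (fact n * of_real (Gamma \<gamma>))" for n :: nat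
  define f where "f n r = of_real (h n r) * c n" for n r
  have h0: "0 \<le> h n r" for n r by (simp add: h_def)
  have hi: "integrable lborel (h n)" for n
    unfolding h_def using real_Gamma_integral_scaled(1)[of "\<gamma> + real n" p0] \<gamma> p0 by simp
  have hv: "(LINT r|lborel. h n r) = Gamma (\<gamma> + real n) / p0 powr (\<gamma> + real n)" for n
    unfolding h_def using real_Gamma_integral_scaled(2)[of "\<gamma> + real n" p0] \<gamma> p0 by simp
  have fi: "integrable lborel (f n)" for n unfolding f_def using hi by simp
  have hf: "h n r = h 0 r * r ^ n" for n r
    using powr_add[of r "\<gamma> - 1" "real n"]
    by (auto simp: h_def indicator_def powr_realpow algebra_simps)
  have coeff: "Gamma (\<gamma> + real n) / p0 powr (\<gamma> + real n) / Gamma \<gamma>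
      = p0 powr (- \<gamma>) * pochhammer \<gamma> n / p0 ^ n" for n
  proof -
    have "\<gamma> \<notin> \<int>\<^sub>\<le>\<^sub>0" using \<gamma> by auto
    then show ?thesis
      using p0 by (simp add: pochhammer_Gamma powr_add powr_realpow powr_minus field_simps)
  qed
  have binom: "((- a) gchoose n) * (- z) ^ n = pochhammer a n / fact n * z ^ n"
    for a z :: "'a::field_char_0" and n
    by (cases "even n") (simp_all add: gbinomial_pochhammer)
  have fv: "(LINT r|lborel. f n r) = of_real (p0 powr (- \<gamma>)) * (((- of_real \<gamma>) gchoose n) * (- w) ^ n)" for n
  proof -
    have "(LINT r|lborel. f n r) = of_real (Gamma (\<gamma> + real n) / p0 powr (\<gamma> + real n)) * c n"
      unfolding f_def using hi by (simp add: hv)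
    also have "\<dots> = of_real (Gamma (\<gamma> + real n) / p0 powr (\<gamma> + real n) / Gamma \<gamma>) * ((of_real p0 - p) ^ n / fact n)"
      by (simp add: c_def)
    also have "\<dots> = of_real (p0 powr (- \<gamma>)) * (pochhammer (of_real \<gamma>) n / fact n * w ^ n)"
      unfolding coeff by (simp add: w_def power_divide pochhammer_of_real mult_ac)
    finally show ?thesis by (simp only: binom)
  qed
  have nfv: "(LINT r|lborel. norm (f n r)) = p0 powr (- \<gamma>) * (((- \<gamma>) gchoose n) * (- norm w) ^ n)" for n
  proof -
    have "(LINT r|lborel. norm (f n r)) = Gamma (\<gamma> + real n) / p0 powr (\<gamma> + real n) * norm (c n)"
      unfolding f_def using hi h0 by (simp add: hv norm_mult)
    also have "\<dots> = Gamma (\<gamma> + real n) / p0 powr (\<gamma> + real n) / Gamma \<gamma> * (norm (of_real p0 - p) ^ n / fact n)"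
      using \<Gamma> by (simp add: c_def norm_divide norm_mult norm_power)
    also have "\<dots> = p0 powr (- \<gamma>) * (pochhammer \<gamma> n / fact n * norm w ^ n)"
      unfolding coeff using p0 by (simp add: w_def power_divide norm_divide mult_ac)
    finally show ?thesis by (simp only: binom)
  qed
  have sum_real: "(\<lambda>n. ((- \<gamma>) gchoose n) * (- norm w) ^ n) sums (1 + (- norm w)) powr (- \<gamma>)"
    using wless by (intro gen_binomial_real) simp
  have sum_cplx: "(\<lambda>n. ((- of_real \<gamma>) gchoose n) * (- w) ^ n) sums (1 + (- w)) powr (- of_real \<gamma>)"
    using wless by (intro gen_binomial_complex) simp
  have pt: "(\<lambda>n. f n r) sums (of_real (indicator {0<..} r * omega \<gamma> r) * exp (- (of_real r * p)))" for r
  proof -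
    have "(\<lambda>n. of_real (h 0 r / Gamma \<gamma>) * ((of_real r * (of_real p0 - p)) ^ n /\<^sub>R fact n))
        sums (of_real (h 0 r / Gamma \<gamma>) * exp (of_real r * (of_real p0 - p)))"
      by (intro sums_mult exp_converges)
    also have "(\<lambda>n. of_real (h 0 r / Gamma \<gamma>) * ((of_real r * (of_real p0 - p)) ^ n /\<^sub>R fact n)) = (\<lambda>n. f n r)"
    proof (rule ext)
      fix n
      show "of_real (h 0 r / Gamma \<gamma>) * ((of_real r * (of_real p0 - p)) ^ n /\<^sub>R fact n) = f n r"
        unfolding f_def hf[of n r] c_def power_mult_distrib by (simp add: scaleR_conv_of_real field_simps)
    qed
    also have "of_real (h 0 r / Gamma \<gamma>) * exp (of_real r * (of_real p0 - p))
        = of_real (indicator {0<..} r * omega \<gamma> r) * exp (- (of_real r * p))"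
    proof -
      have "of_real (exp (- (p0 * r))) * exp (of_real r * (of_real p0 - p)) = exp (- (of_real r * p))"
        by (simp add: exp_of_real[symmetric] exp_add[symmetric] algebra_simps)
      then have "of_real (indicator {0<..} r * omega \<gamma> r) * (of_real (exp (- (p0 * r))) * exp (of_real r * (of_real p0 - p)))
          = of_real (indicator {0<..} r * omega \<gamma> r) * exp (- (of_real r * p))" by simp
      then show ?thesis by (simp add: h_def omega_def mult_ac)
    qed
    finally show ?thesis .
  qed
  have ptn: "summable (\<lambda>n. norm (f n r))" for r
  proof -
    have "summable (\<lambda>n. (h 0 r / Gamma \<gamma>) * ((\<bar>r\<bar> * norm (of_real p0 - p)) ^ n /\<^sub>R fact n))"
      by (intro summable_mult summable_exp_generic)
    also have "(\<lambda>n. (h 0 r / Gamma \<gamma>) * ((\<bar>r\<bar> * norm (of_real p0 - p)) ^ n /\<^sub>R fact n)) = (\<lambda>n. norm (f n r))"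
    proof (rule ext)
      fix n
      have "norm (f n r) = h 0 r * \<bar>r\<bar> ^ n * (norm (of_real p0 - p) ^ n / (fact n * Gamma \<gamma>))"
        unfolding f_def hf[of n r] c_def
        using \<Gamma> h0[of 0 r] by (simp add: norm_mult norm_divide norm_power power_abs abs_mult)
      then show "h 0 r / Gamma \<gamma> * ((\<bar>r\<bar> * norm (of_real p0 - p)) ^ n /\<^sub>R fact n) = norm (f n r)"
        unfolding power_mult_distrib by (simp add: field_simps)
    qed
    finally show ?thesis .
  qed
  have S: "summable (\<lambda>n. LINT r|lborel. norm (f n r))"
    unfolding nfv using sum_real by (intro summable_mult) (rule sums_summable)
  have suminf_eq: "(\<Sum>n. f n r) = of_real (indicator {0<..} r * omega \<gamma> r) * exp (- (of_real r * p))" for r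
    using pt[of r] by (rule sums_unique[symmetric])
  have "integrable lborel (\<lambda>r. \<Sum>n. f n r)"
    by (rule integrable_suminf[OF fi _ S]) (use ptn in auto)
  then show ?I unfolding suminf_eq .
  have "(LINT r|lborel. (\<Sum>n. f n r)) = (\<Sum>n. LINT r|lborel. f n r)"
    by (rule integral_suminf[OF fi _ S]) (use ptn in auto)
  also have "\<dots> = of_real (p0 powr (- \<gamma>)) * (1 + (- w)) powr (- of_real \<gamma>)"
    unfolding fv using sums_mult[OF sum_cplx] by (intro sums_unique[symmetric])
  also have "1 + (- w) = of_real (1 / p0) * p" using p0 by (simp add: w_def field_simps)
  also have "of_real (p0 powr (- \<gamma>)) * (of_real (1 / p0) * p) powr (- of_real \<gamma>) = p powr (- of_real \<gamma>)"
  proof -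
    have pz: "p \<noteq> 0" using p by auto
    have "Ln (of_real (1 / p0) * p) = of_real (ln (1 / p0)) + Ln p"
      using Ln_times_of_real[of "1 / p0" p] Ln_of_real[of "1 / p0"] p0 pz by simp
    also have "ln (1 / p0) = - ln p0" using p0 by (simp add: ln_div)
    finally have Ln: "Ln (of_real (1 / p0) * p) = Ln p - of_real (ln p0)" by simp
    have "complex_of_real (p0 powr (- \<gamma>)) = exp (- of_real \<gamma> * of_real (ln p0))"
      using p0 by (simp add: powr_def exp_of_real[symmetric])
    moreover have "(of_real (1 / p0) * p) powr (- of_real \<gamma>) = exp (- of_real \<gamma> * (Ln p - of_real (ln p0)))"
      unfolding powr_def Ln using pz p0 by simp
    moreover have "p powr (- of_real \<gamma>) = exp (- of_real \<gamma> * Ln p)" using pz by (simp add: powr_def)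
    ultimately show ?thesis by (simp only: exp_add[symmetric]) (simp add: algebra_simps)
  qed
  finally show ?V unfolding suminf_eq .
qed

lemma line_measurable:
  assumes "decays \<delta> M H"
  shows "(\<lambda>y. H (Complex 1 y)) \<in> borel_measurable borel"
  using assms by (intro borel_measurable_continuous_onI continuous_on_line) (auto simp: decays_def)

lemma line_integrable_0:
  assumes "decays \<delta> M H" "0 < \<delta>"
  shows "integrable lborel (\<lambda>y. H (Complex 1 y))"
  using line_integrable[OF assms, of 1 0] by simp

text \<open>The sign \<open>b\<close> selects convolution with \<open>w\<close> (\<open>b = -1\<close>) or the forward transform of \<open>inv_Laplace H\<close>
  (\<open>b = 1\<close> and \<open>t = 0\<close>); the exchange of the integrals is the same for both.\<close>

lemma inv_Laplace_Fubini:
  fixes w :: "real \<Rightarrow> real"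
  assumes H: "decays \<delta> M H" and \<delta>: "0 < \<delta>" and w [measurable]: "w \<in> borel_measurable borel"
    and w0: "\<And>r. 0 \<le> w r" and int: "integrable lborel (\<lambda>r. w r * exp (b * r))" and b: "b = 1 \<or> b = -1"
  shows "integrable lborel (\<lambda>r. of_real (w r) * inv_Laplace H (t + b * r))"
    and "(LINT r|lborel. of_real (w r) * inv_Laplace H (t + b * r)) =
      (LINT y|lborel. exp (of_real t * Complex 1 y) * H (Complex 1 y)
         * (LINT r|lborel. of_real (w r) * exp (of_real (b * r) * Complex 1 y))) / of_real (2 * pi)"
proof -
  note [measurable] = line_measurable[OF H]
  define f where "f r y = of_real (w r) * (exp (of_real (t + b * r) * Complex 1 y) * H (Complex 1 y))" for r y
  define N where "N = (LINT y|lborel. norm (H (Complex 1 y)))"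
  have Complex_m [measurable]: "Complex 1 \<in> borel_measurable borel"
    unfolding Complex_eq by (intro borel_measurable_continuous_onI continuous_intros)
  have fm: "case_prod f \<in> borel_measurable (lborel \<Otimes>\<^sub>M lborel)"
    unfolding f_def by measurable
  have nf: "norm (f r y) = w r * exp (b * r) * (exp t * norm (H (Complex 1 y)))" for r y
    using w0[of r] by (simp add: f_def norm_mult exp_add)
  have fi: "integrable (lborel \<Otimes>\<^sub>M lborel) (case_prod f)"
  proof (rule lborel_pair.Fubini_integrable[OF fm])
    have "integrable lborel (\<lambda>r. w r * exp (b * r) * (exp t * N))" using int by simp
    then show "integrable lborel (\<lambda>r. LINT y|lborel. norm (case_prod f (r, y)))"
      using line_integrable_0[OF H \<delta>] by (simp add: nf N_def)
    show "AE r in lborel. integrable lborel (\<lambda>y. case_prod f (r, y))"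
      using line_integrable[OF H \<delta>, of 1 "t + b * _"] by (intro AE_I2) (simp add: f_def)
  qed
  have inner: "(LINT y|lborel. f r y) = of_real (2 * pi) * (of_real (w r) * inv_Laplace H (t + b * r))" for r
    unfolding f_def inv_Laplace_line_def using line_integrable[OF H \<delta>, of 1 "t + b * r"] by simp
  have "integrable lborel (\<lambda>r. LINT y|lborel. f r y)" by (rule lborel_pair.integrable_fst[OF fi])
  from integrable_mult_right[OF this, of "1 / of_real (2 * pi)"]
  show "integrable lborel (\<lambda>r. of_real (w r) * inv_Laplace H (t + b * r))" unfolding inner by simp
  have inner2: "(LINT r|lborel. f r y) = exp (of_real t * Complex 1 y) * H (Complex 1 y)
         * (LINT r|lborel. of_real (w r) * exp (of_real (b * r) * Complex 1 y))" for y
  proof -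
    have "f r y = exp (of_real t * Complex 1 y) * H (Complex 1 y) * (of_real (w r) * exp (of_real (b * r) * Complex 1 y))" for r
      by (simp add: f_def distrib_right exp_add)
    then show ?thesis by simp
  qed
  have "(LINT y|lborel. LINT r|lborel. f r y) = (LINT r|lborel. LINT y|lborel. f r y)"
    by (rule lborel_pair.Fubini_integral[OF fi])
  then have "(LINT y|lborel. exp (of_real t * Complex 1 y) * H (Complex 1 y)
         * (LINT r|lborel. of_real (w r) * exp (of_real (b * r) * Complex 1 y)))
      = of_real (2 * pi) * (LINT r|lborel. of_real (w r) * inv_Laplace H (t + b * r))"
    unfolding inner inner2 by simp
  then show "(LINT r|lborel. of_real (w r) * inv_Laplace H (t + b * r)) =
      (LINT y|lborel. exp (of_real t * Complex 1 y) * H (Complex 1 y)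
         * (LINT r|lborel. of_real (w r) * exp (of_real (b * r) * Complex 1 y))) / of_real (2 * pi)"
    by simp
qed

text \<open>Fractional integration of order \<open>\<gamma>\<close> is multiplication of the symbol by \<open>p powr (- \<gamma>)\<close>.\<close>

lemma inv_Laplace_convolution:
  fixes \<gamma> t :: real
  assumes H: "decays \<delta> M H" and \<delta>: "0 < \<delta>" and \<gamma>: "0 < \<gamma>"
  shows "set_integrable lborel {0<..<t} (\<lambda>r. of_real (omega \<gamma> (t - r)) * inv_Laplace H r)"
    and "(LINT r:{0<..<t}|lborel. of_real (omega \<gamma> (t - r)) * inv_Laplace H r)
      = inv_Laplace (\<lambda>p. p powr (- of_real \<gamma>) * H p) t"
proof -
  define w where "w r = indicator {0<..} r * omega \<gamma> r" for r :: real
  have wint: "integrable lborel (\<lambda>r. w r * exp (- 1 * r))"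
  proof -
    have "integrable lborel (\<lambda>r. indicator {0<..} r * (r powr (\<gamma> - 1) * exp (- (1 * r))) / Gamma \<gamma>)"
      using real_Gamma_integral_scaled(1)[OF \<gamma>, of 1] by simp
    then show ?thesis by (simp add: w_def omega_def mult.assoc)
  qed
  have w0: "0 \<le> w r" for r using omega_nonneg[OF \<gamma>] by (simp add: w_def)
  have wm: "w \<in> borel_measurable borel" unfolding w_def by measurable
  note F = inv_Laplace_Fubini[OF H \<delta> wm w0 wint, of t]
  define g where "g r = of_real (w r) * inv_Laplace H (t + - 1 * r)" for r
  have gi: "integrable lborel g" unfolding g_def using F(1) by simp
  have flip: "g (t + - 1 * r) = indicator {0<..<t} r *\<^sub>R (of_real (omega \<gamma> (t - r)) * inv_Laplace H r)" for r
    using inv_Laplace_nonpos[OF H \<delta>, of r] by (auto simp: g_def w_def indicator_def)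
  have "integrable lborel (\<lambda>r. g (t + - 1 * r))"
    by (rule lborel_integrable_real_affine[OF gi]) simp
  then show "set_integrable lborel {0<..<t} (\<lambda>r. of_real (omega \<gamma> (t - r)) * inv_Laplace H r)"
    unfolding flip set_integrable_def .
  have inner: "(LINT r|lborel. of_real (w r) * exp (of_real (- 1 * r) * Complex 1 y)) = Complex 1 y powr (- of_real \<gamma>)" for y
    using complex_Gamma_integral_scaled(2)[OF \<gamma>, of "Complex 1 y"] by (simp add: w_def)
  have "(LINT r:{0<..<t}|lborel. of_real (omega \<gamma> (t - r)) * inv_Laplace H r) = (LINT r|lborel. g (t + - 1 * r))"
    unfolding flip set_lebesgue_integral_def ..
  also have "\<dots> = (LINT r|lborel. g r)" using lborel_integral_real_affine[of "-1" g t] by simp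
  also have "\<dots> = inv_Laplace (\<lambda>p. p powr (- of_real \<gamma>) * H p) t"
    unfolding g_def using F(2) unfolding inner inv_Laplace_line_def by (simp add: mult_ac)
  finally show "(LINT r:{0<..<t}|lborel. of_real (omega \<gamma> (t - r)) * inv_Laplace H r)
      = inv_Laplace (\<lambda>p. p powr (- of_real \<gamma>) * H p) t" .
qed

lemma decays_inverse_square: "decays 1 1 (\<lambda>p. 1 / p\<^sup>2)"
  unfolding decays_def
proof (intro conjI allI impI)
  show "(\<lambda>p. 1 / p\<^sup>2) holomorphic_on {p::complex. 0 < Re p}"
    by (intro holomorphic_intros) auto
  fix p :: complex assume "0 < Re p"
  then have "p \<noteq> 0" by auto
  then show "norm (1 / p\<^sup>2) \<le> 1 * norm p powr (- 1 - 1)"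
    by (simp add: norm_divide norm_power powr_minus powr_numeral field_simps)
qed

lemma integral_inverse_square_sum: "(LINT y|lborel. 1 / (1 + y\<^sup>2)\<^sup>2) = pi / 2"
proof -
  have n4: "norm (Complex 1 y) powr (-1 - 3) = 1 / (1 + y\<^sup>2)\<^sup>2" for y
  proof -
    have "norm (Complex 1 y) powr (-1 - 3) = inverse (norm (Complex 1 y) ^ 4)"
      by (simp add: powr_minus powr_numeral)
    also have "norm (Complex 1 y) ^ 4 = ((norm (Complex 1 y))\<^sup>2)\<^sup>2" by simp
    also have "(norm (Complex 1 y))\<^sup>2 = 1 + y\<^sup>2" by (simp add: cmod_power2)
    finally show ?thesis by (simp add: inverse_eq_divide)
  qed
  have "integrable lborel (\<lambda>y::real. 1 / (1 + y\<^sup>2)\<^sup>2)"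
    using line_weight_integrable_1[of 3] unfolding n4 by simp
  then have *: "(\<lambda>n. (real n / (1 + (real n)\<^sup>2) + arctan (real n)) / 2 - (- real n / (1 + (- real n)\<^sup>2) + arctan (- real n)) / 2)
      \<longlonglongrightarrow> (LINT y|lborel. 1 / (1 + y\<^sup>2)\<^sup>2)"
  proof (rule symmetric_integral_FTC)
    fix y :: real
    have pos: "1 + y\<^sup>2 \<noteq> 0" by (smt (verit) zero_le_power2)
    have "((\<lambda>y. (y / (1 + y\<^sup>2) + arctan y) / 2) has_real_derivative
        ((1 * (1 + y\<^sup>2) - y * (2 * y)) / ((1 + y\<^sup>2) * (1 + y\<^sup>2)) + inverse (1 + y\<^sup>2)) / 2) (at y)"
      by (auto intro!: derivative_eq_intros simp: pos)
    also have "((1 * (1 + y\<^sup>2) - y * (2 * y)) / ((1 + y\<^sup>2) * (1 + y\<^sup>2)) + inverse (1 + y\<^sup>2)) / 2 = 1 / (1 + y\<^sup>2)\<^sup>2"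
      using pos by (simp add: divide_simps power2_eq_square)
    finally show "((\<lambda>y. (y / (1 + y\<^sup>2) + arctan y) / 2) has_vector_derivative 1 / (1 + y\<^sup>2)\<^sup>2) (at y)"
      by (simp add: has_real_derivative_iff_has_vector_derivative)
  next
    have "1 + y\<^sup>2 \<noteq> 0" for y :: real by (smt (verit) zero_le_power2)
    then show "continuous_on UNIV (\<lambda>y::real. 1 / (1 + y\<^sup>2)\<^sup>2)" by (intro continuous_intros) auto
  qed
  have "(\<lambda>n. real n / (1 + (real n)\<^sup>2) + arctan (real n)) \<longlonglongrightarrow> 0 + pi / 2"
  proof (rule tendsto_add)
    show "(\<lambda>n. real n / (1 + (real n)\<^sup>2)) \<longlonglongrightarrow> 0"
    proof (rule Lim_null_comparison[OF _ lim_inverse_n'], rule always_eventually, rule allI)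
      fix n :: nat
      have "1 + (real n)\<^sup>2 > 0" by (smt (verit) zero_le_power2)
      then have "real n / (1 + (real n)\<^sup>2) \<le> 1 / real n"
        by (cases "n = 0") (simp_all add: divide_simps power2_eq_square)
      then show "norm (real n / (1 + (real n)\<^sup>2)) \<le> 1 / real n" using \<open>1 + (real n)\<^sup>2 > 0\<close> by simp
    qed
    show "(\<lambda>n. arctan (real n)) \<longlonglongrightarrow> pi / 2"
      by (rule filterlim_compose[OF tendsto_arctan_at_top filterlim_real_sequentially])
  qed
  then have L: "(\<lambda>n. real n / (1 + (real n)\<^sup>2) + arctan (real n)) \<longlonglongrightarrow> pi / 2" by simp
  have "(\<lambda>n. (real n / (1 + (real n)\<^sup>2) + arctan (real n)) / 2 - (- real n / (1 + (- real n)\<^sup>2) + arctan (- real n)) / 2)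
      = (\<lambda>n. real n / (1 + (real n)\<^sup>2) + arctan (real n))"
  proof (rule ext)
    fix n
    have "(a + A) / 2 - (- a + - A) / 2 = a + A" for a A :: real by (simp add: field_simps)
    then show "(real n / (1 + (real n)\<^sup>2) + arctan (real n)) / 2 - (- real n / (1 + (- real n)\<^sup>2) + arctan (- real n)) / 2
        = real n / (1 + (real n)\<^sup>2) + arctan (real n)"
      unfolding arctan_minus power2_minus minus_divide_left[symmetric] .
  qed
  from *[unfolded this] show ?thesis using L by (rule LIMSEQ_unique)
qed

text \<open>The only transform that is evaluated.  Scaling shows that it is a multiple of \<open>t\<close>; the factor is found
  by applying the forward transform at the point 2, where both sides reduce to elementary integrals.\<close>

lemma inv_Laplace_inverse_square:
  assumes "0 < t"
  shows "Re (inv_Laplace (\<lambda>p. 1 / p\<^sup>2) t) = t"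
proof -
  note D = decays_inverse_square
  define \<kappa> where "\<kappa> = inv_Laplace (\<lambda>p. 1 / p\<^sup>2) 1"
  have scale: "inv_Laplace (\<lambda>p. 1 / p\<^sup>2) t = of_real t * \<kappa>" if t: "0 < t" for t
  proof -
    have C: "Complex (1 / t) (0 + 1 / t * y) = of_real (1 / t) * Complex 1 y" for y
      by (simp add: complex_eq_iff)
    have "inv_Laplace (\<lambda>p. 1 / p\<^sup>2) t = inv_Laplace_line (1 / t) (\<lambda>p. 1 / p\<^sup>2) t"
      using t by (intro inv_Laplace_line_independent[OF D]) auto
    also have "\<dots> = (1 / t) *\<^sub>R (LINT y|lborel. exp (of_real t * Complex (1 / t) (0 + 1 / t * y)) * (1 / (Complex (1 / t) (0 + 1 / t * y))\<^sup>2)) / of_real (2 * pi)"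
      unfolding inv_Laplace_line_def
      using t by (subst lborel_integral_real_affine[of "1 / t" _ 0]) auto
    also have "(LINT y|lborel. exp (of_real t * Complex (1 / t) (0 + 1 / t * y)) * (1 / (Complex (1 / t) (0 + 1 / t * y))\<^sup>2))
        = (LINT y|lborel. of_real (t\<^sup>2) * (exp (of_real 1 * Complex 1 y) * (1 / (Complex 1 y)\<^sup>2)))"
      unfolding C using t by (intro Bochner_Integration.integral_cong refl) (simp add: power_mult_distrib field_simps)
    also have "\<dots> = of_real (t\<^sup>2) * (of_real (2 * pi) * \<kappa>)"
      unfolding integral_mult_right_zero \<kappa>_def inv_Laplace_line_def by simp
    finally show ?thesis using t by (simp add: scaleR_conv_of_real power2_eq_square)
  qed
  \<comment> \<open>The forward Laplace transform at the point 2 identifies the constant.\<close>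
  define w where "w r = indicator {0<..} r * exp (- (2 * r))" for r :: real
  have wm: "w \<in> borel_measurable borel" unfolding w_def by measurable
  have w0: "0 \<le> w r" for r by (simp add: w_def)
  have e1: "indicator {0<..} r * (r powr (1 - 1) * exp (- (b * r))) = indicator {0<..} r * exp (- (b * r))" for r b :: real
    by (simp add: indicator_def)
  have wint: "integrable lborel (\<lambda>r. w r * exp (1 * r))"
    using real_Gamma_integral_scaled(1)[of 1 1] unfolding e1
    by (simp add: w_def mult_exp_exp mult.assoc)
  note F = inv_Laplace_Fubini[OF D zero_less_one wm w0 wint, of 0, simplified]
  have inner: "(LINT r|lborel. of_real (w r) * exp (of_real r * Complex 1 y)) = 1 / cnj (Complex 1 y)" for y
  proof -
    have v: "(LINT r|lborel. of_real (indicator {0<..} r * omega 1 r) * exp (- (of_real r * Complex 1 (- y))))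
        = Complex 1 (- y) powr (- of_real 1)"
      by (rule complex_Gamma_integral_scaled(2)) auto
    have v2: "Complex 1 (- y) powr (- of_real 1) = 1 / cnj (Complex 1 y)"
      by (simp add: powr_minus complex_cnj inverse_eq_divide complex_eq_iff del: inverse_divide)
    have e: "of_real (indicator {0<..} r * omega 1 r) * exp (- (of_real r * Complex 1 (- y)))
        = of_real (w r) * exp (of_real r * Complex 1 y)" for r
    proof -
      have "- (of_real r * Complex 1 (- y)) = of_real (- (2 * r)) + of_real r * Complex 1 y"
        by (simp add: complex_eq_iff)
      then have "exp (- (of_real r * Complex 1 (- y))) = of_real (exp (- (2 * r))) * exp (of_real r * Complex 1 y)"
        by (simp only: exp_add exp_of_real)
      then show ?thesis by (simp add: w_def omega_def indicator_def)
    qed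
    show ?thesis using v unfolding e v2 .
  qed
  have wr: "(LINT r|lborel. w r * r) = 1 / 4"
  proof -
    have e2: "indicator {0<..} r * (r powr (2 - 1) * exp (- (2 * r))) = w r * r" for r :: real
      by (simp add: w_def indicator_def)
    show ?thesis using real_Gamma_integral_scaled(2)[of 2 2] unfolding e2 by (simp add: Gamma_numeral)
  qed
  have "Re (LINT r|lborel. of_real (w r) * inv_Laplace (\<lambda>p. 1 / p\<^sup>2) r)
      = (LINT r|lborel. Re (of_real (w r) * inv_Laplace (\<lambda>p. 1 / p\<^sup>2) r))"
    by (rule integral_Re[symmetric, OF F(1)])
  also have "\<dots> = (LINT r|lborel. Re \<kappa> * (w r * r))"
  proof (intro Bochner_Integration.integral_cong refl)
    fix r :: real
    show "Re (of_real (w r) * inv_Laplace (\<lambda>p. 1 / p\<^sup>2) r) = Re \<kappa> * (w r * r)"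
      using scale[of r] by (cases "0 < r") (auto simp: w_def)
  qed
  also have "\<dots> = Re \<kappa> / 4" by (simp add: wr)
  finally have lhs: "Re (LINT r|lborel. of_real (w r) * inv_Laplace (\<lambda>p. 1 / p\<^sup>2) r) = Re \<kappa> / 4" .
  define q where "q y = 1 / ((Complex 1 y)\<^sup>2 * cnj (Complex 1 y))" for y
  have Req: "Re (q y) = 1 / (1 + y\<^sup>2)\<^sup>2" for y
  proof -
    have nz: "1 + y\<^sup>2 \<noteq> 0" by (smt (verit) zero_le_power2)
    have "(Complex 1 y)\<^sup>2 * cnj (Complex 1 y) = Complex 1 y * of_real (1 + y\<^sup>2)"
      by (simp add: complex_eq_iff power2_eq_square algebra_simps)
    then have "q y = inverse (Complex 1 y) / of_real (1 + y\<^sup>2)"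
      by (simp add: q_def field_simps)
    then have "Re (q y) = Re (inverse (Complex 1 y)) / (1 + y\<^sup>2)" by (simp add: Re_divide_of_real)
    also have "Re (inverse (Complex 1 y)) = 1 / (1 + y\<^sup>2)" by (simp add: power2_eq_square)
    finally show ?thesis using nz by (simp add: power2_eq_square)
  qed
  have qi: "integrable lborel q"
  proof (rule Bochner_Integration.integrable_bound[OF line_weight_integrable_1[of 1]])
    show "q \<in> borel_measurable lborel"
      unfolding q_def Complex_eq by (auto intro!: borel_measurable_continuous_onI continuous_intros simp: complex_eq_iff)
    show "AE y in lborel. norm (q y) \<le> norm (norm (Complex 1 y) powr (- 1 - 1))"
    proof (rule AE_I2)
      fix y :: real
      have n1: "1 \<le> norm (Complex 1 y)" using norm_Complex_ge(1)[of 1 y] by simp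
      then have "norm (q y) = norm (Complex 1 y) powr (- 1 - 1) * (1 / norm (Complex 1 y))"
        by (simp add: q_def norm_divide norm_mult norm_power powr_minus powr_numeral field_simps del: complex_cnj)
      also have "\<dots> \<le> norm (Complex 1 y) powr (- 1 - 1) * 1"
        using n1 by (intro mult_left_mono) (auto simp: divide_le_eq)
      finally show "norm (q y) \<le> norm (norm (Complex 1 y) powr (- 1 - 1))" by simp
    qed
  qed simp
  have "(LINT r|lborel. of_real (w r) * inv_Laplace (\<lambda>p. 1 / p\<^sup>2) r) = (LINT y|lborel. q y) / of_real (2 * pi)"
    using F(2) unfolding inner q_def by (simp add: mult.commute)
  then have "Re \<kappa> / 4 = Re (LINT y|lborel. q y) / (2 * pi)"
    using lhs by (simp add: Re_divide_of_real flip: of_real_mult)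
  also have "Re (LINT y|lborel. q y) = (LINT y|lborel. Re (q y))" by (rule integral_Re[symmetric, OF qi])
  also have "\<dots> = pi / 2" unfolding Req by (rule integral_inverse_square_sum)
  finally have "Re \<kappa> = 1" by simp
  then show ?thesis using scale[OF assms] by simp
qed

section \<open>The solution of a single mode\<close>

lemma omega_convolution:
  assumes "0 < a" "0 < b" "0 < t"
  shows "set_integrable lborel {0<..<t} (\<lambda>s. omega a (t - s) * omega b s)"
    and "(LINT s:{0<..<t}|lborel. omega a (t - s) * omega b s) = omega (a + b) t"
proof -
  have eq: "omega a (t - s) * omega b s = 1 / (Gamma a * Gamma b) * ((t - s) powr (a - 1) * s powr (b - 1))" for s
    by (simp add: omega_def)
  show "set_integrable lborel {0<..<t} (\<lambda>s. omega a (t - s) * omega b s)"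
    unfolding eq by (intro set_integrable_mult_right Beta_integral_lborel(1) assms)
  have G: "0 < Gamma a" "0 < Gamma b" using assms by auto
  show "(LINT s:{0<..<t}|lborel. omega a (t - s) * omega b s) = omega (a + b) t"
    unfolding eq set_integral_mult_right Beta_integral_lborel(2)[OF assms]
    using G by (simp add: Beta_def omega_def)
qed

lemma omega_1: "0 < t \<Longrightarrow> omega 1 t = 1"
  by (simp add: omega_def)

lemma inv_Laplace_cong:
  assumes "\<And>p. 0 < Re p \<Longrightarrow> H p = H' p"
  shows "inv_Laplace H t = inv_Laplace H' t"
  unfolding inv_Laplace_line_def using assms by simp

lemma Re_inv_Laplace_convolution:
  assumes H: "decays \<delta> M H" and \<delta>: "0 < \<delta>" and \<gamma>: "0 < \<gamma>"
  shows "set_integrable lborel {0<..<t} (\<lambda>r. omega \<gamma> (t - r) * Re (inv_Laplace H r))"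
    and "(LINT r:{0<..<t}|lborel. omega \<gamma> (t - r) * Re (inv_Laplace H r))
      = Re (inv_Laplace (\<lambda>p. p powr (- of_real \<gamma>) * H p) t)"
proof -
  note c = inv_Laplace_convolution[OF assms, of t]
  have eq: "indicat_real {0<..<t} r *\<^sub>R (omega \<gamma> (t - r) * Re (inv_Laplace H r))
      = Re (indicat_real {0<..<t} r *\<^sub>R (of_real (omega \<gamma> (t - r)) * inv_Laplace H r))" for r
    by simp
  show "set_integrable lborel {0<..<t} (\<lambda>r. omega \<gamma> (t - r) * Re (inv_Laplace H r))"
    unfolding set_integrable_def eq using c(1)[unfolded set_integrable_def] by (rule integrable_Re)
  show "(LINT r:{0<..<t}|lborel. omega \<gamma> (t - r) * Re (inv_Laplace H r))
      = Re (inv_Laplace (\<lambda>p. p powr (- of_real \<gamma>) * H p) t)"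
    unfolding set_lebesgue_integral_def eq c(2)[symmetric]
    using c(1)[unfolded set_integrable_def] by (rule integral_Re)
qed

text \<open>Division of the symbol by \<open>p\<close> is integration from 0, the case \<open>\<gamma> = 1\<close> of the convolution rule.\<close>

lemma inv_Laplace_antiderivative:
  assumes H: "decays \<delta> M H" and \<delta>: "0 < \<delta>" and G: "\<And>p. 0 < Re p \<Longrightarrow> G p = H p / p" and t: "0 < t"
  shows "((\<lambda>t. Re (inv_Laplace G t)) has_real_derivative Re (inv_Laplace H t)) (at t)"
proof -
  define f where "f t = Re (inv_Laplace H t)" for t
  have cf: "continuous_on UNIV f"
    unfolding f_def by (intro continuous_intros inv_Laplace_continuous[OF H \<delta>])
  have eq: "Re (inv_Laplace G x) = integral {0..x} f" if x: "0 \<le> x" for x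
  proof -
    have "inv_Laplace G x = inv_Laplace (\<lambda>p. p powr (- of_real 1) * H p) x"
    proof (rule inv_Laplace_cong)
      fix p :: complex assume "0 < Re p"
      then have "p \<noteq> 0" by auto
      then show "G p = p powr (- of_real 1) * H p"
        using G[OF \<open>0 < Re p\<close>] by (simp add: powr_minus field_simps)
    qed
    then have "Re (inv_Laplace G x) = (LINT r:{0<..<x}|lborel. omega 1 (x - r) * f r)"
      using Re_inv_Laplace_convolution(2)[OF H \<delta> zero_less_one, of x] by (simp add: f_def)
    also have "\<dots> = (LINT r:{0<..<x}|lborel. f r)"
      by (rule set_lebesgue_integral_cong) (auto simp: omega_1)
    also have "\<dots> = integral {0<..<x} f"
    proof (rule set_borel_integral_eq_integral(2))
      have "set_integrable lborel {0..x} f"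
        by (rule borel_integrable_compact[OF compact_Icc, folded set_integrable_def])
           (rule continuous_on_subset[OF cf], simp)
      then show "set_integrable lborel {0<..<x} f" by (rule set_integrable_subset) auto
    qed
    also have "\<dots> = integral {0..x} f" by (simp add: integral_open_interval_real)
    finally show ?thesis .
  qed
  have "((\<lambda>x. integral {0..x} f) has_real_derivative f t) (at t within {0..t+1})"
    using t by (intro integral_has_real_derivative continuous_on_subset[OF cf]) auto
  then have "((\<lambda>x. integral {0..x} f) has_real_derivative f t) (at t)"
    using at_within_Icc_at[of 0 t "t + 1"] t by simp
  then have "((\<lambda>t. Re (inv_Laplace G t)) has_real_derivative f t) (at t)"
    by (rule has_field_derivative_transform_within_open[where S = "{0<..}"]) (use t eq in auto)
  then show ?thesis unfolding f_def .
qed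

text \<open>The argument of \<open>p powr (2 * \<nu>)\<close> is at most \<open>pi * \<nu>\<close> in absolute value, and \<open>cos\<close> decreases on \<open>{0..pi}\<close>.\<close>

lemma Re_powr_sector:
  assumes "0 < Re p" "0 \<le> \<nu>" "\<nu> \<le> 1"
  shows "norm p powr (2 * \<nu>) * cos (pi * \<nu>) \<le> Re (p powr of_real (2 * \<nu>))"
proof -
  have p: "p \<noteq> 0" using assms by auto
  have im: "\<bar>Im (Ln p)\<bar> \<le> pi / 2" using Re_Ln_pos_lt[OF p] assms by auto
  have "cos (pi * \<nu>) \<le> cos (\<bar>2 * \<nu> * Im (Ln p)\<bar>)"
  proof (rule cos_monotone_0_pi_le)
    have "2 * \<nu> * \<bar>Im (Ln p)\<bar> \<le> 2 * \<nu> * (pi / 2)" using im assms by (intro mult_left_mono) auto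
    then show "\<bar>2 * \<nu> * Im (Ln p)\<bar> \<le> pi * \<nu>" using assms by (simp add: abs_mult mult.commute)
  qed (use assms in auto)
  then have "cos (pi * \<nu>) \<le> cos (2 * \<nu> * Im (Ln p))" by simp
  then have "norm p powr (2 * \<nu>) * cos (pi * \<nu>) \<le> norm p powr (2 * \<nu>) * cos (2 * \<nu> * Im (Ln p))"
    by (rule mult_left_mono) simp
  also have "\<dots> = Re (p powr of_real (2 * \<nu>))"
    using p by (simp add: powr_def Re_exp Re_Ln)
  finally show ?thesis .
qed

text \<open>The cosine of \<open>pi * \<nu> / 2\<close>, written so that its square is at hand.\<close>

definition sector_const :: "real \<Rightarrow> real" where
  "sector_const \<nu> = sqrt ((1 + cos (pi * \<nu>)) / 2)"

lemma sector_const_pos: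
  assumes "0 \<le> \<nu>" "\<nu> < 1" shows "0 < sector_const \<nu>"
proof -
  have "cos pi < cos (pi * \<nu>)" using assms by (intro cos_monotone_0_pi) auto
  then show ?thesis by (simp add: sector_const_def)
qed

text \<open>A power of a right half plane stays away from the negative real axis by a sector, so its sum with a
  positive number cannot cancel.  As \<open>\<nu>\<close> tends to 1 the constant degenerates, as it must: the wave
  equation proper has its poles on the imaginary axis.\<close>

lemma symbol_lower_bound:
  assumes p: "0 < Re p" and \<nu>: "0 \<le> \<nu>" "\<nu> < 1"
  shows "sector_const \<nu> * (norm p powr (2 * \<nu>) + \<mu>\<^sup>2) \<le> norm (p powr of_real (2 * \<nu>) + of_real (\<mu>\<^sup>2))"
proof (rule power2_le_imp_le)
  define X where "X = norm p powr (2 * \<nu>)"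
  define z where "z = p powr of_real (2 * \<nu>)"
  define c where "c = cos (pi * \<nu>)"
  have p0: "p \<noteq> 0" using p by auto
  have nz: "norm z = X" using p0 by (simp add: z_def X_def norm_powr_real_powr')
  have Re: "X * c \<le> Re z" unfolding X_def c_def z_def using Re_powr_sector p \<nu> by simp
  have c1: "c \<le> 1" "-1 \<le> c" by (simp_all add: c_def)
  have "(sector_const \<nu> * (X + \<mu>\<^sup>2))\<^sup>2 = (1 + c) / 2 * (X + \<mu>\<^sup>2)\<^sup>2"
    using c1 unfolding sector_const_def c_def[symmetric] power_mult_distrib
    by (subst real_sqrt_pow2) auto
  also have "\<dots> = X\<^sup>2 + 2 * (X * c) * \<mu>\<^sup>2 + (\<mu>\<^sup>2)\<^sup>2 - (1 - c) / 2 * (X - \<mu>\<^sup>2)\<^sup>2"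
    by (simp add: power2_eq_square field_simps)
  also have "\<dots> \<le> X\<^sup>2 + 2 * (X * c) * \<mu>\<^sup>2 + (\<mu>\<^sup>2)\<^sup>2" using c1 by simp
  also have "\<dots> \<le> X\<^sup>2 + 2 * Re z * \<mu>\<^sup>2 + (\<mu>\<^sup>2)\<^sup>2"
    using Re by (intro add_mono mult_right_mono mult_left_mono order.refl) auto
  also have "\<dots> = (norm (z + of_real (\<mu>\<^sup>2)))\<^sup>2"
    unfolding nz[symmetric] cmod_power2 by (simp add: power2_eq_square algebra_simps)
  finally show "(sector_const \<nu> * (norm p powr (2 * \<nu>) + \<mu>\<^sup>2))\<^sup>2
      \<le> (norm (p powr of_real (2 * \<nu>) + of_real (\<mu>\<^sup>2)))\<^sup>2"
    by (simp add: X_def z_def)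
qed simp

text \<open>The symbols of the resolvent kernel of one mode and of its fractional integrals of order \<open>\<beta>\<close>.\<close>

definition res :: "real \<Rightarrow> real \<Rightarrow> real \<Rightarrow> complex \<Rightarrow> complex" where
  "res \<nu> \<mu> \<beta> p = p powr (- of_real \<beta>) / (p powr of_real (2 * \<nu>) + of_real (\<mu>\<^sup>2))"

text \<open>The derivative of \<open>res\<close> in the form of a bounded factor times \<open>res \<nu> \<mu> \<beta> p / p\<close>.\<close>

definition res' :: "real \<Rightarrow> real \<Rightarrow> real \<Rightarrow> complex \<Rightarrow> complex" where
  "res' \<nu> \<mu> \<beta> p = - (of_real \<beta> + of_real (2 * \<nu>) * (p powr of_real (2 * \<nu>) / (p powr of_real (2 * \<nu>) + of_real (\<mu>\<^sup>2))))
      * res \<nu> \<mu> \<beta> p / p"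

context
  fixes \<nu> \<mu> :: real
  assumes \<nu>: "1/2 < \<nu>" "\<nu> < 1" and \<mu>: "0 < \<mu>"
begin

lemma symbol_nonzero:
  assumes "0 < Re p" shows "p powr of_real (2 * \<nu>) + of_real (\<mu>\<^sup>2) \<noteq> (0::complex)"
proof -
  have "0 < sector_const \<nu> * (norm p powr (2 * \<nu>) + \<mu>\<^sup>2)"
    using sector_const_pos[of \<nu>] \<nu> \<mu> by (intro mult_pos_pos add_nonneg_pos) auto
  then show ?thesis using symbol_lower_bound[OF assms, of \<nu> \<mu>] \<nu> by auto
qed

lemma Re_pos_not_nonpos_Reals: "0 < Re p \<Longrightarrow> p \<notin> \<real>\<^sub>\<le>\<^sub>0"
  by (auto simp: complex_nonpos_Reals_iff)

lemma res_holomorphic: "res \<nu> \<mu> \<beta> holomorphic_on {p. 0 < Re p}"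
  unfolding res_def[abs_def]
  by (intro holomorphic_intros) (use symbol_nonzero Re_pos_not_nonpos_Reals in auto)

text \<open>The denominator dominates any geometric mean of its two terms.  The parameter \<open>\<theta>\<close> distributes the decay
  between \<open>\<mu>\<close> and \<open>p\<close>: powers of the eigenvalue are traded for regularity in time.\<close>

lemma res_bound:
  assumes p: "0 < Re p" and \<theta>: "0 \<le> \<theta>" "\<theta> \<le> 1"
  shows "norm (res \<nu> \<mu> \<beta> p) \<le> \<mu> powr (- 2 * \<theta>) / sector_const \<nu> * norm p powr (- \<beta> - 2 * \<nu> * (1 - \<theta>))"
proof -
  have p0: "p \<noteq> 0" "0 < norm p" using p by auto
  define X where "X = norm p powr (2 * \<nu>)"
  have X: "0 < X" using p0 by (simp add: X_def)
  have m: "0 < \<mu>\<^sup>2" using \<mu> by simp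
  have "X powr (1 - \<theta>) * (\<mu>\<^sup>2) powr \<theta> \<le> (X + \<mu>\<^sup>2) powr (1 - \<theta>) * (X + \<mu>\<^sup>2) powr \<theta>"
    using X m \<theta> by (intro mult_mono powr_mono2) auto
  also have "\<dots> = X + \<mu>\<^sup>2" using X m by (simp add: powr_add[symmetric])
  finally have "sector_const \<nu> * (X powr (1 - \<theta>) * (\<mu>\<^sup>2) powr \<theta>) \<le> sector_const \<nu> * (X + \<mu>\<^sup>2)"
    using sector_const_pos[of \<nu>] \<nu> by (intro mult_left_mono) auto
  also have "\<dots> \<le> norm (p powr of_real (2 * \<nu>) + of_real (\<mu>\<^sup>2))"
    unfolding X_def using symbol_lower_bound p \<nu> by simp
  finally have low: "sector_const \<nu> * (X powr (1 - \<theta>) * (\<mu>\<^sup>2) powr \<theta>) \<le> norm (p powr of_real (2 * \<nu>) + of_real (\<mu>\<^sup>2))" .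
  have pos: "0 < sector_const \<nu> * (X powr (1 - \<theta>) * (\<mu>\<^sup>2) powr \<theta>)"
    using sector_const_pos[of \<nu>] \<nu> X m by simp
  have npb: "norm (p powr (- of_real \<beta>)) = norm p powr (- \<beta>)"
    using norm_powr_real_powr'[of "- of_real \<beta>" p] p0 by (simp add: powr_def)
  have "norm (res \<nu> \<mu> \<beta> p) = norm p powr (- \<beta>) / norm (p powr of_real (2 * \<nu>) + of_real (\<mu>\<^sup>2))"
    unfolding res_def norm_divide npb ..
  also have "\<dots> \<le> norm p powr (- \<beta>) / (sector_const \<nu> * (X powr (1 - \<theta>) * (\<mu>\<^sup>2) powr \<theta>))"
    by (rule divide_left_mono[OF low _ mult_pos_pos[OF less_le_trans[OF pos low] pos]]) simp
  also have "\<dots> = \<mu> powr (- 2 * \<theta>) / sector_const \<nu> * norm p powr (- \<beta> - 2 * \<nu> * (1 - \<theta>))"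
  proof -
    have "X powr (1 - \<theta>) = norm p powr (2 * \<nu> * (1 - \<theta>))" by (simp add: X_def powr_powr)
    moreover have "(\<mu>\<^sup>2) powr \<theta> = \<mu> powr (2 * \<theta>)"
      using \<mu> by (simp add: powr_powr flip: powr_numeral)
    moreover have "norm p powr (- \<beta> - 2 * \<nu> * (1 - \<theta>)) = norm p powr (- \<beta>) / norm p powr (2 * \<nu> * (1 - \<theta>))"
      by (simp add: powr_diff)
    moreover have "\<mu> powr (- 2 * \<theta>) = 1 / \<mu> powr (2 * \<theta>)" by (simp add: powr_minus_divide)
    ultimately show ?thesis by (simp add: mult_ac)
  qed
  finally show ?thesis .
qed

lemma res_decays:
  assumes "0 \<le> \<theta>" "\<theta> \<le> 1" "\<delta> = \<beta> + 2 * \<nu> * (1 - \<theta>) - 1"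
  shows "decays \<delta> (\<mu> powr (- 2 * \<theta>) / sector_const \<nu>) (res \<nu> \<mu> \<beta>)"
  unfolding decays_def
proof (intro conjI res_holomorphic allI impI)
  fix p :: complex assume p: "0 < Re p"
  have e: "- \<beta> - 2 * \<nu> * (1 - \<theta>) = - 1 - \<delta>" using assms by simp
  show "norm (res \<nu> \<mu> \<beta> p) \<le> \<mu> powr (- 2 * \<theta>) / sector_const \<nu> * norm p powr (- 1 - \<delta>)"
    using res_bound[OF p assms(1,2), of \<beta>] unfolding e .
qed

lemma res_decays_0: "0 \<le> \<beta> \<Longrightarrow> \<exists>\<delta>>0. \<exists>M. decays \<delta> M (res \<nu> \<mu> \<beta>)"
  using res_decays[of 0 "\<beta> + 2 * \<nu> - 1" \<beta>] \<nu>
  by (intro exI[of _ "\<beta> + 2 * \<nu> - 1"]) auto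

lemma res_derivative:
  assumes p: "0 < Re p"
  shows "(res \<nu> \<mu> \<beta> has_field_derivative res' \<nu> \<mu> \<beta> p) (at p)"
proof -
  define S where "S = p powr of_real (2 * \<nu>) + of_real (\<mu>\<^sup>2)"
  have p0: "p \<noteq> 0" using p by auto
  have np: "p \<notin> \<real>\<^sub>\<le>\<^sub>0" using p by (rule Re_pos_not_nonpos_Reals)
  have S: "S \<noteq> 0" unfolding S_def using symbol_nonzero[OF p] .
  have d1: "((\<lambda>p. p powr a) has_field_derivative a * p powr a / p) (at p)" for a :: complex
    using has_field_derivative_powr[OF np, of a] p0 by (simp add: powr_diff)
  have "((\<lambda>p. p powr (- of_real \<beta>) / (p powr of_real (2 * \<nu>) + of_real (\<mu>\<^sup>2))) has_field_derivative
      ((- of_real \<beta> * p powr (- of_real \<beta>) / p) * S - p powr (- of_real \<beta>) * (of_real (2 * \<nu>) * p powr of_real (2 * \<nu>) / p + 0)) / (S * S)) (at p)"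
    unfolding S_def by (intro DERIV_divide DERIV_add d1 DERIV_const symbol_nonzero p)
  also have "((- of_real \<beta> * p powr (- of_real \<beta>) / p) * S - p powr (- of_real \<beta>) * (of_real (2 * \<nu>) * p powr of_real (2 * \<nu>) / p + 0)) / (S * S)
      = res' \<nu> \<mu> \<beta> p"
    unfolding res'_def res_def S_def[symmetric] using S p0 by (simp add: divide_simps) (simp add: algebra_simps)
  finally show ?thesis unfolding res_def[abs_def] .
qed

lemma res'_bound:
  assumes p: "0 < Re p" and \<beta>: "0 \<le> \<beta>"
  shows "norm (p * res' \<nu> \<mu> \<beta> p) \<le> (\<beta> + 2 * \<nu> / sector_const \<nu>) * norm (res \<nu> \<mu> \<beta> p)"
proof -
  have p0: "p \<noteq> 0" using p by auto
  define S where "S = p powr of_real (2 * \<nu>) + of_real (\<mu>\<^sup>2)"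
  have c: "0 < sector_const \<nu>" using sector_const_pos \<nu> by simp
  have S: "S \<noteq> 0" unfolding S_def using symbol_nonzero[OF p] .
  have "sector_const \<nu> * norm p powr (2 * \<nu>) \<le> sector_const \<nu> * (norm p powr (2 * \<nu>) + \<mu>\<^sup>2)"
    using c by (intro mult_left_mono) auto
  also have "\<dots> \<le> norm S" unfolding S_def using symbol_lower_bound p \<nu> by simp
  finally have "norm (p powr of_real (2 * \<nu>) / S) \<le> 1 / sector_const \<nu>"
    using c S p0 by (simp add: norm_divide norm_powr_real_powr' field_simps)
  then have "norm (of_real (2 * \<nu>) * (p powr of_real (2 * \<nu>) / S)) \<le> 2 * \<nu> * (1 / sector_const \<nu>)"
    unfolding norm_mult norm_of_real using \<nu> by (intro mult_mono) auto
  then have "norm (of_real \<beta> + of_real (2 * \<nu>) * (p powr of_real (2 * \<nu>) / S)) \<le> \<beta> + 2 * \<nu> * (1 / sector_const \<nu>)"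
    using norm_triangle_ineq[of "of_real \<beta>" "of_real (2 * \<nu>) * (p powr of_real (2 * \<nu>) / S)"] \<beta> by simp
  then have "norm (of_real \<beta> + of_real (2 * \<nu>) * (p powr of_real (2 * \<nu>) / S)) * norm (res \<nu> \<mu> \<beta> p)
      \<le> (\<beta> + 2 * \<nu> / sector_const \<nu>) * norm (res \<nu> \<mu> \<beta> p)"
    by (intro mult_right_mono) auto
  moreover have "p * res' \<nu> \<mu> \<beta> p = - ((of_real \<beta> + of_real (2 * \<nu>) * (p powr of_real (2 * \<nu>) / S)) * res \<nu> \<mu> \<beta> p)"
  proof -
    have "p * (- A * r / p) = - (A * r)" for A r using p0 by simp
    then show ?thesis unfolding res'_def S_def .
  qed
  ultimately show ?thesis by (simp only: norm_minus_cancel norm_mult)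
qed

lemma res'_holomorphic: "res' \<nu> \<mu> \<beta> holomorphic_on {p. 0 < Re p}"
  unfolding res'_def[abs_def]
  by (intro holomorphic_intros res_holomorphic) (use symbol_nonzero Re_pos_not_nonpos_Reals in auto)

lemma res'_decays:
  assumes "0 \<le> \<theta>" "\<theta> \<le> 1" "\<delta> = \<beta> + 2 * \<nu> * (1 - \<theta>) - 1" "0 \<le> \<beta>"
  shows "decays \<delta> ((\<beta> + 2 * \<nu> / sector_const \<nu>) * (\<mu> powr (- 2 * \<theta>) / sector_const \<nu>)) (\<lambda>p. p * res' \<nu> \<mu> \<beta> p)"
    and "decays (1 + \<delta>) ((\<beta> + 2 * \<nu> / sector_const \<nu>) * (\<mu> powr (- 2 * \<theta>) / sector_const \<nu>)) (res' \<nu> \<mu> \<beta>)"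
proof -
  define A where "A = (\<beta> + 2 * \<nu> / sector_const \<nu>) * (\<mu> powr (- 2 * \<theta>) / sector_const \<nu>)"
  have b: "norm (p * res' \<nu> \<mu> \<beta> p) \<le> A * norm p powr (-1 - \<delta>)" if p: "0 < Re p" for p
  proof -
    have "norm (p * res' \<nu> \<mu> \<beta> p) \<le> (\<beta> + 2 * \<nu> / sector_const \<nu>) * norm (res \<nu> \<mu> \<beta> p)"
      using res'_bound p assms by simp
    also have "\<dots> \<le> (\<beta> + 2 * \<nu> / sector_const \<nu>) * (\<mu> powr (- 2 * \<theta>) / sector_const \<nu> * norm p powr (-1 - \<delta>))"
      using res_decays[OF assms(1-3)] p sector_const_pos[of \<nu>] \<nu> assms(4)
      by (intro mult_left_mono) (auto simp: decays_def)
    finally show ?thesis by (simp add: A_def mult.assoc)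
  qed
  show "decays \<delta> A (\<lambda>p. p * res' \<nu> \<mu> \<beta> p)"
    unfolding decays_def using b by (auto intro!: holomorphic_intros res'_holomorphic)
  have "norm (res' \<nu> \<mu> \<beta> p) \<le> A * norm p powr (-1 - (1 + \<delta>))" if p: "0 < Re p" for p
  proof -
    have p0: "0 < norm p" using p by auto
    have e: "norm p powr (-1 - (1 + \<delta>)) = norm p powr (-1 - \<delta>) / norm p"
      using p0 powr_diff[of "norm p" "-1 - \<delta>" 1] by simp
    show ?thesis unfolding e using b[OF p] p0 by (simp add: norm_mult field_simps)
  qed
  then show "decays (1 + \<delta>) A (res' \<nu> \<mu> \<beta>)"
    unfolding decays_def using res'_holomorphic by auto
qed

text \<open>In terms of the Mittag-Leffler function, \<open>K \<beta> t\<close> is \<open>t powr (\<beta> + 2 * \<nu> - 1)\<close> times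
  the function with parameters \<open>2 * \<nu>\<close> and \<open>\<beta> + 2 * \<nu>\<close> at \<open>- \<mu>\<^sup>2 * t powr (2 * \<nu>)\<close>.\<close>

definition K :: "real \<Rightarrow> real \<Rightarrow> real" where
  "K \<beta> t = Re (inv_Laplace (res \<nu> \<mu> \<beta>) t)"

lemma K_convolution:
  assumes "0 \<le> \<beta>" "0 < \<gamma>"
  shows "set_integrable lborel {0<..<t} (\<lambda>r. omega \<gamma> (t - r) * K \<beta> r)"
    and "(LINT r:{0<..<t}|lborel. omega \<gamma> (t - r) * K \<beta> r) = K (\<beta> + \<gamma>) t"
proof -
  obtain \<delta> M where D: "0 < \<delta>" "decays \<delta> M (res \<nu> \<mu> \<beta>)" using res_decays_0[OF assms(1)] by blast
  show "set_integrable lborel {0<..<t} (\<lambda>r. omega \<gamma> (t - r) * K \<beta> r)"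
    unfolding K_def by (rule Re_inv_Laplace_convolution(1)[OF D(2,1) assms(2)])
  have "p powr (- of_real \<gamma>) * res \<nu> \<mu> \<beta> p = res \<nu> \<mu> (\<beta> + \<gamma>) p" for p
    by (simp add: res_def powr_add[symmetric] add.commute)
  then show "(LINT r:{0<..<t}|lborel. omega \<gamma> (t - r) * K \<beta> r) = K (\<beta> + \<gamma>) t"
    unfolding K_def Re_inv_Laplace_convolution(2)[OF D(2,1) assms(2)] by simp
qed

lemma K_continuous: "0 \<le> \<beta> \<Longrightarrow> continuous_on S (K \<beta>)"
  using res_decays_0[of \<beta>] unfolding K_def
  by (auto intro!: continuous_intros intro: continuous_on_subset inv_Laplace_continuous)

lemma K_0: "0 \<le> \<beta> \<Longrightarrow> K \<beta> 0 = 0"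
  using res_decays_0[of \<beta>] inv_Laplace_nonpos[of _ _ "res \<nu> \<mu> \<beta>" 0] unfolding K_def by auto

lemma K_derivative:
  assumes "0 \<le> \<beta>" "0 < t"
  shows "(K (\<beta> + 1) has_real_derivative K \<beta> t) (at t)"
proof -
  obtain \<delta> M where D: "0 < \<delta>" "decays \<delta> M (res \<nu> \<mu> \<beta>)" using res_decays_0[OF assms(1)] by blast
  show ?thesis unfolding K_def[abs_def]
  proof (rule inv_Laplace_antiderivative[OF D(2,1) _ assms(2)])
    fix p :: complex assume "0 < Re p"
    then have "p \<noteq> 0" by auto
    then show "res \<nu> \<mu> (\<beta> + 1) p = res \<nu> \<mu> \<beta> p / p"
      by (simp add: res_def powr_diff)
  qed
qed

text \<open>The equation of the mode in terms of symbols: the two on the left add up to \<open>1 / p\<^sup>2\<close>.\<close>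

lemma K_identity:
  assumes "0 < t"
  shows "K (2 - 2 * \<nu>) t + \<mu>\<^sup>2 * K 2 t = t"
proof -
  obtain \<delta> M where D: "0 < \<delta>" "decays \<delta> M (res \<nu> \<mu> (2 - 2 * \<nu>))" using res_decays_0[of "2 - 2 * \<nu>"] \<nu> by auto
  obtain \<delta>' M' where D': "0 < \<delta>'" "decays \<delta>' M' (res \<nu> \<mu> 2)" using res_decays_0[of 2] by auto
  have eq: "1 / p\<^sup>2 = res \<nu> \<mu> (2 - 2 * \<nu>) p + of_real (\<mu>\<^sup>2) * res \<nu> \<mu> 2 p" if p: "0 < Re p" for p
  proof -
    have p0: "p \<noteq> 0" using p by auto
    define S where "S = p powr of_real (2 * \<nu>) + of_real (\<mu>\<^sup>2)"
    have S: "S \<noteq> 0" unfolding S_def using symbol_nonzero[OF p] .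
    have e: "p powr (- of_real 2) = 1 / p\<^sup>2"
    proof -
      have "p powr (of_nat 2) = p ^ 2" using p0 by (rule powr_complexpow)
      then show ?thesis by (simp add: powr_minus inverse_eq_divide)
    qed
    have "p powr (- of_real (2 - 2 * \<nu>)) = p powr (- of_real 2) * p powr of_real (2 * \<nu>)"
      by (simp add: powr_add[symmetric])
    then have "res \<nu> \<mu> (2 - 2 * \<nu>) p + of_real (\<mu>\<^sup>2) * res \<nu> \<mu> 2 p = p powr (- of_real 2) * S / S"
      unfolding res_def S_def by (simp add: add_divide_distrib algebra_simps)
    then show ?thesis using S e by simp
  qed
  have "inv_Laplace (\<lambda>p. 1 / p\<^sup>2) t = inv_Laplace (\<lambda>p. res \<nu> \<mu> (2 - 2 * \<nu>) p + of_real (\<mu>\<^sup>2) * res \<nu> \<mu> 2 p) t"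
    by (rule inv_Laplace_cong) (rule eq)
  also have "\<dots> = inv_Laplace (res \<nu> \<mu> (2 - 2 * \<nu>)) t + of_real (\<mu>\<^sup>2) * inv_Laplace (res \<nu> \<mu> 2) t"
  proof -
    define E where "E y = exp (of_real t * Complex 1 y)" for y
    have i: "integrable lborel (\<lambda>y. E y * res \<nu> \<mu> (2 - 2 * \<nu>) (Complex 1 y))"
      unfolding E_def using line_integrable[OF D(2,1), of 1 t] by simp
    have i': "integrable lborel (\<lambda>y. of_real (\<mu>\<^sup>2) * (E y * res \<nu> \<mu> 2 (Complex 1 y)))"
      unfolding E_def using line_integrable[OF D'(2,1), of 1 t] by (intro integrable_mult_right) simp
    have "(LINT y|lborel. E y * (res \<nu> \<mu> (2 - 2 * \<nu>) (Complex 1 y) + of_real (\<mu>\<^sup>2) * res \<nu> \<mu> 2 (Complex 1 y)))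
        = (LINT y|lborel. E y * res \<nu> \<mu> (2 - 2 * \<nu>) (Complex 1 y) + of_real (\<mu>\<^sup>2) * (E y * res \<nu> \<mu> 2 (Complex 1 y)))"
      by (intro Bochner_Integration.integral_cong refl) (simp only: distrib_left mult.left_commute)
    also have "\<dots> = (LINT y|lborel. E y * res \<nu> \<mu> (2 - 2 * \<nu>) (Complex 1 y)) + of_real (\<mu>\<^sup>2) * (LINT y|lborel. E y * res \<nu> \<mu> 2 (Complex 1 y))"
      by (subst Bochner_Integration.integral_add[OF i i']) (simp only: integral_mult_right_zero)
    finally show ?thesis unfolding inv_Laplace_line_def E_def by (simp only: add_divide_distrib times_divide_eq_right)
  qed
  finally have "t = Re (inv_Laplace (res \<nu> \<mu> (2 - 2 * \<nu>)) t + of_real (\<mu>\<^sup>2) * inv_Laplace (res \<nu> \<mu> 2) t)"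
    using inv_Laplace_inverse_square[OF assms] by simp
  then show ?thesis by (simp add: K_def del: of_real_power)
qed

lemma K_bound:
  assumes "0 \<le> \<theta>" "\<theta> \<le> 1" "\<delta> = \<beta> + 2 * \<nu> * (1 - \<theta>) - 1" "0 < \<delta>" "0 < t"
  shows "\<bar>K \<beta> t\<bar> \<le> exp 1 * line_weight \<delta> / sector_const \<nu> * \<mu> powr (- 2 * \<theta>) * t powr \<delta>"
proof -
  have "\<bar>K \<beta> t\<bar> \<le> norm (inv_Laplace (res \<nu> \<mu> \<beta>) t)" unfolding K_def by (rule abs_Re_le_cmod)
  also have "\<dots> \<le> exp 1 * line_weight \<delta> * (\<mu> powr (- 2 * \<theta>) / sector_const \<nu>) * t powr \<delta>"
    by (rule inv_Laplace_bound[OF res_decays[OF assms(1-3)] assms(4,5)])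
  finally show ?thesis by (simp add: mult_ac)
qed

text \<open>One more power of \<open>t\<close> than in \<open>K_bound\<close> is allowed on the left, and positivity of the exponent is
  required after this gain only.  This covers the second derivative of the mode, whose symbol decays too
  slowly once a power of \<open>\<mu>\<close> has been extracted.\<close>

lemma K_time_weighted:
  assumes \<theta>: "0 \<le> \<theta>" "\<theta> \<le> 1" and \<delta>: "\<delta> = \<beta> + 2 * \<nu> * (1 - \<theta>)" "0 < \<delta>" and \<beta>: "0 \<le> \<beta>" and t: "0 < t"
  shows "t * \<bar>K \<beta> t\<bar> \<le> exp 1 * line_weight \<delta> * ((\<beta> + 2 * \<nu> / sector_const \<nu>) * (\<mu> powr (- 2 * \<theta>) / sector_const \<nu>)) * t powr \<delta>"
proof -
  obtain \<delta>0 M0 where D: "0 < \<delta>0" "decays \<delta>0 M0 (res \<nu> \<mu> \<beta>)" using res_decays_0[OF \<beta>] by blast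
  have r': "decays \<delta> ((\<beta> + 2 * \<nu> / sector_const \<nu>) * (\<mu> powr (- 2 * \<theta>) / sector_const \<nu>)) (res' \<nu> \<mu> \<beta>)"
    using res'_decays(2)[OF \<theta> refl \<beta>] \<delta>(1) by simp
  have "of_real t * inv_Laplace (res \<nu> \<mu> \<beta>) t = - inv_Laplace (res' \<nu> \<mu> \<beta>) t"
    by (rule inv_Laplace_mult_time[OF D(2) r' D(1) \<delta>(2) res_derivative])
  then have "Re (of_real t * inv_Laplace (res \<nu> \<mu> \<beta>) t) = Re (- inv_Laplace (res' \<nu> \<mu> \<beta>) t)" by simp
  then have "t * K \<beta> t = - Re (inv_Laplace (res' \<nu> \<mu> \<beta>) t)" by (simp add: K_def)
  then have "t * \<bar>K \<beta> t\<bar> \<le> norm (inv_Laplace (res' \<nu> \<mu> \<beta>) t)"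
    using abs_Re_le_cmod[of "inv_Laplace (res' \<nu> \<mu> \<beta>) t"] t by (metis abs_minus_cancel abs_mult abs_of_pos)
  also have "\<dots> \<le> exp 1 * line_weight \<delta> * ((\<beta> + 2 * \<nu> / sector_const \<nu>) * (\<mu> powr (- 2 * \<theta>) / sector_const \<nu>)) * t powr \<delta>"
    by (rule inv_Laplace_bound[OF r' \<delta>(2) t])
  finally show ?thesis .
qed

end

section \<open>Regularity of the mode functions\<close>

lemma Lipschitz_from_decaying_derivative:
  fixes f f' :: "real \<Rightarrow> real"
  assumes xy: "0 < x" "x \<le> y" and e: "e \<le> 0" and M: "0 \<le> M"
    and d: "\<And>t. x \<le> t \<Longrightarrow> t \<le> y \<Longrightarrow> (f has_real_derivative f' t) (at t)"
    and b: "\<And>t. x \<le> t \<Longrightarrow> t \<le> y \<Longrightarrow> \<bar>f' t\<bar> \<le> M * t powr e"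
  shows "\<bar>f y - f x\<bar> \<le> M * x powr e * (y - x)"
proof (cases "x = y")
  case False
  then have "x < y" using xy by simp
  then obtain z where z: "x < z" "z < y" "f y - f x = (y - x) * f' z"
    using MVT2[of x y f f'] d by auto
  have "\<bar>f' z\<bar> \<le> M * z powr e" using b z by simp
  also have "\<dots> \<le> M * x powr e" using z xy e M by (intro mult_left_mono powr_mono2') auto
  finally have "(y - x) * \<bar>f' z\<bar> \<le> (y - x) * (M * x powr e)" using xy by (intro mult_left_mono) auto
  then show ?thesis using z(3) xy by (simp add: abs_mult mult.commute)
qed simp

lemma omega_derivative:
  assumes "0 < t" "0 < p"
  shows "(omega (p + 1) has_real_derivative omega p t) (at t)"
proof -
  have "((\<lambda>t. t powr p / Gamma (p + 1)) has_real_derivative p * t powr (p - 1) / Gamma (p + 1)) (at t)"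
    by (intro DERIV_cdivide has_real_derivative_powr assms)
  moreover have "p * t powr (p - 1) / Gamma (p + 1) = omega p t"
    using assms Gamma_plus1[of p] by (simp add: omega_def nonpos_Ints_def)
  ultimately show ?thesis by (simp add: omega_def[abs_def])
qed

lemma omega_continuous:
  assumes "1 < p" shows "continuous_on {0..} (omega p)"
proof -
  have "0 < Gamma p" by (rule Gamma_real_pos) (use assms in simp)
  then have "Gamma p \<noteq> 0" by simp
  then show ?thesis
    unfolding omega_def[abs_def] using assms
    by (intro continuous_on_divide continuous_on_powr' continuous_intros) auto
qed

text \<open>The solution of the scalar wave equation with \<open>Y 0 = 0\<close> and \<open>Y' 0 = 1\<close>, and its derivatives; below,
  its Caputo derivative \<open>V\<close> of order \<open>\<nu>\<close>.  Splitting off the terms without \<open>\<mu>\<close> leaves kernels that vanish at 0.\<close>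

definition modeY :: "real \<Rightarrow> real \<Rightarrow> real \<Rightarrow> real" where
  "modeY \<nu> \<mu> t = t - \<mu>\<^sup>2 * K \<nu> \<mu> 2 t"

definition modeY' :: "real \<Rightarrow> real \<Rightarrow> real \<Rightarrow> real" where
  "modeY' \<nu> \<mu> t = 1 - \<mu>\<^sup>2 * K \<nu> \<mu> 1 t"

definition modeY'' :: "real \<Rightarrow> real \<Rightarrow> real \<Rightarrow> real" where
  "modeY'' \<nu> \<mu> t = - (\<mu>\<^sup>2 * K \<nu> \<mu> 0 t)"

definition modeV :: "real \<Rightarrow> real \<Rightarrow> real \<Rightarrow> real" where
  "modeV \<nu> \<mu> t = omega (2 - \<nu>) t - \<mu>\<^sup>2 * K \<nu> \<mu> (2 - \<nu>) t"

definition modeV' :: "real \<Rightarrow> real \<Rightarrow> real \<Rightarrow> real" where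
  "modeV' \<nu> \<mu> t = omega (1 - \<nu>) t - \<mu>\<^sup>2 * K \<nu> \<mu> (1 - \<nu>) t"

context
  fixes \<nu> \<mu> :: real
  assumes \<nu>: "1/2 < \<nu>" "\<nu> < 1" and \<mu>: "0 < \<mu>"
begin

lemma modeY_0: "modeY \<nu> \<mu> 0 = 0"
  by (simp add: modeY_def K_0[OF \<nu> \<mu>])

lemma modeY'_0: "modeY' \<nu> \<mu> 0 = 1"
  by (simp add: modeY'_def K_0[OF \<nu> \<mu>])

lemma modeV_0: "modeV \<nu> \<mu> 0 = 0"
  using \<nu> by (simp add: modeV_def K_0[OF \<nu> \<mu>] omega_def)

lemma modeY_continuous: "continuous_on S (modeY \<nu> \<mu>)"
  unfolding modeY_def[abs_def] by (intro continuous_intros K_continuous[OF \<nu> \<mu>]) simp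

lemma modeY'_continuous: "continuous_on S (modeY' \<nu> \<mu>)"
  unfolding modeY'_def[abs_def] by (intro continuous_intros K_continuous[OF \<nu> \<mu>]) simp

lemma modeV_continuous: "continuous_on {0..T} (modeV \<nu> \<mu>)"
  unfolding modeV_def[abs_def]
  by (intro continuous_intros K_continuous[OF \<nu> \<mu>] continuous_on_subset[OF omega_continuous])
     (use \<nu> in auto)

lemma modeV'_continuous: "continuous_on {0<..T} (modeV' \<nu> \<mu>)"
proof -
  have "0 < Gamma (1 - \<nu>)" by (rule Gamma_real_pos) (use \<nu> in simp)
  then have "Gamma (1 - \<nu>) \<noteq> 0" by simp
  then show ?thesis
    unfolding modeV'_def[abs_def] omega_def
    by (intro continuous_intros K_continuous[OF \<nu> \<mu>]) (use \<nu> in auto)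
qed

lemma modeY_derivative: "0 < t \<Longrightarrow> (modeY \<nu> \<mu> has_real_derivative modeY' \<nu> \<mu> t) (at t)"
  unfolding modeY_def[abs_def] modeY'_def
  using K_derivative[OF \<nu> \<mu>, of 1 t] by (auto intro!: derivative_eq_intros)

lemma modeY'_derivative: "0 < t \<Longrightarrow> (modeY' \<nu> \<mu> has_real_derivative modeY'' \<nu> \<mu> t) (at t)"
  unfolding modeY'_def[abs_def] modeY''_def
  using K_derivative[OF \<nu> \<mu>, of 0 t] by (auto intro!: derivative_eq_intros)

lemma modeV_derivative:
  assumes "0 < t" shows "(modeV \<nu> \<mu> has_real_derivative modeV' \<nu> \<mu> t) (at t)"
proof -
  have "1 - \<nu> + 1 = 2 - \<nu>" by simp
  then show ?thesis
    unfolding modeV_def[abs_def] modeV'_def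
    using K_derivative[OF \<nu> \<mu>, of "1 - \<nu>" t] omega_derivative[of t "1 - \<nu>"] \<nu> assms
    by (intro DERIV_diff DERIV_cmult) auto
qed

lemma modeY_caputo:
  assumes t: "0 < t"
  shows "(LINT s:{0<..<t}|lborel. omega (1 - \<nu>) (t - s) * modeY' \<nu> \<mu> s) = modeV \<nu> \<mu> t"
proof -
  have c: "set_integrable lborel {0<..<t} (\<lambda>s. omega (1 - \<nu>) (t - s) * omega 1 s)"
    "(LINT s:{0<..<t}|lborel. omega (1 - \<nu>) (t - s) * omega 1 s) = omega (1 - \<nu> + 1) t"
    using omega_convolution[of "1 - \<nu>" 1 t] \<nu> t by auto
  have k: "set_integrable lborel {0<..<t} (\<lambda>s. omega (1 - \<nu>) (t - s) * K \<nu> \<mu> 1 s)"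
    "(LINT s:{0<..<t}|lborel. omega (1 - \<nu>) (t - s) * K \<nu> \<mu> 1 s) = K \<nu> \<mu> (1 + (1 - \<nu>)) t"
    using K_convolution[OF \<nu> \<mu>, of 1 "1 - \<nu>"] \<nu> by auto
  have "(LINT s:{0<..<t}|lborel. omega (1 - \<nu>) (t - s) * modeY' \<nu> \<mu> s) =
    (LINT s:{0<..<t}|lborel. omega (1 - \<nu>) (t - s) * omega 1 s - \<mu>\<^sup>2 * (omega (1 - \<nu>) (t - s) * K \<nu> \<mu> 1 s))"
    by (rule set_lebesgue_integral_cong) (auto simp: omega_1 modeY'_def algebra_simps)
  also have "\<dots> = omega (1 - \<nu> + 1) t - \<mu>\<^sup>2 * K \<nu> \<mu> (1 + (1 - \<nu>)) t"
    by (subst set_integral_diff(2)) (use c k in \<open>auto simp: set_integral_mult_right\<close>)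
  also have "\<dots> = modeV \<nu> \<mu> t" by (simp add: modeV_def algebra_simps)
  finally show ?thesis .
qed

lemma modeY_eq_K: "0 < t \<Longrightarrow> modeY \<nu> \<mu> t = K \<nu> \<mu> (2 - 2 * \<nu>) t"
  using K_identity[OF \<nu> \<mu>, of t] by (simp add: modeY_def)

text \<open>The splitting of the equation of order \<open>2 * \<nu>\<close> into two of order \<open>\<nu>\<close>, which the scheme imitates.\<close>

lemma modeV_caputo:
  assumes t: "0 < t"
  shows "(LINT s:{0<..<t}|lborel. omega (1 - \<nu>) (t - s) * modeV' \<nu> \<mu> s) = omega (2 - 2 * \<nu>) t - \<mu>\<^sup>2 * modeY \<nu> \<mu> t"
proof -
  have c: "set_integrable lborel {0<..<t} (\<lambda>s. omega (1 - \<nu>) (t - s) * omega (1 - \<nu>) s)"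
    "(LINT s:{0<..<t}|lborel. omega (1 - \<nu>) (t - s) * omega (1 - \<nu>) s) = omega (1 - \<nu> + (1 - \<nu>)) t"
    using omega_convolution[of "1 - \<nu>" "1 - \<nu>" t] \<nu> t by auto
  have k: "set_integrable lborel {0<..<t} (\<lambda>s. omega (1 - \<nu>) (t - s) * K \<nu> \<mu> (1 - \<nu>) s)"
    "(LINT s:{0<..<t}|lborel. omega (1 - \<nu>) (t - s) * K \<nu> \<mu> (1 - \<nu>) s) = K \<nu> \<mu> (1 - \<nu> + (1 - \<nu>)) t"
    using K_convolution[OF \<nu> \<mu>, of "1 - \<nu>" "1 - \<nu>"] \<nu> by auto
  have "(LINT s:{0<..<t}|lborel. omega (1 - \<nu>) (t - s) * modeV' \<nu> \<mu> s) =
    (LINT s:{0<..<t}|lborel. omega (1 - \<nu>) (t - s) * omega (1 - \<nu>) s - \<mu>\<^sup>2 * (omega (1 - \<nu>) (t - s) * K \<nu> \<mu> (1 - \<nu>) s))"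
    by (rule set_lebesgue_integral_cong) (auto simp: modeV'_def algebra_simps)
  also have "\<dots> = omega (1 - \<nu> + (1 - \<nu>)) t - \<mu>\<^sup>2 * K \<nu> \<mu> (1 - \<nu> + (1 - \<nu>)) t"
    by (subst set_integral_diff(2)) (use c k in \<open>auto simp: set_integral_mult_right\<close>)
  also have "1 - \<nu> + (1 - \<nu>) = 2 - 2 * \<nu>" by simp
  finally show ?thesis by (simp add: modeY_eq_K[OF t])
qed

lemma modeY_caputo_second:
  assumes t: "0 < t"
  shows "set_integrable lborel {0<..<t} (\<lambda>s. omega (2 - 2 * \<nu>) (t - s) * modeY'' \<nu> \<mu> s)"
    and "(LINT s:{0<..<t}|lborel. omega (2 - 2 * \<nu>) (t - s) * modeY'' \<nu> \<mu> s) = - \<mu>\<^sup>2 * modeY \<nu> \<mu> t"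
proof -
  have k: "set_integrable lborel {0<..<t} (\<lambda>s. omega (2 - 2 * \<nu>) (t - s) * K \<nu> \<mu> 0 s)"
    "(LINT s:{0<..<t}|lborel. omega (2 - 2 * \<nu>) (t - s) * K \<nu> \<mu> 0 s) = K \<nu> \<mu> (0 + (2 - 2 * \<nu>)) t"
    using K_convolution[OF \<nu> \<mu>, of 0 "2 - 2 * \<nu>"] \<nu> by auto
  have eq: "omega (2 - 2 * \<nu>) (t - s) * modeY'' \<nu> \<mu> s = - \<mu>\<^sup>2 * (omega (2 - 2 * \<nu>) (t - s) * K \<nu> \<mu> 0 s)" for s
    by (simp add: modeY''_def)
  show "set_integrable lborel {0<..<t} (\<lambda>s. omega (2 - 2 * \<nu>) (t - s) * modeY'' \<nu> \<mu> s)"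
    unfolding eq by (intro set_integrable_mult_right k)
  show "(LINT s:{0<..<t}|lborel. omega (2 - 2 * \<nu>) (t - s) * modeY'' \<nu> \<mu> s) = - \<mu>\<^sup>2 * modeY \<nu> \<mu> t"
    unfolding eq set_integral_mult_right k(2) by (simp add: modeY_eq_K[OF t])
qed

lemma mode_powers: "\<mu>\<^sup>2 * \<mu> powr a = \<mu> powr (2 + a)"
  using \<mu> by (simp add: powr_add powr_numeral)

lemma modeY''_bound:
  assumes s: "s = 2 * \<nu> * \<epsilon>" "0 < \<epsilon>" "\<epsilon> \<le> 1" and t: "0 < t"
  shows "\<bar>modeY'' \<nu> \<mu> t\<bar> \<le> exp 1 * line_weight s * (2 * \<nu> / (sector_const \<nu>)\<^sup>2) * \<mu> powr (2 * \<epsilon>) * t powr (s - 1)"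
proof -
  have "t * \<bar>K \<nu> \<mu> 0 t\<bar> \<le> exp 1 * line_weight s * ((0 + 2 * \<nu> / sector_const \<nu>) * (\<mu> powr (- 2 * (1 - \<epsilon>)) / sector_const \<nu>)) * t powr s"
    by (rule K_time_weighted[OF \<nu> \<mu>]) (use s \<nu> t in auto)
  then have "t * (\<mu>\<^sup>2 * \<bar>K \<nu> \<mu> 0 t\<bar>) \<le> \<mu>\<^sup>2 * (exp 1 * line_weight s * ((0 + 2 * \<nu> / sector_const \<nu>) * (\<mu> powr (- 2 * (1 - \<epsilon>)) / sector_const \<nu>)) * t powr s)"
    using mult_left_mono[of _ _ "\<mu>\<^sup>2"] by (simp only: mult.left_commute[of t] zero_le_power2)
  also have "\<dots> = exp 1 * line_weight s * (2 * \<nu> / (sector_const \<nu>)\<^sup>2) * (\<mu>\<^sup>2 * \<mu> powr (- 2 * (1 - \<epsilon>))) * t powr s"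
    by (simp add: power2_eq_square mult_ac)
  also have "\<mu>\<^sup>2 * \<mu> powr (- 2 * (1 - \<epsilon>)) = \<mu> powr (2 * \<epsilon>)" unfolding mode_powers by simp
  finally have "t * (\<mu>\<^sup>2 * \<bar>K \<nu> \<mu> 0 t\<bar>) \<le> exp 1 * line_weight s * (2 * \<nu> / (sector_const \<nu>)\<^sup>2) * \<mu> powr (2 * \<epsilon>) * t powr s" .
  moreover have "t powr s = t * t powr (s - 1)" using t by (simp add: powr_diff)
  ultimately have "t * (\<mu>\<^sup>2 * \<bar>K \<nu> \<mu> 0 t\<bar>) \<le> t * (exp 1 * line_weight s * (2 * \<nu> / (sector_const \<nu>)\<^sup>2) * \<mu> powr (2 * \<epsilon>) * t powr (s - 1))"
    by (simp only: mult_ac)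
  then have "\<mu>\<^sup>2 * \<bar>K \<nu> \<mu> 0 t\<bar> \<le> exp 1 * line_weight s * (2 * \<nu> / (sector_const \<nu>)\<^sup>2) * \<mu> powr (2 * \<epsilon>) * t powr (s - 1)"
    using t by (rule mult_left_le_imp_le)
  then show ?thesis by (simp add: modeY''_def abs_mult)
qed

lemma modeY'_bound:
  assumes s: "s = 2 * \<nu> * \<epsilon>" "0 < \<epsilon>" "\<epsilon> \<le> 1" and t: "0 < t"
  shows "\<bar>modeY' \<nu> \<mu> t - 1\<bar> \<le> exp 1 * line_weight s / sector_const \<nu> * \<mu> powr (2 * \<epsilon>) * t powr s"
proof -
  have "\<bar>K \<nu> \<mu> 1 t\<bar> \<le> exp 1 * line_weight s / sector_const \<nu> * \<mu> powr (- 2 * (1 - \<epsilon>)) * t powr s"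
    by (rule K_bound[OF \<nu> \<mu>]) (use s \<nu> t in auto)
  then have "\<mu>\<^sup>2 * \<bar>K \<nu> \<mu> 1 t\<bar> \<le> \<mu>\<^sup>2 * (exp 1 * line_weight s / sector_const \<nu> * \<mu> powr (- 2 * (1 - \<epsilon>)) * t powr s)"
    by (rule mult_left_mono) simp
  also have "\<dots> = exp 1 * line_weight s / sector_const \<nu> * (\<mu>\<^sup>2 * \<mu> powr (- 2 * (1 - \<epsilon>))) * t powr s"
    by (simp only: mult_ac)
  also have "\<mu>\<^sup>2 * \<mu> powr (- 2 * (1 - \<epsilon>)) = \<mu> powr (2 * \<epsilon>)" unfolding mode_powers by simp
  finally show ?thesis by (simp add: modeY'_def abs_mult)
qed

lemma K_half_bound:
  assumes s: "s = 2 * \<nu> * \<epsilon>" "0 < \<epsilon>" "\<epsilon> \<le> 1/2" and t: "0 < t"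
  shows "\<mu>\<^sup>2 * \<bar>K \<nu> \<mu> (1 - \<nu>) t\<bar> \<le> exp 1 * line_weight s / sector_const \<nu> * \<mu> powr (1 + 2 * \<epsilon>) * t powr s"
proof -
  have "\<bar>K \<nu> \<mu> (1 - \<nu>) t\<bar> \<le> exp 1 * line_weight s / sector_const \<nu> * \<mu> powr (- 2 * (1/2 - \<epsilon>)) * t powr s"
    by (rule K_bound[OF \<nu> \<mu>]) (use s \<nu> t in \<open>auto simp: algebra_simps\<close>)
  then have "\<mu>\<^sup>2 * \<bar>K \<nu> \<mu> (1 - \<nu>) t\<bar> \<le> \<mu>\<^sup>2 * (exp 1 * line_weight s / sector_const \<nu> * \<mu> powr (- 2 * (1/2 - \<epsilon>)) * t powr s)"
    by (rule mult_left_mono) simp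
  also have "\<dots> = exp 1 * line_weight s / sector_const \<nu> * (\<mu>\<^sup>2 * \<mu> powr (- 2 * (1/2 - \<epsilon>))) * t powr s"
    by (simp only: mult_ac)
  also have "\<mu>\<^sup>2 * \<mu> powr (- 2 * (1/2 - \<epsilon>)) = \<mu> powr (1 + 2 * \<epsilon>)" unfolding mode_powers by simp
  finally show ?thesis .
qed

text \<open>The symbol \<open>p * res \<nu> \<mu> (1 - \<nu>) p\<close> of the derivative does not have an integrable bound with the power of
  \<open>\<mu>\<close> needed here.  Therefore the kernel is written as the transform of \<open>- res'\<close> divided by \<open>t\<close> and differentiated by
  the quotient rule.\<close>

lemma K_half_derivative:
  assumes s: "s = 2 * \<nu> * \<epsilon>" "0 < \<epsilon>" "\<epsilon> \<le> 1/2" and t: "0 < t"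
  shows "\<exists>D. (K \<nu> \<mu> (1 - \<nu>) has_real_derivative D) (at t) \<and>
    \<mu>\<^sup>2 * \<bar>D\<bar> \<le> (exp 1 * line_weight s / sector_const \<nu>) * (2 - \<nu> + 2 * \<nu> / sector_const \<nu>) * \<mu> powr (1 + 2 * \<epsilon>) * t powr (s - 1)"
proof -
  define \<beta> where "\<beta> = 1 - \<nu>"
  have \<beta>: "0 \<le> \<beta>" using \<nu> by (simp add: \<beta>_def)
  have sd: "s = \<beta> + 2 * \<nu> * (1 - (1/2 - \<epsilon>)) - 1" and s0: "0 < s"
    using s \<nu> by (auto simp: \<beta>_def algebra_simps)
  have \<theta>: "0 \<le> 1/2 - \<epsilon>" "1/2 - \<epsilon> \<le> 1" using s by auto
  define W where "W = (\<beta> + 2 * \<nu> / sector_const \<nu>) * (\<mu> powr (- 2 * (1/2 - \<epsilon>)) / sector_const \<nu>)"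
  have D1: "decays s W (\<lambda>p. p * res' \<nu> \<mu> \<beta> p)" and D2: "decays (1 + s) W (res' \<nu> \<mu> \<beta>)"
    unfolding W_def using res'_decays[OF \<nu> \<mu> \<theta> sd \<beta>] by auto
  note D0 = res_decays[OF \<nu> \<mu> \<theta> sd]
  define A where "A x = Re (inv_Laplace (res' \<nu> \<mu> \<beta>) x)" for x
  define B where "B x = Re (inv_Laplace (\<lambda>p. p * res' \<nu> \<mu> \<beta> p) x)" for x
  have KA: "K \<nu> \<mu> \<beta> x = - A x / x" if x: "0 < x" for x
  proof -
    have "of_real x * inv_Laplace (res \<nu> \<mu> \<beta>) x = - inv_Laplace (res' \<nu> \<mu> \<beta>) x"
      by (rule inv_Laplace_mult_time[OF D0 D2 s0 _ res_derivative[OF \<nu> \<mu>]]) (use s0 in auto)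
    then have "Re (of_real x * inv_Laplace (res \<nu> \<mu> \<beta>) x) = Re (- inv_Laplace (res' \<nu> \<mu> \<beta>) x)" by simp
    then have "x * K \<nu> \<mu> \<beta> x = - A x" by (simp add: K_def[OF \<nu> \<mu>] A_def)
    then show ?thesis using x by (simp add: field_simps)
  qed
  have dA: "(A has_real_derivative B t) (at t)"
    unfolding A_def[abs_def] B_def
    by (rule inv_Laplace_antiderivative[OF D1 s0 _ t]) auto
  have "((\<lambda>x. - A x / x) has_real_derivative (- B t * t - - A t * 1) / (t * t)) (at t)"
    using t by (intro DERIV_divide DERIV_minus dA DERIV_ident) auto
  also have "(- B t * t - - A t * 1) / (t * t) = (- B t - K \<nu> \<mu> \<beta> t) / t"
    using t KA[OF t] by (simp add: field_simps)
  finally have "((\<lambda>x. - A x / x) has_real_derivative (- B t - K \<nu> \<mu> \<beta> t) / t) (at t)" .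
  then have dK: "(K \<nu> \<mu> \<beta> has_real_derivative (- B t - K \<nu> \<mu> \<beta> t) / t) (at t)"
    by (rule has_field_derivative_transform_within_open[where S = "{0<..}"]) (use t KA in auto)
  define c where "c = exp 1 * line_weight s / sector_const \<nu>"
  have "\<bar>B t\<bar> \<le> norm (inv_Laplace (\<lambda>p. p * res' \<nu> \<mu> \<beta> p) t)" unfolding B_def by (rule abs_Re_le_cmod)
  also have "\<dots> \<le> exp 1 * line_weight s * W * t powr s" by (rule inv_Laplace_bound[OF D1 s0 t])
  finally have "\<mu>\<^sup>2 * \<bar>B t\<bar> \<le> \<mu>\<^sup>2 * (exp 1 * line_weight s * W * t powr s)" by (rule mult_left_mono) simp
  also have "\<dots> = c * (\<beta> + 2 * \<nu> / sector_const \<nu>) * (\<mu>\<^sup>2 * \<mu> powr (- 2 * (1/2 - \<epsilon>))) * t powr s"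
    by (simp add: W_def c_def)
  also have "\<mu>\<^sup>2 * \<mu> powr (- 2 * (1/2 - \<epsilon>)) = \<mu> powr (1 + 2 * \<epsilon>)" unfolding mode_powers by simp
  finally have Bb: "\<mu>\<^sup>2 * \<bar>B t\<bar> \<le> c * (\<beta> + 2 * \<nu> / sector_const \<nu>) * \<mu> powr (1 + 2 * \<epsilon>) * t powr s" .
  have Kb: "\<mu>\<^sup>2 * \<bar>K \<nu> \<mu> \<beta> t\<bar> \<le> c * \<mu> powr (1 + 2 * \<epsilon>) * t powr s"
    unfolding \<beta>_def c_def by (rule K_half_bound[OF s t])
  have "\<mu>\<^sup>2 * \<bar>(- B t - K \<nu> \<mu> \<beta> t) / t\<bar> \<le> (\<mu>\<^sup>2 * \<bar>B t\<bar> + \<mu>\<^sup>2 * \<bar>K \<nu> \<mu> \<beta> t\<bar>) / t"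
  proof -
    have "\<bar>- B t - K \<nu> \<mu> \<beta> t\<bar> \<le> \<bar>B t\<bar> + \<bar>K \<nu> \<mu> \<beta> t\<bar>" by linarith
    then have "\<mu>\<^sup>2 * \<bar>- B t - K \<nu> \<mu> \<beta> t\<bar> \<le> \<mu>\<^sup>2 * (\<bar>B t\<bar> + \<bar>K \<nu> \<mu> \<beta> t\<bar>)" by (rule mult_left_mono) simp
    then have "\<mu>\<^sup>2 * \<bar>- B t - K \<nu> \<mu> \<beta> t\<bar> / t \<le> \<mu>\<^sup>2 * (\<bar>B t\<bar> + \<bar>K \<nu> \<mu> \<beta> t\<bar>) / t"
      using t by (intro divide_right_mono) auto
    then show ?thesis using t by (simp add: abs_divide distrib_left)
  qed
  also have "\<dots> \<le> (c * (\<beta> + 2 * \<nu> / sector_const \<nu>) * \<mu> powr (1 + 2 * \<epsilon>) * t powr s + c * \<mu> powr (1 + 2 * \<epsilon>) * t powr s) / t"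
    using Bb Kb t by (intro divide_right_mono add_mono) auto
  also have "\<dots> = c * (2 - \<nu> + 2 * \<nu> / sector_const \<nu>) * \<mu> powr (1 + 2 * \<epsilon>) * t powr (s - 1)"
  proof -
    have "(a * (\<beta> + b) * x * y + a * x * y) / t = a * (2 - \<nu> + b) * x * (y / t)" for a b x y :: real
      using t by (simp add: \<beta>_def field_simps)
    moreover have "t powr (s - 1) = t powr s / t" using t by (simp add: powr_diff)
    ultimately show ?thesis by simp
  qed
  finally show ?thesis using dK unfolding \<beta>_def c_def by blast
qed

end

text \<open>The bounds have the form required by the truncation estimate, with \<open>\<sigma> = 1 + s\<close> for \<open>Y\<close> and
  \<open>\<sigma> = 1 - \<nu>\<close> for \<open>V\<close>, and are uniform in \<open>\<mu>\<close> up to explicit powers.  In the energy \<open>Y\<close> is multiplied by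
  \<open>\<mu>\<close>, after which both are controlled by the weight \<open>\<mu> powr (1 + 2 * \<epsilon>)\<close>, that is \<open>\<lambda> powr (1/2 + \<epsilon>)\<close>.\<close>

theorem mode_regularity:
  fixes \<nu> \<epsilon> T s :: real
  assumes \<nu>: "1/2 < \<nu>" "\<nu> < 1" and \<epsilon>: "0 < \<epsilon>" "\<epsilon> \<le> 1/2" and s: "s = 2 * \<nu> * \<epsilon>" and T: "0 < T"
  shows "\<exists>C\<ge>0. \<forall>\<mu>>0.
     (\<forall>t\<in>{0<..T}. \<bar>modeY' \<nu> \<mu> t - 1\<bar> \<le> C * \<mu> powr (2 * \<epsilon>) * t powr s) \<and>
     (\<forall>x\<in>{0<..T}. \<forall>y\<in>{x..T}. \<bar>modeY' \<nu> \<mu> y - modeY' \<nu> \<mu> x\<bar> \<le> C * \<mu> powr (2 * \<epsilon>) * x powr (s - 1) * (y - x)) \<and>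
     (\<forall>t\<in>{0<..T}. \<bar>modeV' \<nu> \<mu> t\<bar> \<le> C * (1 + \<mu> powr (1 + 2 * \<epsilon>)) * t powr (- \<nu>)) \<and>
     (\<forall>x\<in>{0<..T}. \<forall>y\<in>{x..T}. \<bar>modeV' \<nu> \<mu> y - modeV' \<nu> \<mu> x\<bar> \<le> C * (1 + \<mu> powr (1 + 2 * \<epsilon>)) * x powr (- \<nu> - 1) * (y - x))"
proof -
  have s1: "0 < s" "s \<le> 1"
  proof -
    show "0 < s" using \<nu> \<epsilon> by (simp add: s)
    have "2 * \<nu> * \<epsilon> \<le> 2 * 1 * (1/2)" using \<nu> \<epsilon> by (intro mult_mono) auto
    then show "s \<le> 1" by (simp add: s)
  qed
  have \<epsilon>1: "\<epsilon> \<le> 1" using \<epsilon> by simp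
  define c where "c = exp 1 * line_weight s / sector_const \<nu>"
  define C1 where "C1 = exp 1 * line_weight s * (2 * \<nu> / (sector_const \<nu>)\<^sup>2)"
  define C3 where "C3 = c * (2 - \<nu> + 2 * \<nu> / sector_const \<nu>)"
  define G where "G = Gamma (1 - \<nu>)"
  \<comment> \<open>\<open>P\<close> converts powers \<open>t powr s\<close> into the more singular \<open>t powr (- \<nu>)\<close> on the bounded interval.\<close>
  define P where "P = T powr (s + \<nu>)"
  define C where "C = C1 + c + (1 / G + c * P) + (\<nu> / G + C3 * P)"
  have sc: "0 < sector_const \<nu>" using sector_const_pos \<nu> by simp
  have G: "0 < G" using \<nu> by (simp add: G_def)
  have nn: "0 \<le> c" "0 \<le> C1" "0 \<le> C3" "0 \<le> P" "0 \<le> 1 / G" "0 \<le> \<nu> / G"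
    using sc \<nu> G line_weight_nonneg[of s] by (auto simp: c_def C1_def C3_def P_def)
  have nn2: "0 \<le> c * P" "0 \<le> C3 * P" using nn by auto
  have CC: "0 \<le> C" "C1 \<le> C" "c \<le> C" "1 / G + c * P \<le> C" "\<nu> / G + C3 * P \<le> C"
    unfolding C_def using nn nn2 by linarith+
  have absorb: "a + b * q \<le> (a + b) * (1 + q)" if "0 \<le> a" "0 \<le> b" "0 \<le> q" for a b q :: real
  proof -
    have "(a + b) * (1 + q) = (a + b * q) + (b + a * q)" by (simp add: algebra_simps)
    then show ?thesis using that mult_nonneg_nonneg[of a q] by simp
  qed
  have Pt: "t powr (s + e) \<le> P * t powr (- \<nu> + e)" if "0 < t" "t \<le> T" for t e
  proof -
    have "t powr (s + e) = t powr (s + \<nu>) * t powr (- \<nu> + e)" by (simp add: powr_add[symmetric])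
    also have "\<dots> \<le> P * t powr (- \<nu> + e)"
      unfolding P_def using that s1 \<nu> by (intro mult_right_mono powr_mono2) auto
    finally show ?thesis .
  qed
  show ?thesis
  proof (intro exI[of _ C] conjI allI impI ballI CC(1))
    fix \<mu> t :: real assume \<mu>: "0 < \<mu>" and t: "t \<in> {0<..T}"
    have "\<bar>modeY' \<nu> \<mu> t - 1\<bar> \<le> c * \<mu> powr (2 * \<epsilon>) * t powr s"
      unfolding c_def using modeY'_bound[OF \<nu> \<mu> s \<epsilon>(1) \<epsilon>1] t by simp
    also have "\<dots> \<le> C * \<mu> powr (2 * \<epsilon>) * t powr s" using CC by (intro mult_right_mono) auto
    finally show "\<bar>modeY' \<nu> \<mu> t - 1\<bar> \<le> C * \<mu> powr (2 * \<epsilon>) * t powr s" .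
  next
    fix \<mu> x y :: real assume \<mu>: "0 < \<mu>" and x: "x \<in> {0<..T}" and y: "y \<in> {x..T}"
    show "\<bar>modeY' \<nu> \<mu> y - modeY' \<nu> \<mu> x\<bar> \<le> C * \<mu> powr (2 * \<epsilon>) * x powr (s - 1) * (y - x)"
    proof (rule Lipschitz_from_decaying_derivative[where f' = "modeY'' \<nu> \<mu>"])
      fix t assume t: "x \<le> t" "t \<le> y"
      show "(modeY' \<nu> \<mu> has_real_derivative modeY'' \<nu> \<mu> t) (at t)"
        using modeY'_derivative[OF \<nu> \<mu>, of t] x t by simp
      have "\<bar>modeY'' \<nu> \<mu> t\<bar> \<le> C1 * \<mu> powr (2 * \<epsilon>) * t powr (s - 1)"
        unfolding C1_def using modeY''_bound[OF \<nu> \<mu> s \<epsilon>(1) \<epsilon>1, of t] t x by simp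
      also have "\<dots> \<le> C * \<mu> powr (2 * \<epsilon>) * t powr (s - 1)" using CC by (intro mult_right_mono) auto
      finally show "\<bar>modeY'' \<nu> \<mu> t\<bar> \<le> C * \<mu> powr (2 * \<epsilon>) * t powr (s - 1)" .
    qed (use x y s1 CC in auto)
  next
    fix \<mu> t :: real assume \<mu>: "0 < \<mu>" and t: "t \<in> {0<..T}"
    define Q where "Q = \<mu> powr (1 + 2 * \<epsilon>)"
    have Q: "0 \<le> Q" by (simp add: Q_def)
    have o: "0 \<le> omega (1 - \<nu>) t" using \<nu> by (intro omega_nonneg) simp
    have "\<bar>modeV' \<nu> \<mu> t\<bar> \<le> omega (1 - \<nu>) t + \<mu>\<^sup>2 * \<bar>K \<nu> \<mu> (1 - \<nu>) t\<bar>"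
      unfolding modeV'_def using o abs_triangle_ineq4[of "omega (1 - \<nu>) t" "\<mu>\<^sup>2 * K \<nu> \<mu> (1 - \<nu>) t"]
      by (simp add: abs_mult)
    also have "\<mu>\<^sup>2 * \<bar>K \<nu> \<mu> (1 - \<nu>) t\<bar> \<le> c * Q * t powr s"
      unfolding c_def Q_def using K_half_bound[OF \<nu> \<mu> s \<epsilon>, of t] t by simp
    also have "c * Q * t powr s \<le> c * Q * (P * t powr (- \<nu>))"
      using Pt[of t 0] t nn Q by (intro mult_left_mono) auto
    also have "omega (1 - \<nu>) t = 1 / G * t powr (- \<nu>)" by (simp add: omega_def G_def)
    also have "1 / G * t powr (- \<nu>) + c * Q * (P * t powr (- \<nu>)) \<le> (1 / G + c * P) * (1 + Q) * t powr (- \<nu>)"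
    proof -
      have "(1 / G + c * P * Q) * t powr (- \<nu>) \<le> ((1 / G + c * P) * (1 + Q)) * t powr (- \<nu>)"
        using absorb[OF nn(5) nn2(1) Q] by (intro mult_right_mono) auto
      then show ?thesis by (simp add: algebra_simps)
    qed
    also have "\<dots> \<le> C * (1 + Q) * t powr (- \<nu>)" using CC Q by (intro mult_right_mono) auto
    finally show "\<bar>modeV' \<nu> \<mu> t\<bar> \<le> C * (1 + \<mu> powr (1 + 2 * \<epsilon>)) * t powr (- \<nu>)" by (simp add: Q_def)
  next
    fix \<mu> x y :: real assume \<mu>: "0 < \<mu>" and x: "x \<in> {0<..T}" and y: "y \<in> {x..T}"
    define Q where "Q = \<mu> powr (1 + 2 * \<epsilon>)"
    have Q: "0 \<le> Q" by (simp add: Q_def)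
    define D where "D t = (SOME D. (K \<nu> \<mu> (1 - \<nu>) has_real_derivative D) (at t) \<and>
      \<mu>\<^sup>2 * \<bar>D\<bar> \<le> C3 * \<mu> powr (1 + 2 * \<epsilon>) * t powr (s - 1))" for t
    have D: "(K \<nu> \<mu> (1 - \<nu>) has_real_derivative D t) (at t)" "\<mu>\<^sup>2 * \<bar>D t\<bar> \<le> C3 * Q * t powr (s - 1)" if "0 < t" for t
      using someI_ex[OF K_half_derivative[OF \<nu> \<mu> s \<epsilon> that]] unfolding D_def C3_def c_def Q_def by auto
    show "\<bar>modeV' \<nu> \<mu> y - modeV' \<nu> \<mu> x\<bar> \<le> C * (1 + \<mu> powr (1 + 2 * \<epsilon>)) * x powr (- \<nu> - 1) * (y - x)"
      unfolding Q_def[symmetric]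
    proof (rule Lipschitz_from_decaying_derivative[where f' = "\<lambda>t. - \<nu> * t powr (- \<nu> - 1) / G - \<mu>\<^sup>2 * D t"])
      fix t assume t: "x \<le> t" "t \<le> y"
      have t0: "0 < t" "t \<le> T" using t x y by auto
      show "(modeV' \<nu> \<mu> has_real_derivative - \<nu> * t powr (- \<nu> - 1) / G - \<mu>\<^sup>2 * D t) (at t)"
      proof -
        have "(omega (1 - \<nu>) has_real_derivative - \<nu> * t powr (- \<nu> - 1) / G) (at t)"
          using DERIV_cdivide[OF has_real_derivative_powr[OF t0(1), of "- \<nu>"], of G]
          by (simp add: omega_def[abs_def] G_def)
        then show ?thesis unfolding modeV'_def[abs_def] by (intro DERIV_diff DERIV_cmult D t0)
      qed
      have "\<bar>- \<nu> * t powr (- \<nu> - 1) / G - \<mu>\<^sup>2 * D t\<bar> \<le> \<bar>- \<nu> * t powr (- \<nu> - 1) / G\<bar> + \<bar>\<mu>\<^sup>2 * D t\<bar>"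
        by (rule abs_triangle_ineq4)
      also have "\<bar>- \<nu> * t powr (- \<nu> - 1) / G\<bar> = \<nu> / G * t powr (- \<nu> - 1)"
        using G \<nu> by (simp add: abs_mult)
      also have "\<bar>\<mu>\<^sup>2 * D t\<bar> = \<mu>\<^sup>2 * \<bar>D t\<bar>" by (simp add: abs_mult)
      also have "\<mu>\<^sup>2 * \<bar>D t\<bar> \<le> C3 * Q * t powr (s - 1)" using D(2) t0 by simp
      also have "C3 * Q * t powr (s - 1) \<le> C3 * Q * (P * t powr (- \<nu> - 1))"
        using Pt[OF t0, of "-1"] nn Q by (intro mult_left_mono) auto
      also have "\<nu> / G * t powr (- \<nu> - 1) + C3 * Q * (P * t powr (- \<nu> - 1)) \<le> (\<nu> / G + C3 * P) * (1 + Q) * t powr (- \<nu> - 1)"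
      proof -
        have "(\<nu> / G + C3 * P * Q) * t powr (- \<nu> - 1) \<le> ((\<nu> / G + C3 * P) * (1 + Q)) * t powr (- \<nu> - 1)"
          using absorb[OF nn(6) nn2(2) Q] by (intro mult_right_mono) auto
        then show ?thesis by (simp add: algebra_simps)
      qed
      also have "\<dots> \<le> C * (1 + Q) * t powr (- \<nu> - 1)" using CC Q by (intro mult_right_mono) auto
      finally show "\<bar>- \<nu> * t powr (- \<nu> - 1) / G - \<mu>\<^sup>2 * D t\<bar> \<le> C * (1 + Q) * t powr (- \<nu> - 1)" by simp
    qed (use x y \<nu> CC Q in auto)
  qed
qed

section \<open>The error of a single mode\<close>

lemma L1_diff_complex:
  "L1_diff \<nu> t (\<lambda>k. complex_of_real (v k) + c * of_real (u k)) n
    = of_real (L1_diff \<nu> t v n) + c * of_real (L1_diff \<nu> t u n)"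
proof -
  have "L1_coeff \<nu> t n k *\<^sub>R (complex_of_real (v k) + c * of_real (u k) - (complex_of_real (v (k - 1)) + c * of_real (u (k - 1))))
      = of_real (L1_coeff \<nu> t n k *\<^sub>R (v k - v (k - 1))) + c * of_real (L1_coeff \<nu> t n k *\<^sub>R (u k - u (k - 1)))" for k
    by (simp add: scaleR_conv_of_real algebra_simps)
  then show ?thesis by (simp add: L1_diff_def sum.distrib sum_distrib_left)
qed

lemma L1_diff_lincomb:
  fixes v u :: "nat \<Rightarrow> real"
  shows "L1_diff \<nu> t (\<lambda>k. a * v k - u k) n = a * L1_diff \<nu> t v n - L1_diff \<nu> t u n"
  unfolding L1_diff_def sum_distrib_left sum_subtractf[symmetric]
  by (intro sum.cong refl) (simp add: algebra_simps)

text \<open>The errors \<open>v\<close> and \<open>u\<close> of the two components satisfy \<open>D v = - \<mu>\<^sup>2 * u\<close> and \<open>D u = v\<close> up to truncation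
  errors, where \<open>D\<close> is the L1 operator.  For \<open>W = v + \<i> * \<mu> * u\<close> this is the skew equation
  \<open>D W = \<i> * \<mu> * W + R\<close>, and the square of the modulus of \<open>W\<close> is the energy on the left of the claim.\<close>

theorem mode_error:
  fixes \<nu> \<epsilon> T r q :: real
  assumes \<nu>: "1/2 < \<nu>" "\<nu> < 1" and \<epsilon>: "0 < \<epsilon>" "\<epsilon> \<le> 1/2" and T: "0 < T" and r: "1 \<le> r"
    and q: "q \<le> r * (1 - \<nu>)" "q \<le> 2 - \<nu>"
  shows "\<exists>C\<ge>0. \<forall>N \<mu> a U V n. 1 \<le> n \<longrightarrow> n \<le> N \<longrightarrow> 0 < \<mu> \<longrightarrow> U 0 = 0 \<longrightarrow> V 0 = 0 \<longrightarrow>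
     (\<forall>n\<in>{1..N}. L1_diff \<nu> (graded_mesh T r N) V n + \<mu>\<^sup>2 * U n = a * omega (2 - 2 * \<nu>) (graded_mesh T r N n)) \<longrightarrow>
     (\<forall>n\<in>{1..N}. V n = L1_diff \<nu> (graded_mesh T r N) U n) \<longrightarrow>
     (a * modeV \<nu> \<mu> (graded_mesh T r N n) - V n)\<^sup>2 + \<mu>\<^sup>2 * (a * modeY \<nu> \<mu> (graded_mesh T r N n) - U n)\<^sup>2
       \<le> (C * (1 + \<mu> powr (1 + 2 * \<epsilon>)) * real N powr (- q) * \<bar>a\<bar>)\<^sup>2"
proof -
  have \<nu>0: "0 < \<nu>" using \<nu> by simp
  define s where "s = 2 * \<nu> * \<epsilon>"
  have s: "0 < s" "s \<le> 1"
  proof -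
    show "0 < s" using \<nu> \<epsilon> by (simp add: s_def)
    have "2 * \<nu> * \<epsilon> \<le> 2 * 1 * (1/2)" using \<nu> \<epsilon> by (intro mult_mono) auto
    then show "s \<le> 1" by (simp add: s_def)
  qed
  obtain C1 where C1: "0 \<le> C1" and trunc1: "\<And>N w w' b M m. 1 \<le> m \<Longrightarrow> m \<le> N \<Longrightarrow> 0 \<le> M \<Longrightarrow>
    continuous_on {0..T} w \<Longrightarrow> continuous_on {0<..T} w' \<Longrightarrow>
    (\<forall>s\<in>{0<..T}. (w has_real_derivative w' s) (at s)) \<Longrightarrow>
    (\<forall>s\<in>{0<..T}. \<bar>w' s - b\<bar> \<le> M * s powr (1 - \<nu> - 1)) \<Longrightarrow>
    (\<forall>x\<in>{0<..T}. \<forall>y\<in>{x..T}. \<bar>w' y - w' x\<bar> \<le> M * x powr (1 - \<nu> - 2) * (y - x)) \<Longrightarrow>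
    graded_mesh T r N m powr \<nu> * \<bar>L1_error \<nu> (graded_mesh T r N) w w' m\<bar> \<le> C1 * M * real N powr (- q)"
    using L1_truncation[OF \<nu>0 \<nu>(2) r T, of "1 - \<nu>" q] \<nu> q by auto
  have q': "q \<le> r * (1 + s)"
  proof -
    have "r * (1 - \<nu>) \<le> r * (1 + s)" using r s \<nu> by (intro mult_left_mono) auto
    then show ?thesis using q by simp
  qed
  obtain C2 where C2: "0 \<le> C2" and trunc2: "\<And>N w w' b M m. 1 \<le> m \<Longrightarrow> m \<le> N \<Longrightarrow> 0 \<le> M \<Longrightarrow>
    continuous_on {0..T} w \<Longrightarrow> continuous_on {0<..T} w' \<Longrightarrow>
    (\<forall>s\<in>{0<..T}. (w has_real_derivative w' s) (at s)) \<Longrightarrow>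
    (\<forall>x\<in>{0<..T}. \<bar>w' x - b\<bar> \<le> M * x powr (1 + s - 1)) \<Longrightarrow>
    (\<forall>x\<in>{0<..T}. \<forall>y\<in>{x..T}. \<bar>w' y - w' x\<bar> \<le> M * x powr (1 + s - 2) * (y - x)) \<Longrightarrow>
    graded_mesh T r N m powr \<nu> * \<bar>L1_error \<nu> (graded_mesh T r N) w w' m\<bar> \<le> C2 * M * real N powr (- q)"
    using L1_truncation[OF \<nu>0 \<nu>(2) r T, of "1 + s" q] s q q' by auto
  obtain C3 where C3: "0 \<le> C3" and reg: "\<And>\<mu>. 0 < \<mu> \<Longrightarrow>
     (\<forall>t\<in>{0<..T}. \<bar>modeY' \<nu> \<mu> t - 1\<bar> \<le> C3 * \<mu> powr (2 * \<epsilon>) * t powr s) \<and>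
     (\<forall>x\<in>{0<..T}. \<forall>y\<in>{x..T}. \<bar>modeY' \<nu> \<mu> y - modeY' \<nu> \<mu> x\<bar> \<le> C3 * \<mu> powr (2 * \<epsilon>) * x powr (s - 1) * (y - x)) \<and>
     (\<forall>t\<in>{0<..T}. \<bar>modeV' \<nu> \<mu> t\<bar> \<le> C3 * (1 + \<mu> powr (1 + 2 * \<epsilon>)) * t powr (- \<nu>)) \<and>
     (\<forall>x\<in>{0<..T}. \<forall>y\<in>{x..T}. \<bar>modeV' \<nu> \<mu> y - modeV' \<nu> \<mu> x\<bar> \<le> C3 * (1 + \<mu> powr (1 + 2 * \<epsilon>)) * x powr (- \<nu> - 1) * (y - x))"
    using mode_regularity[OF \<nu> \<epsilon> s_def T] by blast
  define G where "G = Gamma (1 - \<nu>)"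
  have G: "0 < G" using \<nu> by (simp add: G_def)
  define C where "C = G * ((C1 + C2) * C3)"
  have C: "0 \<le> C" using C1 C2 C3 G by (simp add: C_def)
  show ?thesis
  proof (intro exI[of _ C] conjI allI impI C)
    fix N n :: nat and \<mu> a :: real and U V :: "nat \<Rightarrow> real"
    assume n: "1 \<le> n" "n \<le> N" and \<mu>: "0 < \<mu>" and U0: "U 0 = 0" and V0: "V 0 = 0"
      and eqV: "\<forall>n\<in>{1..N}. L1_diff \<nu> (graded_mesh T r N) V n + \<mu>\<^sup>2 * U n = a * omega (2 - 2 * \<nu>) (graded_mesh T r N n)"
      and eqU: "\<forall>n\<in>{1..N}. V n = L1_diff \<nu> (graded_mesh T r N) U n"
    define t where "t = graded_mesh T r N"
    have N1: "1 \<le> N" using n by simp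
    have t0: "t 0 = 0" using r by (simp add: t_def)
    have tmono: "strict_mono t" unfolding t_def using graded_mesh_strict_mono[of T r N] T r N1 by simp
    have tpos: "0 < t k" if "1 \<le> k" for k unfolding t_def using graded_mesh_pos T N1 that by blast
    define Q where "Q = \<mu> powr (1 + 2 * \<epsilon>)"
    have Q: "0 \<le> Q" by (simp add: Q_def)
    define eY where "eY m = L1_error \<nu> t (modeY \<nu> \<mu>) (modeY' \<nu> \<mu>) m" for m
    define eV where "eV m = L1_error \<nu> t (modeV \<nu> \<mu>) (modeV' \<nu> \<mu>) m" for m
    define NQ where "NQ = real N powr (- q)"
    have NQ: "0 \<le> NQ" by (simp add: NQ_def)
    have eV: "t m powr \<nu> * \<bar>eV m\<bar> \<le> C1 * (C3 * (1 + Q)) * NQ" if m: "1 \<le> m" "m \<le> N" for m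
      unfolding eV_def t_def NQ_def
    proof (rule trunc1[where b = 0])
      show "\<forall>s\<in>{0<..T}. \<bar>modeV' \<nu> \<mu> s - 0\<bar> \<le> C3 * (1 + Q) * s powr (1 - \<nu> - 1)"
        using reg[OF \<mu>] by (simp add: Q_def)
      have e: "1 - \<nu> - 2 = - \<nu> - 1" by simp
      show "\<forall>x\<in>{0<..T}. \<forall>y\<in>{x..T}. \<bar>modeV' \<nu> \<mu> y - modeV' \<nu> \<mu> x\<bar> \<le> C3 * (1 + Q) * x powr (1 - \<nu> - 2) * (y - x)"
        using reg[OF \<mu>] unfolding e Q_def by simp
    qed (use m C3 Q modeV_continuous[OF \<nu> \<mu>] modeV'_continuous[OF \<nu> \<mu>] modeV_derivative[OF \<nu> \<mu>] in auto)
    have eY: "t m powr \<nu> * \<bar>eY m\<bar> \<le> C2 * (C3 * \<mu> powr (2 * \<epsilon>)) * NQ" if m: "1 \<le> m" "m \<le> N" for m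
      unfolding eY_def t_def NQ_def
    proof (rule trunc2[where b = 1])
      show "\<forall>x\<in>{0<..T}. \<bar>modeY' \<nu> \<mu> x - 1\<bar> \<le> C3 * \<mu> powr (2 * \<epsilon>) * x powr (1 + s - 1)"
        using reg[OF \<mu>] by simp
      have e: "1 + s - 2 = s - 1" by simp
      show "\<forall>x\<in>{0<..T}. \<forall>y\<in>{x..T}. \<bar>modeY' \<nu> \<mu> y - modeY' \<nu> \<mu> x\<bar> \<le> C3 * \<mu> powr (2 * \<epsilon>) * x powr (1 + s - 2) * (y - x)"
        using reg[OF \<mu>] unfolding e by simp
    qed (use m C3 modeY_continuous[OF \<nu> \<mu>] modeY'_continuous[OF \<nu> \<mu>] modeY_derivative[OF \<nu> \<mu>] in auto)
    define u where "u k = a * modeY \<nu> \<mu> (t k) - U k" for k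
    define v where "v k = a * modeV \<nu> \<mu> (t k) - V k" for k
    have Du: "L1_diff \<nu> t u m = v m - a * eY m" if m: "1 \<le> m" "m \<le> N" for m
    proof -
      have e1: "L1_diff \<nu> t (\<lambda>k. modeY \<nu> \<mu> (t k)) m = modeV \<nu> \<mu> (t m) - eY m"
        unfolding eY_def L1_error_def using modeY_caputo[OF \<nu> \<mu> tpos[OF m(1)]] by simp
      have e2: "L1_diff \<nu> t U m = V m" using eqU m by (simp add: t_def)
      show ?thesis unfolding u_def L1_diff_lincomb v_def e1 e2 by (simp add: algebra_simps)
    qed
    have Dv: "L1_diff \<nu> t v m = - (\<mu>\<^sup>2 * u m) - a * eV m" if m: "1 \<le> m" "m \<le> N" for m
    proof -
      have e1: "L1_diff \<nu> t (\<lambda>k. modeV \<nu> \<mu> (t k)) m = omega (2 - 2 * \<nu>) (t m) - \<mu>\<^sup>2 * modeY \<nu> \<mu> (t m) - eV m"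
        unfolding eV_def L1_error_def using modeV_caputo[OF \<nu> \<mu> tpos[OF m(1)]] by simp
      have e2: "L1_diff \<nu> t V m = a * omega (2 - 2 * \<nu>) (t m) - \<mu>\<^sup>2 * U m"
        using eqV m by (simp add: t_def eq_diff_eq)
      show ?thesis unfolding v_def L1_diff_lincomb u_def e1 e2 by (simp add: algebra_simps)
    qed
    define W where "W k = complex_of_real (v k) + (\<i> * of_real \<mu>) * of_real (u k)" for k
    define R where "R k = - of_real a * (of_real (eV k) + \<i> * of_real \<mu> * of_real (eY k))" for k
    define B where "B = \<bar>a\<bar> * ((C1 + C2) * C3 * (1 + Q) * NQ)"
    have "norm (W n) \<le> Gamma (1 - \<nu>) * B"
    proof (rule L1_skew_stability[OF \<nu>0 \<nu>(2) tmono t0 _ _ _ _ n(2)])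
      show "W 0 = 0" by (simp add: W_def u_def v_def t0 modeY_0[OF \<nu> \<mu>] modeV_0[OF \<nu> \<mu>] U0 V0)
      show "0 \<le> B" unfolding B_def using C1 C2 C3 Q NQ by simp
      fix m assume m: "1 \<le> m" "m \<le> N"
      have "L1_diff \<nu> t W m = of_real (L1_diff \<nu> t v m) + (\<i> * of_real \<mu>) * of_real (L1_diff \<nu> t u m)"
        unfolding W_def by (rule L1_diff_complex)
      also have "\<dots> = \<i> * of_real \<mu> * W m + R m"
        unfolding Du[OF m] Dv[OF m] W_def R_def by (simp add: complex_eq_iff power2_eq_square algebra_simps)
      finally show "L1_diff \<nu> t W m = \<i> * complex_of_real \<mu> * W m + R m" .
      have "norm (R m) \<le> \<bar>a\<bar> * (\<bar>eV m\<bar> + \<mu> * \<bar>eY m\<bar>)"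
      proof -
        have "norm (complex_of_real (eV m) + \<i> * of_real \<mu> * of_real (eY m)) \<le> \<bar>eV m\<bar> + \<mu> * \<bar>eY m\<bar>"
          using norm_triangle_ineq[of "complex_of_real (eV m)" "\<i> * of_real \<mu> * of_real (eY m)"] \<mu>
          by (simp add: norm_mult)
        then show ?thesis unfolding R_def norm_mult by (simp add: mult_left_mono)
      qed
      then have "t m powr \<nu> * norm (R m) \<le> t m powr \<nu> * (\<bar>a\<bar> * (\<bar>eV m\<bar> + \<mu> * \<bar>eY m\<bar>))"
        by (rule mult_left_mono) simp
      also have "\<dots> = \<bar>a\<bar> * (t m powr \<nu> * \<bar>eV m\<bar> + \<mu> * (t m powr \<nu> * \<bar>eY m\<bar>))"
        by (simp add: algebra_simps)
      also have "\<dots> \<le> \<bar>a\<bar> * (C1 * (C3 * (1 + Q)) * NQ + \<mu> * (C2 * (C3 * \<mu> powr (2 * \<epsilon>)) * NQ))"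
        using eV[OF m] eY[OF m] \<mu> by (intro mult_left_mono add_mono) auto
      also have "\<mu> * (C2 * (C3 * \<mu> powr (2 * \<epsilon>)) * NQ) = C2 * (C3 * Q) * NQ"
        using \<mu> by (simp add: Q_def powr_add)
      also have "\<bar>a\<bar> * (C1 * (C3 * (1 + Q)) * NQ + C2 * (C3 * Q) * NQ)
          \<le> \<bar>a\<bar> * (C1 * (C3 * (1 + Q)) * NQ + C2 * (C3 * (1 + Q)) * NQ)"
        using C2 C3 NQ by (intro mult_left_mono add_mono order.refl mult_right_mono) auto
      also have "\<dots> = B" unfolding B_def by (simp add: algebra_simps)
      finally show "t m powr \<nu> * norm (R m) \<le> B" .
    qed
    then have "(norm (W n))\<^sup>2 \<le> (Gamma (1 - \<nu>) * B)\<^sup>2" by (intro power_mono) auto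
    also have "(norm (W n))\<^sup>2 = (v n)\<^sup>2 + \<mu>\<^sup>2 * (u n)\<^sup>2"
      unfolding cmod_power2 by (simp add: W_def power_mult_distrib)
    also have "Gamma (1 - \<nu>) * B = C * (1 + \<mu> powr (1 + 2 * \<epsilon>)) * real N powr (- q) * \<bar>a\<bar>"
      by (simp add: B_def C_def G_def Q_def NQ_def)
    finally show "(a * modeV \<nu> \<mu> (graded_mesh T r N n) - V n)\<^sup>2 + \<mu>\<^sup>2 * (a * modeY \<nu> \<mu> (graded_mesh T r N n) - U n)\<^sup>2
       \<le> (C * (1 + \<mu> powr (1 + 2 * \<epsilon>)) * real N powr (- q) * \<bar>a\<bar>)\<^sup>2"
      by (simp add: u_def v_def t_def)
  qed
qed

section \<open>Uniqueness for the scalar fractional equation\<close>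

lemma omega_convolution_shift:
  assumes "0 < a" "0 < b" "s < t"
  shows "set_integrable lborel {s<..<t} (\<lambda>\<tau>. omega a (t - \<tau>) * omega b (\<tau> - s))"
    and "(LINT \<tau>:{s<..<t}|lborel. omega a (t - \<tau>) * omega b (\<tau> - s)) = omega (a + b) (t - s)"
proof -
  define f where "f r = indicat_real {0<..<t - s} r *\<^sub>R (omega a (t - s - r) * omega b r)" for r
  have c: "integrable lborel f" "(LINT r|lborel. f r) = omega (a + b) (t - s)"
    using omega_convolution[OF assms(1,2), of "t - s"] assms(3)
    by (simp_all add: f_def[abs_def] set_integrable_def set_lebesgue_integral_def)
  have eq: "f (- s + 1 * \<tau>) = indicat_real {s<..<t} \<tau> *\<^sub>R (omega a (t - \<tau>) * omega b (\<tau> - s))" for \<tau>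
    by (simp add: f_def indicator_def)
  have "integrable lborel (\<lambda>\<tau>. f (- s + 1 * \<tau>))"
    by (rule lborel_integrable_real_affine[OF c(1)]) simp
  then show "set_integrable lborel {s<..<t} (\<lambda>\<tau>. omega a (t - \<tau>) * omega b (\<tau> - s))"
    unfolding eq set_integrable_def .
  show "(LINT \<tau>:{s<..<t}|lborel. omega a (t - \<tau>) * omega b (\<tau> - s)) = omega (a + b) (t - s)"
    using lborel_integral_real_affine[of 1 f "- s"] c(2) unfolding eq set_lebesgue_integral_def by simp
qed

text \<open>The exponential is an eigenfunction of fractional integration from minus infinity.\<close>

lemma omega_exp_convolution_bound:
  fixes K :: real
  assumes a: "0 < a" and K: "0 < K"
  shows "integrable lborel (\<lambda>s. indicat_real {..<t} s * (omega a (t - s) * exp (K * s)))"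
    and "(LINT s|lborel. indicat_real {..<t} s * (omega a (t - s) * exp (K * s))) = exp (K * t) * K powr (- a)"
proof -
  define f where "f r = indicat_real {0<..} r * (r powr (a - 1) * exp (- (K * r)))" for r
  have f: "integrable lborel f" "(LINT r|lborel. f r) = Gamma a / K powr a"
    using real_Gamma_integral_scaled[OF a K] by (simp_all add: f_def[abs_def])
  have G: "0 < Gamma a" using a by simp
  have eq: "indicat_real {..<t} s * (omega a (t - s) * exp (K * s)) = exp (K * t) / Gamma a * f (t + - 1 * s)" for s
  proof -
    have "exp (K * t) * exp (- (K * (t - s))) = exp (K * s)" by (simp add: mult_exp_exp algebra_simps)
    then show ?thesis by (simp add: f_def omega_def indicator_def)
  qed
  have fi: "integrable lborel (\<lambda>s. f (t + - 1 * s))" by (rule lborel_integrable_real_affine[OF f(1)]) simp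
  show "integrable lborel (\<lambda>s. indicat_real {..<t} s * (omega a (t - s) * exp (K * s)))"
    unfolding eq using fi by (rule integrable_mult_right)
  have "(LINT s|lborel. f (t + - 1 * s)) = Gamma a / K powr a"
    using lborel_integral_real_affine[of "-1" f t] f(2) by simp
  then show "(LINT s|lborel. indicat_real {..<t} s * (omega a (t - s) * exp (K * s))) = exp (K * t) * K powr (- a)"
    unfolding eq integral_mult_right_zero using G by (simp add: powr_minus_divide)
qed

text \<open>Integration of order \<open>2 * \<nu> - 1\<close> applied to an integral of order \<open>2 - 2 * \<nu>\<close> is an ordinary integral, since
  the kernels convolve to \<open>omega 1 = 1\<close>.  The integrability of \<open>g\<close> itself follows from that of
  its product with the kernel, which is bounded below by a positive constant on \<open>{0<..<t}\<close>.\<close>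

lemma Caputo_inversion:
  fixes d1 g d :: "real \<Rightarrow> real"
  assumes \<nu>: "1/2 < \<nu>" "\<nu> < 1" and t: "0 < t"
    and cont: "continuous_on {0..t} d1"
    and g: "\<And>s. 0 < s \<Longrightarrow> s < t \<Longrightarrow> (d1 has_real_derivative g s) (at s)"
    and int: "\<And>\<tau>. 0 < \<tau> \<Longrightarrow> \<tau> \<le> t \<Longrightarrow> set_integrable lborel {0<..<\<tau>} (\<lambda>s. omega (2 - 2 * \<nu>) (\<tau> - s) * g s)"
    and eq: "\<And>\<tau>. 0 < \<tau> \<Longrightarrow> \<tau> < t \<Longrightarrow> (LINT s:{0<..<\<tau>}|lborel. omega (2 - 2 * \<nu>) (\<tau> - s) * g s) = d \<tau>"
  shows "set_integrable lborel {0<..<t} (\<lambda>\<tau>. omega (2 * \<nu> - 1) (t - \<tau>) * d \<tau>)"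
    and "(LINT \<tau>:{0<..<t}|lborel. omega (2 * \<nu> - 1) (t - \<tau>) * d \<tau>) = d1 t - d1 0"
proof -
  define a where "a = 2 * \<nu> - 1"
  define b where "b = 2 - 2 * \<nu>"
  have ab: "0 < a" "0 < b" "b < 1" "a + b = 1" using \<nu> by (auto simp: a_def b_def)
  define G where "G s = indicat_real {0<..<t} s * g s" for s
  define h where "h s = indicat_real {0<..<t} s *\<^sub>R (omega b (t - s) * g s)" for s
  have hi: "integrable lborel h"
    using int[OF t order.refl] by (simp add: set_integrable_def h_def[abs_def] b_def)
  have Gb: "0 < Gamma b" using ab by simp
  have Gh: "G s = h s * (Gamma b * (t - s) powr (1 - b))" for s
  proof (cases "s \<in> {0<..<t}")
    case True
    then have "omega b (t - s) * (Gamma b * (t - s) powr (1 - b)) = 1"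
      using Gb by (simp add: omega_def powr_add[symmetric])
    then show ?thesis using True by (simp add: G_def h_def)
  qed (simp add: G_def h_def)
  have hm [measurable]: "h \<in> borel_measurable borel" using hi by (simp add: borel_measurable_integrable)
  have Gm [measurable]: "G \<in> borel_measurable borel" unfolding Gh[abs_def] by measurable
  have Gi: "integrable lborel G"
  proof (rule Bochner_Integration.integrable_bound)
    show "integrable lborel (\<lambda>s. h s * (Gamma b * t powr (1 - b)))" using hi by simp
    show "AE s in lborel. norm (G s) \<le> norm (h s * (Gamma b * t powr (1 - b)))"
    proof (rule AE_I2)
      fix s
      show "norm (G s) \<le> norm (h s * (Gamma b * t powr (1 - b)))"
      proof (cases "s \<in> {0<..<t}")
        case True
        then have "(t - s) powr (1 - b) \<le> t powr (1 - b)" using ab by (intro powr_mono2) auto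
        then have "\<bar>h s\<bar> * (Gamma b * (t - s) powr (1 - b)) \<le> \<bar>h s\<bar> * (Gamma b * t powr (1 - b))"
          using Gb by (intro mult_left_mono) auto
        then show ?thesis unfolding Gh using Gb by (simp add: abs_mult)
      qed (simp add: G_def)
    qed
  qed simp
  define F where "F s \<tau> = (if 0 < s \<and> s < \<tau> \<and> \<tau> < t then omega a (t - \<tau>) * omega b (\<tau> - s) else 0) * G s" for s \<tau>
  have Fm: "case_prod F \<in> borel_measurable (lborel \<Otimes>\<^sub>M lborel)"
    unfolding F_def by measurable
  have Feq: "F s \<tau> = indicat_real {s<..<t} \<tau> *\<^sub>R (omega a (t - \<tau>) * omega b (\<tau> - s)) * G s" for s \<tau>
    by (auto simp: F_def G_def indicator_def)
  have inner: "integrable lborel (F s)" "(LINT \<tau>|lborel. F s \<tau>) = G s" "(LINT \<tau>|lborel. norm (F s \<tau>)) = norm (G s)" for s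
  proof -
    have "integrable lborel (F s) \<and> (LINT \<tau>|lborel. F s \<tau>) = G s \<and> (LINT \<tau>|lborel. norm (F s \<tau>)) = norm (G s)"
    proof (cases "0 < s \<and> s < t")
      case True
      then have st: "s < t" by simp
      define k where "k \<tau> = indicat_real {s<..<t} \<tau> *\<^sub>R (omega a (t - \<tau>) * omega b (\<tau> - s))" for \<tau>
      have k: "integrable lborel k" "(LINT \<tau>|lborel. k \<tau>) = 1"
        using omega_convolution_shift[OF ab(1,2) st] omega_1[of "t - s"] st ab(4)
        by (simp_all add: k_def[abs_def] set_integrable_def set_lebesgue_integral_def)
      have k0: "0 \<le> k \<tau>" for \<tau> using omega_nonneg[OF ab(1)] omega_nonneg[OF ab(2)] by (simp add: k_def)
      have F: "F s = (\<lambda>\<tau>. k \<tau> * G s)" by (rule ext) (simp add: Feq k_def)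
      have nF: "norm (k \<tau> * G s) = k \<tau> * norm (G s)" for \<tau> using k0[of \<tau>] by (simp add: abs_mult)
      show ?thesis unfolding F nF using k by simp
    next
      case False
      then have "G s = 0" by (auto simp: G_def)
      then have "F s = (\<lambda>\<tau>. 0)" by (intro ext) (simp add: F_def)
      then show ?thesis using \<open>G s = 0\<close> by simp
    qed
    then show "integrable lborel (F s)" "(LINT \<tau>|lborel. F s \<tau>) = G s" "(LINT \<tau>|lborel. norm (F s \<tau>)) = norm (G s)"
      by auto
  qed
  have Fi: "integrable (lborel \<Otimes>\<^sub>M lborel) (case_prod F)"
    by (rule lborel_pair.Fubini_integrable[OF Fm]) (use inner Gi in auto)
  have other: "(LINT s|lborel. F s \<tau>) = indicat_real {0<..<t} \<tau> *\<^sub>R (omega a (t - \<tau>) * d \<tau>)" for \<tau>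
  proof (cases "\<tau> \<in> {0<..<t}")
    case True
    have "(LINT s|lborel. F s \<tau>) = (LINT s|lborel. omega a (t - \<tau>) * (indicat_real {0<..<\<tau>} s *\<^sub>R (omega b (\<tau> - s) * g s)))"
      using True by (intro Bochner_Integration.integral_cong refl) (auto simp: F_def G_def indicator_def)
    also have "\<dots> = omega a (t - \<tau>) * d \<tau>"
      using eq[of \<tau>] True by (simp add: set_lebesgue_integral_def b_def)
    finally show ?thesis using True by simp
  next
    case False
    then have "F s \<tau> = 0" for s by (auto simp: F_def)
    then show ?thesis using False by simp
  qed
  have "integrable lborel (\<lambda>\<tau>. LINT s|lborel. F s \<tau>)" by (rule lborel_pair.integrable_snd[OF Fi])
  then show "set_integrable lborel {0<..<t} (\<lambda>\<tau>. omega (2 * \<nu> - 1) (t - \<tau>) * d \<tau>)"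
    unfolding other set_integrable_def a_def .
  have "(LINT \<tau>:{0<..<t}|lborel. omega (2 * \<nu> - 1) (t - \<tau>) * d \<tau>) = (LINT \<tau>|lborel. LINT s|lborel. F s \<tau>)"
    unfolding other set_lebesgue_integral_def a_def ..
  also have "\<dots> = (LINT s|lborel. LINT \<tau>|lborel. F s \<tau>)" by (rule lborel_pair.Fubini_integral[OF Fi])
  also have "\<dots> = (LINT s|lborel. G s)" unfolding inner(2) ..
  also have "\<dots> = d1 t - d1 0"
  proof -
    have si: "set_integrable lborel {0<..<t} g" using Gi by (simp add: set_integrable_def G_def[abs_def])
    have "(g has_integral d1 t - d1 0) {0..t}"
      by (rule fundamental_theorem_of_calculus_interior)
         (use t cont g in \<open>auto simp: has_real_derivative_iff_has_vector_derivative[symmetric]\<close>)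
    then have "(g has_integral d1 t - d1 0) {0<..<t}" by (simp add: has_integral_Icc_iff_Ioo)
    then have "integral {0<..<t} g = d1 t - d1 0" by (rule integral_unique)
    moreover have "(LINT s:{0<..<t}|lborel. g s) = integral {0<..<t} g"
      by (rule set_borel_integral_eq_integral(2)[OF si])
    ultimately show ?thesis by (simp add: set_lebesgue_integral_def G_def)
  qed
  finally show "(LINT \<tau>:{0<..<t}|lborel. omega (2 * \<nu> - 1) (t - \<tau>) * d \<tau>) = d1 t - d1 0" .
qed

text \<open>A contraction in a norm with exponential weight: if \<open>d\<close> is bounded by \<open>B * exp (K * s)\<close>, then integrating the
  equation halves \<open>B\<close>, for the choice of \<open>K\<close> made in the proof.  Iteration leaves only \<open>d = 0\<close>.\<close>

lemma fractional_Gronwall_zero: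
  fixes d d1 :: "real \<Rightarrow> real"
  assumes a: "0 < a" and T: "0 < T" and l: "0 < l"
    and cd: "continuous_on {0..T} d" and cd1: "continuous_on {0..T} d1"
    and deriv: "\<And>s. 0 < s \<Longrightarrow> s < T \<Longrightarrow> (d has_real_derivative d1 s) (at s)" and d0: "d 0 = 0"
    and int: "\<And>t. 0 < t \<Longrightarrow> t < T \<Longrightarrow> set_integrable lborel {0<..<t} (\<lambda>s. omega a (t - s) * d s)"
    and eq: "\<And>t. 0 < t \<Longrightarrow> t < T \<Longrightarrow> d1 t = - l * (LINT s:{0<..<t}|lborel. omega a (t - s) * d s)"
    and t: "0 \<le> t" "t < T"
  shows "d t = 0"
proof -
  define K where "K = (2 * l) powr (1 / (a + 1))"
  have K: "0 < K" using l by (simp add: K_def)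
  have Ka: "l * K powr (- a) / K = 1 / 2"
  proof -
    have "K powr (a + 1) = 2 * l" using l a by (simp add: K_def powr_powr)
    then have "K powr a * K = 2 * l" using K by (simp add: powr_add)
    moreover have "l * K powr (- a) / K = l / (K powr a * K)" by (simp add: powr_minus_divide)
    ultimately show ?thesis using l by simp
  qed
  have halve: "\<bar>d t\<bar> \<le> B / 2 * exp (K * t)"
    if B: "0 \<le> B" "\<And>s. 0 \<le> s \<Longrightarrow> s < T \<Longrightarrow> \<bar>d s\<bar> \<le> B * exp (K * s)" and t: "0 \<le> t" "t < T" for B t
  proof -
    have b1: "\<bar>d1 s\<bar> \<le> l * B * K powr (- a) * exp (K * s)" if s: "0 < s" "s < T" for s
    proof -
      have "norm (LINT r|lborel. indicat_real {0<..<s} r *\<^sub>R (omega a (s - r) * d r))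
          \<le> (LINT r|lborel. B * (indicat_real {..<s} r * (omega a (s - r) * exp (K * r))))"
      proof (rule Bochner_Integration.integral_norm_bound_integral)
        show "integrable lborel (\<lambda>r. indicat_real {0<..<s} r *\<^sub>R (omega a (s - r) * d r))"
          using int[OF s] by (simp add: set_integrable_def)
        show "integrable lborel (\<lambda>r. B * (indicat_real {..<s} r * (omega a (s - r) * exp (K * r))))"
          using omega_exp_convolution_bound(1)[OF a K] by (rule integrable_mult_right)
        fix r
        show "norm (indicat_real {0<..<s} r *\<^sub>R (omega a (s - r) * d r)) \<le> B * (indicat_real {..<s} r * (omega a (s - r) * exp (K * r)))"
        proof (cases "0 < r \<and> r < s")
          case True
          have "omega a (s - r) * \<bar>d r\<bar> \<le> omega a (s - r) * (B * exp (K * r))"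
            using B(2)[of r] True s omega_nonneg[OF a] by (intro mult_left_mono) auto
          then show ?thesis using True omega_nonneg[OF a, of "s - r"] by (simp add: abs_mult mult_ac)
        next
          case False
          then show ?thesis using B(1) omega_nonneg[OF a, of "s - r"] by (auto simp: indicator_def)
        qed
      qed
      also have "\<dots> = B * (exp (K * s) * K powr (- a))"
        unfolding integral_mult_right_zero omega_exp_convolution_bound(2)[OF a K] ..
      finally have "\<bar>LINT r:{0<..<s}|lborel. omega a (s - r) * d r\<bar> \<le> B * (exp (K * s) * K powr (- a))"
        by (simp add: set_lebesgue_integral_def)
      then have "l * \<bar>LINT r:{0<..<s}|lborel. omega a (s - r) * d r\<bar> \<le> l * (B * (exp (K * s) * K powr (- a)))"
        using l by (intro mult_left_mono) auto
      then show ?thesis using eq[OF s] l by (simp add: abs_mult mult_ac)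
    qed
    define c where "c = l * B * K powr (- a)"
    have c: "0 \<le> c" using l B by (simp add: c_def)
    have I: "(d1 has_integral d t - d 0) {0<..<t}"
    proof -
      have "(d1 has_integral d t - d 0) {0..t}"
        by (rule fundamental_theorem_of_calculus_interior)
           (use t deriv cd in \<open>auto simp: has_real_derivative_iff_has_vector_derivative[symmetric] intro: continuous_on_subset\<close>)
      then show ?thesis by (simp add: has_integral_Icc_iff_Ioo)
    qed
    have E: "((\<lambda>s. c * exp (K * s)) has_integral (c / K * exp (K * t) - c / K * exp (K * 0))) {0<..<t}"
    proof -
      have "((\<lambda>s. c * exp (K * s)) has_integral (c / K * exp (K * t) - c / K * exp (K * 0))) {0..t}"
      proof (rule fundamental_theorem_of_calculus[OF t(1)])
        fix s :: real
        have "((\<lambda>s. c / K * exp (K * s)) has_real_derivative c / K * (exp (K * s) * (K * 1))) (at s within {0..t})"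
          by (auto intro!: derivative_eq_intros)
        then show "((\<lambda>s. c / K * exp (K * s)) has_vector_derivative c * exp (K * s)) (at s within {0..t})"
          using K by (simp add: has_real_derivative_iff_has_vector_derivative)
      qed
      then show ?thesis by (simp add: has_integral_Icc_iff_Ioo)
    qed
    have "norm (d t - d 0) \<le> c / K * exp (K * t) - c / K * exp (K * 0)"
    proof (rule integral_norm_bound_integral[of d1 "{0<..<t}" "\<lambda>s. c * exp (K * s)", unfolded integral_unique[OF I] integral_unique[OF E]])
      show "norm (d1 s) \<le> c * exp (K * s)" if "s \<in> {0<..<t}" for s
        using b1[of s] that t by (simp add: c_def)
    qed (use I E in \<open>auto intro: has_integral_integrable\<close>)
    also have "\<dots> \<le> c / K * exp (K * t)" using c K by simp
    also have "c / K = B / 2"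
    proof -
      have "c / K = B * (l * K powr (- a) / K)" by (simp add: c_def)
      then show ?thesis unfolding Ka by simp
    qed
    finally show ?thesis by (simp add: d0)
  qed
  obtain B0 where "\<forall>y\<in>d ` {0..T}. norm y \<le> B0"
    using compact_imp_bounded[OF compact_continuous_image[OF cd compact_Icc]] unfolding bounded_iff by blast
  then have B0: "norm (d s) \<le> B0" if "s \<in> {0..T}" for s using that by blast
  have B0': "0 \<le> B0" using B0[of 0] T d0 by simp
  have iter: "\<forall>s. 0 \<le> s \<and> s < T \<longrightarrow> \<bar>d s\<bar> \<le> B0 * (1/2) ^ n * exp (K * s)" for n
  proof (induction n)
    case 0
    show ?case
    proof (intro allI impI)
      fix s assume s: "0 \<le> s \<and> s < T"
      have "\<bar>d s\<bar> \<le> B0 * 1" using B0[of s] s by simp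
      also have "\<dots> \<le> B0 * exp (K * s)" using B0' K s by (intro mult_left_mono) auto
      finally show "\<bar>d s\<bar> \<le> B0 * (1/2) ^ 0 * exp (K * s)" by simp
    qed
  next
    case (Suc n)
    show ?case
    proof (intro allI impI)
      fix s assume s: "0 \<le> s \<and> s < T"
      show "\<bar>d s\<bar> \<le> B0 * (1/2) ^ Suc n * exp (K * s)"
        using halve[of "B0 * (1/2)^n" s] Suc.IH s B0' by simp
    qed
  qed
  have "(\<lambda>n. B0 * (1/2) ^ n * exp (K * t)) \<longlonglongrightarrow> B0 * 0 * exp (K * t)"
    by (intro tendsto_intros LIMSEQ_power_zero) auto
  then have "\<bar>d t\<bar> \<le> B0 * 0 * exp (K * t)"
    by (rule LIMSEQ_le_const) (use iter t in blast)
  then show ?thesis by simp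
qed

text \<open>The hypotheses are what a strong solution of the wave equation provides for its coefficients.  In
  particular nothing is assumed about the second derivative at 0, and it is given separately for each
  final time \<open>t\<close>.\<close>

theorem mode_unique:
  fixes x x1 :: "real \<Rightarrow> real"
  assumes \<nu>: "1/2 < \<nu>" "\<nu> < 1" and \<mu>: "0 < \<mu>" and T: "0 < T"
    and x: "continuous_on {0..T} x" and x1: "continuous_on {0..T} x1"
    and dx: "\<And>s. 0 < s \<Longrightarrow> s < T \<Longrightarrow> (x has_real_derivative x1 s) (at s)"
    and init: "x 0 = 0" "x1 0 = a"
    and eq: "\<And>t. 0 < t \<Longrightarrow> t < T \<Longrightarrow> \<exists>f. (\<forall>s\<in>{0<..<t}. (x1 has_real_derivative f s) (at s)) \<and>
        set_integrable lborel {0<..<t} (\<lambda>s. omega (2 - 2 * \<nu>) (t - s) * f s) \<and>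
        (LINT s:{0<..<t}|lborel. omega (2 - 2 * \<nu>) (t - s) * f s) = - \<mu>\<^sup>2 * x t"
    and t: "0 \<le> t" "t \<le> T"
  shows "x t = a * modeY \<nu> \<mu> t"
proof -
  define d where "d s = x s - a * modeY \<nu> \<mu> s" for s
  define d1 where "d1 s = x1 s - a * modeY' \<nu> \<mu> s" for s
  \<comment> \<open>The second derivatives for different final times agree with \<open>deriv x1\<close>.\<close>
  define g where "g s = deriv x1 s - a * modeY'' \<nu> \<mu> s" for s
  have f: "(\<forall>s\<in>{0<..<\<tau>}. (x1 has_real_derivative deriv x1 s) (at s)) \<and>
      set_integrable lborel {0<..<\<tau>} (\<lambda>s. omega (2 - 2 * \<nu>) (\<tau> - s) * deriv x1 s) \<and>
      (LINT s:{0<..<\<tau>}|lborel. omega (2 - 2 * \<nu>) (\<tau> - s) * deriv x1 s) = - \<mu>\<^sup>2 * x \<tau>"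
    if \<tau>: "0 < \<tau>" "\<tau> < T" for \<tau>
  proof -
    obtain f where f: "\<forall>s\<in>{0<..<\<tau>}. (x1 has_real_derivative f s) (at s)"
      "set_integrable lborel {0<..<\<tau>} (\<lambda>s. omega (2 - 2 * \<nu>) (\<tau> - s) * f s)"
      "(LINT s:{0<..<\<tau>}|lborel. omega (2 - 2 * \<nu>) (\<tau> - s) * f s) = - \<mu>\<^sup>2 * x \<tau>"
      using eq[OF \<tau>] by blast
    have fd: "deriv x1 s = f s" if "s \<in> {0<..<\<tau>}" for s using f(1) that by (intro DERIV_imp_deriv) auto
    have "set_integrable lborel {0<..<\<tau>} (\<lambda>s. omega (2 - 2 * \<nu>) (\<tau> - s) * deriv x1 s)
        = set_integrable lborel {0<..<\<tau>} (\<lambda>s. omega (2 - 2 * \<nu>) (\<tau> - s) * f s)"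
      by (rule set_integrable_cong) (auto simp: fd)
    moreover have "(LINT s:{0<..<\<tau>}|lborel. omega (2 - 2 * \<nu>) (\<tau> - s) * deriv x1 s)
        = (LINT s:{0<..<\<tau>}|lborel. omega (2 - 2 * \<nu>) (\<tau> - s) * f s)"
      by (rule set_lebesgue_integral_cong) (auto simp: fd)
    ultimately show ?thesis using f by (auto simp: fd)
  qed
  have g_int: "set_integrable lborel {0<..<\<tau>} (\<lambda>s. omega (2 - 2 * \<nu>) (\<tau> - s) * g s)"
    and g_eq: "(LINT s:{0<..<\<tau>}|lborel. omega (2 - 2 * \<nu>) (\<tau> - s) * g s) = - \<mu>\<^sup>2 * d \<tau>"
    if \<tau>: "0 < \<tau>" "\<tau> < T" for \<tau>
  proof -
    have e: "omega (2 - 2 * \<nu>) (\<tau> - s) * g s = omega (2 - 2 * \<nu>) (\<tau> - s) * deriv x1 s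
        - a * (omega (2 - 2 * \<nu>) (\<tau> - s) * modeY'' \<nu> \<mu> s)" for s
      by (simp add: g_def algebra_simps)
    note m = modeY_caputo_second[OF \<nu> \<mu> \<tau>(1)]
    note m' = set_integrable_mult_right[OF m(1), of a]
    have fi: "set_integrable lborel {0<..<\<tau>} (\<lambda>s. omega (2 - 2 * \<nu>) (\<tau> - s) * deriv x1 s)" using f[OF \<tau>] by blast
    show "set_integrable lborel {0<..<\<tau>} (\<lambda>s. omega (2 - 2 * \<nu>) (\<tau> - s) * g s)"
      unfolding e by (rule set_integral_diff(1)[OF fi m'])
    show "(LINT s:{0<..<\<tau>}|lborel. omega (2 - 2 * \<nu>) (\<tau> - s) * g s) = - \<mu>\<^sup>2 * d \<tau>"
      unfolding e set_integral_diff(2)[OF fi m'] set_integral_mult_right m(2)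
      using f[OF \<tau>] by (simp add: d_def algebra_simps)
  qed
  have d1c: "continuous_on {0..T} d1" unfolding d1_def by (intro continuous_intros x1 modeY'_continuous[OF \<nu> \<mu>])
  have dc: "continuous_on {0..T} d" unfolding d_def by (intro continuous_intros x modeY_continuous[OF \<nu> \<mu>])
  have d1': "(d1 has_real_derivative g s) (at s)" if s: "0 < s" "s < T" for s
  proof -
    have "s \<in> {0<..<(s + T) / 2}" "0 < (s + T) / 2" "(s + T) / 2 < T" using s by auto
    then have "(x1 has_real_derivative deriv x1 s) (at s)" using f by blast
    then show ?thesis unfolding d1_def[abs_def] g_def
      by (intro DERIV_diff DERIV_cmult modeY'_derivative[OF \<nu> \<mu> s(1)])
  qed
  have dd: "(d has_real_derivative d1 s) (at s)" if s: "0 < s" "s < T" for s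
    unfolding d_def[abs_def] d1_def
    by (intro DERIV_diff DERIV_cmult dx s modeY_derivative[OF \<nu> \<mu> s(1)])
  have d10: "d1 0 = 0" by (simp add: d1_def init modeY'_0[OF \<nu> \<mu>])
  have inv: "set_integrable lborel {0<..<\<tau>} (\<lambda>s. omega (2 * \<nu> - 1) (\<tau> - s) * (- \<mu>\<^sup>2 * d s)) \<and>
      (LINT s:{0<..<\<tau>}|lborel. omega (2 * \<nu> - 1) (\<tau> - s) * (- \<mu>\<^sup>2 * d s)) = d1 \<tau>"
    if \<tau>: "0 < \<tau>" "\<tau> < T" for \<tau>
  proof -
    have "continuous_on {0..\<tau>} d1" by (rule continuous_on_subset[OF d1c]) (use \<tau> in auto)
    from Caputo_inversion[OF \<nu> \<tau>(1) this, of g "\<lambda>s. - \<mu>\<^sup>2 * d s"] show ?thesis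
      using d1' g_int g_eq \<tau> d10 by simp
  qed
  have zero: "d s = 0" if s: "0 \<le> s" "s < T" for s
  proof (rule fractional_Gronwall_zero[where a = "2 * \<nu> - 1" and l = "\<mu>\<^sup>2", OF _ T _ dc d1c dd _ _ _ s])
    show "0 < 2 * \<nu> - 1" using \<nu> by simp
    show "0 < \<mu>\<^sup>2" using \<mu> by simp
    show "d 0 = 0" by (simp add: d_def init modeY_0[OF \<nu> \<mu>])
    fix \<tau> assume \<tau>: "0 < \<tau>" "\<tau> < T"
    have m2: "- \<mu>\<^sup>2 \<noteq> 0" using \<mu> by simp
    have e: "omega (2 * \<nu> - 1) (\<tau> - s) * (- \<mu>\<^sup>2 * d s) = - \<mu>\<^sup>2 * (omega (2 * \<nu> - 1) (\<tau> - s) * d s)" for s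
      by simp
    have "set_integrable lborel {0<..<\<tau>} (\<lambda>s. (1 / - \<mu>\<^sup>2) * (omega (2 * \<nu> - 1) (\<tau> - s) * (- \<mu>\<^sup>2 * d s)))"
      by (rule set_integrable_mult_right) (use inv[OF \<tau>] in blast)
    moreover have "(1 / - \<mu>\<^sup>2) * (omega (2 * \<nu> - 1) (\<tau> - s) * (- \<mu>\<^sup>2 * d s)) = omega (2 * \<nu> - 1) (\<tau> - s) * d s" for s
      using m2 by simp
    ultimately show "set_integrable lborel {0<..<\<tau>} (\<lambda>s. omega (2 * \<nu> - 1) (\<tau> - s) * d s)" by simp
    show "d1 \<tau> = - \<mu>\<^sup>2 * (LINT s:{0<..<\<tau>}|lborel. omega (2 * \<nu> - 1) (\<tau> - s) * d s)"
      using inv[OF \<tau>] unfolding e set_integral_mult_right by simp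
  qed auto
  have "d t = 0"
  proof (cases "t < T")
    case False
    then have tT: "t = T" using t by simp
    have "((d \<longlongrightarrow> d T) (at T within {0..T}))" using dc T by (simp add: continuous_on_def)
    then have l1: "(d \<longlongrightarrow> d T) (at_left T)"
      using T by (simp add: at_within_Icc_at_left)
    have l2: "(d \<longlongrightarrow> 0) (at_left T)"
    proof (rule tendsto_eventually)
      show "\<forall>\<^sub>F s in at_left T. d s = 0"
        using eventually_at_left_real[OF T] by eventually_elim (auto intro: zero)
    qed
    show ?thesis unfolding tT using tendsto_unique[OF _ l1 l2] by simp
  qed (use zero t in auto)
  then show ?thesis by (simp add: d_def)
qed

section \<open>Coefficients of the solution and of the scheme\<close>

lemma eventually_at_within_mem: "\<forall>\<^sub>F s in at t within S. s \<in> S \<and> s \<noteq> t"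
  by (simp add: eventually_at_filter)

lemma L2_derivative_coefficient:
  assumes d: "has_L2_derivative_on \<Omega> S u u'" and t: "t \<in> S" and \<eta>: "\<eta> \<in> L2 \<Omega>"
  shows "((\<lambda>s. L2_inner \<Omega> (u s) \<eta>) has_real_derivative L2_inner \<Omega> (u' t) \<eta>) (at t within S)"
proof -
  have L: "u s \<in> L2 \<Omega>" "u' s \<in> L2 \<Omega>" if "s \<in> S" for s using d that by (auto simp: has_L2_derivative_on_def)
  have lim: "((\<lambda>s. L2_norm \<Omega> (\<lambda>x. (u s x - u t x) / (s - t) - u' t x) * L2_norm \<Omega> \<eta>) \<longlongrightarrow> 0) (at t within S)"
    using d t by (intro tendsto_mult_left_zero) (auto simp: has_L2_derivative_on_def)
  have "((\<lambda>s. (L2_inner \<Omega> (u s) \<eta> - L2_inner \<Omega> (u t) \<eta>) / (s - t) - L2_inner \<Omega> (u' t) \<eta>) \<longlongrightarrow> 0) (at t within S)"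
  proof (rule Lim_null_comparison[OF _ lim])
    show "\<forall>\<^sub>F s in at t within S. norm ((L2_inner \<Omega> (u s) \<eta> - L2_inner \<Omega> (u t) \<eta>) / (s - t) - L2_inner \<Omega> (u' t) \<eta>)
        \<le> L2_norm \<Omega> (\<lambda>x. (u s x - u t x) / (s - t) - u' t x) * L2_norm \<Omega> \<eta>"
      using eventually_at_within_mem
    proof eventually_elim
      case (elim s)
      define D where "D x = 1 / (s - t) * (u s x - u t x)" for x
      have DL: "D \<in> L2 \<Omega>" unfolding D_def using L elim t by (intro L2_mult L2_diff) auto
      have "L2_inner \<Omega> D \<eta> = 1 / (s - t) * (L2_inner \<Omega> (u s) \<eta> - L2_inner \<Omega> (u t) \<eta>)"
        unfolding D_def L2_inner_mult_left using L elim t \<eta> by (subst L2_inner_diff_left) auto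
      then have "(L2_inner \<Omega> (u s) \<eta> - L2_inner \<Omega> (u t) \<eta>) / (s - t) - L2_inner \<Omega> (u' t) \<eta>
          = L2_inner \<Omega> (\<lambda>x. D x - u' t x) \<eta>"
        using DL L t \<eta> by (subst L2_inner_diff_left) auto
      moreover have "(\<lambda>x. D x - u' t x) = (\<lambda>x. (u s x - u t x) / (s - t) - u' t x)"
        by (simp add: D_def fun_eq_iff)
      moreover have "\<bar>L2_inner \<Omega> (\<lambda>x. D x - u' t x) \<eta>\<bar> \<le> L2_norm \<Omega> (\<lambda>x. D x - u' t x) * L2_norm \<Omega> \<eta>"
        using DL L t \<eta> by (intro L2_Cauchy_Schwarz) auto
      ultimately show ?case by simp
    qed
  qed
  then show ?thesis
    unfolding has_field_derivative_iff by (rule LIM_zero_cancel)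
qed

lemma L2_continuous_coefficient:
  assumes c: "L2_continuous_on \<Omega> S u" and \<eta>: "\<eta> \<in> L2 \<Omega>"
  shows "continuous_on S (\<lambda>s. L2_inner \<Omega> (u s) \<eta>)"
  unfolding continuous_on_def
proof
  fix t assume t: "t \<in> S"
  have L: "u s \<in> L2 \<Omega>" if "s \<in> S" for s using c that by (auto simp: L2_continuous_on_def)
  have lim: "((\<lambda>s. L2_norm \<Omega> (\<lambda>x. u s x - u t x) * L2_norm \<Omega> \<eta>) \<longlongrightarrow> 0) (at t within S)"
    using c t by (intro tendsto_mult_left_zero) (auto simp: L2_continuous_on_def)
  have "((\<lambda>s. L2_inner \<Omega> (u s) \<eta> - L2_inner \<Omega> (u t) \<eta>) \<longlongrightarrow> 0) (at t within S)"
  proof (rule Lim_null_comparison[OF _ lim])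
    show "\<forall>\<^sub>F s in at t within S. norm (L2_inner \<Omega> (u s) \<eta> - L2_inner \<Omega> (u t) \<eta>)
        \<le> L2_norm \<Omega> (\<lambda>x. u s x - u t x) * L2_norm \<Omega> \<eta>"
      using eventually_at_within_mem
    proof eventually_elim
      case (elim s)
      then show ?case
        using L2_Cauchy_Schwarz[OF L2_diff[OF L L[OF t]] \<eta>, of s] L t \<eta> by (simp add: L2_inner_diff_left)
    qed
  qed
  then show "((\<lambda>s. L2_inner \<Omega> (u s) \<eta>) \<longlongrightarrow> L2_inner \<Omega> (u t) \<eta>) (at t within S)"
    by (rule LIM_zero_cancel)
qed

text \<open>The initial value is replaced by 0, to which it is equal almost everywhere; this gives the
  sequence of coefficients its value at \<open>j = 0\<close>.\<close>

lemma L1_derivative_coefficient: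
  assumes W: "\<And>j. 1 \<le> j \<Longrightarrow> j \<le> n \<Longrightarrow> W j \<in> L2 \<Omega>" and W0: "AE x in lebesgue_on \<Omega>. W 0 x = 0"
    and f: "f \<in> L2 \<Omega>" "AE x in lebesgue_on \<Omega>. L1_derivative \<nu> t W n x = f x" and \<eta>: "\<eta> \<in> L2 \<Omega>"
  shows "L2_inner \<Omega> f \<eta> = L1_diff \<nu> t (\<lambda>j. if j = 0 then 0 else L2_inner \<Omega> (W j) \<eta>) n"
proof -
  define W' where "W' j = (if j = 0 then (\<lambda>x. 0) else W j)" for j
  have L: "W' j \<in> L2 \<Omega>" if "j \<le> n" for j using W that by (auto simp: W'_def)
  define h where "h x = (\<Sum>k=1..n. L1_coeff \<nu> t n k * (W' k x - W' (k - 1) x))" for x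
  have hL: "h \<in> L2 \<Omega>" unfolding h_def by (intro L2_sum L2_mult L2_diff L) auto
  have "AE x in lebesgue_on \<Omega>. f x = h x"
    using f(2) W0
  proof eventually_elim
    case (elim x)
    have "W' j x = W j x" for j using elim by (simp add: W'_def)
    then show ?case using elim by (simp add: h_def L1_derivative_def)
  qed
  then have "L2_inner \<Omega> f \<eta> = L2_inner \<Omega> h \<eta>" by (rule L2_inner_AE_cong[OF _ f(1) hL \<eta>])
  also have "\<dots> = (\<Sum>k=1..n. L2_inner \<Omega> (\<lambda>x. L1_coeff \<nu> t n k * (W' k x - W' (k - 1) x)) \<eta>)"
    unfolding h_def by (rule L2_inner_sum_left) (auto intro!: L2_mult L2_diff L \<eta>)
  also have "\<dots> = (\<Sum>k=1..n. L1_coeff \<nu> t n k * (L2_inner \<Omega> (W' k) \<eta> - L2_inner \<Omega> (W' (k - 1)) \<eta>))"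
  proof (intro sum.cong refl)
    fix k assume k: "k \<in> {1..n}"
    show "L2_inner \<Omega> (\<lambda>x. L1_coeff \<nu> t n k * (W' k x - W' (k - 1) x)) \<eta>
        = L1_coeff \<nu> t n k * (L2_inner \<Omega> (W' k) \<eta> - L2_inner \<Omega> (W' (k - 1)) \<eta>)"
    proof -
      have "k \<le> n" "k - 1 \<le> n" using k by auto
      then show ?thesis unfolding L2_inner_mult_left using L2_inner_diff_left[OF L L \<eta>, of k "k - 1"] by simp
    qed
  qed
  also have "\<dots> = L1_diff \<nu> t (\<lambda>j. if j = 0 then 0 else L2_inner \<Omega> (W j) \<eta>) n"
    unfolding L1_diff_def by (intro sum.cong refl) (simp add: W'_def)
  finally show ?thesis .
qed

text \<open>Inner products commute with the derivatives in time and with the Bochner integral, so the Caputo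
  derivative of a coefficient is the coefficient of the Caputo derivative.  The first derivative of the
  coefficient is prescribed as \<open>x1\<close>, because the one provided by the Caputo derivative is tied to the
  final time \<open>t\<close>.\<close>

lemma Caputo_12_coefficient:
  assumes c: "has_caputo_12 \<Omega> \<alpha> u t w" and t: "t \<le> T" and \<eta>: "\<eta> \<in> L2 \<Omega>"
    and x1: "\<And>s. 0 < s \<Longrightarrow> s < T \<Longrightarrow> ((\<lambda>s. L2_inner \<Omega> (u s) \<eta>) has_real_derivative x1 s) (at s)"
  shows "\<exists>f. (\<forall>s\<in>{0<..<t}. (x1 has_real_derivative f s) (at s)) \<and>
        set_integrable lborel {0<..<t} (\<lambda>s. omega (2 - \<alpha>) (t - s) * f s) \<and>
        (LINT s:{0<..<t}|lborel. omega (2 - \<alpha>) (t - s) * f s) = L2_inner \<Omega> w \<eta>"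
proof -
  obtain u' u'' where d1: "has_L2_derivative_on \<Omega> {0<..<t} u u'" and d2: "has_L2_derivative_on \<Omega> {0<..<t} u' u''"
    and I: "has_L2_integral \<Omega> {0<..<t} (\<lambda>s x. 1 / Gamma (2 - \<alpha>) * (t - s) powr (1 - \<alpha>) * u'' s x) w"
    using c by (auto simp: has_caputo_12_def)
  define f where "f s = L2_inner \<Omega> (u'' s) \<eta>" for s
  have eq: "L2_inner \<Omega> (\<lambda>x. 1 / Gamma (2 - \<alpha>) * (t - s) powr (1 - \<alpha>) * u'' s x) \<eta> = omega (2 - \<alpha>) (t - s) * f s" for s
    unfolding L2_inner_mult_left f_def by (simp add: omega_def)
  have x1': "L2_inner \<Omega> (u' s) \<eta> = x1 s" if s: "s \<in> {0<..<t}" for s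
  proof -
    have "((\<lambda>s. L2_inner \<Omega> (u s) \<eta>) has_real_derivative L2_inner \<Omega> (u' s) \<eta>) (at s)"
      using L2_derivative_coefficient[OF d1 s \<eta>] unfolding at_within_open[OF s open_greaterThanLessThan] .
    moreover have "((\<lambda>s. L2_inner \<Omega> (u s) \<eta>) has_real_derivative x1 s) (at s)" using x1[of s] s t by simp
    ultimately show ?thesis by (rule DERIV_unique)
  qed
  have "(x1 has_real_derivative f s) (at s)" if s: "s \<in> {0<..<t}" for s
  proof -
    have "((\<lambda>s. L2_inner \<Omega> (u' s) \<eta>) has_real_derivative f s) (at s)"
      using L2_derivative_coefficient[OF d2 s \<eta>] unfolding at_within_open[OF s open_greaterThanLessThan] f_def .
    then show ?thesis
      by (rule has_field_derivative_transform_within_open[where S = "{0<..<t}"]) (use s x1' in auto)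
  qed
  moreover have "set_integrable lborel {0<..<t} (\<lambda>s. omega (2 - \<alpha>) (t - s) * f s)"
    and "(LINT s:{0<..<t}|lborel. omega (2 - \<alpha>) (t - s) * f s) = L2_inner \<Omega> w \<eta>"
    using I[unfolded has_L2_integral_def, THEN conjunct2, THEN conjunct2, THEN conjunct2, THEN bspec, OF \<eta>, unfolded eq] by simp_all
  ultimately show ?thesis by blast
qed

lemma Caputo_01_coefficient:
  assumes c: "has_caputo_01 \<Omega> \<nu> u t w" and t: "t \<le> T" and \<eta>: "\<eta> \<in> L2 \<Omega>"
    and x1: "\<And>s. 0 < s \<Longrightarrow> s < T \<Longrightarrow> ((\<lambda>s. L2_inner \<Omega> (u s) \<eta>) has_real_derivative x1 s) (at s)"
  shows "L2_inner \<Omega> w \<eta> = (LINT s:{0<..<t}|lborel. omega (1 - \<nu>) (t - s) * x1 s)"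
proof -
  obtain u' where d1: "has_L2_derivative_on \<Omega> {0<..<t} u u'"
    and I: "has_L2_integral \<Omega> {0<..<t} (\<lambda>s x. 1 / Gamma (1 - \<nu>) * (t - s) powr (- \<nu>) * u' s x) w"
    using c by (auto simp: has_caputo_01_def)
  have eq: "L2_inner \<Omega> (\<lambda>x. 1 / Gamma (1 - \<nu>) * (t - s) powr (- \<nu>) * u' s x) \<eta> = omega (1 - \<nu>) (t - s) * L2_inner \<Omega> (u' s) \<eta>" for s
    unfolding L2_inner_mult_left by (simp add: omega_def)
  have x1': "L2_inner \<Omega> (u' s) \<eta> = x1 s" if s: "s \<in> {0<..<t}" for s
  proof -
    have "((\<lambda>s. L2_inner \<Omega> (u s) \<eta>) has_real_derivative L2_inner \<Omega> (u' s) \<eta>) (at s)"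
      using L2_derivative_coefficient[OF d1 s \<eta>] unfolding at_within_open[OF s open_greaterThanLessThan] .
    moreover have "((\<lambda>s. L2_inner \<Omega> (u s) \<eta>) has_real_derivative x1 s) (at s)" using x1[of s] s t by simp
    ultimately show ?thesis by (rule DERIV_unique)
  qed
  have "L2_inner \<Omega> w \<eta> = (LINT s:{0<..<t}|lborel. omega (1 - \<nu>) (t - s) * L2_inner \<Omega> (u' s) \<eta>)"
    using I[unfolded has_L2_integral_def, THEN conjunct2, THEN conjunct2, THEN conjunct2, THEN bspec, OF \<eta>, unfolded eq] by simp
  also have "\<dots> = (LINT s:{0<..<t}|lborel. omega (1 - \<nu>) (t - s) * x1 s)"
    by (rule set_lebesgue_integral_cong) (auto simp: x1')
  finally show ?thesis .
qed

text \<open>The coefficient solves the scalar equation because the eigenfunction absorbs the Laplacian; uniqueness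
  for that equation identifies it.\<close>

lemma wave_solution_coefficient:
  fixes k :: nat
  assumes dom: "bounded_domain \<Omega>" and eig: "dirichlet_eigensystem \<Omega> lam \<phi>"
    and \<nu>: "1/2 < \<nu>" "\<nu> < 1" and T: "0 < T" and a1: "a1 \<in> L2 \<Omega>"
    and sol: "fractional_wave_solution \<Omega> (2 * \<nu>) T (\<lambda>x. 0) a1 (\<lambda>t x. 0) u"
  defines "\<mu> \<equiv> sqrt (lam k)" and "a \<equiv> L2_inner \<Omega> a1 (\<phi> k)"
  shows "\<And>t. 0 \<le> t \<Longrightarrow> t \<le> T \<Longrightarrow> L2_inner \<Omega> (u t) (\<phi> k) = a * modeY \<nu> \<mu> t"
    and "\<And>t. 0 < t \<Longrightarrow> t < T \<Longrightarrow> ((\<lambda>s. L2_inner \<Omega> (u s) (\<phi> k)) has_real_derivative a * modeY' \<nu> \<mu> t) (at t)"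
proof -
  have lam0: "0 < lam k" using lam_pos[OF dom eig] .
  then have \<mu>: "0 < \<mu>" "\<mu>\<^sup>2 = lam k" by (simp_all add: \<mu>_def)
  have pL: "\<phi> k \<in> L2 \<Omega>" using eig_L2[OF dom eig] .
  obtain u' where d: "has_L2_derivative_on \<Omega> {0..T} u u'" and c: "L2_continuous_on \<Omega> {0..T} u'"
    and i0: "AE x in lebesgue_on \<Omega>. u 0 x = 0" and i1: "AE x in lebesgue_on \<Omega>. u' 0 x = a1 x"
    using sol by (auto simp: fractional_wave_solution_def)
  have L: "u s \<in> L2 \<Omega>" "u' s \<in> L2 \<Omega>" if "s \<in> {0..T}" for s using d that by (auto simp: has_L2_derivative_on_def)
  define x where "x s = L2_inner \<Omega> (u s) (\<phi> k)" for s
  define x1 where "x1 s = L2_inner \<Omega> (u' s) (\<phi> k)" for s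
  have dx: "(x has_real_derivative x1 s) (at s within {0..T})" if "s \<in> {0..T}" for s
    unfolding x_def[abs_def] x1_def by (rule L2_derivative_coefficient[OF d that pL])
  have xc: "continuous_on {0..T} x"
    unfolding continuous_on_eq_continuous_within using DERIV_continuous[OF dx] by blast
  have x1c: "continuous_on {0..T} x1"
    unfolding x1_def[abs_def] by (rule L2_continuous_coefficient[OF c pL])
  have dxi: "(x has_real_derivative x1 s) (at s)" if "0 < s" "s < T" for s
    using dx[of s] that at_within_Icc_at[of 0 s T] by simp
  have x0: "x 0 = 0"
    using L2_inner_AE_cong[OF i0 L(1) _ pL] T by (simp add: x_def)
  have x10: "x1 0 = a"
    using L2_inner_AE_cong[OF i1 L(2) a1 pL] T by (simp add: x1_def a_def)
  have eq: "\<exists>f. (\<forall>s\<in>{0<..<t}. (x1 has_real_derivative f s) (at s)) \<and>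
        set_integrable lborel {0<..<t} (\<lambda>s. omega (2 - 2 * \<nu>) (t - s) * f s) \<and>
        (LINT s:{0<..<t}|lborel. omega (2 - 2 * \<nu>) (t - s) * f s) = - \<mu>\<^sup>2 * x t"
    if t: "0 < t" "t < T" for t
  proof -
    have "t \<in> {0<..<T}" using t by simp
    then have "u t \<in> H10 \<Omega> \<and> (\<exists>w g. has_caputo_12 \<Omega> (2 * \<nu>) u t w \<and> has_weak_laplace \<Omega> (u t) g \<and>
        (AE x in lebesgue_on \<Omega>. w x - g x = 0))"
      using sol unfolding fractional_wave_solution_def by blast
    then obtain w g where H: "u t \<in> H10 \<Omega>" and cap: "has_caputo_12 \<Omega> (2 * \<nu>) u t w"
      and lap: "has_weak_laplace \<Omega> (u t) g" and ae: "AE x in lebesgue_on \<Omega>. w x - g x = 0" by blast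
    have wL: "w \<in> L2 \<Omega>" using cap by (auto simp: has_caputo_12_def has_L2_integral_def)
    have gL: "g \<in> L2 \<Omega>" using lap by (simp add: has_weak_laplace_def)
    have "AE x in lebesgue_on \<Omega>. w x = g x" using ae by eventually_elim simp
    then have "L2_inner \<Omega> w (\<phi> k) = L2_inner \<Omega> g (\<phi> k)" by (rule L2_inner_AE_cong[OF _ wL gL pL])
    also have "\<dots> = - \<mu>\<^sup>2 * x t"
      using weak_laplace_coefficient[OF dom eig H lap] \<mu> by (simp add: x_def)
    finally have "L2_inner \<Omega> w (\<phi> k) = - \<mu>\<^sup>2 * x t" .
    then show ?thesis
      using Caputo_12_coefficient[OF cap less_imp_le[OF t(2)] pL dxi[unfolded x_def[abs_def]]] by simp
  qed
  have main: "x t = a * modeY \<nu> \<mu> t" if "0 \<le> t" "t \<le> T" for t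
    by (rule mode_unique[OF \<nu> \<mu>(1) T xc x1c dxi x0 x10 eq that])
  then show "\<And>t. 0 \<le> t \<Longrightarrow> t \<le> T \<Longrightarrow> L2_inner \<Omega> (u t) (\<phi> k) = a * modeY \<nu> \<mu> t" by (simp add: x_def)
  fix t assume t: "0 < t" "t < T"
  have "((\<lambda>s. a * modeY \<nu> \<mu> s) has_real_derivative a * modeY' \<nu> \<mu> t) (at t)"
    by (intro DERIV_cmult modeY_derivative[OF \<nu> \<mu>(1) t(1)])
  then have "(x has_real_derivative a * modeY' \<nu> \<mu> t) (at t)"
    by (rule has_field_derivative_transform_within_open[where S = "{0<..<T}"]) (use t main in auto)
  then show "((\<lambda>s. L2_inner \<Omega> (u s) (\<phi> k)) has_real_derivative a * modeY' \<nu> \<mu> t) (at t)"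
    unfolding x_def[abs_def] .
qed

lemma L1_scheme_coefficient:
  fixes k n N :: nat
  assumes dom: "bounded_domain \<Omega>" and eig: "dirichlet_eigensystem \<Omega> lam \<phi>" and a1: "a1 \<in> L2 \<Omega>"
    and sch: "L1_scheme \<Omega> (2 * \<nu>) \<nu> t N a1 U V" and n: "1 \<le> n" "n \<le> N"
  defines "Uk \<equiv> \<lambda>j. if j = 0 then 0 else L2_inner \<Omega> (U j) (\<phi> k)"
    and "Vk \<equiv> \<lambda>j. if j = 0 then 0 else L2_inner \<Omega> (V j) (\<phi> k)"
  shows "L1_diff \<nu> t Vk n + lam k * Uk n = L2_inner \<Omega> a1 (\<phi> k) * omega (2 - 2 * \<nu>) (t n)"
    and "Vk n = L1_diff \<nu> t Uk n"
proof -
  have pL: "\<phi> k \<in> L2 \<Omega>" using eig_L2[OF dom eig] .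
  have H: "U j \<in> H10 \<Omega>" "V j \<in> H10 \<Omega>" if "1 \<le> j" "j \<le> n" for j
    using sch that n by (auto simp: L1_scheme_def)
  have L: "U j \<in> L2 \<Omega>" "V j \<in> L2 \<Omega>" if "1 \<le> j" "j \<le> n" for j using H[OF that] H10_L2 by auto
  have z: "AE x in lebesgue_on \<Omega>. U 0 x = 0" "AE x in lebesgue_on \<Omega>. V 0 x = 0" using sch by (auto simp: L1_scheme_def)
  have "n \<in> {1..N}" using n by simp
  then have eqs: "(\<exists>g. has_weak_laplace \<Omega> (U n) g \<and>
           (AE x in lebesgue_on \<Omega>. L1_derivative \<nu> t V n x - g x = a1 x * omega (2 - 2 * \<nu>) (t n)))"
     "AE x in lebesgue_on \<Omega>. V n x = L1_derivative \<nu> t U n x"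
    using sch unfolding L1_scheme_def by blast+
  have "AE x in lebesgue_on \<Omega>. L1_derivative \<nu> t U n x = V n x" using eqs(2) by eventually_elim simp
  from L1_derivative_coefficient[OF L(1) z(1) L(2)[OF n(1) order.refl] this pL]
  show "Vk n = L1_diff \<nu> t Uk n" using n by (simp add: Vk_def Uk_def)
  obtain g where lap: "has_weak_laplace \<Omega> (U n) g"
    and ae: "AE x in lebesgue_on \<Omega>. L1_derivative \<nu> t V n x - g x = a1 x * omega (2 - 2 * \<nu>) (t n)" using eqs(1) by blast
  have gL: "g \<in> L2 \<Omega>" using lap by (simp add: has_weak_laplace_def)
  have fL: "(\<lambda>x. omega (2 - 2 * \<nu>) (t n) * a1 x + g x) \<in> L2 \<Omega>" using a1 gL by auto
  have "AE x in lebesgue_on \<Omega>. L1_derivative \<nu> t V n x = omega (2 - 2 * \<nu>) (t n) * a1 x + g x"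
    using ae by eventually_elim (simp add: algebra_simps)
  from L1_derivative_coefficient[OF L(2) z(2) fL this pL]
  have "L1_diff \<nu> t Vk n = L2_inner \<Omega> (\<lambda>x. omega (2 - 2 * \<nu>) (t n) * a1 x + g x) (\<phi> k)" by (simp add: Vk_def)
  also have "\<dots> = omega (2 - 2 * \<nu>) (t n) * L2_inner \<Omega> a1 (\<phi> k) + L2_inner \<Omega> g (\<phi> k)"
    using a1 gL pL by (subst L2_inner_add_left) (auto simp: L2_inner_mult_left)
  also have "L2_inner \<Omega> g (\<phi> k) = - (lam k * Uk n)"
    using weak_laplace_coefficient[OF dom eig H(1)[OF n(1) order.refl] lap] n by (simp add: Uk_def)
  finally show "L1_diff \<nu> t Vk n + lam k * Uk n = L2_inner \<Omega> a1 (\<phi> k) * omega (2 - 2 * \<nu>) (t n)" by simp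
qed

section \<open>The error estimate\<close>

text \<open>The eigenvalues are bounded below by the first one, so lower powers are dominated by higher ones.\<close>

lemma spectral_weight_bound:
  fixes l l0 e p :: real
  assumes "0 < l0" "l0 \<le> l" "0 \<le> e" "1/2 + e \<le> p"
  shows "1 + sqrt l powr (1 + 2 * e) \<le> (l0 powr (- p) + l0 powr (- (p - 1/2 - e))) * l powr p"
proof -
  have l: "0 < l" using assms by simp
  have "1 = l powr (- p) * l powr p" using l by (simp add: powr_add[symmetric])
  also have "\<dots> \<le> l0 powr (- p) * l powr p" using assms by (intro mult_right_mono powr_mono2') auto
  finally have 1: "1 \<le> l0 powr (- p) * l powr p" .
  have "sqrt l powr (1 + 2 * e) = l powr (1/2 * (1 + 2 * e))"
    using l by (simp add: powr_half_sqrt[symmetric] powr_powr)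
  also have "1/2 * (1 + 2 * e) = - (p - 1/2 - e) + p" by simp
  also have "l powr (- (p - 1/2 - e) + p) = l powr (- (p - 1/2 - e)) * l powr p" by (rule powr_add)
  also have "\<dots> \<le> l0 powr (- (p - 1/2 - e)) * l powr p" using assms by (intro mult_right_mono powr_mono2') auto
  finally show ?thesis using 1 by (simp add: distrib_right)
qed

text \<open>The energy of each mode is bounded by the square of its coefficient with the weight \<open>lam k powr p\<close>, with a
  constant independent of \<open>k\<close>.  Parseval's identity, for the functions and for their gradients, sums these
  bounds to the norm of the fractional power of the datum.\<close>

lemma scheme_error_estimate:
  fixes \<Omega> :: "(real^2) set"
  assumes dom: "bounded_domain \<Omega>" and eig: "dirichlet_eigensystem \<Omega> lam \<phi>"
    and \<nu>: "1/2 < \<nu>" "\<nu> < 1" and T: "0 < T" and r: "1 \<le> r"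
    and e: "0 < e" "e \<le> 1/2" and p: "1/2 + e \<le> p"
    and q: "q \<le> r * (1 - \<nu>)" "q \<le> 2 - \<nu>"
  shows "\<exists>C\<ge>0. \<forall>a1 u v N U V n. a1 \<in> frac_domain \<Omega> lam \<phi> p \<longrightarrow>
     fractional_wave_solution \<Omega> (2 * \<nu>) T (\<lambda>x. 0) a1 (\<lambda>t x. 0) u \<longrightarrow>
     (\<forall>t\<in>{0<..T}. has_caputo_01 \<Omega> \<nu> u t (v t)) \<longrightarrow>
     L1_scheme \<Omega> (2 * \<nu>) \<nu> (graded_mesh T r N) N a1 U V \<longrightarrow> 1 \<le> n \<longrightarrow> n \<le> N \<longrightarrow>
       (\<lambda>x. u (graded_mesh T r N n) x - U n x) \<in> H10 \<Omega> \<and>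
       L2_norm \<Omega> (\<lambda>x. v (graded_mesh T r N n) x - V n x)
         \<le> C * real N powr (- q) * L2_norm \<Omega> (frac_laplace \<Omega> lam \<phi> p a1) \<and>
       L2_norm \<Omega> (weak_grad \<Omega> (\<lambda>x. u (graded_mesh T r N n) x - U n x))
         \<le> C * real N powr (- q) * L2_norm \<Omega> (frac_laplace \<Omega> lam \<phi> p a1)"
proof -
  obtain C0 where C0: "0 \<le> C0" and mode: "\<And>N \<mu> a U V n. 1 \<le> n \<Longrightarrow> n \<le> N \<Longrightarrow> 0 < \<mu> \<Longrightarrow> U 0 = 0 \<Longrightarrow> V 0 = 0 \<Longrightarrow>
     (\<forall>n\<in>{1..N}. L1_diff \<nu> (graded_mesh T r N) V n + \<mu>\<^sup>2 * U n = a * omega (2 - 2 * \<nu>) (graded_mesh T r N n)) \<Longrightarrow>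
     (\<forall>n\<in>{1..N}. V n = L1_diff \<nu> (graded_mesh T r N) U n) \<Longrightarrow>
     (a * modeV \<nu> \<mu> (graded_mesh T r N n) - V n)\<^sup>2 + \<mu>\<^sup>2 * (a * modeY \<nu> \<mu> (graded_mesh T r N n) - U n)\<^sup>2
       \<le> (C0 * (1 + \<mu> powr (1 + 2 * e)) * real N powr (- q) * \<bar>a\<bar>)\<^sup>2"
  proof -
    from mode_error[OF \<nu> e T r q] obtain C0 where "0 \<le> C0" and *: "\<forall>N \<mu> a U V n. 1 \<le> n \<longrightarrow> n \<le> N \<longrightarrow> 0 < \<mu> \<longrightarrow> U 0 = 0 \<longrightarrow> V 0 = 0 \<longrightarrow>
     (\<forall>n\<in>{1..N}. L1_diff \<nu> (graded_mesh T r N) V n + \<mu>\<^sup>2 * U n = a * omega (2 - 2 * \<nu>) (graded_mesh T r N n)) \<longrightarrow>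
     (\<forall>n\<in>{1..N}. V n = L1_diff \<nu> (graded_mesh T r N) U n) \<longrightarrow>
     (a * modeV \<nu> \<mu> (graded_mesh T r N n) - V n)\<^sup>2 + \<mu>\<^sup>2 * (a * modeY \<nu> \<mu> (graded_mesh T r N n) - U n)\<^sup>2
       \<le> (C0 * (1 + \<mu> powr (1 + 2 * e)) * real N powr (- q) * \<bar>a\<bar>)\<^sup>2"
      by (elim exE conjE) (rule that)
    show thesis
      by (rule that[OF \<open>0 \<le> C0\<close>], rule *[THEN spec, THEN spec, THEN spec, THEN spec, THEN spec, THEN spec, THEN mp, THEN mp, THEN mp, THEN mp, THEN mp, THEN mp, THEN mp])
  qed
  define l0 where "l0 = lam 0"
  have l0: "0 < l0" "l0 \<le> lam k" for k
    using lam_pos[OF dom eig] lam_mono[OF dom eig] by (auto simp: l0_def mono_def)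
  define CL where "CL = l0 powr (- p) + l0 powr (- (p - 1/2 - e))"
  have CL: "0 \<le> CL" by (simp add: CL_def)
  define C where "C = C0 * CL"
  have C: "0 \<le> C" using C0 CL by (simp add: C_def)
  show ?thesis
  proof (intro exI[of _ C] conjI C allI impI)
    fix a1 :: "real^2 \<Rightarrow> real" and u v :: "real \<Rightarrow> real^2 \<Rightarrow> real" and N n :: nat and U V :: "nat \<Rightarrow> real^2 \<Rightarrow> real"
    assume a1: "a1 \<in> frac_domain \<Omega> lam \<phi> p"
      and sol: "fractional_wave_solution \<Omega> (2 * \<nu>) T (\<lambda>x. 0) a1 (\<lambda>t x. 0) u"
      and v: "\<forall>t\<in>{0<..T}. has_caputo_01 \<Omega> \<nu> u t (v t)"
      and sch: "L1_scheme \<Omega> (2 * \<nu>) \<nu> (graded_mesh T r N) N a1 U V" and n: "1 \<le> n" "n \<le> N"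
    have a1L: "a1 \<in> L2 \<Omega>" using a1 by (simp add: frac_domain_def)
    define \<tau> where "\<tau> = graded_mesh T r N n"
    have N1: "1 \<le> N" using n by simp
    have \<tau>: "0 < \<tau>" "\<tau> \<le> T"
      using graded_mesh_pos[OF T N1 n(1)] graded_mesh_le[OF T _ n(2), of r] r by (auto simp: \<tau>_def)
    define a where "a k = L2_inner \<Omega> a1 (\<phi> k)" for k
    define F where "F = L2_norm \<Omega> (frac_laplace \<Omega> lam \<phi> p a1)"
    define B where "B = C * real N powr (- q)"
    have B: "0 \<le> B" using C by (simp add: B_def)
    have pL: "\<phi> k \<in> L2 \<Omega>" for k using eig_L2[OF dom eig] .
    have uL: "u \<tau> \<in> L2 \<Omega>" using sol \<tau> by (auto simp: fractional_wave_solution_def has_L2_derivative_on_def)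
    have cap: "has_caputo_01 \<Omega> \<nu> u \<tau> (v \<tau>)" using v \<tau> by simp
    have vL: "v \<tau> \<in> L2 \<Omega>" using cap by (auto simp: has_caputo_01_def has_L2_integral_def)
    have UV: "U n \<in> H10 \<Omega>" "V n \<in> H10 \<Omega>" using sch n by (auto simp: L1_scheme_def)
    define ub where "ub x = u \<tau> x - U n x" for x
    define vb where "vb x = v \<tau> x - V n x" for x
    have L: "ub \<in> L2 \<Omega>" "vb \<in> L2 \<Omega>" unfolding ub_def vb_def using uL vL UV H10_L2 by auto
    have coef: "(L2_inner \<Omega> vb (\<phi> k))\<^sup>2 + lam k * (L2_inner \<Omega> ub (\<phi> k))\<^sup>2 \<le> B\<^sup>2 * (lam k powr p * a k)\<^sup>2" for k
    proof -
      define \<mu> where "\<mu> = sqrt (lam k)"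
      have \<mu>: "0 < \<mu>" "\<mu>\<^sup>2 = lam k" using l0(1) l0(2)[of k] by (simp_all add: \<mu>_def)
      define Uk where "Uk j = (if j = 0 then 0 else L2_inner \<Omega> (U j) (\<phi> k))" for j
      define Vk where "Vk j = (if j = 0 then 0 else L2_inner \<Omega> (V j) (\<phi> k))" for j
      note w = wave_solution_coefficient[OF dom eig \<nu> T a1L sol, where k = k, folded \<mu>_def a_def]
      have uc: "L2_inner \<Omega> (u \<tau>) (\<phi> k) = a k * modeY \<nu> \<mu> \<tau>" using w(1) \<tau> by simp
      have vc: "L2_inner \<Omega> (v \<tau>) (\<phi> k) = a k * modeV \<nu> \<mu> \<tau>"
      proof -
        have "L2_inner \<Omega> (v \<tau>) (\<phi> k) = (LINT s:{0<..<\<tau>}|lborel. omega (1 - \<nu>) (\<tau> - s) * (a k * modeY' \<nu> \<mu> s))"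
          by (rule Caputo_01_coefficient[OF cap \<tau>(2) pL w(2)])
        also have "\<dots> = (LINT s:{0<..<\<tau>}|lborel. a k * (omega (1 - \<nu>) (\<tau> - s) * modeY' \<nu> \<mu> s))"
          by (simp add: mult.left_commute)
        also have "\<dots> = a k * modeV \<nu> \<mu> \<tau>"
          by (simp add: set_integral_mult_right modeY_caputo[OF \<nu> \<mu>(1) \<tau>(1)])
        finally show ?thesis .
      qed
      have ubc: "L2_inner \<Omega> ub (\<phi> k) = a k * modeY \<nu> \<mu> \<tau> - Uk n"
        unfolding ub_def using L2_inner_diff_left[OF uL H10_L2[OF UV(1)] pL] uc n by (simp add: Uk_def)
      have vbc: "L2_inner \<Omega> vb (\<phi> k) = a k * modeV \<nu> \<mu> \<tau> - Vk n"
        unfolding vb_def using L2_inner_diff_left[OF vL H10_L2[OF UV(2)] pL] vc n by (simp add: Vk_def)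
      have s1: "\<forall>n\<in>{1..N}. L1_diff \<nu> (graded_mesh T r N) Vk n + \<mu>\<^sup>2 * Uk n = a k * omega (2 - 2 * \<nu>) (graded_mesh T r N n)"
        and s2: "\<forall>n\<in>{1..N}. Vk n = L1_diff \<nu> (graded_mesh T r N) Uk n"
        using L1_scheme_coefficient[OF dom eig a1L sch, where k = k] unfolding \<mu>(2) a_def Uk_def[abs_def] Vk_def[abs_def] by auto
      have "(a k * modeV \<nu> \<mu> \<tau> - Vk n)\<^sup>2 + \<mu>\<^sup>2 * (a k * modeY \<nu> \<mu> \<tau> - Uk n)\<^sup>2
          \<le> (C0 * (1 + \<mu> powr (1 + 2 * e)) * real N powr (- q) * \<bar>a k\<bar>)\<^sup>2"
        unfolding \<tau>_def by (rule mode[OF n \<mu>(1) _ _ s1 s2]) (simp_all add: Uk_def Vk_def)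
      also have "\<dots> \<le> (B * (lam k powr p * \<bar>a k\<bar>))\<^sup>2"
      proof (rule power_mono)
        have "1 + \<mu> powr (1 + 2 * e) \<le> CL * lam k powr p"
          unfolding \<mu>_def CL_def using spectral_weight_bound[OF l0(1) l0(2) _ p] e by simp
        then have "C0 * (1 + \<mu> powr (1 + 2 * e)) * real N powr (- q) * \<bar>a k\<bar> \<le> C0 * (CL * lam k powr p) * real N powr (- q) * \<bar>a k\<bar>"
          using C0 by (intro mult_right_mono mult_left_mono) auto
        then show "C0 * (1 + \<mu> powr (1 + 2 * e)) * real N powr (- q) * \<bar>a k\<bar> \<le> B * (lam k powr p * \<bar>a k\<bar>)"
          by (simp add: B_def C_def mult_ac)
        show "0 \<le> C0 * (1 + \<mu> powr (1 + 2 * e)) * real N powr (- q) * \<bar>a k\<bar>"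
          using C0 by (intro mult_nonneg_nonneg add_nonneg_nonneg) auto
      qed
      also have "\<dots> = B\<^sup>2 * (lam k powr p * a k)\<^sup>2" by (simp add: power_mult_distrib)
      finally show ?thesis unfolding ubc vbc \<mu>(2) .
    qed
    have Fs: "(\<lambda>k. B\<^sup>2 * (lam k powr p * a k)\<^sup>2) sums (B\<^sup>2 * F\<^sup>2)"
      unfolding a_def F_def by (intro sums_mult frac_laplace_norm[OF dom eig a1])
    have lamn: "0 \<le> lam k" for k using l0(1) l0(2)[of k] by simp
    have cu: "lam k * (L2_inner \<Omega> ub (\<phi> k))\<^sup>2 \<le> B\<^sup>2 * (lam k powr p * a k)\<^sup>2" for k
      using coef[of k] zero_le_power2[of "L2_inner \<Omega> vb (\<phi> k)"] by linarith
    have cv: "(L2_inner \<Omega> vb (\<phi> k))\<^sup>2 \<le> B\<^sup>2 * (lam k powr p * a k)\<^sup>2" for k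
      using coef[of k] mult_nonneg_nonneg[OF lamn[of k] zero_le_power2[of "L2_inner \<Omega> ub (\<phi> k)"]] by linarith
    have "summable (\<lambda>k. lam k * (L2_inner \<Omega> ub (\<phi> k))\<^sup>2)"
      by (rule summable_comparison_test'[OF sums_summable[OF Fs], where N = 0]) (use cu lamn in auto)
    note H = H10_by_coefficients[OF dom eig L(1) this]
    have F0: "0 \<le> B * F" using B by (simp add: F_def)
    have "(L2_norm \<Omega> (weak_grad \<Omega> ub))\<^sup>2 \<le> B\<^sup>2 * F\<^sup>2" by (rule sums_le[OF cu H(2) Fs])
    then have gb: "L2_norm \<Omega> (weak_grad \<Omega> ub) \<le> B * F"
      unfolding power_mult_distrib[symmetric] by (rule power2_le_imp_le[OF _ F0])
    have "(L2_norm \<Omega> vb)\<^sup>2 \<le> B\<^sup>2 * F\<^sup>2" by (rule sums_le[OF cv Parseval(1)[OF dom eig L(2)] Fs])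
    then have vbb: "L2_norm \<Omega> vb \<le> B * F"
      unfolding power_mult_distrib[symmetric] by (rule power2_le_imp_le[OF _ F0])
    show "(\<lambda>x. u (graded_mesh T r N n) x - U n x) \<in> H10 \<Omega>" using H(1) unfolding ub_def \<tau>_def .
    show "L2_norm \<Omega> (\<lambda>x. v (graded_mesh T r N n) x - V n x)
         \<le> C * real N powr (- q) * L2_norm \<Omega> (frac_laplace \<Omega> lam \<phi> p a1)"
      using vbb unfolding vb_def \<tau>_def B_def F_def .
    show "L2_norm \<Omega> (weak_grad \<Omega> (\<lambda>x. u (graded_mesh T r N n) x - U n x))
         \<le> C * real N powr (- q) * L2_norm \<Omega> (frac_laplace \<Omega> lam \<phi> p a1)"
      using gb unfolding ub_def \<tau>_def B_def F_def .
  qed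
qed

theorem theorem4:
  fixes \<Omega> :: "(real^2) set" and lam :: "nat \<Rightarrow> real" and \<phi> :: "nat \<Rightarrow> real^2 \<Rightarrow> real"
    and \<alpha> \<nu> T r \<gamma> \<epsilon> q1 q2 :: real
  assumes "bounded_domain \<Omega>" and "C_k_boundary 2 \<Omega>"
    and "dirichlet_eigensystem \<Omega> lam \<phi>"
    and "1 < \<alpha>" and "\<alpha> < 2" and "\<nu> = \<alpha> / 2" and "T > 0" and "r \<ge> 1"
    and "1/2 < \<gamma>" and "\<gamma> \<le> 1" and "0 < \<epsilon>" and "\<epsilon> < 1"
    and "q1 = min (r * (1 - \<nu>)) (2 - \<nu>)"
    and "q2 = min (r * (1 + \<epsilon> * \<alpha>)) (2 - \<nu>)"
  shows "\<exists>C>0. \<forall>a1 \<in> frac_domain \<Omega> lam \<phi> (\<gamma> + \<epsilon>). \<forall>u v.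
     fractional_wave_solution \<Omega> \<alpha> T (\<lambda>x. 0) a1 (\<lambda>t x. 0) u \<longrightarrow>
     (\<forall>t\<in>{0<..T}. has_caputo_01 \<Omega> \<nu> u t (v t)) \<longrightarrow>
     (\<forall>N\<ge>1. \<forall>t U V. t = graded_mesh T r N \<longrightarrow> L1_scheme \<Omega> \<alpha> \<nu> t N a1 U V \<longrightarrow>
       (\<forall>n\<in>{1..N}.
          (\<lambda>x. u (t n) x - U n x) \<in> H10 \<Omega> \<and>
          L2_norm \<Omega> (\<lambda>x. v (t n) x - V n x)
            + L2_norm \<Omega> (weak_grad \<Omega> (\<lambda>x. u (t n) x - U n x))
          \<le> C * (t 1 + real N powr (- q1) + real N powr (- q2))
              * L2_norm \<Omega> (frac_laplace \<Omega> lam \<phi> (\<gamma> + \<epsilon>) a1)))"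
proof -
  have \<nu>: "1/2 < \<nu>" "\<nu> < 1" and \<alpha>: "\<alpha> = 2 * \<nu>" using assms by auto
  \<comment> \<open>The modal estimates hold for exponents up to 1/2; the choice is compatible with the datum as \<open>1/2 < \<gamma>\<close>.\<close>
  define e where "e = min \<epsilon> (1/2)"
  have e: "0 < e" "e \<le> 1/2" "1/2 + e \<le> \<gamma> + \<epsilon>" using assms by (auto simp: e_def)
  have q: "q1 \<le> r * (1 - \<nu>)" "q1 \<le> 2 - \<nu>" using assms by auto
  obtain C where C: "0 \<le> C" and est: "\<And>a1 u v N U V n. a1 \<in> frac_domain \<Omega> lam \<phi> (\<gamma> + \<epsilon>) \<Longrightarrow>
     fractional_wave_solution \<Omega> \<alpha> T (\<lambda>x. 0) a1 (\<lambda>t x. 0) u \<Longrightarrow>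
     (\<forall>t\<in>{0<..T}. has_caputo_01 \<Omega> \<nu> u t (v t)) \<Longrightarrow>
     L1_scheme \<Omega> \<alpha> \<nu> (graded_mesh T r N) N a1 U V \<Longrightarrow> 1 \<le> n \<Longrightarrow> n \<le> N \<Longrightarrow>
       (\<lambda>x. u (graded_mesh T r N n) x - U n x) \<in> H10 \<Omega> \<and>
       L2_norm \<Omega> (\<lambda>x. v (graded_mesh T r N n) x - V n x)
         \<le> C * real N powr (- q1) * L2_norm \<Omega> (frac_laplace \<Omega> lam \<phi> (\<gamma> + \<epsilon>) a1) \<and>
       L2_norm \<Omega> (weak_grad \<Omega> (\<lambda>x. u (graded_mesh T r N n) x - U n x))
         \<le> C * real N powr (- q1) * L2_norm \<Omega> (frac_laplace \<Omega> lam \<phi> (\<gamma> + \<epsilon>) a1)"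
  proof -
    from scheme_error_estimate[OF assms(1,3) \<nu> assms(7,8) e q] obtain C where "0 \<le> C" and
     *: "\<forall>a1 u v N U V n. a1 \<in> frac_domain \<Omega> lam \<phi> (\<gamma> + \<epsilon>) \<longrightarrow>
     fractional_wave_solution \<Omega> (2 * \<nu>) T (\<lambda>x. 0) a1 (\<lambda>t x. 0) u \<longrightarrow>
     (\<forall>t\<in>{0<..T}. has_caputo_01 \<Omega> \<nu> u t (v t)) \<longrightarrow>
     L1_scheme \<Omega> (2 * \<nu>) \<nu> (graded_mesh T r N) N a1 U V \<longrightarrow> 1 \<le> n \<longrightarrow> n \<le> N \<longrightarrow>
       (\<lambda>x. u (graded_mesh T r N n) x - U n x) \<in> H10 \<Omega> \<and>
       L2_norm \<Omega> (\<lambda>x. v (graded_mesh T r N n) x - V n x)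
         \<le> C * real N powr (- q1) * L2_norm \<Omega> (frac_laplace \<Omega> lam \<phi> (\<gamma> + \<epsilon>) a1) \<and>
       L2_norm \<Omega> (weak_grad \<Omega> (\<lambda>x. u (graded_mesh T r N n) x - U n x))
         \<le> C * real N powr (- q1) * L2_norm \<Omega> (frac_laplace \<Omega> lam \<phi> (\<gamma> + \<epsilon>) a1)"
      by (elim exE conjE) (rule that)
    show thesis
      by (rule that[OF \<open>0 \<le> C\<close>], rule *[THEN spec, THEN spec, THEN spec, THEN spec, THEN spec, THEN spec, THEN spec, THEN mp, THEN mp, THEN mp, THEN mp, THEN mp, THEN mp, folded \<alpha>])
  qed
  show ?thesis
  proof (intro exI[of _ "2 * C + 1"] conjI ballI allI impI)
    \<comment> \<open>Adding 1 makes the constant positive even if \<open>C = 0\<close>.\<close>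
    show "0 < 2 * C + 1" using C by simp
    fix a1 u v and N :: nat and t U V n
    assume h: "a1 \<in> frac_domain \<Omega> lam \<phi> (\<gamma> + \<epsilon>)" "fractional_wave_solution \<Omega> \<alpha> T (\<lambda>x. 0) a1 (\<lambda>t x. 0) u"
      "\<forall>t\<in>{0<..T}. has_caputo_01 \<Omega> \<nu> u t (v t)"
      and t: "t = graded_mesh T r N" and sch: "L1_scheme \<Omega> \<alpha> \<nu> t N a1 U V" and n: "n \<in> {1..N}"
    define F where "F = L2_norm \<Omega> (frac_laplace \<Omega> lam \<phi> (\<gamma> + \<epsilon>) a1)"
    have E: "(\<lambda>x. u (t n) x - U n x) \<in> H10 \<Omega>"
      "L2_norm \<Omega> (\<lambda>x. v (t n) x - V n x) \<le> C * real N powr (- q1) * F"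
      "L2_norm \<Omega> (weak_grad \<Omega> (\<lambda>x. u (t n) x - U n x)) \<le> C * real N powr (- q1) * F"
      using est[OF h sch[unfolded t], of n] n unfolding t F_def by auto
    show "(\<lambda>x. u (t n) x - U n x) \<in> H10 \<Omega>" by (rule E)
    have F: "0 \<le> F" by (simp add: F_def)
    have t1: "0 \<le> t 1" using assms by (simp add: t graded_mesh_def)
    have "L2_norm \<Omega> (\<lambda>x. v (t n) x - V n x) + L2_norm \<Omega> (weak_grad \<Omega> (\<lambda>x. u (t n) x - U n x))
        \<le> (2 * C) * real N powr (- q1) * F" using E by simp
    also have "\<dots> \<le> (2 * C + 1) * (t 1 + real N powr (- q1) + real N powr (- q2)) * F"
      using C F t1 by (intro mult_right_mono mult_mono) auto
    finally show "L2_norm \<Omega> (\<lambda>x. v (t n) x - V n x) + L2_norm \<Omega> (weak_grad \<Omega> (\<lambda>x. u (t n) x - U n x))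
        \<le> (2 * C + 1) * (t 1 + real N powr (- q1) + real N powr (- q2)) * L2_norm \<Omega> (frac_laplace \<Omega> lam \<phi> (\<gamma> + \<epsilon>) a1)"
      unfolding F_def .
  qed
qed

end
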